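(* A $1$-univalent FOLDS-category $M$ is $0$-univalent if and only if its associated precategory is a univalent category, i.e. for all $a,b:MO$ the map $\mathrm{idtoiso}_{a,b}:(a=b)\to(a\cong b)$ (sending $\mathrm{refl}_a$ to the identity isomorphism) is an equivalence.
   Context: Homotopy type theory. A $1$-univalent FOLDS-category $M$ consists of a type $MO$; a family $MA:MO\times MO\to\mathcal{U}$ of sets; families of propositions $MI_x(f)$ for $f:MA(x,x)$, $MT_{x,y,z}(f,g,h)$ for $f:MA(x,y),g:MA(y,z),h:MA(x,z)$, and $ME_{x,y}(f,g)$ with $ME_{x,y}(f,g)\leftrightarrow(f=g)$; satisfying the axioms of a category: each $x$ has a unique $1_x$ with $MI_x(1_x)$; composable $f,g$ have a unique $g\circ f$ with $MT(f,g,g\circ f)$; unit laws and associativity hold. The associated precategory has objects $MO$, hom-sets $MA(x,y)$, identities $1_x$ and composition $\circ$; isomorphisms $a\cong b$ are morphisms with two-sided inverses. An indiscernibility from $a$ to $b$ (type $a\asymp b$) consists of equivalences $\phi_{x\bullet}:MA(x,a)\simeq MA(x,b)$ ($x:MO$), $\phi_{\bullet z}:MA(a,z)\simeq MA(b,z)$ ($z:MO$), $\phi_{\bullet\bullet}:MA(a,a)\simeq MA(b,b)$, such that for all $x,y,z,w$ and appropriately typed $f,g,h$: $MT_{x,y,a}(f,g,h)\leftrightarrow MT_{x,y,b}(f,\phi_{y\bullet}(g),\phi_{x\bullet}(h))$; $MT_{x,a,z}(f,g,h)\leftrightarrow MT_{x,b,z}(\phi_{x\bullet}(f),\phi_{\bullet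 z}(g),h)$; $MT_{a,z,w}(f,g,h)\leftrightarrow MT_{b,z,w}(\phi_{\bullet z}(f),g,\phi_{\bullet w}(h))$; $MT_{x,a,a}(f,g,h)\leftrightarrow MT_{x,b,b}(\phi_{x\bullet}(f),\phi_{\bullet\bullet}(g),\phi_{x\bullet}(h))$; $MT_{a,x,a}(f,g,h)\leftrightarrow MT_{b,x,b}(\phi_{\bullet x}(f),\phi_{x\bullet}(g),\phi_{\bullet\bullet}(h))$; $MT_{a,a,x}(f,g,h)\leftrightarrow MT_{b,b,x}(\phi_{\bullet\bullet}(f),\phi_{\bullet x}(g),\phi_{\bullet x}(h))$; $MT_{a,a,a}(f,g,h)\leftrightarrow MT_{b,b,b}(\phi_{\bullet\bullet}(f),\phi_{\bullet\bullet}(g),\phi_{\bullet\bullet}(h))$; $MI_a(f)\leftrightarrow MI_b(\phi_{\bullet\bullet}(f))$. $M$ is $0$-univalent if for all $a,b:MO$ the canonical map $(a=b)\to(a\asymp b)$, sending $\mathrm{refl}_a$ to the indiscernibility all of whose equivalences are identities, is an equivalence. *)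

theory Defs
  imports Main
begin

text \<open>
  Homotopy type theory is represented by its formal system: raw terms in de Bruijn notation and
  inductively defined judgements, following the second presentation in the appendix of the HoTT book
  (\<open>\<Pi>\<close>, \<open>\<Sigma>\<close>, \<open>+\<close>, \<open>0\<close>, \<open>1\<close>, \<open>\<nat>\<close>, identity types, cumulative universes \<open>\<U>\<^sub>0, \<U>\<^sub>1, \<dots>\<close>
  in the style of Russell), together with function extensionality and univalence.
  A statement of HoTT holds if the corresponding closed type has a closed term.

  A shallow embedding, with HOL functions as families of types, is not an option: since HOL functions
  can decide equality of terms, path induction over them would refute univalence.
\<close>

section \<open>Raw terms\<close>

text \<open>
  Binding structure: \<open>PiT A B\<close>, \<open>SigT A B\<close> and \<open>Lam A b\<close> bind one variable in the second argument.
  Motives of eliminators bind one variable, except that the motive of \<open>IndId\<close> binds three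
  (\<open>x, y, p\<close>). The remaining binders are: two in the second argument of \<open>IndSig\<close>;
  one in the second and third argument of \<open>IndSum\<close>; two in the third argument of \<open>IndNat\<close>
  (predecessor, recursive value); one in the second argument of \<open>IndId\<close>.
\<close>

datatype tm =
    Var nat
  | Univ nat
  | PiT tm tm
  | Lam tm tm
  | App tm tm
  | SigT tm tm
  | MkPair tm tm
  | IndSig tm tm tm
  | SumT tm tm
  | InL tm
  | InR tm
  | IndSum tm tm tm tm
  | EmptyT
  | IndEmpty tm tm
  | UnitT
  | Star
  | IndUnit tm tm tm
  | NatT
  | ZeroN
  | SucN tm
  | IndNat tm tm tm tm
  | IdT tm tm tm
  | Refl tm
  | IndId tm tm tm tm tm
  | FunExt nat
  | Univalence nat

text \<open>\<open>lift d k t\<close> adds \<open>d\<close> to all variables of \<open>t\<close> with index at least \<open>k\<close>.\<close>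

primrec lift :: "nat \<Rightarrow> nat \<Rightarrow> tm \<Rightarrow> tm" where
  "lift d k (Var n) = (if n < k then Var n else Var (n + d))"
| "lift d k (Univ i) = Univ i"
| "lift d k (PiT A B) = PiT (lift d k A) (lift d (Suc k) B)"
| "lift d k (Lam A b) = Lam (lift d k A) (lift d (Suc k) b)"
| "lift d k (App f a) = App (lift d k f) (lift d k a)"
| "lift d k (SigT A B) = SigT (lift d k A) (lift d (Suc k) B)"
| "lift d k (MkPair a b) = MkPair (lift d k a) (lift d k b)"
| "lift d k (IndSig C g p) = IndSig (lift d (Suc k) C) (lift d (Suc (Suc k)) g) (lift d k p)"
| "lift d k (SumT A B) = SumT (lift d k A) (lift d k B)"
| "lift d k (InL a) = InL (lift d k a)"
| "lift d k (InR b) = InR (lift d k b)"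
| "lift d k (IndSum C l r e) =
     IndSum (lift d (Suc k) C) (lift d (Suc k) l) (lift d (Suc k) r) (lift d k e)"
| "lift d k EmptyT = EmptyT"
| "lift d k (IndEmpty C a) = IndEmpty (lift d (Suc k) C) (lift d k a)"
| "lift d k UnitT = UnitT"
| "lift d k Star = Star"
| "lift d k (IndUnit C c a) = IndUnit (lift d (Suc k) C) (lift d k c) (lift d k a)"
| "lift d k NatT = NatT"
| "lift d k ZeroN = ZeroN"
| "lift d k (SucN n) = SucN (lift d k n)"
| "lift d k (IndNat C z s n) =
     IndNat (lift d (Suc k) C) (lift d k z) (lift d (Suc (Suc k)) s) (lift d k n)"
| "lift d k (IdT A a b) = IdT (lift d k A) (lift d k a) (lift d k b)"
| "lift d k (Refl a) = Refl (lift d k a)"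
| "lift d k (IndId C c a b p) =
     IndId (lift d (Suc (Suc (Suc k))) C) (lift d (Suc k) c) (lift d k a) (lift d k b) (lift d k p)"
| "lift d k (FunExt i) = FunExt i"
| "lift d k (Univalence i) = Univalence i"

text \<open>
  \<open>subst k s t\<close> replaces variable \<open>k\<close> of \<open>t\<close> by \<open>s\<close> and lowers the variables above \<open>k\<close>; here \<open>s\<close>
  lives in the context without the \<open>k\<close> innermost variables, and is lifted when it is inserted.
\<close>

primrec subst :: "nat \<Rightarrow> tm \<Rightarrow> tm \<Rightarrow> tm" where
  "subst k s (Var n) = (if n < k then Var n else if n = k then lift k 0 s else Var (n - 1))"
| "subst k s (Univ i) = Univ i"
| "subst k s (PiT A B) = PiT (subst k s A) (subst (Suc k) s B)"
| "subst k s (Lam A b) = Lam (subst k s A) (subst (Suc k) s b)"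
| "subst k s (App f a) = App (subst k s f) (subst k s a)"
| "subst k s (SigT A B) = SigT (subst k s A) (subst (Suc k) s B)"
| "subst k s (MkPair a b) = MkPair (subst k s a) (subst k s b)"
| "subst k s (IndSig C g p) = IndSig (subst (Suc k) s C) (subst (Suc (Suc k)) s g) (subst k s p)"
| "subst k s (SumT A B) = SumT (subst k s A) (subst k s B)"
| "subst k s (InL a) = InL (subst k s a)"
| "subst k s (InR b) = InR (subst k s b)"
| "subst k s (IndSum C l r e) =
     IndSum (subst (Suc k) s C) (subst (Suc k) s l) (subst (Suc k) s r) (subst k s e)"
| "subst k s EmptyT = EmptyT"
| "subst k s (IndEmpty C a) = IndEmpty (subst (Suc k) s C) (subst k s a)"
| "subst k s UnitT = UnitT"
| "subst k s Star = Star"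
| "subst k s (IndUnit C c a) = IndUnit (subst (Suc k) s C) (subst k s c) (subst k s a)"
| "subst k s NatT = NatT"
| "subst k s ZeroN = ZeroN"
| "subst k s (SucN n) = SucN (subst k s n)"
| "subst k s (IndNat C z t n) =
     IndNat (subst (Suc k) s C) (subst k s z) (subst (Suc (Suc k)) s t) (subst k s n)"
| "subst k s (IdT A a b) = IdT (subst k s A) (subst k s a) (subst k s b)"
| "subst k s (Refl a) = Refl (subst k s a)"
| "subst k s (IndId C c a b p) =
     IndId (subst (Suc (Suc (Suc k))) s C) (subst (Suc k) s c)
       (subst k s a) (subst k s b) (subst k s p)"
| "subst k s (FunExt i) = FunExt i"
| "subst k s (Univalence i) = Univalence i"

text \<open>Instantiation of the innermost one, two or three variables, outermost variable first.\<close>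

abbreviation inst1 :: "tm \<Rightarrow> tm \<Rightarrow> tm" where
  "inst1 t a \<equiv> subst 0 a t"

definition inst2 :: "tm \<Rightarrow> tm \<Rightarrow> tm \<Rightarrow> tm" where
  "inst2 t a b = subst 0 a (subst 0 (lift 1 0 b) t)"

definition inst3 :: "tm \<Rightarrow> tm \<Rightarrow> tm \<Rightarrow> tm \<Rightarrow> tm" where
  "inst3 t a b c = subst 0 a (subst 0 (lift 1 0 b) (subst 0 (lift 2 0 c) t))"

section \<open>Terms with binders written in HOL\<close>

text \<open>
  To write concrete terms without indices, a term is given as a function of the depth (number of
  enclosing binders) at which it is placed. A variable bound at depth \<open>n\<close> has index \<open>m - Suc n\<close> when
  it occurs at depth \<open>m\<close>. A closed term is obtained by placing it at depth \<open>0\<close>.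
\<close>

type_synonym hterm = "nat \<Rightarrow> tm"

definition hvar :: "nat \<Rightarrow> hterm" where
  "hvar n = (\<lambda>m. Var (m - Suc n))"

definition closed :: "hterm \<Rightarrow> tm" where
  "closed t = t 0"

definition hUniv :: "nat \<Rightarrow> hterm"  ("\<U>") where
  "\<U> i = (\<lambda>n. Univ i)"

definition hPi :: "hterm \<Rightarrow> (hterm \<Rightarrow> hterm) \<Rightarrow> hterm" where
  "hPi A B = (\<lambda>n. PiT (A n) (B (hvar n) (Suc n)))"

definition hLam :: "hterm \<Rightarrow> (hterm \<Rightarrow> hterm) \<Rightarrow> hterm" where
  "hLam A b = (\<lambda>n. Lam (A n) (b (hvar n) (Suc n)))"

definition hApp :: "hterm \<Rightarrow> hterm \<Rightarrow> hterm"  (infixl "\<cdot>" 90) where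
  "f \<cdot> a = (\<lambda>n. App (f n) (a n))"

definition hSig :: "hterm \<Rightarrow> (hterm \<Rightarrow> hterm) \<Rightarrow> hterm" where
  "hSig A B = (\<lambda>n. SigT (A n) (B (hvar n) (Suc n)))"

definition hPair :: "hterm \<Rightarrow> hterm \<Rightarrow> hterm"  ("\<langle>_,/ _\<rangle>") where
  "\<langle>a, b\<rangle> = (\<lambda>n. MkPair (a n) (b n))"

definition hIndSig :: "(hterm \<Rightarrow> hterm) \<Rightarrow> (hterm \<Rightarrow> hterm \<Rightarrow> hterm) \<Rightarrow> hterm \<Rightarrow> hterm" where
  "hIndSig C g p =
     (\<lambda>n. IndSig (C (hvar n) (Suc n)) (g (hvar n) (hvar (Suc n)) (Suc (Suc n))) (p n))"

definition hId :: "hterm \<Rightarrow> hterm \<Rightarrow> hterm \<Rightarrow> hterm"  ("(_ =\<^bsub>_\<^esub> _)" [71, 0, 71] 70) where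
  "(a =\<^bsub>A\<^esub> b) = (\<lambda>n. IdT (A n) (a n) (b n))"

definition hRefl :: "hterm \<Rightarrow> hterm" where
  "hRefl a = (\<lambda>n. Refl (a n))"

definition hIndId ::
  "(hterm \<Rightarrow> hterm \<Rightarrow> hterm \<Rightarrow> hterm) \<Rightarrow> (hterm \<Rightarrow> hterm) \<Rightarrow> hterm \<Rightarrow> hterm \<Rightarrow> hterm \<Rightarrow> hterm" where
  "hIndId C c a b p =
     (\<lambda>n. IndId (C (hvar n) (hvar (Suc n)) (hvar (Suc (Suc n))) (Suc (Suc (Suc n))))
            (c (hvar n) (Suc n)) (a n) (b n) (p n))"

syntax
  "_hPi" :: "pttrn \<Rightarrow> 'a \<Rightarrow> 'a \<Rightarrow> 'a"  ("(3\<Pi> _:_./ _)" [0, 0, 10] 10)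
  "_hSig" :: "pttrn \<Rightarrow> 'a \<Rightarrow> 'a \<Rightarrow> 'a"  ("(3\<Sigma> _:_./ _)" [0, 0, 10] 10)
  "_hLam" :: "pttrn \<Rightarrow> 'a \<Rightarrow> 'a \<Rightarrow> 'a"  ("(3\<Lambda> _:_./ _)" [0, 0, 10] 10)
translations
  "\<Pi> x:A. B" \<rightleftharpoons> "CONST hPi A (\<lambda>x. B)"
  "\<Sigma> x:A. B" \<rightleftharpoons> "CONST hSig A (\<lambda>x. B)"
  "\<Lambda> x:A. b" \<rightleftharpoons> "CONST hLam A (\<lambda>x. b)"

definition hFun :: "hterm \<Rightarrow> hterm \<Rightarrow> hterm"  (infixr "\<rightarrow>" 60) where
  "A \<rightarrow> B = (\<Pi> _:A. B)"

definition hProd :: "hterm \<Rightarrow> hterm \<Rightarrow> hterm"  (infixr "\<otimes>" 65) where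
  "A \<otimes> B = (\<Sigma> _:A. B)"

definition pr1 :: "hterm \<Rightarrow> hterm \<Rightarrow> hterm" where
  "pr1 A p = hIndSig (\<lambda>_. A) (\<lambda>x y. x) p"

section \<open>Basic notions of homotopy type theory\<close>

definition hIff :: "hterm \<Rightarrow> hterm \<Rightarrow> hterm"  (infixr "\<leftrightarrow>" 55) where
  "P \<leftrightarrow> Q = (P \<rightarrow> Q) \<otimes> (Q \<rightarrow> P)"

definition isContr :: "hterm \<Rightarrow> hterm" where
  "isContr A = (\<Sigma> x:A. \<Pi> y:A. x =\<^bsub>A\<^esub> y)"

definition isProp :: "hterm \<Rightarrow> hterm" where
  "isProp A = (\<Pi> x:A. \<Pi> y:A. x =\<^bsub>A\<^esub> y)"

definition isSet :: "hterm \<Rightarrow> hterm" where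
  "isSet A = (\<Pi> x:A. \<Pi> y:A. isProp (x =\<^bsub>A\<^esub> y))"

definition isEquiv :: "hterm \<Rightarrow> hterm \<Rightarrow> hterm \<Rightarrow> hterm" where
  "isEquiv A B f =
     (\<Sigma> g:B \<rightarrow> A. \<Pi> y:B. f \<cdot> (g \<cdot> y) =\<^bsub>B\<^esub> y) \<otimes> (\<Sigma> h:B \<rightarrow> A. \<Pi> x:A. h \<cdot> (f \<cdot> x) =\<^bsub>A\<^esub> x)"

definition hEquiv :: "hterm \<Rightarrow> hterm \<Rightarrow> hterm"  (infix "\<simeq>" 58) where
  "A \<simeq> B = (\<Sigma> f:A \<rightarrow> B. isEquiv A B f)"

definition eapp :: "hterm \<Rightarrow> hterm \<Rightarrow> hterm \<Rightarrow> hterm \<Rightarrow> hterm" where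
  "eapp A B e x = pr1 (A \<rightarrow> B) e \<cdot> x"

definition idFun :: "hterm \<Rightarrow> hterm" where
  "idFun A = (\<Lambda> x:A. x)"

definition idEquiv :: "hterm \<Rightarrow> hterm" where
  "idEquiv A = \<langle>idFun A, \<langle>\<langle>idFun A, \<Lambda> x:A. hRefl x\<rangle>, \<langle>idFun A, \<Lambda> x:A. hRefl x\<rangle>\<rangle>\<rangle>"

definition happly :: "hterm \<Rightarrow> hterm \<Rightarrow> hterm \<Rightarrow> hterm \<Rightarrow> hterm" where
  "happly A B f g =
     (\<Lambda> p:(f =\<^bsub>\<Pi> x:A. B \<cdot> x\<^esub> g).
        hIndId (\<lambda>f g p. \<Pi> x:A. f \<cdot> x =\<^bsub>B \<cdot> x\<^esub> g \<cdot> x) (\<lambda>f. \<Lambda> x:A. hRefl (f \<cdot> x)) f g p)"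

definition idtoeqv :: "nat \<Rightarrow> hterm \<Rightarrow> hterm \<Rightarrow> hterm" where
  "idtoeqv i A B = (\<Lambda> p:(A =\<^bsub>\<U> i\<^esub> B). hIndId (\<lambda>A B p. A \<simeq> B) (\<lambda>A. idEquiv A) A B p)"

definition funext_type :: "nat \<Rightarrow> hterm" where
  "funext_type i =
     (\<Pi> A:\<U> i. \<Pi> B:(A \<rightarrow> \<U> i). \<Pi> f:(\<Pi> x:A. B \<cdot> x). \<Pi> g:(\<Pi> x:A. B \<cdot> x).
        isEquiv (f =\<^bsub>\<Pi> x:A. B \<cdot> x\<^esub> g) (\<Pi> x:A. f \<cdot> x =\<^bsub>B \<cdot> x\<^esub> g \<cdot> x) (happly A B f g))"

definition univalence_type :: "nat \<Rightarrow> hterm" where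
  "univalence_type i =
     (\<Pi> A:\<U> i. \<Pi> B:\<U> i. isEquiv (A =\<^bsub>\<U> i\<^esub> B) (A \<simeq> B) (idtoeqv i A B))"

section \<open>Judgements\<close>

text \<open>
  Contexts are lists with the innermost variable first, so \<open>\<Delta> @ A # \<Gamma>\<close> is the context written
  \<open>\<Gamma>, x : A, \<Delta>\<close> in named notation.
\<close>

primrec lift_ctx :: "tm list \<Rightarrow> tm list" where
  "lift_ctx [] = []"
| "lift_ctx (A # \<Delta>) = lift 1 (length \<Delta>) A # lift_ctx \<Delta>"

primrec subst_ctx :: "tm \<Rightarrow> tm list \<Rightarrow> tm list" where
  "subst_ctx s [] = []"
| "subst_ctx s (A # \<Delta>) = subst (length \<Delta>) s A # subst_ctx s \<Delta>"

text \<open>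
  Substitution and weakening are admissible, but are included among the rules.
\<close>

inductive
  wf_ctx :: "tm list \<Rightarrow> bool"  ("\<turnstile> _ ctx" [51] 50) and
  typed :: "tm list \<Rightarrow> tm \<Rightarrow> tm \<Rightarrow> bool"  ("_ \<turnstile> _ : _" [51, 51, 51] 50) and
  jeq :: "tm list \<Rightarrow> tm \<Rightarrow> tm \<Rightarrow> tm \<Rightarrow> bool"  ("_ \<turnstile> _ \<equiv> _ : _" [51, 51, 51, 51] 50)
where
  ctx_emp: "\<turnstile> [] ctx"
| ctx_ext: "\<Gamma> \<turnstile> A : Univ i \<Longrightarrow> \<turnstile> A # \<Gamma> ctx"

| vble: "\<turnstile> \<Gamma> ctx \<Longrightarrow> n < length \<Gamma> \<Longrightarrow> \<Gamma> \<turnstile> Var n : lift (Suc n) 0 (\<Gamma> ! n)"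
| subst_typed: "\<Gamma> \<turnstile> a : A \<Longrightarrow> \<Delta> @ A # \<Gamma> \<turnstile> b : B \<Longrightarrow>
    subst_ctx a \<Delta> @ \<Gamma> \<turnstile> subst (length \<Delta>) a b : subst (length \<Delta>) a B"
| subst_jeq: "\<Gamma> \<turnstile> a : A \<Longrightarrow> \<Delta> @ A # \<Gamma> \<turnstile> b \<equiv> c : B \<Longrightarrow>
    subst_ctx a \<Delta> @ \<Gamma> \<turnstile> subst (length \<Delta>) a b \<equiv> subst (length \<Delta>) a c : subst (length \<Delta>) a B"
| wkg_typed: "\<Gamma> \<turnstile> A : Univ i \<Longrightarrow> \<Delta> @ \<Gamma> \<turnstile> b : B \<Longrightarrow>
    lift_ctx \<Delta> @ A # \<Gamma> \<turnstile> lift 1 (length \<Delta>) b : lift 1 (length \<Delta>) B"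
| wkg_jeq: "\<Gamma> \<turnstile> A : Univ i \<Longrightarrow> \<Delta> @ \<Gamma> \<turnstile> b \<equiv> c : B \<Longrightarrow>
    lift_ctx \<Delta> @ A # \<Gamma> \<turnstile> lift 1 (length \<Delta>) b \<equiv> lift 1 (length \<Delta>) c : lift 1 (length \<Delta>) B"

| jeq_refl: "\<Gamma> \<turnstile> a : A \<Longrightarrow> \<Gamma> \<turnstile> a \<equiv> a : A"
| jeq_sym: "\<Gamma> \<turnstile> a \<equiv> b : A \<Longrightarrow> \<Gamma> \<turnstile> b \<equiv> a : A"
| jeq_trans: "\<Gamma> \<turnstile> a \<equiv> b : A \<Longrightarrow> \<Gamma> \<turnstile> b \<equiv> c : A \<Longrightarrow> \<Gamma> \<turnstile> a \<equiv> c : A"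
| conv_typed: "\<Gamma> \<turnstile> a : A \<Longrightarrow> \<Gamma> \<turnstile> A \<equiv> B : Univ i \<Longrightarrow> \<Gamma> \<turnstile> a : B"
| conv_jeq: "\<Gamma> \<turnstile> a \<equiv> b : A \<Longrightarrow> \<Gamma> \<turnstile> A \<equiv> B : Univ i \<Longrightarrow> \<Gamma> \<turnstile> a \<equiv> b : B"

| univ_intro: "\<turnstile> \<Gamma> ctx \<Longrightarrow> \<Gamma> \<turnstile> Univ i : Univ (Suc i)"
| univ_cumul: "\<Gamma> \<turnstile> A : Univ i \<Longrightarrow> \<Gamma> \<turnstile> A : Univ (Suc i)"
| univ_cumul_jeq: "\<Gamma> \<turnstile> A \<equiv> B : Univ i \<Longrightarrow> \<Gamma> \<turnstile> A \<equiv> B : Univ (Suc i)"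

| pi_form: "\<Gamma> \<turnstile> A : Univ i \<Longrightarrow> A # \<Gamma> \<turnstile> B : Univ i \<Longrightarrow> \<Gamma> \<turnstile> PiT A B : Univ i"
| pi_form_eq: "\<Gamma> \<turnstile> A \<equiv> A' : Univ i \<Longrightarrow> A # \<Gamma> \<turnstile> B \<equiv> B' : Univ i \<Longrightarrow>
    \<Gamma> \<turnstile> PiT A B \<equiv> PiT A' B' : Univ i"
| pi_intro: "A # \<Gamma> \<turnstile> b : B \<Longrightarrow> \<Gamma> \<turnstile> Lam A b : PiT A B"
| pi_intro_eq: "\<Gamma> \<turnstile> A \<equiv> A' : Univ i \<Longrightarrow> A # \<Gamma> \<turnstile> b \<equiv> b' : B \<Longrightarrow> \<Gamma> \<turnstile> Lam A b \<equiv> Lam A' b' : PiT A B"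
| pi_elim: "\<Gamma> \<turnstile> f : PiT A B \<Longrightarrow> \<Gamma> \<turnstile> a : A \<Longrightarrow> \<Gamma> \<turnstile> App f a : inst1 B a"
| pi_elim_eq: "\<Gamma> \<turnstile> f \<equiv> f' : PiT A B \<Longrightarrow> \<Gamma> \<turnstile> a \<equiv> a' : A \<Longrightarrow> \<Gamma> \<turnstile> App f a \<equiv> App f' a' : inst1 B a"
| pi_comp: "A # \<Gamma> \<turnstile> b : B \<Longrightarrow> \<Gamma> \<turnstile> a : A \<Longrightarrow> \<Gamma> \<turnstile> App (Lam A b) a \<equiv> inst1 b a : inst1 B a"
| pi_uniq: "\<Gamma> \<turnstile> f : PiT A B \<Longrightarrow> \<Gamma> \<turnstile> f \<equiv> Lam A (App (lift 1 0 f) (Var 0)) : PiT A B"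

| sig_form: "\<Gamma> \<turnstile> A : Univ i \<Longrightarrow> A # \<Gamma> \<turnstile> B : Univ i \<Longrightarrow> \<Gamma> \<turnstile> SigT A B : Univ i"
| sig_form_eq: "\<Gamma> \<turnstile> A \<equiv> A' : Univ i \<Longrightarrow> A # \<Gamma> \<turnstile> B \<equiv> B' : Univ i \<Longrightarrow>
    \<Gamma> \<turnstile> SigT A B \<equiv> SigT A' B' : Univ i"
| sig_intro: "A # \<Gamma> \<turnstile> B : Univ i \<Longrightarrow> \<Gamma> \<turnstile> a : A \<Longrightarrow> \<Gamma> \<turnstile> b : inst1 B a \<Longrightarrow> \<Gamma> \<turnstile> MkPair a b : SigT A B"
| sig_intro_eq: "A # \<Gamma> \<turnstile> B : Univ i \<Longrightarrow> \<Gamma> \<turnstile> a \<equiv> a' : A \<Longrightarrow> \<Gamma> \<turnstile> b \<equiv> b' : inst1 B a \<Longrightarrow>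
    \<Gamma> \<turnstile> MkPair a b \<equiv> MkPair a' b' : SigT A B"
| sig_elim: "SigT A B # \<Gamma> \<turnstile> C : Univ i \<Longrightarrow>
    B # A # \<Gamma> \<turnstile> g : inst1 (lift 2 1 C) (MkPair (Var 1) (Var 0)) \<Longrightarrow>
    \<Gamma> \<turnstile> p : SigT A B \<Longrightarrow>
    \<Gamma> \<turnstile> IndSig C g p : inst1 C p"
| sig_elim_eq: "SigT A B # \<Gamma> \<turnstile> C \<equiv> C' : Univ i \<Longrightarrow>
    B # A # \<Gamma> \<turnstile> g \<equiv> g' : inst1 (lift 2 1 C) (MkPair (Var 1) (Var 0)) \<Longrightarrow>
    \<Gamma> \<turnstile> p \<equiv> p' : SigT A B \<Longrightarrow>
    \<Gamma> \<turnstile> IndSig C g p \<equiv> IndSig C' g' p' : inst1 C p"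
| sig_comp: "SigT A B # \<Gamma> \<turnstile> C : Univ i \<Longrightarrow>
    B # A # \<Gamma> \<turnstile> g : inst1 (lift 2 1 C) (MkPair (Var 1) (Var 0)) \<Longrightarrow>
    \<Gamma> \<turnstile> a : A \<Longrightarrow> \<Gamma> \<turnstile> b : inst1 B a \<Longrightarrow>
    \<Gamma> \<turnstile> IndSig C g (MkPair a b) \<equiv> inst2 g a b : inst1 C (MkPair a b)"

| sum_form: "\<Gamma> \<turnstile> A : Univ i \<Longrightarrow> \<Gamma> \<turnstile> B : Univ i \<Longrightarrow> \<Gamma> \<turnstile> SumT A B : Univ i"
| sum_form_eq: "\<Gamma> \<turnstile> A \<equiv> A' : Univ i \<Longrightarrow> \<Gamma> \<turnstile> B \<equiv> B' : Univ i \<Longrightarrow> \<Gamma> \<turnstile> SumT A B \<equiv> SumT A' B' : Univ i"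
| sum_introl: "\<Gamma> \<turnstile> A : Univ i \<Longrightarrow> \<Gamma> \<turnstile> B : Univ i \<Longrightarrow> \<Gamma> \<turnstile> a : A \<Longrightarrow> \<Gamma> \<turnstile> InL a : SumT A B"
| sum_introl_eq: "\<Gamma> \<turnstile> A : Univ i \<Longrightarrow> \<Gamma> \<turnstile> B : Univ i \<Longrightarrow> \<Gamma> \<turnstile> a \<equiv> a' : A \<Longrightarrow>
    \<Gamma> \<turnstile> InL a \<equiv> InL a' : SumT A B"
| sum_intror: "\<Gamma> \<turnstile> A : Univ i \<Longrightarrow> \<Gamma> \<turnstile> B : Univ i \<Longrightarrow> \<Gamma> \<turnstile> b : B \<Longrightarrow> \<Gamma> \<turnstile> InR b : SumT A B"
| sum_intror_eq: "\<Gamma> \<turnstile> A : Univ i \<Longrightarrow> \<Gamma> \<turnstile> B : Univ i \<Longrightarrow> \<Gamma> \<turnstile> b \<equiv> b' : B \<Longrightarrow>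
    \<Gamma> \<turnstile> InR b \<equiv> InR b' : SumT A B"
| sum_elim: "SumT A B # \<Gamma> \<turnstile> C : Univ i \<Longrightarrow>
    A # \<Gamma> \<turnstile> l : inst1 (lift 1 1 C) (InL (Var 0)) \<Longrightarrow>
    B # \<Gamma> \<turnstile> r : inst1 (lift 1 1 C) (InR (Var 0)) \<Longrightarrow>
    \<Gamma> \<turnstile> e : SumT A B \<Longrightarrow>
    \<Gamma> \<turnstile> IndSum C l r e : inst1 C e"
| sum_elim_eq: "SumT A B # \<Gamma> \<turnstile> C \<equiv> C' : Univ i \<Longrightarrow>
    A # \<Gamma> \<turnstile> l \<equiv> l' : inst1 (lift 1 1 C) (InL (Var 0)) \<Longrightarrow>
    B # \<Gamma> \<turnstile> r \<equiv> r' : inst1 (lift 1 1 C) (InR (Var 0)) \<Longrightarrow>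
    \<Gamma> \<turnstile> e \<equiv> e' : SumT A B \<Longrightarrow>
    \<Gamma> \<turnstile> IndSum C l r e \<equiv> IndSum C' l' r' e' : inst1 C e"
| sum_compl: "SumT A B # \<Gamma> \<turnstile> C : Univ i \<Longrightarrow>
    A # \<Gamma> \<turnstile> l : inst1 (lift 1 1 C) (InL (Var 0)) \<Longrightarrow>
    B # \<Gamma> \<turnstile> r : inst1 (lift 1 1 C) (InR (Var 0)) \<Longrightarrow>
    \<Gamma> \<turnstile> a : A \<Longrightarrow>
    \<Gamma> \<turnstile> IndSum C l r (InL a) \<equiv> inst1 l a : inst1 C (InL a)"
| sum_compr: "SumT A B # \<Gamma> \<turnstile> C : Univ i \<Longrightarrow>
    A # \<Gamma> \<turnstile> l : inst1 (lift 1 1 C) (InL (Var 0)) \<Longrightarrow>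
    B # \<Gamma> \<turnstile> r : inst1 (lift 1 1 C) (InR (Var 0)) \<Longrightarrow>
    \<Gamma> \<turnstile> b : B \<Longrightarrow>
    \<Gamma> \<turnstile> IndSum C l r (InR b) \<equiv> inst1 r b : inst1 C (InR b)"

| empty_form: "\<turnstile> \<Gamma> ctx \<Longrightarrow> \<Gamma> \<turnstile> EmptyT : Univ i"
| empty_elim: "EmptyT # \<Gamma> \<turnstile> C : Univ i \<Longrightarrow> \<Gamma> \<turnstile> a : EmptyT \<Longrightarrow> \<Gamma> \<turnstile> IndEmpty C a : inst1 C a"
| empty_elim_eq: "EmptyT # \<Gamma> \<turnstile> C \<equiv> C' : Univ i \<Longrightarrow> \<Gamma> \<turnstile> a \<equiv> a' : EmptyT \<Longrightarrow>
    \<Gamma> \<turnstile> IndEmpty C a \<equiv> IndEmpty C' a' : inst1 C a"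

| unit_form: "\<turnstile> \<Gamma> ctx \<Longrightarrow> \<Gamma> \<turnstile> UnitT : Univ i"
| unit_intro: "\<turnstile> \<Gamma> ctx \<Longrightarrow> \<Gamma> \<turnstile> Star : UnitT"
| unit_elim: "UnitT # \<Gamma> \<turnstile> C : Univ i \<Longrightarrow> \<Gamma> \<turnstile> c : inst1 C Star \<Longrightarrow> \<Gamma> \<turnstile> a : UnitT \<Longrightarrow>
    \<Gamma> \<turnstile> IndUnit C c a : inst1 C a"
| unit_elim_eq: "UnitT # \<Gamma> \<turnstile> C \<equiv> C' : Univ i \<Longrightarrow> \<Gamma> \<turnstile> c \<equiv> c' : inst1 C Star \<Longrightarrow>
    \<Gamma> \<turnstile> a \<equiv> a' : UnitT \<Longrightarrow> \<Gamma> \<turnstile> IndUnit C c a \<equiv> IndUnit C' c' a' : inst1 C a"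
| unit_comp: "UnitT # \<Gamma> \<turnstile> C : Univ i \<Longrightarrow> \<Gamma> \<turnstile> c : inst1 C Star \<Longrightarrow>
    \<Gamma> \<turnstile> IndUnit C c Star \<equiv> c : inst1 C Star"

| nat_form: "\<turnstile> \<Gamma> ctx \<Longrightarrow> \<Gamma> \<turnstile> NatT : Univ i"
| nat_intro0: "\<turnstile> \<Gamma> ctx \<Longrightarrow> \<Gamma> \<turnstile> ZeroN : NatT"
| nat_introS: "\<Gamma> \<turnstile> n : NatT \<Longrightarrow> \<Gamma> \<turnstile> SucN n : NatT"
| nat_introS_eq: "\<Gamma> \<turnstile> n \<equiv> n' : NatT \<Longrightarrow> \<Gamma> \<turnstile> SucN n \<equiv> SucN n' : NatT"
| nat_elim: "NatT # \<Gamma> \<turnstile> C : Univ i \<Longrightarrow>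
    \<Gamma> \<turnstile> z : inst1 C ZeroN \<Longrightarrow>
    C # NatT # \<Gamma> \<turnstile> s : inst1 (lift 2 1 C) (SucN (Var 1)) \<Longrightarrow>
    \<Gamma> \<turnstile> n : NatT \<Longrightarrow>
    \<Gamma> \<turnstile> IndNat C z s n : inst1 C n"
| nat_elim_eq: "NatT # \<Gamma> \<turnstile> C \<equiv> C' : Univ i \<Longrightarrow>
    \<Gamma> \<turnstile> z \<equiv> z' : inst1 C ZeroN \<Longrightarrow>
    C # NatT # \<Gamma> \<turnstile> s \<equiv> s' : inst1 (lift 2 1 C) (SucN (Var 1)) \<Longrightarrow>
    \<Gamma> \<turnstile> n \<equiv> n' : NatT \<Longrightarrow>
    \<Gamma> \<turnstile> IndNat C z s n \<equiv> IndNat C' z' s' n' : inst1 C n"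
| nat_comp0: "NatT # \<Gamma> \<turnstile> C : Univ i \<Longrightarrow>
    \<Gamma> \<turnstile> z : inst1 C ZeroN \<Longrightarrow>
    C # NatT # \<Gamma> \<turnstile> s : inst1 (lift 2 1 C) (SucN (Var 1)) \<Longrightarrow>
    \<Gamma> \<turnstile> IndNat C z s ZeroN \<equiv> z : inst1 C ZeroN"
| nat_compS: "NatT # \<Gamma> \<turnstile> C : Univ i \<Longrightarrow>
    \<Gamma> \<turnstile> z : inst1 C ZeroN \<Longrightarrow>
    C # NatT # \<Gamma> \<turnstile> s : inst1 (lift 2 1 C) (SucN (Var 1)) \<Longrightarrow>
    \<Gamma> \<turnstile> n : NatT \<Longrightarrow>
    \<Gamma> \<turnstile> IndNat C z s (SucN n) \<equiv> inst2 s n (IndNat C z s n) : inst1 C (SucN n)"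

| id_form: "\<Gamma> \<turnstile> A : Univ i \<Longrightarrow> \<Gamma> \<turnstile> a : A \<Longrightarrow> \<Gamma> \<turnstile> b : A \<Longrightarrow> \<Gamma> \<turnstile> IdT A a b : Univ i"
| id_form_eq: "\<Gamma> \<turnstile> A \<equiv> A' : Univ i \<Longrightarrow> \<Gamma> \<turnstile> a \<equiv> a' : A \<Longrightarrow> \<Gamma> \<turnstile> b \<equiv> b' : A \<Longrightarrow>
    \<Gamma> \<turnstile> IdT A a b \<equiv> IdT A' a' b' : Univ i"
| id_intro: "\<Gamma> \<turnstile> A : Univ i \<Longrightarrow> \<Gamma> \<turnstile> a : A \<Longrightarrow> \<Gamma> \<turnstile> Refl a : IdT A a a"
| id_intro_eq: "\<Gamma> \<turnstile> A : Univ i \<Longrightarrow> \<Gamma> \<turnstile> a \<equiv> a' : A \<Longrightarrow> \<Gamma> \<turnstile> Refl a \<equiv> Refl a' : IdT A a a"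
| id_elim: "IdT (lift 2 0 A) (Var 1) (Var 0) # lift 1 0 A # A # \<Gamma> \<turnstile> C : Univ i \<Longrightarrow>
    A # \<Gamma> \<turnstile> c : inst3 (lift 1 3 C) (Var 0) (Var 0) (Refl (Var 0)) \<Longrightarrow>
    \<Gamma> \<turnstile> a : A \<Longrightarrow> \<Gamma> \<turnstile> b : A \<Longrightarrow> \<Gamma> \<turnstile> p : IdT A a b \<Longrightarrow>
    \<Gamma> \<turnstile> IndId C c a b p : inst3 C a b p"
| id_elim_eq: "IdT (lift 2 0 A) (Var 1) (Var 0) # lift 1 0 A # A # \<Gamma> \<turnstile> C \<equiv> C' : Univ i \<Longrightarrow>
    A # \<Gamma> \<turnstile> c \<equiv> c' : inst3 (lift 1 3 C) (Var 0) (Var 0) (Refl (Var 0)) \<Longrightarrow>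
    \<Gamma> \<turnstile> a \<equiv> a' : A \<Longrightarrow> \<Gamma> \<turnstile> b \<equiv> b' : A \<Longrightarrow> \<Gamma> \<turnstile> p \<equiv> p' : IdT A a b \<Longrightarrow>
    \<Gamma> \<turnstile> IndId C c a b p \<equiv> IndId C' c' a' b' p' : inst3 C a b p"
| id_comp: "IdT (lift 2 0 A) (Var 1) (Var 0) # lift 1 0 A # A # \<Gamma> \<turnstile> C : Univ i \<Longrightarrow>
    A # \<Gamma> \<turnstile> c : inst3 (lift 1 3 C) (Var 0) (Var 0) (Refl (Var 0)) \<Longrightarrow>
    \<Gamma> \<turnstile> a : A \<Longrightarrow>
    \<Gamma> \<turnstile> IndId C c a a (Refl a) \<equiv> inst1 c a : inst3 C a a (Refl a)"

| funext: "\<turnstile> \<Gamma> ctx \<Longrightarrow> \<Gamma> \<turnstile> FunExt i : closed (funext_type i)"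
| univalence: "\<turnstile> \<Gamma> ctx \<Longrightarrow> \<Gamma> \<turnstile> Univalence i : closed (univalence_type i)"

section \<open>FOLDS-categories\<close>

definition hom :: "hterm \<Rightarrow> hterm \<Rightarrow> hterm \<Rightarrow> hterm" where
  "hom MA x y = MA \<cdot> \<langle>x, y\<rangle>"

definition MT_type :: "nat \<Rightarrow> hterm \<Rightarrow> hterm \<Rightarrow> hterm" where
  "MT_type i MO MA =
     (\<Pi> x:MO. \<Pi> y:MO. \<Pi> z:MO. hom MA x y \<rightarrow> hom MA y z \<rightarrow> hom MA x z \<rightarrow> \<U> i)"

definition MT_prop :: "hterm \<Rightarrow> hterm \<Rightarrow> hterm \<Rightarrow> hterm" where
  "MT_prop MO MA MT =
     (\<Pi> x:MO. \<Pi> y:MO. \<Pi> z:MO. \<Pi> f:hom MA x y. \<Pi> g:hom MA y z. \<Pi> h:hom MA x z.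
        isProp (MT \<cdot> x \<cdot> y \<cdot> z \<cdot> f \<cdot> g \<cdot> h))"

definition unique_identities :: "hterm \<Rightarrow> hterm \<Rightarrow> hterm \<Rightarrow> hterm" where
  "unique_identities MO MA MI = (\<Pi> x:MO. isContr (\<Sigma> f:hom MA x x. MI \<cdot> x \<cdot> f))"

definition unique_composites :: "hterm \<Rightarrow> hterm \<Rightarrow> hterm \<Rightarrow> hterm" where
  "unique_composites MO MA MT =
     (\<Pi> x:MO. \<Pi> y:MO. \<Pi> z:MO. \<Pi> f:hom MA x y. \<Pi> g:hom MA y z.
        isContr (\<Sigma> h:hom MA x z. MT \<cdot> x \<cdot> y \<cdot> z \<cdot> f \<cdot> g \<cdot> h))"

text \<open>
  The identity \<open>1\<^sub>x\<close> and the composite \<open>g \<circ> f\<close> (for \<open>f : x \<rightarrow> y\<close>, \<open>g : y \<rightarrow> z\<close>) are read off from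
  inhabitants \<open>uI\<close>, \<open>uT\<close> of the two types above.
\<close>

definition ident :: "hterm \<Rightarrow> hterm \<Rightarrow> hterm \<Rightarrow> hterm \<Rightarrow> hterm" where
  "ident MA MI uI x = pr1 (hom MA x x) (pr1 (\<Sigma> f:hom MA x x. MI \<cdot> x \<cdot> f) (uI \<cdot> x))"

definition cmp :: "hterm \<Rightarrow> hterm \<Rightarrow> hterm \<Rightarrow> hterm \<Rightarrow> hterm \<Rightarrow> hterm \<Rightarrow> hterm \<Rightarrow> hterm \<Rightarrow> hterm" where
  "cmp MA MT uT x y z g f =
     pr1 (hom MA x z) (pr1 (\<Sigma> h:hom MA x z. MT \<cdot> x \<cdot> y \<cdot> z \<cdot> f \<cdot> g \<cdot> h) (uT \<cdot> x \<cdot> y \<cdot> z \<cdot> f \<cdot> g))"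

definition right_unit_law :: "hterm \<Rightarrow> hterm \<Rightarrow> hterm \<Rightarrow> hterm \<Rightarrow> hterm \<Rightarrow> hterm \<Rightarrow> hterm" where
  "right_unit_law MO MA MI MT uI uT =
     (\<Pi> x:MO. \<Pi> y:MO. \<Pi> f:hom MA x y. cmp MA MT uT x x y f (ident MA MI uI x) =\<^bsub>hom MA x y\<^esub> f)"

definition left_unit_law :: "hterm \<Rightarrow> hterm \<Rightarrow> hterm \<Rightarrow> hterm \<Rightarrow> hterm \<Rightarrow> hterm \<Rightarrow> hterm" where
  "left_unit_law MO MA MI MT uI uT =
     (\<Pi> x:MO. \<Pi> y:MO. \<Pi> f:hom MA x y. cmp MA MT uT x y y (ident MA MI uI y) f =\<^bsub>hom MA x y\<^esub> f)"

definition assoc_law :: "hterm \<Rightarrow> hterm \<Rightarrow> hterm \<Rightarrow> hterm \<Rightarrow> hterm" where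
  "assoc_law MO MA MT uT =
     (\<Pi> x:MO. \<Pi> y:MO. \<Pi> z:MO. \<Pi> w:MO. \<Pi> f:hom MA x y. \<Pi> g:hom MA y z. \<Pi> h:hom MA z w.
        cmp MA MT uT x z w h (cmp MA MT uT x y z g f) =\<^bsub>hom MA x w\<^esub>
        cmp MA MT uT x y w (cmp MA MT uT y z w h g) f)"

subsection \<open>Univalence of the associated precategory\<close>

definition iso :: "hterm \<Rightarrow> hterm \<Rightarrow> hterm \<Rightarrow> hterm \<Rightarrow> hterm \<Rightarrow> hterm \<Rightarrow> hterm \<Rightarrow> hterm" where
  "iso MA MI MT uI uT a b =
     (\<Sigma> f:hom MA a b. \<Sigma> g:hom MA b a.
        (cmp MA MT uT a b a g f =\<^bsub>hom MA a a\<^esub> ident MA MI uI a) \<otimes>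
        (cmp MA MT uT b a b f g =\<^bsub>hom MA b b\<^esub> ident MA MI uI b))"

text \<open>\<open>ru\<close> is an inhabitant of the right unit law; it proves \<open>1\<^sub>a \<circ> 1\<^sub>a = 1\<^sub>a\<close>.\<close>

definition id_iso :: "hterm \<Rightarrow> hterm \<Rightarrow> hterm \<Rightarrow> hterm \<Rightarrow> hterm \<Rightarrow> hterm" where
  "id_iso MA MI uI ru a =
     \<langle>ident MA MI uI a, \<langle>ident MA MI uI a,
       \<langle>ru \<cdot> a \<cdot> a \<cdot> ident MA MI uI a, ru \<cdot> a \<cdot> a \<cdot> ident MA MI uI a\<rangle>\<rangle>\<rangle>"

definition idtoiso ::
  "hterm \<Rightarrow> hterm \<Rightarrow> hterm \<Rightarrow> hterm \<Rightarrow> hterm \<Rightarrow> hterm \<Rightarrow> hterm \<Rightarrow> hterm \<Rightarrow> hterm \<Rightarrow> hterm" where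
  "idtoiso MO MA MI MT uI uT ru a b =
     (\<Lambda> p:(a =\<^bsub>MO\<^esub> b).
        hIndId (\<lambda>x y p. iso MA MI MT uI uT x y) (\<lambda>x. id_iso MA MI uI ru x) a b p)"

definition univalent_category ::
  "hterm \<Rightarrow> hterm \<Rightarrow> hterm \<Rightarrow> hterm \<Rightarrow> hterm \<Rightarrow> hterm \<Rightarrow> hterm \<Rightarrow> hterm" where
  "univalent_category MO MA MI MT uI uT ru =
     (\<Pi> a:MO. \<Pi> b:MO.
        isEquiv (a =\<^bsub>MO\<^esub> b) (iso MA MI MT uI uT a b) (idtoiso MO MA MI MT uI uT ru a b))"

subsection \<open>Indiscernibilities\<close>

text \<open>
  The arguments \<open>l\<close>, \<open>r\<close>, \<open>c\<close> stand for \<open>\<phi>\<^sub>x\<^sub>\<bullet>\<close> and \<open>\<phi>\<^sub>\<bullet>\<^sub>z\<close> (as functions of \<open>x\<close> and \<open>z\<close>) and \<open>\<phi>\<^sub>\<bullet>\<^sub>\<bullet>\<close>.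
\<close>

definition \<phi>l :: "hterm \<Rightarrow> hterm \<Rightarrow> hterm \<Rightarrow> hterm \<Rightarrow> hterm \<Rightarrow> hterm \<Rightarrow> hterm" where
  "\<phi>l MA a b l x f = eapp (hom MA x a) (hom MA x b) (l \<cdot> x) f"

definition \<phi>r :: "hterm \<Rightarrow> hterm \<Rightarrow> hterm \<Rightarrow> hterm \<Rightarrow> hterm \<Rightarrow> hterm \<Rightarrow> hterm" where
  "\<phi>r MA a b r z f = eapp (hom MA a z) (hom MA b z) (r \<cdot> z) f"

definition \<phi>c :: "hterm \<Rightarrow> hterm \<Rightarrow> hterm \<Rightarrow> hterm \<Rightarrow> hterm \<Rightarrow> hterm" where
  "\<phi>c MA a b c f = eapp (hom MA a a) (hom MA b b) c f"

definition indisc :: "hterm \<Rightarrow> hterm \<Rightarrow> hterm \<Rightarrow> hterm \<Rightarrow> hterm \<Rightarrow> hterm \<Rightarrow> hterm" where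
  "indisc MO MA MI MT a b =
     (\<Sigma> l:(\<Pi> x:MO. hom MA x a \<simeq> hom MA x b).
      \<Sigma> r:(\<Pi> z:MO. hom MA a z \<simeq> hom MA b z).
      \<Sigma> c:(hom MA a a \<simeq> hom MA b b).
        (\<Pi> x:MO. \<Pi> y:MO. \<Pi> f:hom MA x y. \<Pi> g:hom MA y a. \<Pi> h:hom MA x a.
           MT \<cdot> x \<cdot> y \<cdot> a \<cdot> f \<cdot> g \<cdot> h \<leftrightarrow>
           MT \<cdot> x \<cdot> y \<cdot> b \<cdot> f \<cdot> \<phi>l MA a b l y g \<cdot> \<phi>l MA a b l x h) \<otimes>
        (\<Pi> x:MO. \<Pi> z:MO. \<Pi> f:hom MA x a. \<Pi> g:hom MA a z. \<Pi> h:hom MA x z.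
           MT \<cdot> x \<cdot> a \<cdot> z \<cdot> f \<cdot> g \<cdot> h \<leftrightarrow>
           MT \<cdot> x \<cdot> b \<cdot> z \<cdot> \<phi>l MA a b l x f \<cdot> \<phi>r MA a b r z g \<cdot> h) \<otimes>
        (\<Pi> z:MO. \<Pi> w:MO. \<Pi> f:hom MA a z. \<Pi> g:hom MA z w. \<Pi> h:hom MA a w.
           MT \<cdot> a \<cdot> z \<cdot> w \<cdot> f \<cdot> g \<cdot> h \<leftrightarrow>
           MT \<cdot> b \<cdot> z \<cdot> w \<cdot> \<phi>r MA a b r z f \<cdot> g \<cdot> \<phi>r MA a b r w h) \<otimes>
        (\<Pi> x:MO. \<Pi> f:hom MA x a. \<Pi> g:hom MA a a. \<Pi> h:hom MA x a.
           MT \<cdot> x \<cdot> a \<cdot> a \<cdot> f \<cdot> g \<cdot> h \<leftrightarrow>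
           MT \<cdot> x \<cdot> b \<cdot> b \<cdot> \<phi>l MA a b l x f \<cdot> \<phi>c MA a b c g \<cdot> \<phi>l MA a b l x h) \<otimes>
        (\<Pi> x:MO. \<Pi> f:hom MA a x. \<Pi> g:hom MA x a. \<Pi> h:hom MA a a.
           MT \<cdot> a \<cdot> x \<cdot> a \<cdot> f \<cdot> g \<cdot> h \<leftrightarrow>
           MT \<cdot> b \<cdot> x \<cdot> b \<cdot> \<phi>r MA a b r x f \<cdot> \<phi>l MA a b l x g \<cdot> \<phi>c MA a b c h) \<otimes>
        (\<Pi> x:MO. \<Pi> f:hom MA a a. \<Pi> g:hom MA a x. \<Pi> h:hom MA a x.
           MT \<cdot> a \<cdot> a \<cdot> x \<cdot> f \<cdot> g \<cdot> h \<leftrightarrow>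
           MT \<cdot> b \<cdot> b \<cdot> x \<cdot> \<phi>c MA a b c f \<cdot> \<phi>r MA a b r x g \<cdot> \<phi>r MA a b r x h) \<otimes>
        (\<Pi> f:hom MA a a. \<Pi> g:hom MA a a. \<Pi> h:hom MA a a.
           MT \<cdot> a \<cdot> a \<cdot> a \<cdot> f \<cdot> g \<cdot> h \<leftrightarrow>
           MT \<cdot> b \<cdot> b \<cdot> b \<cdot> \<phi>c MA a b c f \<cdot> \<phi>c MA a b c g \<cdot> \<phi>c MA a b c h) \<otimes>
        (\<Pi> f:hom MA a a. MI \<cdot> a \<cdot> f \<leftrightarrow> MI \<cdot> b \<cdot> \<phi>c MA a b c f))"

definition iff_refl :: "hterm \<Rightarrow> hterm" where
  "iff_refl P = \<langle>idFun P, idFun P\<rangle>"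

definition id_indisc :: "hterm \<Rightarrow> hterm \<Rightarrow> hterm \<Rightarrow> hterm \<Rightarrow> hterm \<Rightarrow> hterm" where
  "id_indisc MO MA MI MT a =
     \<langle>\<Lambda> x:MO. idEquiv (hom MA x a),
     \<langle>\<Lambda> z:MO. idEquiv (hom MA a z),
     \<langle>idEquiv (hom MA a a),
     \<langle>\<Lambda> x:MO. \<Lambda> y:MO. \<Lambda> f:hom MA x y. \<Lambda> g:hom MA y a. \<Lambda> h:hom MA x a.
        iff_refl (MT \<cdot> x \<cdot> y \<cdot> a \<cdot> f \<cdot> g \<cdot> h),
     \<langle>\<Lambda> x:MO. \<Lambda> z:MO. \<Lambda> f:hom MA x a. \<Lambda> g:hom MA a z. \<Lambda> h:hom MA x z.
        iff_refl (MT \<cdot> x \<cdot> a \<cdot> z \<cdot> f \<cdot> g \<cdot> h),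
     \<langle>\<Lambda> z:MO. \<Lambda> w:MO. \<Lambda> f:hom MA a z. \<Lambda> g:hom MA z w. \<Lambda> h:hom MA a w.
        iff_refl (MT \<cdot> a \<cdot> z \<cdot> w \<cdot> f \<cdot> g \<cdot> h),
     \<langle>\<Lambda> x:MO. \<Lambda> f:hom MA x a. \<Lambda> g:hom MA a a. \<Lambda> h:hom MA x a.
        iff_refl (MT \<cdot> x \<cdot> a \<cdot> a \<cdot> f \<cdot> g \<cdot> h),
     \<langle>\<Lambda> x:MO. \<Lambda> f:hom MA a x. \<Lambda> g:hom MA x a. \<Lambda> h:hom MA a a.
        iff_refl (MT \<cdot> a \<cdot> x \<cdot> a \<cdot> f \<cdot> g \<cdot> h),
     \<langle>\<Lambda> x:MO. \<Lambda> f:hom MA a a. \<Lambda> g:hom MA a x. \<Lambda> h:hom MA a x.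
        iff_refl (MT \<cdot> a \<cdot> a \<cdot> x \<cdot> f \<cdot> g \<cdot> h),
     \<langle>\<Lambda> f:hom MA a a. \<Lambda> g:hom MA a a. \<Lambda> h:hom MA a a.
        iff_refl (MT \<cdot> a \<cdot> a \<cdot> a \<cdot> f \<cdot> g \<cdot> h),
      \<Lambda> f:hom MA a a. iff_refl (MI \<cdot> a \<cdot> f)\<rangle>\<rangle>\<rangle>\<rangle>\<rangle>\<rangle>\<rangle>\<rangle>\<rangle>\<rangle>"

definition idtoindisc ::
  "hterm \<Rightarrow> hterm \<Rightarrow> hterm \<Rightarrow> hterm \<Rightarrow> hterm \<Rightarrow> hterm \<Rightarrow> hterm" where
  "idtoindisc MO MA MI MT a b =
     (\<Lambda> p:(a =\<^bsub>MO\<^esub> b).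
        hIndId (\<lambda>x y p. indisc MO MA MI MT x y) (\<lambda>x. id_indisc MO MA MI MT x) a b p)"

definition zero_univalent :: "hterm \<Rightarrow> hterm \<Rightarrow> hterm \<Rightarrow> hterm \<Rightarrow> hterm" where
  "zero_univalent MO MA MI MT =
     (\<Pi> a:MO. \<Pi> b:MO.
        isEquiv (a =\<^bsub>MO\<^esub> b) (indisc MO MA MI MT a b) (idtoindisc MO MA MI MT a b))"

end

theory Submission
  imports Defs
begin

text \<open>
  An indiscernibility \<open>\<phi>\<close> from \<open>a\<close> to \<open>b\<close> is determined by the morphism \<open>f = \<phi>\<^sub>a\<^sub>\<bullet>(1\<^sub>a)\<close>: its components are
  composition with \<open>f\<close> or with \<open>g = \<phi>\<^sub>\<bullet>\<^sub>a(1\<^sub>a)\<close>, which is inverse to \<open>f\<close>. Conversely, composition with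
  an isomorphism and its inverse is an indiscernibility. Hence the relation
  \<open>f\<^sub>e = \<phi>\<^sub>a\<^sub>\<bullet>(1\<^sub>a)\<close> is a one-to-one correspondence between isomorphisms \<open>e\<close> and indiscernibilities
  \<open>\<phi>\<close>, and by path induction it relates the two images of every identification \<open>a = b\<close>. So one
  canonical map is an equivalence if and only if the other is.

  Explicit proof terms are avoided: apart from the data occurring in types, arguments inside the
  object theory are carried out up to mere inhabitation in all extensions of the context.
\<close>

section \<open>Naturality of terms with binders\<close>

text \<open>The obstacle is less the category theory than binding. Families are HOL functions on
  \<open>hterm\<close>, and nothing in HOL ties the instances of such a function to one de Bruijn
  term with a free variable. The tie is parametricity: functions built from the combinators preserve
  a logical relation indexed by changes of context, and taking substitution or weakening as the
  change turns application in HOL into substitution in the object theory. A term found for a fresh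
  variable then gives a dependent function, so witnesses are uniform without any choice principle:
  inhabitation means that a term exists in the context, not that a truncation is inhabited. Apart
  from arrows and equivalences, the data of isomorphisms and indiscernibilities are propositions,
  since hom-types are sets and \<open>MI\<close>, \<open>MT\<close> are propositional; hence tuples
  are compared through their underlying functions. The identity indiscernibility calls for
  judgemental computation rules, because its proof components are well typed only after the identity
  equivalences have computed.\<close>

lemma lift_0 [simp]: "lift 0 k t = t"
  by (induction t arbitrary: k) auto

text \<open>The bounds place the cutoff \<open>j\<close> inside or at the edge of the block of
  \<open>a\<close> variables that the first lifting opens at \<open>k\<close>, so the second lifting
  only enlarges that block.\<close>

lemma lift_lift: "k \<le> j \<Longrightarrow> j \<le> k + a \<Longrightarrow> lift b j (lift a k t) = lift (a + b) k t"
  by (induction t arbitrary: j k) auto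

text \<open>Variable \<open>j\<close> is one of the \<open>Suc a\<close> variables just opened at
  \<open>k\<close>, so it does not occur: \<open>s\<close> is dropped and the block shrinks by
  one.\<close>

lemma subst_lift: "k \<le> j \<Longrightarrow> j \<le> k + a \<Longrightarrow> subst j s (lift (Suc a) k t) = lift a k t"
  by (induction t arbitrary: j k) auto

text \<open>Lifting, substitution and their composites all have this shape. The clauses cover the
  constructors from which the concrete terms of this development are built, namely those with a
  combinator on \<open>hterm\<close>, together with \<open>FunExt\<close>.\<close>

definition structural :: "(nat \<Rightarrow> tm \<Rightarrow> tm) \<Rightarrow> bool" where
  "structural \<sigma> \<longleftrightarrow>
     (\<forall>d k. k < d \<longrightarrow> \<sigma> d (Var k) = Var k) \<and>
     (\<forall>d i. \<sigma> d (Univ i) = Univ i) \<and>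
     (\<forall>d i. \<sigma> d (FunExt i) = FunExt i) \<and>
     (\<forall>d A B. \<sigma> d (PiT A B) = PiT (\<sigma> d A) (\<sigma> (Suc d) B)) \<and>
     (\<forall>d A b. \<sigma> d (Lam A b) = Lam (\<sigma> d A) (\<sigma> (Suc d) b)) \<and>
     (\<forall>d f a. \<sigma> d (App f a) = App (\<sigma> d f) (\<sigma> d a)) \<and>
     (\<forall>d A B. \<sigma> d (SigT A B) = SigT (\<sigma> d A) (\<sigma> (Suc d) B)) \<and>
     (\<forall>d a b. \<sigma> d (MkPair a b) = MkPair (\<sigma> d a) (\<sigma> d b)) \<and>
     (\<forall>d C g p. \<sigma> d (IndSig C g p) = IndSig (\<sigma> (Suc d) C) (\<sigma> (Suc (Suc d)) g) (\<sigma> d p)) \<and>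
     (\<forall>d A a b. \<sigma> d (IdT A a b) = IdT (\<sigma> d A) (\<sigma> d a) (\<sigma> d b)) \<and>
     (\<forall>d a. \<sigma> d (Refl a) = Refl (\<sigma> d a)) \<and>
     (\<forall>d C c a b p. \<sigma> d (IndId C c a b p) =
        IndId (\<sigma> (Suc (Suc (Suc d))) C) (\<sigma> (Suc d) c) (\<sigma> d a) (\<sigma> d b) (\<sigma> d p))"

text \<open>
  A change of context from depth \<open>src\<close> to depth \<open>tgt\<close> that fixes the outermost \<open>base\<close> variables;
  \<open>act d\<close> is its action below \<open>d\<close> further binders.
\<close>

datatype change = Change (base: nat) (src: nat) (tgt: nat) (act: "nat \<Rightarrow> tm \<Rightarrow> tm")

text \<open>The last clause concerns a term \<open>t\<close> of the common base context: its
  weakening to \<open>d\<close> binders below the source must be sent to its weakening to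
  \<open>d\<close> binders below the target. This is what makes terms of the base context
  invariant.\<close>

definition valid :: "change \<Rightarrow> bool" where
  "valid s \<longleftrightarrow> base s \<le> src s \<and> base s \<le> tgt s \<and> structural (act s) \<and>
     (\<forall>d t. act s d (lift (src s - base s + d) 0 t) = lift (tgt s - base s + d) 0 t)"

text \<open>A Kripke-style logical relation whose worlds are the depths \<open>k\<close>. An
  argument may be used below further binders than those present where it is supplied, hence the
  quantification over all \<open>j \<ge> k\<close> wherever arguments are related.\<close>

definition rel :: "change \<Rightarrow> nat \<Rightarrow> hterm \<Rightarrow> hterm \<Rightarrow> bool" where
  "rel s k t t' \<longleftrightarrow> t' (tgt s + k) = act s k (t (src s + k))"

text \<open>
  HOL functions on \<open>hterm\<close> need not come from terms of the object language. Those that do are natural: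
  they preserve the relation \<open>rel s\<close> for every change of context \<open>s\<close>, at all depths.
\<close>

definition sc :: "nat \<Rightarrow> hterm \<Rightarrow> bool" where
  "sc n t \<longleftrightarrow> (\<forall>s k. valid s \<longrightarrow> base s = n \<longrightarrow> rel s k t t)"

definition natf :: "nat \<Rightarrow> (hterm \<Rightarrow> hterm) \<Rightarrow> bool" where
  "natf n B \<longleftrightarrow> (\<forall>s k t t'. valid s \<longrightarrow> base s = n \<longrightarrow>
     (\<forall>j\<ge>k. rel s j t t') \<longrightarrow> rel s k (B t) (B t'))"

definition natf2 :: "nat \<Rightarrow> (hterm \<Rightarrow> hterm \<Rightarrow> hterm) \<Rightarrow> bool" where
  "natf2 n B \<longleftrightarrow> (\<forall>s k t t' u u'. valid s \<longrightarrow> base s = n \<longrightarrow>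
     (\<forall>j\<ge>k. rel s j t t') \<longrightarrow> (\<forall>j\<ge>k. rel s j u u') \<longrightarrow> rel s k (B t u) (B t' u'))"

definition natf3 :: "nat \<Rightarrow> (hterm \<Rightarrow> hterm \<Rightarrow> hterm \<Rightarrow> hterm) \<Rightarrow> bool" where
  "natf3 n B \<longleftrightarrow> (\<forall>s k t t' u u' v v'. valid s \<longrightarrow> base s = n \<longrightarrow>
     (\<forall>j\<ge>k. rel s j t t') \<longrightarrow> (\<forall>j\<ge>k. rel s j u u') \<longrightarrow> (\<forall>j\<ge>k. rel s j v v') \<longrightarrow>
     rel s k (B t u v) (B t' u' v'))"

named_theorems nat_defs
lemmas [nat_defs] = natf_def natf2_def natf3_def

lemma rel_sc [simp]: "valid s \<Longrightarrow> sc (base s) t \<Longrightarrow> rel s k t t"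
  by (simp add: sc_def)

lemma act_simps:
  assumes "valid s"
  shows "k < d \<Longrightarrow> act s d (Var k) = Var k"
    "act s d (Univ i) = Univ i"
    "act s d (FunExt i) = FunExt i"
    "act s d (PiT A B) = PiT (act s d A) (act s (Suc d) B)"
    "act s d (Lam A B) = Lam (act s d A) (act s (Suc d) B)"
    "act s d (App A B) = App (act s d A) (act s d B)"
    "act s d (SigT A B) = SigT (act s d A) (act s (Suc d) B)"
    "act s d (MkPair A B) = MkPair (act s d A) (act s d B)"
    "act s d (IndSig C g p) = IndSig (act s (Suc d) C) (act s (Suc (Suc d)) g) (act s d p)"
    "act s d (IdT A a b) = IdT (act s d A) (act s d a) (act s d b)"
    "act s d (Refl a) = Refl (act s d a)"
    "act s d (IndId C c a b p) =
       IndId (act s (Suc (Suc (Suc d))) C) (act s (Suc d) c) (act s d a) (act s d b) (act s d p)"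
  using assms unfolding valid_def structural_def by simp_all

lemma act_lift: "valid s \<Longrightarrow> act s d (lift (src s - base s + d) 0 t) = lift (tgt s - base s + d) 0 t"
  unfolding valid_def by blast

text \<open>At depth \<open>j\<close> both variables have index \<open>j - Suc k\<close>, which lies
  below the \<open>j\<close> binders, where the action fixes variables.\<close>

lemma rel_bound: "valid s \<Longrightarrow> k < j \<Longrightarrow> rel s j (hvar (src s + k)) (hvar (tgt s + k))"
  by (simp add: rel_def hvar_def act_simps)

text \<open>The hypothesis on related arguments is instantiated at the variable that the binder
  introduces on each side. The rules for \<open>hPi\<close>, \<open>hSig\<close> and
  \<open>hLam\<close> rest on this.\<close>

lemma rel_binder:
  assumes "valid s" "\<forall>x x'. (\<forall>j\<ge>Suc k. rel s j x x') \<longrightarrow> rel s (Suc k) (B x) (B' x')"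
  shows "B' (hvar (tgt s + k)) (Suc (tgt s + k)) = act s (Suc k) (B (hvar (src s + k)) (Suc (src s + k)))"
proof -
  have "rel s (Suc k) (B (hvar (src s + k))) (B' (hvar (tgt s + k)))"
    using assms(2) rel_bound[OF assms(1), of k] by auto
  then show ?thesis by (simp add: rel_def)
qed

section \<open>The combinators preserve the logical relation\<close>

lemma rel_Univ [simp]: "valid s \<Longrightarrow> rel s k (\<U> i) (\<U> i)"
  by (simp add: rel_def hUniv_def act_simps)

lemma rel_FunExt [simp]: "valid s \<Longrightarrow> rel s k (\<lambda>_. FunExt i) (\<lambda>_. FunExt i)"
  by (simp add: rel_def act_simps)

lemma rel_hApp [simp]: "valid s \<Longrightarrow> rel s k f f' \<Longrightarrow> rel s k a a' \<Longrightarrow> rel s k (f \<cdot> a) (f' \<cdot> a')"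
  by (simp add: rel_def hApp_def act_simps)

lemma rel_hPair [simp]: "valid s \<Longrightarrow> rel s k a a' \<Longrightarrow> rel s k b b' \<Longrightarrow> rel s k \<langle>a, b\<rangle> \<langle>a', b'\<rangle>"
  by (simp add: rel_def hPair_def act_simps)

lemma rel_hId [simp]:
  "valid s \<Longrightarrow> rel s k A A' \<Longrightarrow> rel s k a a' \<Longrightarrow> rel s k b b' \<Longrightarrow>
   rel s k (a =\<^bsub>A\<^esub> b) (a' =\<^bsub>A'\<^esub> b')"
  by (simp add: rel_def hId_def act_simps)

lemma rel_hRefl [simp]: "valid s \<Longrightarrow> rel s k a a' \<Longrightarrow> rel s k (hRefl a) (hRefl a')"
  by (simp add: rel_def hRefl_def act_simps)

lemma rel_hPi [simp]:
  "valid s \<Longrightarrow> rel s k A A' \<Longrightarrow>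
   (\<forall>x x'. (\<forall>j\<ge>Suc k. rel s j x x') \<longrightarrow> rel s (Suc k) (B x) (B' x')) \<Longrightarrow>
   rel s k (hPi A B) (hPi A' B')"
  using rel_binder[of s k B B'] unfolding rel_def[of s k] by (simp add: hPi_def act_simps)

lemma rel_hSig [simp]:
  "valid s \<Longrightarrow> rel s k A A' \<Longrightarrow>
   (\<forall>x x'. (\<forall>j\<ge>Suc k. rel s j x x') \<longrightarrow> rel s (Suc k) (B x) (B' x')) \<Longrightarrow>
   rel s k (hSig A B) (hSig A' B')"
  using rel_binder[of s k B B'] unfolding rel_def[of s k] by (simp add: hSig_def act_simps)

lemma rel_hLam [simp]:
  "valid s \<Longrightarrow> rel s k A A' \<Longrightarrow>
   (\<forall>x x'. (\<forall>j\<ge>Suc k. rel s j x x') \<longrightarrow> rel s (Suc k) (B x) (B' x')) \<Longrightarrow>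
   rel s k (hLam A B) (hLam A' B')"
  using rel_binder[of s k B B'] unfolding rel_def[of s k] by (simp add: hLam_def act_simps)

lemma rel_hIndSig [simp]:
  assumes s: "valid s"
    and C: "\<forall>x x'. (\<forall>j\<ge>Suc k. rel s j x x') \<longrightarrow> rel s (Suc k) (C x) (C' x')"
    and g: "\<forall>x x' y y'. (\<forall>j\<ge>Suc (Suc k). rel s j x x') \<longrightarrow> (\<forall>j\<ge>Suc (Suc k). rel s j y y') \<longrightarrow>
      rel s (Suc (Suc k)) (g x y) (g' x' y')"
    and p: "rel s k p p'"
  shows "rel s k (hIndSig C g p) (hIndSig C' g' p')"
proof -
  have r: "\<forall>j\<ge>Suc (Suc k). rel s j (hvar (src s + m)) (hvar (tgt s + m))" if "m \<le> Suc k" for m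
    using rel_bound[OF s] that by auto
  have "rel s (Suc (Suc k)) (g (hvar (src s + k)) (hvar (src s + Suc k)))
      (g' (hvar (tgt s + k)) (hvar (tgt s + Suc k)))"
    by (rule g[rule_format]) (simp_all only: r[rule_format] le_SucI order_refl)
  then show ?thesis
    using rel_binder[OF s C] p s unfolding rel_def by (simp add: hIndSig_def act_simps)
qed

lemma rel_hIndId [simp]:
  assumes s: "valid s"
    and C: "\<forall>x x' y y' z z'. (\<forall>j\<ge>Suc (Suc (Suc k)). rel s j x x') \<longrightarrow>
      (\<forall>j\<ge>Suc (Suc (Suc k)). rel s j y y') \<longrightarrow> (\<forall>j\<ge>Suc (Suc (Suc k)). rel s j z z') \<longrightarrow>
      rel s (Suc (Suc (Suc k))) (C x y z) (C' x' y' z')"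
    and c: "\<forall>x x'. (\<forall>j\<ge>Suc k. rel s j x x') \<longrightarrow> rel s (Suc k) (c x) (c' x')"
    and a: "rel s k a a'" and b: "rel s k b b'" and p: "rel s k p p'"
  shows "rel s k (hIndId C c a b p) (hIndId C' c' a' b' p')"
proof -
  have r: "\<forall>j\<ge>Suc (Suc (Suc k)). rel s j (hvar (src s + m)) (hvar (tgt s + m))"
    if "m \<le> Suc (Suc k)" for m
    using rel_bound[OF s] that by auto
  have "rel s (Suc (Suc (Suc k)))
      (C (hvar (src s + k)) (hvar (src s + Suc k)) (hvar (src s + Suc (Suc k))))
      (C' (hvar (tgt s + k)) (hvar (tgt s + Suc k)) (hvar (tgt s + Suc (Suc k))))"
    by (rule C[rule_format]) (simp_all only: r[rule_format] le_SucI order_refl)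
  then show ?thesis
    using rel_binder[OF s c] a b p s unfolding rel_def by (simp add: hIndId_def act_simps)
qed

lemma rel_hFun [simp]: "valid s \<Longrightarrow> rel s k A A' \<Longrightarrow> rel s (Suc k) B B' \<Longrightarrow> rel s k (A \<rightarrow> B) (A' \<rightarrow> B')"
  by (simp add: hFun_def)

lemma rel_hProd [simp]: "valid s \<Longrightarrow> rel s k A A' \<Longrightarrow> rel s (Suc k) B B' \<Longrightarrow> rel s k (A \<otimes> B) (A' \<otimes> B')"
  by (simp add: hProd_def)

text \<open>A term of the smaller context is first weakened to the old base; the two weakenings
  merge, so the clause of \<open>valid\<close> on weakened terms is inherited. Hence facts about a
  context remain available in its extensions.\<close>

lemma rebase:
  assumes s: "valid s" and n: "n \<le> base s"
  obtains s' where "valid s'" "base s' = n" "rel s' = rel s"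
proof -
  obtain m p q \<sigma> where sd: "s = Change m p q \<sigma>" by (cases s)
  have *: "\<sigma> d (lift (p - n + d) 0 u) = lift (q - n + d) 0 u" for d u
  proof -
    have "\<sigma> d (lift (p - m + d) 0 (lift (m - n) 0 u)) = lift (q - m + d) 0 (lift (m - n) 0 u)"
      using act_lift[of s d "lift (m - n) 0 u"] s sd by simp
    then show ?thesis
      using n s sd by (simp add: lift_lift valid_def)
  qed
  show ?thesis
  proof (rule that)
    show "valid (Change n p q \<sigma>)"
      using s sd n * by (simp add: valid_def)
    show "rel (Change n p q \<sigma>) = rel s"
      by (intro ext) (simp add: rel_def sd)
  qed simp
qed

lemma sc_up: "sc n t \<Longrightarrow> n \<le> m \<Longrightarrow> sc m t"
  unfolding sc_def by (metis rebase)

lemma natf_up: "natf n B \<Longrightarrow> n \<le> m \<Longrightarrow> natf m B"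
  unfolding natf_def by (metis rebase)

lemma sc_Suc [simp]: "sc n t \<Longrightarrow> sc (Suc n) t"
  by (rule sc_up) auto

text \<open>Weakening from depth \<open>n\<close> to depth \<open>m\<close> is itself a valid change
  of context, and the claim is self-relatedness along it. A well-scoped \<open>hterm\<close> is thus
  determined by its value at depth \<open>n\<close>.\<close>

lemma sc_at: "sc n t \<Longrightarrow> n \<le> m \<Longrightarrow> t m = lift (m - n) 0 (t n)"
proof -
  assume t: "sc n t" and m: "n \<le> m"
  have "lift (m - n) d (lift d 0 u) = lift (m - n + d) 0 u" for d u
    by (simp add: lift_lift add.commute[of d])
  then have "valid (Change n n m (\<lambda>d. lift (m - n) d))"
    using m by (simp add: valid_def structural_def)
  then have "rel (Change n n m (\<lambda>d. lift (m - n) d)) 0 t t"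
    using t by simp
  then show ?thesis by (simp add: rel_def)
qed

lemma sc_add: "sc n t \<Longrightarrow> t (n + j) = lift j 0 (t n)"
  using sc_at[of n t "n + j"] by simp

lemma sc_hvar [simp]: "k < n \<Longrightarrow> sc n (hvar k)"
  unfolding sc_def
proof (intro allI impI)
  fix s j
  assume k: "k < n" and s: "valid s" "base s = n"
  \<comment> \<open>At depth \<open>n\<close> the variable is \<open>Var (n - Suc k)\<close>, a term
    of the base context, so the clause of \<open>valid\<close> on weakened terms applies to
    it.\<close>
  have "act s j (lift (src s - n + j) 0 (Var (n - Suc k))) = lift (tgt s - n + j) 0 (Var (n - Suc k))"
    using act_lift[OF s(1), of j "Var (n - Suc k)"] s by simp
  moreover have "n \<le> src s" "n \<le> tgt s" using s by (auto simp: valid_def)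
  ultimately show "rel s j (hvar k) (hvar k)"
    using k by (simp add: rel_def hvar_def)
qed

text \<open>Turns a raw term of a context of length \<open>n\<close> into an \<open>hterm\<close>,
  so that a raw typing derivation can witness inhabitation.\<close>

definition at :: "nat \<Rightarrow> tm \<Rightarrow> hterm" where
  "at n u = (\<lambda>m. lift (m - n) 0 u)"

lemma sc_at_tm [simp]: "sc n (at n u)"
  unfolding sc_def
proof (intro allI impI)
  fix s k
  assume s: "valid s" "base s = n"
  then have "n \<le> src s" "n \<le> tgt s" by (auto simp: valid_def)
  then show "rel s k (at n u) (at n u)"
    using act_lift[OF s(1), of k u] s(2) by (simp add: rel_def at_def)
qed

lemma at_same [simp]: "at n u n = u"
  by (simp add: at_def)

lemma natf_rel: "natf (base s) B \<Longrightarrow> valid s \<Longrightarrow> (\<forall>j\<ge>k. rel s j t t') \<Longrightarrow> rel s k (B t) (B t')"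
  by (simp add: natf_def)

lemma scI: "(\<And>s k. valid s \<Longrightarrow> base s = n \<Longrightarrow> rel s k t t) \<Longrightarrow> sc n t"
  unfolding sc_def by blast

lemma sc_natf: "natf n B \<Longrightarrow> sc n a \<Longrightarrow> sc n (B a)"
  unfolding natf_def sc_def by blast

lemma sc_natf3: "natf3 n B \<Longrightarrow> sc n a \<Longrightarrow> sc n b \<Longrightarrow> sc n c \<Longrightarrow> sc n (B a b c)"
  unfolding natf3_def sc_def by blast

section \<open>Instances of families as weakenings and substitutions\<close>

lemma natf_weak_inst:
  assumes B: "natf n B"
  shows "B (hvar (Suc n)) (Suc (Suc n)) = lift 1 1 (B (hvar n) (Suc n))"
proof -
  \<comment> \<open>The cutoff is \<open>Suc d\<close> rather than \<open>d\<close>: the bound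
    variable of the family stays below the newly inserted one.\<close>
  let ?s = "Change n (Suc n) (Suc (Suc n)) (\<lambda>d. lift 1 (Suc d))"
  have "valid ?s"
    by (simp add: valid_def structural_def lift_lift)
  moreover have "\<forall>j\<ge>0. rel ?s j (hvar n) (hvar (Suc n))"
    by (simp add: rel_def hvar_def)
  ultimately have "rel ?s 0 (B (hvar n)) (B (hvar (Suc n)))"
    using B[unfolded natf_def, rule_format, of ?s 0 "hvar n" "hvar (Suc n)"] by simp
  then show ?thesis by (simp add: rel_def)
qed

text \<open>Substitution for the last variable is a valid change from depth \<open>Suc n\<close> to
  depth \<open>n\<close>, and it relates \<open>hvar n\<close> to \<open>a\<close>. This is the
  bridge from application in HOL to the substitutions in the typing rules.\<close>

lemma natf_inst:
  assumes B: "natf n B" and a: "sc n a"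
  shows "B a n = subst 0 (a n) (B (hvar n) (Suc n))"
proof -
  let ?s = "Change n (Suc n) n (\<lambda>d. subst d (a n))"
  have "valid ?s"
    by (simp add: valid_def structural_def subst_lift)
  moreover have "\<forall>j\<ge>0. rel ?s j (hvar n) a"
    using sc_add[OF a] by (simp add: rel_def hvar_def)
  ultimately have "rel ?s 0 (B (hvar n)) (B a)"
    using B[unfolded natf_def, rule_format, of ?s 0 "hvar n" a] by simp
  then show ?thesis by (simp add: rel_def)
qed

text \<open>The right-hand side is the type that \<open>sig_elim\<close> demands of its branch: one
  variable is traded for the pair of two new ones.\<close>

lemma natf_pair_inst:
  assumes B: "natf n B"
  shows "B \<langle>hvar n, hvar (Suc n)\<rangle> (Suc (Suc n)) =
    subst 0 (MkPair (Var 1) (Var 0)) (lift 2 1 (B (hvar n) (Suc n)))"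
proof -
  let ?s = "Change n (Suc n) (Suc (Suc n))
    (\<lambda>d t. subst d (MkPair (Var 1) (Var 0)) (lift 2 (Suc d) t))"
  have "lift 2 (Suc d) (lift (Suc d) 0 t) = lift (Suc (Suc (Suc d))) 0 t" for d t
    by (simp add: lift_lift)
  then have "valid ?s"
    by (simp add: valid_def structural_def subst_lift)
  moreover have "\<forall>j\<ge>0. rel ?s j (hvar n) \<langle>hvar n, hvar (Suc n)\<rangle>"
    by (simp add: rel_def hvar_def hPair_def)
  ultimately have "rel ?s 0 (B (hvar n)) (B \<langle>hvar n, hvar (Suc n)\<rangle>)"
    using B[unfolded natf_def, rule_format, of ?s 0] by simp
  then show ?thesis by (simp add: rel_def)
qed

text \<open>The three substitutions of \<open>inst3\<close> form a single valid change from depth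
  \<open>n + 3\<close> to depth \<open>n\<close>; the weakenings inside \<open>inst3\<close> cancel
  against the substitutions performed after them.\<close>

lemma natf3_inst:
  assumes C: "natf3 n C" and abp: "sc n a" "sc n b" "sc n p"
  shows "C a b p n =
    inst3 (C (hvar n) (hvar (Suc n)) (hvar (Suc (Suc n))) (Suc (Suc (Suc n)))) (a n) (b n) (p n)"
proof -
  let ?s = "Change n (Suc (Suc (Suc n))) n
    (\<lambda>d t. subst d (a n) (subst d (lift 1 0 (b n)) (subst d (lift 2 0 (p n)) t)))"
  have "valid ?s"
    by (simp add: valid_def structural_def subst_lift numeral_3_eq_3)
  moreover have "\<forall>j\<ge>0. rel ?s j (hvar n) a" "\<forall>j\<ge>0. rel ?s j (hvar (Suc n)) b"
    "\<forall>j\<ge>0. rel ?s j (hvar (Suc (Suc n))) p"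
    using sc_add[OF abp(1)] sc_add[OF abp(2)] sc_add[OF abp(3)]
    by (simp_all add: rel_def hvar_def lift_lift subst_lift)
  ultimately have "rel ?s 0 (C (hvar n) (hvar (Suc n)) (hvar (Suc (Suc n)))) (C a b p)"
    using C[unfolded natf3_def, rule_format, of ?s 0] by simp
  then show ?thesis by (simp add: rel_def inst3_def)
qed

text \<open>This is the motive on the diagonal, in the form that \<open>id_elim\<close> demands of
  its branch.\<close>

lemma natf3_refl_inst:
  assumes C: "natf3 n C"
  shows "C (hvar n) (hvar n) (hRefl (hvar n)) (Suc n) =
    inst3 (lift 1 3 (C (hvar n) (hvar (Suc n)) (hvar (Suc (Suc n))) (Suc (Suc (Suc n)))))
      (Var 0) (Var 0) (Refl (Var 0))"
proof -
  \<comment> \<open>The inner substitutions happen while outer variables are still present, so the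
    \<open>Var 0\<close> of the diagonal appears there as \<open>Var 1\<close> and as
    \<open>Var 2\<close>.\<close>
  let ?s = "Change n (Suc (Suc (Suc n))) (Suc n)
    (\<lambda>d t. subst d (Var 0) (subst d (Var 1) (subst d (Refl (Var 2)) (lift 1 (Suc (Suc (Suc d))) t))))"
  have "lift (Suc 0) (Suc (Suc (Suc d))) (lift (Suc (Suc (Suc d))) 0 t)
      = lift (Suc (Suc (Suc (Suc d)))) 0 t" for d t
    by (simp add: lift_lift)
  then have "valid ?s"
    by (simp add: valid_def structural_def subst_lift numeral_3_eq_3)
  moreover have "\<forall>j\<ge>0. rel ?s j (hvar n) (hvar n)" "\<forall>j\<ge>0. rel ?s j (hvar (Suc n)) (hvar n)"
    "\<forall>j\<ge>0. rel ?s j (hvar (Suc (Suc n))) (hRefl (hvar n))"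
    by (simp_all add: rel_def hvar_def hRefl_def)
  ultimately have "rel ?s 0 (C (hvar n) (hvar (Suc n)) (hvar (Suc (Suc n))))
      (C (hvar n) (hvar n) (hRefl (hvar n)))"
    using C[unfolded natf3_def, rule_format, of ?s 0] by simp
  then show ?thesis by (simp add: rel_def inst3_def numeral_3_eq_3 numeral_2_eq_2)
qed

section \<open>Judgements for terms with binders\<close>

definition cext :: "tm list \<Rightarrow> hterm \<Rightarrow> tm list"  (infixl "\<triangleright>" 52) where
  "\<Gamma> \<triangleright> A = A (length \<Gamma>) # \<Gamma>"

text \<open>The universe level stays existential. Where a rule asks for one level for two types,
  \<open>fam_Univ\<close> finds it by cumulativity.\<close>

definition ty :: "tm list \<Rightarrow> hterm \<Rightarrow> bool" where
  "ty \<Gamma> A \<longleftrightarrow> (\<turnstile> \<Gamma> ctx) \<and> sc (length \<Gamma>) A \<and> (\<exists>j. \<Gamma> \<turnstile> A (length \<Gamma>) : Univ j)"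

definition wt :: "tm list \<Rightarrow> hterm \<Rightarrow> hterm \<Rightarrow> bool"  ("_ \<Turnstile> _ \<Colon> _" [51, 51, 51] 50) where
  "\<Gamma> \<Turnstile> t \<Colon> A \<longleftrightarrow> (\<turnstile> \<Gamma> ctx) \<and> sc (length \<Gamma>) t \<and> sc (length \<Gamma>) A \<and>
     \<Gamma> \<turnstile> t (length \<Gamma>) : A (length \<Gamma>)"

text \<open>Existence at the meta level: the witness is a term of \<open>\<Gamma>\<close> and can be
  recovered from it. No truncation is formed.\<close>

definition inh :: "tm list \<Rightarrow> hterm \<Rightarrow> bool" where
  "inh \<Gamma> A \<longleftrightarrow> (\<exists>t. \<Gamma> \<Turnstile> t \<Colon> A)"

text \<open>Typing is required only at the generic variable of the extended context; naturality
  carries it to every other instance, see \<open>fam_sub\<close>.\<close>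

definition fam :: "tm list \<Rightarrow> hterm \<Rightarrow> (hterm \<Rightarrow> hterm) \<Rightarrow> bool" where
  "fam \<Gamma> A B \<longleftrightarrow> ty \<Gamma> A \<and> natf (length \<Gamma>) B \<and> ty (\<Gamma> \<triangleright> A) (B (hvar (length \<Gamma>)))"

text \<open>Provable equality, as opposed to the judgemental equality \<open>hjeq\<close>. The proof
  term is forgotten, and the typings are bundled so that chains of equations compose.\<close>

definition heq :: "tm list \<Rightarrow> hterm \<Rightarrow> hterm \<Rightarrow> hterm \<Rightarrow> bool"
    ("_ \<Turnstile> _ \<approx> _ \<Colon> _" [51, 51, 51, 51] 50) where
  "\<Gamma> \<Turnstile> a \<approx> b \<Colon> A \<longleftrightarrow> ty \<Gamma> A \<and> \<Gamma> \<Turnstile> a \<Colon> A \<and> \<Gamma> \<Turnstile> b \<Colon> A \<and> inh \<Gamma> (a =\<^bsub>A\<^esub> b)"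

definition hjeq :: "tm list \<Rightarrow> hterm \<Rightarrow> hterm \<Rightarrow> hterm \<Rightarrow> bool"
    ("_ \<Turnstile> _ \<equiv> _ \<Colon> _" [51, 51, 51, 51] 50) where
  "\<Gamma> \<Turnstile> a \<equiv> b \<Colon> A \<longleftrightarrow> \<Gamma> \<Turnstile> a \<Colon> A \<and> \<Gamma> \<Turnstile> b \<Colon> A \<and> \<Gamma> \<turnstile> a (length \<Gamma>) \<equiv> b (length \<Gamma>) : A (length \<Gamma>)"

lemma hterm_at:
  "hPi A B n = PiT (A n) (B (hvar n) (Suc n))"
  "hSig A B n = SigT (A n) (B (hvar n) (Suc n))"
  "hLam A B n = Lam (A n) (B (hvar n) (Suc n))"
  "hApp a b n = App (a n) (b n)"
  "hPair a b n = MkPair (a n) (b n)"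
  "hId a A b n = IdT (A n) (a n) (b n)"
  "hRefl a n = Refl (a n)"
  "hUniv i n = Univ i"
  "hvar k n = Var (n - Suc k)"
  by (simp_all add: hPi_def hSig_def hLam_def hApp_def hPair_def hId_def hRefl_def hUniv_def hvar_def)

lemma length_cext [simp]: "length (\<Gamma> \<triangleright> A) = Suc (length \<Gamma>)"
  by (simp add: cext_def)

lemma ty_sc: "ty \<Gamma> A \<Longrightarrow> sc (length \<Gamma>) A"
  by (simp add: ty_def)

lemma wt_ctx: "\<Gamma> \<Turnstile> t \<Colon> A \<Longrightarrow> \<turnstile> \<Gamma> ctx"
  and wt_sc: "\<Gamma> \<Turnstile> t \<Colon> A \<Longrightarrow> sc (length \<Gamma>) t"
  and wt_scT: "\<Gamma> \<Turnstile> t \<Colon> A \<Longrightarrow> sc (length \<Gamma>) A"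
  by (simp_all add: wt_def)

lemma inhI: "\<Gamma> \<Turnstile> t \<Colon> A \<Longrightarrow> inh \<Gamma> A"
  by (auto simp: inh_def)

lemma inhE: "inh \<Gamma> A \<Longrightarrow> (\<And>t. \<Gamma> \<Turnstile> t \<Colon> A \<Longrightarrow> sc (length \<Gamma>) t \<Longrightarrow> thesis) \<Longrightarrow> thesis"
  by (auto simp: inh_def wt_def)

lemma inh_tm: "\<turnstile> \<Gamma> ctx \<Longrightarrow> sc (length \<Gamma>) A \<Longrightarrow> \<Gamma> \<turnstile> u : A (length \<Gamma>) \<Longrightarrow> inh \<Gamma> A"
  by (rule inhI[of _ "at (length \<Gamma>) u"]) (simp add: wt_def)

lemma sc_step: "sc n t \<Longrightarrow> t (Suc n) = lift 1 0 (t n)"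
  using sc_add[of n t 1] by simp

lemma ctx_cext [simp]: "ty \<Gamma> A \<Longrightarrow> \<turnstile> \<Gamma> \<triangleright> A ctx"
  by (auto simp: ty_def cext_def intro: ctx_ext)

lemma ty_weak [simp]: "ty \<Gamma> C \<Longrightarrow> ty \<Gamma> A \<Longrightarrow> ty (\<Gamma> \<triangleright> C) A"
proof -
  assume C: "ty \<Gamma> C" and A: "ty \<Gamma> A"
  then obtain i j where "\<Gamma> \<turnstile> C (length \<Gamma>) : Univ i" "\<Gamma> \<turnstile> A (length \<Gamma>) : Univ j"
    by (auto simp: ty_def)
  from wkg_typed[OF this(1), of "[]", simplified, OF this(2)]
  have "\<Gamma> \<triangleright> C \<turnstile> A (Suc (length \<Gamma>)) : Univ j"
    using sc_step[OF ty_sc[OF A]] by (simp add: cext_def)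
  then show ?thesis
    using A ctx_cext[OF C] by (auto simp: ty_def)
qed

lemma wt_weak [simp]: "ty \<Gamma> C \<Longrightarrow> \<Gamma> \<Turnstile> t \<Colon> A \<Longrightarrow> \<Gamma> \<triangleright> C \<Turnstile> t \<Colon> A"
proof -
  assume C: "ty \<Gamma> C" and t: "\<Gamma> \<Turnstile> t \<Colon> A"
  then obtain i where "\<Gamma> \<turnstile> C (length \<Gamma>) : Univ i" "\<Gamma> \<turnstile> t (length \<Gamma>) : A (length \<Gamma>)"
    by (auto simp: ty_def wt_def)
  from wkg_typed[OF this(1), of "[]", simplified, OF this(2)]
  have "\<Gamma> \<triangleright> C \<turnstile> t (Suc (length \<Gamma>)) : A (Suc (length \<Gamma>))"
    using sc_step[OF wt_sc[OF t]] sc_step[OF wt_scT[OF t]] by (simp add: cext_def)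
  then show ?thesis
    using t ctx_cext[OF C] by (auto simp: wt_def)
qed

lemma inh_weak [simp]: "ty \<Gamma> C \<Longrightarrow> inh \<Gamma> A \<Longrightarrow> inh (\<Gamma> \<triangleright> C) A"
  by (meson inh_def wt_weak)

lemma wt_var: "ty \<Gamma> A \<Longrightarrow> \<Gamma> \<triangleright> A \<Turnstile> hvar (length \<Gamma>) \<Colon> A"
  using vble[OF ctx_cext, of \<Gamma> A 0] sc_step[of "length \<Gamma>" A]
  by (simp add: wt_def ty_sc) (simp add: cext_def hterm_at)

lemma univ_le: "\<Gamma> \<turnstile> A : Univ i \<Longrightarrow> i \<le> j \<Longrightarrow> \<Gamma> \<turnstile> A : Univ j"
  by (induction j) (auto simp: le_Suc_eq intro: univ_cumul)

text \<open>The premise speaks of an opaque \<open>x\<close> rather than of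
  \<open>hvar (length \<Gamma>)\<close>, so that only its scope and its type can enter the argument.
  The same form recurs in \<open>wt_hLam\<close> and \<open>inh_hPi\<close>.\<close>

lemma famI:
  "ty \<Gamma> A \<Longrightarrow> natf (length \<Gamma>) B \<Longrightarrow>
   (\<forall>x. sc (Suc (length \<Gamma>)) x \<longrightarrow> \<Gamma> \<triangleright> A \<Turnstile> x \<Colon> A \<longrightarrow> ty (\<Gamma> \<triangleright> A) (B x)) \<Longrightarrow> fam \<Gamma> A B"
  by (simp add: fam_def wt_var)

text \<open>The term \<open>a\<close> is substituted into the typing of the generic instance, and
  naturality identifies the result with \<open>B a\<close>.\<close>

lemma fam_sub: "fam \<Gamma> A B \<Longrightarrow> \<Gamma> \<Turnstile> a \<Colon> A \<Longrightarrow> ty \<Gamma> (B a)"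
proof -
  assume f: "fam \<Gamma> A B" and a: "\<Gamma> \<Turnstile> a \<Colon> A"
  then obtain j where "\<Gamma> \<triangleright> A \<turnstile> B (hvar (length \<Gamma>)) (Suc (length \<Gamma>)) : Univ j"
    by (auto simp: fam_def ty_def)
  then have "\<Gamma> \<turnstile> subst 0 (a (length \<Gamma>)) (B (hvar (length \<Gamma>)) (Suc (length \<Gamma>))) : Univ j"
    using subst_typed[of \<Gamma> "a (length \<Gamma>)" "A (length \<Gamma>)" "[]"] a by (fastforce simp: cext_def wt_def)
  moreover have "natf (length \<Gamma>) B" using f by (simp add: fam_def)
  ultimately show ?thesis
    using natf_inst[of "length \<Gamma>" B a] sc_natf[of "length \<Gamma>" B a] a
    by (auto simp: ty_def wt_def)
qed

lemma sc_hPi: "sc n A \<Longrightarrow> natf n B \<Longrightarrow> sc n (hPi A B)"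
  by (rule scI) (simp add: natf_def)

lemma sc_hSig: "sc n A \<Longrightarrow> natf n B \<Longrightarrow> sc n (hSig A B)"
  by (rule scI) (simp add: natf_def)

lemma sc_hLam: "sc n A \<Longrightarrow> natf n B \<Longrightarrow> sc n (hLam A B)"
  by (rule scI) (simp add: natf_def)

lemma sc_hId: "sc n A \<Longrightarrow> sc n a \<Longrightarrow> sc n b \<Longrightarrow> sc n (a =\<^bsub>A\<^esub> b)"
  by (rule scI) simp

lemma sc_hRefl: "sc n a \<Longrightarrow> sc n (hRefl a)"
  by (rule scI) simp

lemma sc_hApp: "sc n a \<Longrightarrow> sc n b \<Longrightarrow> sc n (a \<cdot> b)"
  by (rule scI) simp

lemma sc_hPair: "sc n a \<Longrightarrow> sc n b \<Longrightarrow> sc n \<langle>a, b\<rangle>"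
  by (rule scI) simp

lemma fam_Univ:
  assumes "fam \<Gamma> A B"
  obtains j where "\<Gamma> \<turnstile> A (length \<Gamma>) : Univ j"
    "\<Gamma> \<triangleright> A \<turnstile> B (hvar (length \<Gamma>)) (Suc (length \<Gamma>)) : Univ j"
proof -
  obtain i k where "\<Gamma> \<turnstile> A (length \<Gamma>) : Univ i"
    "\<Gamma> \<triangleright> A \<turnstile> B (hvar (length \<Gamma>)) (Suc (length \<Gamma>)) : Univ k"
    using assms by (auto simp: fam_def ty_def)
  then show ?thesis
    using that[of "max i k"] univ_le[of _ _ i "max i k"] univ_le[of _ _ k "max i k"] by simp
qed

lemma fam_nat: "fam \<Gamma> A B \<Longrightarrow> natf (length \<Gamma>) B" and fam_ty: "fam \<Gamma> A B \<Longrightarrow> ty \<Gamma> A"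
  by (simp_all add: fam_def)

lemma ty_hPi: "fam \<Gamma> A B \<Longrightarrow> ty \<Gamma> (hPi A B)"
  by (rule fam_Univ, assumption)
    (auto simp: ty_def fam_def hterm_at cext_def intro: pi_form sc_hPi)

lemma ty_hSig: "fam \<Gamma> A B \<Longrightarrow> ty \<Gamma> (hSig A B)"
  by (rule fam_Univ, assumption)
    (auto simp: ty_def fam_def hterm_at cext_def intro: sig_form sc_hSig)

lemma fam_const [simp]: "ty \<Gamma> A \<Longrightarrow> ty \<Gamma> B \<Longrightarrow> fam \<Gamma> A (\<lambda>_. B)"
  by (rule famI) (simp_all add: natf_def ty_sc)

lemma ty_hFun [simp]: "ty \<Gamma> A \<Longrightarrow> ty \<Gamma> B \<Longrightarrow> ty \<Gamma> (A \<rightarrow> B)"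
  by (simp add: hFun_def ty_hPi)

lemma ty_hProd [simp]: "ty \<Gamma> A \<Longrightarrow> ty \<Gamma> B \<Longrightarrow> ty \<Gamma> (A \<otimes> B)"
  by (simp add: hProd_def ty_hSig)

lemma ty_hUniv [simp]: "\<turnstile> \<Gamma> ctx \<Longrightarrow> ty \<Gamma> (\<U> i)"
proof -
  have "sc (length \<Gamma>) (\<U> i)" by (rule scI) simp
  then show "\<turnstile> \<Gamma> ctx \<Longrightarrow> ty \<Gamma> (\<U> i)"
    by (auto simp: ty_def hterm_at intro: univ_intro)
qed

lemma wt_Univ_ty: "\<Gamma> \<Turnstile> A \<Colon> \<U> i \<Longrightarrow> ty \<Gamma> A"
  by (auto simp: wt_def ty_def hterm_at)

lemma ty_hId [simp]: "ty \<Gamma> A \<Longrightarrow> \<Gamma> \<Turnstile> a \<Colon> A \<Longrightarrow> \<Gamma> \<Turnstile> b \<Colon> A \<Longrightarrow> ty \<Gamma> (a =\<^bsub>A\<^esub> b)"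
  using sc_hId[of "length \<Gamma>" A a b] by (auto simp: ty_def wt_def hterm_at intro: id_form)

lemma wt_hLam:
  assumes A: "ty \<Gamma> A" and nat: "natf (length \<Gamma>) b" "natf (length \<Gamma>) B"
    and b: "\<forall>x. sc (Suc (length \<Gamma>)) x \<longrightarrow> \<Gamma> \<triangleright> A \<Turnstile> x \<Colon> A \<longrightarrow> \<Gamma> \<triangleright> A \<Turnstile> b x \<Colon> B x"
  shows "\<Gamma> \<Turnstile> hLam A b \<Colon> hPi A B"
proof -
  have "\<Gamma> \<triangleright> A \<Turnstile> b (hvar (length \<Gamma>)) \<Colon> B (hvar (length \<Gamma>))"
    using b wt_var[OF A] by simp
  then have "\<Gamma> \<turnstile> Lam (A (length \<Gamma>)) (b (hvar (length \<Gamma>)) (Suc (length \<Gamma>))) :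
      PiT (A (length \<Gamma>)) (B (hvar (length \<Gamma>)) (Suc (length \<Gamma>)))"
    by (intro pi_intro) (simp add: wt_def cext_def)
  then show ?thesis
    using A nat sc_hPi sc_hLam by (simp add: wt_def ty_def hterm_at)
qed

lemma wt_hApp:
  assumes f: "\<Gamma> \<Turnstile> f \<Colon> hPi A B" and a: "\<Gamma> \<Turnstile> a \<Colon> A" and B: "natf (length \<Gamma>) B"
  shows "\<Gamma> \<Turnstile> f \<cdot> a \<Colon> B a"
  using pi_elim[of \<Gamma> "f (length \<Gamma>)" "A (length \<Gamma>)" _ "a (length \<Gamma>)"] f a
    natf_inst[OF B, of a] sc_natf[OF B, of a] sc_hApp[of "length \<Gamma>" f a]
  by (simp add: wt_def hterm_at)

lemma wt_hApp_fun: "\<Gamma> \<Turnstile> f \<Colon> A \<rightarrow> B \<Longrightarrow> \<Gamma> \<Turnstile> a \<Colon> A \<Longrightarrow> sc (length \<Gamma>) B \<Longrightarrow> \<Gamma> \<Turnstile> f \<cdot> a \<Colon> B"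
  unfolding hFun_def by (drule (1) wt_hApp) (simp_all add: natf_def)

lemma wt_hPair:
  assumes B: "fam \<Gamma> A B" and a: "\<Gamma> \<Turnstile> a \<Colon> A" and b: "\<Gamma> \<Turnstile> b \<Colon> B a"
  shows "\<Gamma> \<Turnstile> \<langle>a, b\<rangle> \<Colon> hSig A B"
proof -
  obtain j where j: "\<Gamma> \<triangleright> A \<turnstile> B (hvar (length \<Gamma>)) (Suc (length \<Gamma>)) : Univ j"
    using fam_Univ[OF B] by blast
  show ?thesis
    using sig_intro[OF j[unfolded cext_def], of "a (length \<Gamma>)" "b (length \<Gamma>)"] a b
      natf_inst[OF fam_nat[OF B], of a] ty_sc[OF ty_hSig[OF B]] sc_hPair[of "length \<Gamma>" a b]
    by (simp add: wt_def hterm_at)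
qed

lemma wt_hPair_prod: "ty \<Gamma> A \<Longrightarrow> ty \<Gamma> B \<Longrightarrow> \<Gamma> \<Turnstile> a \<Colon> A \<Longrightarrow> \<Gamma> \<Turnstile> b \<Colon> B \<Longrightarrow> \<Gamma> \<Turnstile> \<langle>a, b\<rangle> \<Colon> A \<otimes> B"
  unfolding hProd_def by (rule wt_hPair) simp_all

lemma inh_hSig: "fam \<Gamma> A B \<Longrightarrow> \<Gamma> \<Turnstile> a \<Colon> A \<Longrightarrow> inh \<Gamma> (B a) \<Longrightarrow> inh \<Gamma> (hSig A B)"
  by (meson inh_def wt_hPair)

lemma inh_hProd: "ty \<Gamma> A \<Longrightarrow> ty \<Gamma> B \<Longrightarrow> inh \<Gamma> A \<Longrightarrow> inh \<Gamma> B \<Longrightarrow> inh \<Gamma> (A \<otimes> B)"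
  by (meson inh_def wt_hPair_prod)

text \<open>The term found for the generic variable is placed under a \<open>Lam\<close>. One
  existence statement thus becomes a witness that is uniform in the argument; all functions obtained
  without being written down come from here.\<close>

lemma inh_hPi:
  assumes A: "ty \<Gamma> A" and B: "natf (length \<Gamma>) B"
    and b: "\<And>x. sc (Suc (length \<Gamma>)) x \<Longrightarrow> \<Gamma> \<triangleright> A \<Turnstile> x \<Colon> A \<Longrightarrow> inh (\<Gamma> \<triangleright> A) (B x)"
  shows "inh \<Gamma> (hPi A B)"
proof -
  obtain t where t: "\<Gamma> \<triangleright> A \<Turnstile> t \<Colon> B (hvar (length \<Gamma>))"
    using b[OF _ wt_var[OF A]] by (auto simp: inh_def)
  have "\<Gamma> \<turnstile> Lam (A (length \<Gamma>)) (t (Suc (length \<Gamma>))) : hPi A B (length \<Gamma>)"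
    using t by (auto simp: wt_def cext_def hterm_at intro: pi_intro)
  then show ?thesis
    by (rule inh_tm[rotated 2]) (use A B in \<open>simp_all add: ty_def sc_hPi\<close>)
qed

lemma inh_hPiE: "inh \<Gamma> (hPi A B) \<Longrightarrow> natf (length \<Gamma>) B \<Longrightarrow> \<Gamma> \<Turnstile> a \<Colon> A \<Longrightarrow> inh \<Gamma> (B a)"
  by (meson inh_def wt_hApp)

lemma inh_hFun:
  assumes A: "ty \<Gamma> A" and B: "sc (length \<Gamma>) B" and b: "inh (\<Gamma> \<triangleright> A) A \<Longrightarrow> inh (\<Gamma> \<triangleright> A) B"
  shows "inh \<Gamma> (A \<rightarrow> B)"
  unfolding hFun_def by (rule inh_hPi[OF A]) (use B b in \<open>auto simp: natf_def intro: inhI\<close>)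

lemma inh_hFunE: "inh \<Gamma> (A \<rightarrow> B) \<Longrightarrow> sc (length \<Gamma>) B \<Longrightarrow> inh \<Gamma> A \<Longrightarrow> inh \<Gamma> B"
  by (meson inh_def wt_hApp_fun)

subsection \<open>Dependent pairs\<close>

text \<open>Some inhabitant over the two fresh variables serves as the branch of
  \<open>IndSig\<close>, so induction on pairs can be used without naming the branch.\<close>

lemma inh_hSig_ind:
  assumes B: "fam \<Gamma> A B" and C: "fam \<Gamma> (hSig A B) C" and p: "\<Gamma> \<Turnstile> p \<Colon> hSig A B"
    and g: "\<And>x y. sc (Suc (Suc (length \<Gamma>))) x \<Longrightarrow> sc (Suc (Suc (length \<Gamma>))) y \<Longrightarrow> ty (\<Gamma> \<triangleright> A) (B x) \<Longrightarrow>
      \<Gamma> \<triangleright> A \<triangleright> B x \<Turnstile> x \<Colon> A \<Longrightarrow> \<Gamma> \<triangleright> A \<triangleright> B x \<Turnstile> y \<Colon> B x \<Longrightarrow> inh (\<Gamma> \<triangleright> A \<triangleright> B x) (C \<langle>x, y\<rangle>)"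
  shows "inh \<Gamma> (C p)"
proof -
  let ?n = "length \<Gamma>"
  have Bn: "ty (\<Gamma> \<triangleright> A) (B (hvar ?n))" and A: "ty \<Gamma> A" and nC: "natf ?n C"
    using B C by (auto simp: fam_def)
  obtain t where t: "\<Gamma> \<triangleright> A \<triangleright> B (hvar ?n) \<Turnstile> t \<Colon> C \<langle>hvar ?n, hvar (Suc ?n)\<rangle>"
    using g[of "hvar ?n" "hvar (Suc ?n)"] wt_var[OF Bn] wt_weak[OF Bn wt_var[OF A]] Bn
    by (auto simp: inh_def)
  obtain j where j: "\<Gamma> \<triangleright> hSig A B \<turnstile> C (hvar ?n) (Suc ?n) : Univ j"
    using fam_Univ[OF C] by blast
  have "\<Gamma> \<turnstile> IndSig (C (hvar ?n) (Suc ?n)) (t (Suc (Suc ?n))) (p ?n) :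
      inst1 (C (hvar ?n) (Suc ?n)) (p ?n)"
    by (rule sig_elim[where A = "A ?n" and B = "B (hvar ?n) (Suc ?n)" and i = j])
      (use j t p natf_pair_inst[OF nC] in \<open>simp_all add: cext_def wt_def hterm_at\<close>)
  then show ?thesis
    using natf_inst[OF nC, of p] sc_natf[OF nC, of p] p
    by (intro inh_tm) (auto simp: wt_def)
qed

lemma rel_pr1 [simp]: "valid s \<Longrightarrow> rel s (Suc k) A A' \<Longrightarrow> rel s k p p' \<Longrightarrow> rel s k (pr1 A p) (pr1 A' p')"
  by (simp add: pr1_def)

lemma wt_pr1:
  assumes B: "fam \<Gamma> A B" and p: "\<Gamma> \<Turnstile> p \<Colon> hSig A B"
  shows "\<Gamma> \<Turnstile> pr1 A p \<Colon> A"
proof -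
  let ?n = "length \<Gamma>"
  have A: "ty \<Gamma> A" and Bn: "ty (\<Gamma> \<triangleright> A) (B (hvar ?n))" using B by (simp_all add: fam_def)
  have n: "natf ?n (\<lambda>_. A)" using ty_sc[OF A] by (simp add: natf_def)
  obtain j where j: "\<Gamma> \<triangleright> hSig A B \<turnstile> A (Suc ?n) : Univ j"
    using fam_Univ[OF fam_const[OF ty_hSig[OF B] A]] by blast
  have v: "\<Gamma> \<triangleright> A \<triangleright> B (hvar ?n) \<Turnstile> hvar ?n \<Colon> A"
    using wt_var[OF A] Bn by simp
  have "\<Gamma> \<turnstile> IndSig (A (Suc ?n)) (Var 1) (p ?n) : inst1 (A (Suc ?n)) (p ?n)"
    by (rule sig_elim[where A = "A ?n" and B = "B (hvar ?n) (Suc ?n)" and i = j])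
      (use j p v natf_pair_inst[OF n] in \<open>simp_all add: cext_def wt_def hterm_at\<close>)
  moreover have "sc ?n (pr1 A p)"
    by (rule scI) (use p A in \<open>simp add: wt_def ty_def\<close>)
  ultimately show ?thesis
    using natf_inst[OF n, of p] p A by (simp add: wt_def pr1_def hIndSig_def ty_def hterm_at)
qed

lemma hjeqD:
  assumes "\<Gamma> \<Turnstile> a \<equiv> b \<Colon> A"
  shows hjeq_wt1: "\<Gamma> \<Turnstile> a \<Colon> A" and hjeq_wt2: "\<Gamma> \<Turnstile> b \<Colon> A"
    and hjeq_at: "\<Gamma> \<turnstile> a (length \<Gamma>) \<equiv> b (length \<Gamma>) : A (length \<Gamma>)"
  using assms by (simp_all add: hjeq_def)

lemma hjeq_refl: "\<Gamma> \<Turnstile> a \<Colon> A \<Longrightarrow> \<Gamma> \<Turnstile> a \<equiv> a \<Colon> A"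
  by (auto simp: hjeq_def wt_def intro: jeq_refl)

lemma hjeq_sym: "\<Gamma> \<Turnstile> a \<equiv> b \<Colon> A \<Longrightarrow> \<Gamma> \<Turnstile> b \<equiv> a \<Colon> A"
  by (auto simp: hjeq_def intro: jeq_sym)

lemma hjeq_trans [trans]: "\<Gamma> \<Turnstile> a \<equiv> b \<Colon> A \<Longrightarrow> \<Gamma> \<Turnstile> b \<equiv> c \<Colon> A \<Longrightarrow> \<Gamma> \<Turnstile> a \<equiv> c \<Colon> A"
  by (auto simp: hjeq_def intro: jeq_trans)

lemma hjeq_weak [simp]: "ty \<Gamma> C \<Longrightarrow> \<Gamma> \<Turnstile> a \<equiv> b \<Colon> A \<Longrightarrow> \<Gamma> \<triangleright> C \<Turnstile> a \<equiv> b \<Colon> A"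
proof -
  assume C: "ty \<Gamma> C" and e: "\<Gamma> \<Turnstile> a \<equiv> b \<Colon> A"
  then obtain i where "\<Gamma> \<turnstile> C (length \<Gamma>) : Univ i" by (auto simp: ty_def)
  from wkg_jeq[OF this, of "[]", simplified, OF hjeq_at[OF e]]
  have "\<Gamma> \<triangleright> C \<turnstile> a (Suc (length \<Gamma>)) \<equiv> b (Suc (length \<Gamma>)) : A (Suc (length \<Gamma>))"
    using sc_step[OF wt_sc[OF hjeq_wt1[OF e]]] sc_step[OF wt_sc[OF hjeq_wt2[OF e]]]
      sc_step[OF wt_scT[OF hjeq_wt1[OF e]]]
    by (simp add: cext_def)
  then show ?thesis
    using C e by (simp add: hjeq_def)
qed

lemma hjeq_app_fun:
  assumes f: "\<Gamma> \<Turnstile> f \<equiv> g \<Colon> A \<rightarrow> B" and a: "\<Gamma> \<Turnstile> a \<equiv> b \<Colon> A" and B: "sc (length \<Gamma>) B"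
  shows "\<Gamma> \<Turnstile> f \<cdot> a \<equiv> g \<cdot> b \<Colon> B"
  unfolding hjeq_def
proof (intro conjI)
  show "\<Gamma> \<Turnstile> f \<cdot> a \<Colon> B" "\<Gamma> \<Turnstile> g \<cdot> b \<Colon> B"
    using f a B by (auto simp: hjeq_def intro: wt_hApp_fun)
  have "natf (length \<Gamma>) (\<lambda>_. B)" using B by (simp add: natf_def)
  from natf_inst[OF this wt_sc[OF hjeq_wt1[OF a]]]
  show "\<Gamma> \<turnstile> (f \<cdot> a) (length \<Gamma>) \<equiv> (g \<cdot> b) (length \<Gamma>) : B (length \<Gamma>)"
    using pi_elim_eq[OF hjeq_at[OF f, unfolded hFun_def hterm_at(1)] hjeq_at[OF a]]
    by (simp add: hterm_at)
qed

text \<open>Reflexivity at \<open>a\<close> is converted along the congruence rule for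
  \<open>IdT\<close>.\<close>

lemma heq_hjeq:
  assumes A: "ty \<Gamma> A" and ab: "\<Gamma> \<Turnstile> a \<equiv> b \<Colon> A"
  shows "\<Gamma> \<Turnstile> a \<approx> b \<Colon> A"
proof -
  let ?n = "length \<Gamma>"
  note a = hjeq_wt1[OF ab] and b = hjeq_wt2[OF ab]
  obtain j where j: "\<Gamma> \<turnstile> A ?n : Univ j" using A by (auto simp: ty_def)
  have "\<Gamma> \<turnstile> Refl (a ?n) : IdT (A ?n) (a ?n) (a ?n)"
    using id_intro[OF j] a by (simp add: wt_def)
  moreover have "\<Gamma> \<turnstile> IdT (A ?n) (a ?n) (a ?n) \<equiv> IdT (A ?n) (a ?n) (b ?n) : Univ j"
    using a by (intro id_form_eq jeq_refl j hjeq_at[OF ab]) (simp_all add: wt_def)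
  ultimately have "\<Gamma> \<turnstile> Refl (a ?n) : IdT (A ?n) (a ?n) (b ?n)"
    by (rule conv_typed)
  then have "inh \<Gamma> (a =\<^bsub>A\<^esub> b)"
    using A a b sc_hId by (intro inh_tm) (auto simp: ty_def wt_def hterm_at)
  then show ?thesis using A a b by (simp add: heq_def)
qed

lemma heq_refl [simp]: "ty \<Gamma> A \<Longrightarrow> \<Gamma> \<Turnstile> a \<Colon> A \<Longrightarrow> \<Gamma> \<Turnstile> a \<approx> a \<Colon> A"
  by (rule heq_hjeq[OF _ hjeq_refl])

lemma wt_hRefl: "ty \<Gamma> A \<Longrightarrow> \<Gamma> \<Turnstile> a \<Colon> A \<Longrightarrow> \<Gamma> \<Turnstile> hRefl a \<Colon> (a =\<^bsub>A\<^esub> a)"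
  using sc_hId[of "length \<Gamma>" A a a] sc_hRefl[of "length \<Gamma>" a]
  by (auto simp: wt_def ty_def hterm_at intro: id_intro)

lemma hjeq_beta:
  assumes A: "ty \<Gamma> A" and nat: "natf (length \<Gamma>) b" "natf (length \<Gamma>) B"
    and b: "\<forall>x. sc (Suc (length \<Gamma>)) x \<longrightarrow> \<Gamma> \<triangleright> A \<Turnstile> x \<Colon> A \<longrightarrow> \<Gamma> \<triangleright> A \<Turnstile> b x \<Colon> B x"
    and a: "\<Gamma> \<Turnstile> a \<Colon> A"
  shows "\<Gamma> \<Turnstile> hLam A b \<cdot> a \<equiv> b a \<Colon> B a"
proof -
  let ?n = "length \<Gamma>"
  have b0: "\<Gamma> \<triangleright> A \<Turnstile> b (hvar ?n) \<Colon> B (hvar ?n)"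
    using b wt_var[OF A] by simp
  then have b1: "\<Gamma> \<turnstile> App (Lam (A ?n) (b (hvar ?n) (Suc ?n))) (a ?n) \<equiv>
      inst1 (b (hvar ?n) (Suc ?n)) (a ?n) : inst1 (B (hvar ?n) (Suc ?n)) (a ?n)"
    using a by (intro pi_comp) (simp_all add: wt_def cext_def)
  have b2: "\<Gamma> \<turnstile> subst 0 (a ?n) (b (hvar ?n) (Suc ?n)) : subst 0 (a ?n) (B (hvar ?n) (Suc ?n))"
    using subst_typed[of \<Gamma> "a ?n" "A ?n" "[]"] b0 a by (fastforce simp: cext_def wt_def)
  note i = natf_inst[OF nat(1), of a] natf_inst[OF nat(2), of a]
  show ?thesis
    unfolding hjeq_def
  proof (intro conjI)
    show "\<Gamma> \<Turnstile> hLam A b \<cdot> a \<Colon> B a"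
      by (rule wt_hApp[OF wt_hLam[OF A nat b] a nat(2)])
    show "\<Gamma> \<Turnstile> b a \<Colon> B a"
      using b2 i a sc_natf[OF nat(1), of a] sc_natf[OF nat(2), of a] by (simp add: wt_def)
    show "\<Gamma> \<turnstile> (hLam A b \<cdot> a) ?n \<equiv> b a ?n : B a ?n"
      using b1 i a by (simp add: wt_def hterm_at)
  qed
qed

lemma heq_beta:
  assumes "ty \<Gamma> A" "natf (length \<Gamma>) b" "natf (length \<Gamma>) B" "ty \<Gamma> (B a)"
    "\<forall>x. sc (Suc (length \<Gamma>)) x \<longrightarrow> \<Gamma> \<triangleright> A \<Turnstile> x \<Colon> A \<longrightarrow> \<Gamma> \<triangleright> A \<Turnstile> b x \<Colon> B x" "\<Gamma> \<Turnstile> a \<Colon> A"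
  shows "\<Gamma> \<Turnstile> hLam A b \<cdot> a \<approx> b a \<Colon> B a"
  by (rule heq_hjeq[OF assms(4) hjeq_beta[OF assms(1-3,5,6)]])

text \<open>The judgemental forms are kept because the projection from \<open>idEquiv\<close> has to
  compute inside the types of the components of \<open>id_indisc\<close>.\<close>

lemma pr1_rules:
  assumes B: "fam \<Gamma> A B"
  shows hjeq_pr1: "\<Gamma> \<Turnstile> a \<Colon> A \<Longrightarrow> \<Gamma> \<Turnstile> b \<Colon> B a \<Longrightarrow> \<Gamma> \<Turnstile> pr1 A \<langle>a, b\<rangle> \<equiv> a \<Colon> A"
    and hjeq_pr1_cong: "\<Gamma> \<Turnstile> p \<equiv> q \<Colon> hSig A B \<Longrightarrow> \<Gamma> \<Turnstile> pr1 A p \<equiv> pr1 A q \<Colon> A"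
proof -
  let ?n = "length \<Gamma>"
  have A: "ty \<Gamma> A" and Bn: "ty (\<Gamma> \<triangleright> A) (B (hvar ?n))" using B by (simp_all add: fam_def)
  have n: "natf ?n (\<lambda>_. A)" using ty_sc[OF A] by (simp add: natf_def)
  obtain j where j: "\<Gamma> \<triangleright> hSig A B \<turnstile> A (Suc ?n) : Univ j"
    using fam_Univ[OF fam_const[OF ty_hSig[OF B] A]] by blast
  have v: "\<Gamma> \<triangleright> A \<triangleright> B (hvar ?n) \<Turnstile> hvar ?n \<Colon> A"
    using wt_var[OF A] Bn by simp
  {
    assume a: "\<Gamma> \<Turnstile> a \<Colon> A" and b: "\<Gamma> \<Turnstile> b \<Colon> B a"
    have p: "\<Gamma> \<Turnstile> \<langle>a, b\<rangle> \<Colon> hSig A B" by (rule wt_hPair[OF B a b])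
    have "\<Gamma> \<turnstile> IndSig (A (Suc ?n)) (Var 1) (MkPair (a ?n) (b ?n)) \<equiv> inst2 (Var 1) (a ?n) (b ?n) :
        inst1 (A (Suc ?n)) (MkPair (a ?n) (b ?n))"
      by (rule sig_comp[where A = "A ?n" and B = "B (hvar ?n) (Suc ?n)" and i = j])
        (use j a b v natf_pair_inst[OF n] natf_inst[OF fam_nat[OF B], of a]
          in \<open>simp_all add: cext_def wt_def hterm_at\<close>)
    then show "\<Gamma> \<Turnstile> pr1 A \<langle>a, b\<rangle> \<equiv> a \<Colon> A"
      using natf_inst[OF n wt_sc[OF p]] wt_pr1[OF B p] a
      by (simp add: hjeq_def pr1_def hIndSig_def hterm_at inst2_def)
  }
  assume e: "\<Gamma> \<Turnstile> p \<equiv> q \<Colon> hSig A B"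
  note p = hjeq_wt1[OF e] and q = hjeq_wt2[OF e]
  have "\<Gamma> \<turnstile> IndSig (A (Suc ?n)) (Var 1) (p ?n) \<equiv> IndSig (A (Suc ?n)) (Var 1) (q ?n) :
      inst1 (A (Suc ?n)) (p ?n)"
    by (rule sig_elim_eq[where A = "A ?n" and B = "B (hvar ?n) (Suc ?n)" and i = j])
      (use j v hjeq_at[OF e] natf_pair_inst[OF n] in \<open>auto simp: cext_def wt_def hterm_at intro!: jeq_refl\<close>)
  then show "\<Gamma> \<Turnstile> pr1 A p \<equiv> pr1 A q \<Colon> A"
    using natf_inst[OF n wt_sc[OF p]] wt_pr1[OF B p] wt_pr1[OF B q]
    by (simp add: hjeq_def pr1_def hIndSig_def hterm_at)
qed

lemma heq_pr1: "fam \<Gamma> A B \<Longrightarrow> \<Gamma> \<Turnstile> a \<Colon> A \<Longrightarrow> \<Gamma> \<Turnstile> b \<Colon> B a \<Longrightarrow> \<Gamma> \<Turnstile> pr1 A \<langle>a, b\<rangle> \<approx> a \<Colon> A"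
  by (rule heq_hjeq[OF fam_ty hjeq_pr1])

subsection \<open>Identity types\<close>

text \<open>Motive and branch are evaluated at fresh variables, which gives the raw premises of
  \<open>id_elim\<close> and \<open>id_comp\<close>; naturality rewrites the resulting
  \<open>inst3\<close> instances back to \<open>C\<close> applied to terms.\<close>

lemma hIndId_rules:
  assumes A: "ty \<Gamma> A" and nat: "natf3 (length \<Gamma>) C" "natf (length \<Gamma>) c"
    and C: "\<And>x y p. sc (Suc (Suc (Suc (length \<Gamma>)))) x \<Longrightarrow> sc (Suc (Suc (Suc (length \<Gamma>)))) y \<Longrightarrow>
      sc (Suc (Suc (Suc (length \<Gamma>)))) p \<Longrightarrow> ty (\<Gamma> \<triangleright> A \<triangleright> A) (x =\<^bsub>A\<^esub> y) \<Longrightarrow>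
      \<Gamma> \<triangleright> A \<triangleright> A \<triangleright> (x =\<^bsub>A\<^esub> y) \<Turnstile> x \<Colon> A \<Longrightarrow> \<Gamma> \<triangleright> A \<triangleright> A \<triangleright> (x =\<^bsub>A\<^esub> y) \<Turnstile> y \<Colon> A \<Longrightarrow>
      \<Gamma> \<triangleright> A \<triangleright> A \<triangleright> (x =\<^bsub>A\<^esub> y) \<Turnstile> p \<Colon> (x =\<^bsub>A\<^esub> y) \<Longrightarrow> ty (\<Gamma> \<triangleright> A \<triangleright> A \<triangleright> (x =\<^bsub>A\<^esub> y)) (C x y p)"
    and c: "\<And>x. sc (Suc (length \<Gamma>)) x \<Longrightarrow> \<Gamma> \<triangleright> A \<Turnstile> x \<Colon> A \<Longrightarrow> \<Gamma> \<triangleright> A \<Turnstile> c x \<Colon> C x x (hRefl x)"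
  shows wt_hIndId: "\<Gamma> \<Turnstile> a \<Colon> A \<Longrightarrow> \<Gamma> \<Turnstile> b \<Colon> A \<Longrightarrow> \<Gamma> \<Turnstile> p \<Colon> (a =\<^bsub>A\<^esub> b) \<Longrightarrow>
      \<Gamma> \<Turnstile> hIndId C c a b p \<Colon> C a b p"
    and hIndId_hRefl: "\<Gamma> \<Turnstile> a \<Colon> A \<Longrightarrow> ty \<Gamma> (C a a (hRefl a)) \<Longrightarrow>
      \<Gamma> \<Turnstile> hIndId C c a a (hRefl a) \<approx> c a \<Colon> C a a (hRefl a)"
proof -
  let ?n = "length \<Gamma>"
  let ?x = "hvar ?n" and ?y = "hvar (Suc ?n)" and ?p = "hvar (Suc (Suc ?n))"
  let ?\<Gamma> = "\<Gamma> \<triangleright> A \<triangleright> A \<triangleright> (?x =\<^bsub>A\<^esub> ?y)"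
  have AA: "ty (\<Gamma> \<triangleright> A) A" using A by simp
  have x: "\<Gamma> \<triangleright> A \<triangleright> A \<Turnstile> ?x \<Colon> A" and y: "\<Gamma> \<triangleright> A \<triangleright> A \<Turnstile> ?y \<Colon> A"
    using wt_var[OF A] wt_var[OF AA] AA by simp_all
  have I: "ty (\<Gamma> \<triangleright> A \<triangleright> A) (?x =\<^bsub>A\<^esub> ?y)"
    using x y AA by simp
  have "ty ?\<Gamma> (C ?x ?y ?p)"
    using C[of ?x ?y ?p] x y I wt_var[OF I] by simp
  then obtain j where "?\<Gamma> \<turnstile> C ?x ?y ?p (Suc (Suc (Suc ?n))) : Univ j"
    by (auto simp: ty_def)
  moreover have "A (Suc ?n) = lift 1 0 (A ?n)" "A (Suc (Suc ?n)) = lift 2 0 (A ?n)"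
    using sc_add[OF ty_sc[OF A], of 1] sc_add[OF ty_sc[OF A], of 2] by simp_all
  ultimately have j: "IdT (lift 2 0 (A ?n)) (Var 1) (Var 0) # lift 1 0 (A ?n) # A ?n # \<Gamma> \<turnstile>
      C ?x ?y ?p (Suc (Suc (Suc ?n))) : Univ j"
    by (simp add: cext_def hterm_at)
  have c0: "\<Gamma> \<triangleright> A \<Turnstile> c ?x \<Colon> C ?x ?x (hRefl ?x)"
    using c[of ?x] wt_var[OF A] by simp
  then have c1: "A ?n # \<Gamma> \<turnstile> c ?x (Suc ?n) :
      inst3 (lift 1 3 (C ?x ?y ?p (Suc (Suc (Suc ?n))))) (Var 0) (Var 0) (Refl (Var 0))"
    using natf3_refl_inst[OF nat(1)] by (simp add: wt_def cext_def)
  {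
    fix a b p
    assume a: "\<Gamma> \<Turnstile> a \<Colon> A" and b: "\<Gamma> \<Turnstile> b \<Colon> A" and p: "\<Gamma> \<Turnstile> p \<Colon> (a =\<^bsub>A\<^esub> b)"
    note s = wt_sc[OF a] wt_sc[OF b] wt_sc[OF p]
    have "\<Gamma> \<turnstile> IndId (C ?x ?y ?p (Suc (Suc (Suc ?n)))) (c ?x (Suc ?n)) (a ?n) (b ?n) (p ?n) :
        inst3 (C ?x ?y ?p (Suc (Suc (Suc ?n)))) (a ?n) (b ?n) (p ?n)"
      by (rule id_elim[OF j c1]) (use a b p in \<open>simp_all add: wt_def hterm_at\<close>)
    moreover have "sc ?n (hIndId C c a b p)"
      by (rule scI) (use s nat in \<open>simp add: natf_def natf3_def\<close>)
    ultimately show "\<Gamma> \<Turnstile> hIndId C c a b p \<Colon> C a b p"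
      using natf3_inst[OF nat(1) s] sc_natf3[OF nat(1) s] wt_ctx[OF a]
      by (simp add: wt_def hIndId_def)
  } note typed = this
  {
    assume a: "\<Gamma> \<Turnstile> a \<Colon> A" and Ca: "ty \<Gamma> (C a a (hRefl a))"
    have r: "\<Gamma> \<Turnstile> hRefl a \<Colon> (a =\<^bsub>A\<^esub> a)" by (rule wt_hRefl[OF A a])
    note s = wt_sc[OF a] wt_sc[OF a] wt_sc[OF r]
    have e: "\<Gamma> \<turnstile> IndId (C ?x ?y ?p (Suc (Suc (Suc ?n)))) (c ?x (Suc ?n)) (a ?n) (a ?n) (Refl (a ?n)) \<equiv>
        inst1 (c ?x (Suc ?n)) (a ?n) :
        inst3 (C ?x ?y ?p (Suc (Suc (Suc ?n)))) (a ?n) (a ?n) (Refl (a ?n))"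
      by (rule id_comp[OF j c1]) (use a in \<open>simp add: wt_def\<close>)
    have D: "natf ?n (\<lambda>x. C x x (hRefl x))"
      using nat(1) by (simp add: natf_def natf3_def)
    have "\<Gamma> \<turnstile> subst 0 (a ?n) (c ?x (Suc ?n)) : subst 0 (a ?n) (C ?x ?x (hRefl ?x) (Suc ?n))"
      using subst_typed[of \<Gamma> "a ?n" "A ?n" "[]"] c0 a by (fastforce simp: cext_def wt_def)
    then have "\<Gamma> \<Turnstile> c a \<Colon> C a a (hRefl a)"
      using natf_inst[OF nat(2), of a] natf_inst[OF D, of a] sc_natf[OF nat(2), of a] a Ca
      by (simp add: wt_def ty_def)
    then show "\<Gamma> \<Turnstile> hIndId C c a a (hRefl a) \<approx> c a \<Colon> C a a (hRefl a)"
      using e natf3_inst[OF nat(1) s] natf_inst[OF nat(2), of a] s(1) typed[OF a a r]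
      by (intro heq_hjeq[OF Ca]) (simp add: hjeq_def hIndId_def hterm_at)
  }
qed

section \<open>Transport and extensionality\<close>

text \<open>From here on a naturality goal is unfolded and decomposed one combinator at a time
  through the \<open>rel\<close> rules; where \<open>natf\<close> must be kept as a unit, the
  definitions are removed again.\<close>

declare nat_defs [simp]

lemma fam_natE:
  "fam \<Gamma> A B \<Longrightarrow> valid s \<Longrightarrow> length \<Gamma> \<le> base s \<Longrightarrow> (\<forall>j\<ge>k. rel s j t t') \<Longrightarrow> rel s k (B t) (B t')"
  by (rule natf_rel[OF natf_up[OF fam_nat]])

text \<open>The new variable is inserted below the variable of \<open>A\<close>, which therefore
  moves from level \<open>length \<Gamma>\<close> to the next one. The universe level
  \<open>j\<close> is preserved, which \<open>fam_level\<close> relies on.\<close>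

lemma weak_under:
  assumes nat: "natf (length \<Gamma>) B" and A: "sc (length \<Gamma>) A" and C: "ty \<Gamma> C"
    and B: "\<Gamma> \<triangleright> A \<turnstile> B (hvar (length \<Gamma>)) (Suc (length \<Gamma>)) : Univ j"
  shows "\<Gamma> \<triangleright> C \<triangleright> A \<turnstile> B (hvar (Suc (length \<Gamma>))) (Suc (Suc (length \<Gamma>))) : Univ j"
proof -
  let ?n = "length \<Gamma>"
  obtain i where i: "\<Gamma> \<turnstile> C ?n : Univ i" using C by (auto simp: ty_def)
  have "[A ?n] @ \<Gamma> \<turnstile> B (hvar ?n) (Suc ?n) : Univ j"
    using B by (simp add: cext_def)
  from wkg_typed[OF i this]
  have "lift 1 0 (A ?n) # C ?n # \<Gamma> \<turnstile> lift 1 1 (B (hvar ?n) (Suc ?n)) : Univ j"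
    by simp
  then show ?thesis
    using natf_weak_inst[OF nat] sc_step[OF A] by (simp add: cext_def)
qed

lemma fam_weak [simp]:
  assumes B: "fam \<Gamma> A B" and C: "ty \<Gamma> C"
  shows "fam (\<Gamma> \<triangleright> C) A B"
proof -
  let ?n = "length \<Gamma>"
  obtain j where "\<Gamma> \<triangleright> A \<turnstile> B (hvar ?n) (Suc ?n) : Univ j"
    using fam_Univ[OF B] by blast
  then have "\<Gamma> \<triangleright> C \<triangleright> A \<turnstile> B (hvar (Suc ?n)) (Suc (Suc ?n)) : Univ j"
    by (rule weak_under[OF fam_nat[OF B] ty_sc[OF fam_ty[OF B]] C])
  moreover have n: "natf (Suc ?n) B" by (rule natf_up[OF fam_nat[OF B]]) simp
  moreover have "ty (\<Gamma> \<triangleright> C) A" using C fam_ty[OF B] by simp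
  moreover have "sc (Suc (Suc ?n)) (B (hvar (Suc ?n)))"
    by (rule sc_natf[OF natf_up[OF fam_nat[OF B]]]) simp_all
  ultimately show ?thesis
    unfolding fam_def by (auto simp: ty_def[of "_ \<triangleright> A"] simp del: nat_defs)
qed

lemma wt_sub:
  assumes nat: "natf (length \<Gamma>) b" "natf (length \<Gamma>) B"
    and b: "\<forall>x. sc (Suc (length \<Gamma>)) x \<longrightarrow> \<Gamma> \<triangleright> A \<Turnstile> x \<Colon> A \<longrightarrow> \<Gamma> \<triangleright> A \<Turnstile> b x \<Colon> B x"
    and A: "ty \<Gamma> A" and a: "\<Gamma> \<Turnstile> a \<Colon> A"
  shows "\<Gamma> \<Turnstile> b a \<Colon> B a"
proof -
  let ?n = "length \<Gamma>"
  have "\<Gamma> \<triangleright> A \<Turnstile> b (hvar ?n) \<Colon> B (hvar ?n)"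
    using b wt_var[OF A] by simp
  then have "\<Gamma> \<turnstile> subst 0 (a ?n) (b (hvar ?n) (Suc ?n)) : subst 0 (a ?n) (B (hvar ?n) (Suc ?n))"
    using subst_typed[of \<Gamma> "a ?n" "A ?n" "[]"] a by (fastforce simp: cext_def wt_def)
  then show ?thesis
    using natf_inst[OF nat(1), of a] natf_inst[OF nat(2), of a] sc_natf[OF nat(1), of a]
      sc_natf[OF nat(2), of a] a by (simp add: wt_def)
qed

lemma heqD: assumes "\<Gamma> \<Turnstile> a \<approx> b \<Colon> A"
  shows heq_ty: "ty \<Gamma> A" and heq_wt1: "\<Gamma> \<Turnstile> a \<Colon> A" and heq_wt2: "\<Gamma> \<Turnstile> b \<Colon> A"
    and heq_inh: "inh \<Gamma> (a =\<^bsub>A\<^esub> b)"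
  using assms by (simp_all add: heq_def)

lemma heq_weak [simp]: "ty \<Gamma> C \<Longrightarrow> \<Gamma> \<Turnstile> a \<approx> b \<Colon> A \<Longrightarrow> \<Gamma> \<triangleright> C \<Turnstile> a \<approx> b \<Colon> A"
  by (simp add: heq_def)

text \<open>Path induction with motive \<open>C x \<rightarrow> C y\<close> and the identity
  function on the diagonal; the resulting function is applied to the inhabitant of
  \<open>C a\<close>.\<close>

lemma transport:
  assumes ab: "\<Gamma> \<Turnstile> a \<approx> b \<Colon> A" and C: "fam \<Gamma> A C" and Ca: "inh \<Gamma> (C a)"
  shows "inh \<Gamma> (C b)"
proof -
  obtain p where p: "\<Gamma> \<Turnstile> p \<Colon> (a =\<^bsub>A\<^esub> b)" using heq_inh[OF ab] by (rule inhE)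
  note [simp] = heq_ty[OF ab] fam_natE[OF C]
  have "\<Gamma> \<Turnstile> hIndId (\<lambda>x y _. C x \<rightarrow> C y) (\<lambda>x. hLam (C x) (\<lambda>z. z)) a b p \<Colon> C a \<rightarrow> C b"
  proof (rule wt_hIndId[OF heq_ty[OF ab]])
    fix x y p
    assume "ty (\<Gamma> \<triangleright> A \<triangleright> A) (x =\<^bsub>A\<^esub> y)"
      "\<Gamma> \<triangleright> A \<triangleright> A \<triangleright> (x =\<^bsub>A\<^esub> y) \<Turnstile> x \<Colon> A" "\<Gamma> \<triangleright> A \<triangleright> A \<triangleright> (x =\<^bsub>A\<^esub> y) \<Turnstile> y \<Colon> A"
    then show "ty (\<Gamma> \<triangleright> A \<triangleright> A \<triangleright> (x =\<^bsub>A\<^esub> y)) (C x \<rightarrow> C y)"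
      using C by (intro ty_hFun; intro fam_sub[where A = A and B = C]) simp_all
  next
    fix x
    assume "sc (Suc (length \<Gamma>)) x" and x: "\<Gamma> \<triangleright> A \<Turnstile> x \<Colon> A"
    moreover have Cx: "ty (\<Gamma> \<triangleright> A) (C x)"
      using C x by (intro fam_sub[where A = A and B = C]) simp_all
    ultimately show "\<Gamma> \<triangleright> A \<Turnstile> hLam (C x) (\<lambda>z. z) \<Colon> C x \<rightarrow> C x"
      unfolding hFun_def using ty_sc[OF Cx] by (intro wt_hLam) simp_all
  qed (use ab p in \<open>simp_all add: heqD\<close>)
  then show ?thesis
    using Ca ty_sc[OF fam_sub[OF C heq_wt2[OF ab]]] by (meson inh_def wt_hApp_fun)
qed

lemma heq_sym:
  assumes ab: "\<Gamma> \<Turnstile> a \<approx> b \<Colon> A"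
  shows "\<Gamma> \<Turnstile> b \<approx> a \<Colon> A"
proof -
  note [simp] = heqD[OF ab] heq_ty[OF ab, THEN ty_sc] heq_wt1[OF ab, THEN wt_sc]
  have "inh \<Gamma> (b =\<^bsub>A\<^esub> a)"
    by (rule transport[OF ab, where C = "\<lambda>x. x =\<^bsub>A\<^esub> a"], rule famI)
      (simp_all add: heq_inh[OF heq_refl])
  then show ?thesis by (simp add: heq_def)
qed

lemma heq_trans [trans]:
  assumes ab: "\<Gamma> \<Turnstile> a \<approx> b \<Colon> A" and bc: "\<Gamma> \<Turnstile> b \<approx> c \<Colon> A"
  shows "\<Gamma> \<Turnstile> a \<approx> c \<Colon> A"
proof -
  note [simp] = heqD[OF ab] heq_ty[OF ab, THEN ty_sc] heq_wt1[OF ab, THEN wt_sc]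
  have "inh \<Gamma> (a =\<^bsub>A\<^esub> c)"
    by (rule transport[OF bc, where C = "\<lambda>x. a =\<^bsub>A\<^esub> x"], rule famI) simp_all
  then show ?thesis using heq_wt2[OF bc] by (simp add: heq_def)
qed

text \<open>Transport in the family of equations \<open>f a = f x\<close>, starting from
  reflexivity. Since \<open>f\<close> is an operation in HOL, it may be any term context with a
  hole.\<close>

lemma heq_cong:
  assumes ab: "\<Gamma> \<Turnstile> a \<approx> b \<Colon> A" and B: "ty \<Gamma> B" and nat: "natf (length \<Gamma>) f"
    and f: "\<forall>x. sc (Suc (length \<Gamma>)) x \<longrightarrow> \<Gamma> \<triangleright> A \<Turnstile> x \<Colon> A \<longrightarrow> \<Gamma> \<triangleright> A \<Turnstile> f x \<Colon> B"
  shows "\<Gamma> \<Turnstile> f a \<approx> f b \<Colon> B"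
proof -
  note [simp] = heqD[OF ab] heq_ty[OF ab, THEN ty_sc] B ty_sc[OF B]
  have fx: "\<Gamma> \<Turnstile> f x \<Colon> B" if "\<Gamma> \<Turnstile> x \<Colon> A" for x
    by (rule wt_sub[where B = "\<lambda>_. B", OF nat _ f _ that]) simp_all
  have [simp]: "sc (length \<Gamma>) (f a)" using fx heq_wt1[OF ab] by (blast intro: wt_sc)
  have "inh \<Gamma> (f a =\<^bsub>B\<^esub> f b)"
    by (rule transport[OF ab, where C = "\<lambda>x. f a =\<^bsub>B\<^esub> f x"], rule famI)
      (use nat f fx in \<open>simp_all add: heq_inh[OF heq_refl]\<close>)
  then show ?thesis using fx by (simp add: heq_def)
qed

lemma heq_app1:
  assumes fg: "\<Gamma> \<Turnstile> f \<approx> g \<Colon> hPi A B" and B: "fam \<Gamma> A B" and a: "\<Gamma> \<Turnstile> a \<Colon> A"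
  shows "\<Gamma> \<Turnstile> f \<cdot> a \<approx> g \<cdot> a \<Colon> B a"
proof (rule heq_cong[OF fg])
  note [simp] = fam_natE[OF B] wt_sc[OF a] ty_hPi[OF B]
  show "ty \<Gamma> (B a)" by (rule fam_sub[OF B a])
  show "natf (length \<Gamma>) (\<lambda>f. f \<cdot> a)" by simp
  show "\<forall>x. sc (Suc (length \<Gamma>)) x \<longrightarrow> \<Gamma> \<triangleright> hPi A B \<Turnstile> x \<Colon> hPi A B \<longrightarrow> \<Gamma> \<triangleright> hPi A B \<Turnstile> x \<cdot> a \<Colon> B a"
    using a by (auto intro!: wt_hApp[where A = A and B = B])
qed

lemma heq_app1_fun:
  "\<Gamma> \<Turnstile> f \<approx> g \<Colon> A \<rightarrow> B \<Longrightarrow> ty \<Gamma> A \<Longrightarrow> ty \<Gamma> B \<Longrightarrow> \<Gamma> \<Turnstile> a \<Colon> A \<Longrightarrow> \<Gamma> \<Turnstile> f \<cdot> a \<approx> g \<cdot> a \<Colon> B"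
  unfolding hFun_def by (drule heq_app1) (auto simp: ty_sc)

lemma heq_app2:
  assumes ab: "\<Gamma> \<Turnstile> a \<approx> b \<Colon> A" and f: "\<Gamma> \<Turnstile> f \<Colon> A \<rightarrow> B" and B: "ty \<Gamma> B"
  shows "\<Gamma> \<Turnstile> f \<cdot> a \<approx> f \<cdot> b \<Colon> B"
proof (rule heq_cong[OF ab B])
  note [simp] = wt_sc[OF f] heq_ty[OF ab] ty_sc[OF B]
  show "natf (length \<Gamma>) (\<lambda>a. f \<cdot> a)" by simp
  show "\<forall>x. sc (Suc (length \<Gamma>)) x \<longrightarrow> \<Gamma> \<triangleright> A \<Turnstile> x \<Colon> A \<longrightarrow> \<Gamma> \<triangleright> A \<Turnstile> f \<cdot> x \<Colon> B"
    using f by (auto intro!: wt_hApp_fun[where A = A and B = B])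
qed

lemma heq_pr1_cong:
  assumes pq: "\<Gamma> \<Turnstile> p \<approx> q \<Colon> hSig A B" and B: "fam \<Gamma> A B"
  shows "\<Gamma> \<Turnstile> pr1 A p \<approx> pr1 A q \<Colon> A"
proof (rule heq_cong[OF pq fam_ty[OF B]])
  note [simp] = ty_sc[OF fam_ty[OF B]] heq_ty[OF pq]
  show "natf (length \<Gamma>) (pr1 A)" by simp
  show "\<forall>x. sc (Suc (length \<Gamma>)) x \<longrightarrow> \<Gamma> \<triangleright> hSig A B \<Turnstile> x \<Colon> hSig A B \<longrightarrow> \<Gamma> \<triangleright> hSig A B \<Turnstile> pr1 A x \<Colon> A"
    using B by (auto intro!: wt_pr1[where A = A and B = B])
qed

text \<open>There is no term for the second projection. Induction on pairs proves the motive
  \<open>B (pr1 A p)\<close>: over a literal pair the computation rule of \<open>pr1\<close> holds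
  up to equality, and the second component is transported back along it.\<close>

lemma inh_pr2:
  assumes B: "fam \<Gamma> A B" and p: "\<Gamma> \<Turnstile> p \<Colon> hSig A B"
  shows "inh \<Gamma> (B (pr1 A p))"
proof (rule inh_hSig_ind[OF B _ p])
  note [simp] = fam_natE[OF B] fam_ty[OF B] ty_sc[OF fam_ty[OF B]] ty_hSig[OF B]
  show "fam \<Gamma> (hSig A B) (\<lambda>p. B (pr1 A p))"
    using B by (intro famI) (auto intro!: fam_sub[where A = A and B = B] wt_pr1[where B = B])
  fix x y
  let ?\<Gamma> = "\<Gamma> \<triangleright> A \<triangleright> B x"
  assume x: "ty (\<Gamma> \<triangleright> A) (B x)" "?\<Gamma> \<Turnstile> x \<Colon> A" and y: "?\<Gamma> \<Turnstile> y \<Colon> B x"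
  have B': "fam ?\<Gamma> A B" using B x by simp
  show "inh ?\<Gamma> (B (pr1 A \<langle>x, y\<rangle>))"
    by (rule transport[OF heq_sym[OF heq_pr1[OF B' x(2) y]] B' inhI[OF y]])
qed

lemma inh_hSigE:
  assumes "inh \<Gamma> (hSig A B)" "fam \<Gamma> A B"
  obtains x where "\<Gamma> \<Turnstile> x \<Colon> A" "sc (length \<Gamma>) x" "inh \<Gamma> (B x)"
  using assms by (meson inhE inh_pr2 wt_pr1 wt_sc)

lemma inh_hProdE:
  assumes "inh \<Gamma> (A \<otimes> B)" "ty \<Gamma> A" "ty \<Gamma> B"
  shows "inh \<Gamma> A" "inh \<Gamma> B"
  using assms by (auto simp: hProd_def intro: inhI elim!: inh_hSigE)

text \<open>To avoid a second projection, the statement that \<open>p\<close> equals some pair is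
  itself expressed as a \<Sigma>-type. It is inhabited by induction on pairs, and its components are
  then extracted one by one.\<close>

lemma hSig_eta:
  assumes B: "fam \<Gamma> A B" and p: "\<Gamma> \<Turnstile> p \<Colon> hSig A B"
  obtains x y where "\<Gamma> \<Turnstile> x \<Colon> A" "\<Gamma> \<Turnstile> y \<Colon> B x" "\<Gamma> \<Turnstile> p \<approx> \<langle>x, y\<rangle> \<Colon> hSig A B"
proof -
  note [simp] = fam_natE[OF B] fam_ty[OF B] ty_sc[OF fam_ty[OF B]] ty_hSig[OF B]
  \<comment> \<open>These formation facts are needed in \<open>\<Gamma>\<close>, over a variable for
    \<open>p\<close>, and over the two variables of the induction, hence for a variable context and
    a variable pair.\<close>
  have *: "fam \<Delta> A (\<lambda>x. \<Sigma> y:B x. q =\<^bsub>hSig A B\<^esub> \<langle>x, y\<rangle>)" "ty \<Delta> (\<Sigma> x:A. \<Sigma> y:B x. q =\<^bsub>hSig A B\<^esub> \<langle>x, y\<rangle>)"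
    and **: "\<And>x. \<Delta> \<Turnstile> x \<Colon> A \<Longrightarrow> fam \<Delta> (B x) (\<lambda>y. q =\<^bsub>hSig A B\<^esub> \<langle>x, y\<rangle>)"
    if \<Delta>: "fam \<Delta> A B" "length \<Gamma> \<le> length \<Delta>" and q: "\<Delta> \<Turnstile> q \<Colon> hSig A B" for \<Delta> q
  proof -
    note [simp] = wt_sc[OF q] fam_ty[OF \<Delta>(1)] ty_sc[OF fam_ty[OF \<Delta>(1)]] \<Delta>(2) ty_hSig[OF \<Delta>(1)]
    note [simp] = le_trans[OF \<Delta>(2)]
    have 1: "fam \<Delta>' (B x) (\<lambda>y. q =\<^bsub>hSig A B\<^esub> \<langle>x, y\<rangle>)"
      if "fam \<Delta>' A B" "\<Delta>' \<Turnstile> q \<Colon> hSig A B" "\<Delta>' \<Turnstile> x \<Colon> A" "length \<Delta> \<le> length \<Delta>'" for \<Delta>' x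
      using that fam_sub[OF that(1,3)] ty_hSig[OF that(1)] sc_up[OF ty_sc[OF ty_hSig[OF \<Delta>(1)]] that(4)]
        wt_sc[OF that(3)] wt_sc[OF that(2)] ty_sc[OF fam_ty[OF that(1)]]
      by (intro famI) (auto intro!: wt_hPair ty_hId le_trans[OF \<Delta>(2)])
    show 2: "fam \<Delta> A (\<lambda>x. \<Sigma> y:B x. q =\<^bsub>hSig A B\<^esub> \<langle>x, y\<rangle>)"
      using \<Delta> q by (intro famI) (auto intro!: ty_hSig 1)
    show "ty \<Delta> (\<Sigma> x:A. \<Sigma> y:B x. q =\<^bsub>hSig A B\<^esub> \<langle>x, y\<rangle>)"
      by (rule ty_hSig[OF 2])
    show "fam \<Delta> (B x) (\<lambda>y. q =\<^bsub>hSig A B\<^esub> \<langle>x, y\<rangle>)" if "\<Delta> \<Turnstile> x \<Colon> A" for x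
      using that \<Delta> q by (intro 1) auto
  qed
  have "inh \<Gamma> (\<Sigma> x:A. \<Sigma> y:B x. p =\<^bsub>hSig A B\<^esub> \<langle>x, y\<rangle>)"
  proof (rule inh_hSig_ind[OF B _ p])
    show "fam \<Gamma> (hSig A B) (\<lambda>p. \<Sigma> x:A. \<Sigma> y:B x. p =\<^bsub>hSig A B\<^esub> \<langle>x, y\<rangle>)"
      using B by (intro famI) (auto intro!: *)
    fix x y
    let ?\<Gamma> = "\<Gamma> \<triangleright> A \<triangleright> B x"
    assume x: "ty (\<Gamma> \<triangleright> A) (B x)" "?\<Gamma> \<Turnstile> x \<Colon> A" and y: "?\<Gamma> \<Turnstile> y \<Colon> B x"
    have B': "fam ?\<Gamma> A B" using B x by simp
    have xy: "?\<Gamma> \<Turnstile> \<langle>x, y\<rangle> \<Colon> hSig A B" by (rule wt_hPair[OF B' x(2) y])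
    show "inh ?\<Gamma> (\<Sigma> x':A. \<Sigma> y':B x'. \<langle>x, y\<rangle> =\<^bsub>hSig A B\<^esub> \<langle>x', y'\<rangle>)"
      using B' xy x y
      by (intro inh_hSig[where a = x] inh_hSig[where a = y] *(1) **)
        (auto intro!: heq_inh[OF heq_refl] ty_hSig)
  qed
  then obtain x where x: "\<Gamma> \<Turnstile> x \<Colon> A" "inh \<Gamma> (\<Sigma> y:B x. p =\<^bsub>hSig A B\<^esub> \<langle>x, y\<rangle>)"
    using *(1)[OF B _ p] by (blast elim: inh_hSigE)
  then obtain y where y: "\<Gamma> \<Turnstile> y \<Colon> B x" "inh \<Gamma> (p =\<^bsub>hSig A B\<^esub> \<langle>x, y\<rangle>)"
    using **[OF B _ p x(1)] by (blast elim: inh_hSigE)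
  show ?thesis
    using that[OF x(1) y(1)] y wt_hPair[OF B x(1) y(1)] p by (simp add: heq_def)
qed

text \<open>A statement made for all extensions of \<open>\<Gamma>\<close> is the meta-level form of
  a hypothetical judgement: it can be used below any binder met later, and \<open>inh_hPi\<close>
  turns it back into a term.\<close>

inductive ext :: "tm list \<Rightarrow> tm list \<Rightarrow> bool" where
  ext_refl [simp]: "ext \<Gamma> \<Gamma>"
| ext_cext [simp]: "ext \<Gamma> \<Delta> \<Longrightarrow> ty \<Delta> A \<Longrightarrow> ext \<Gamma> (\<Delta> \<triangleright> A)"

lemma ext_trans: "ext \<Delta> E \<Longrightarrow> ext \<Gamma> \<Delta> \<Longrightarrow> ext \<Gamma> E"
  by (induction rule: ext.induct) auto

lemma ext_length: "ext \<Gamma> \<Delta> \<Longrightarrow> length \<Gamma> \<le> length \<Delta>"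
  by (induction rule: ext.induct) auto

lemma ty_ext: "ext \<Gamma> \<Delta> \<Longrightarrow> ty \<Gamma> A \<Longrightarrow> ty \<Delta> A"
  by (induction rule: ext.induct) auto

lemma wt_ext: "ext \<Gamma> \<Delta> \<Longrightarrow> \<Gamma> \<Turnstile> t \<Colon> A \<Longrightarrow> \<Delta> \<Turnstile> t \<Colon> A"
  by (induction rule: ext.induct) auto

lemma inh_ext: "ext \<Gamma> \<Delta> \<Longrightarrow> inh \<Gamma> A \<Longrightarrow> inh \<Delta> A"
  by (induction rule: ext.induct) auto

lemma heq_ext: "ext \<Gamma> \<Delta> \<Longrightarrow> \<Gamma> \<Turnstile> a \<approx> b \<Colon> A \<Longrightarrow> \<Delta> \<Turnstile> a \<approx> b \<Colon> A"
  by (induction rule: ext.induct) auto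

lemma fam_ext: "ext \<Gamma> \<Delta> \<Longrightarrow> fam \<Gamma> A B \<Longrightarrow> fam \<Delta> A B"
  by (induction rule: ext.induct) auto

lemma sc_ext: "ext \<Gamma> \<Delta> \<Longrightarrow> sc (length \<Gamma>) t \<Longrightarrow> sc (length \<Delta>) t"
  by (rule sc_up) (auto simp: ext_length)

subsection \<open>Function extensionality\<close>

lemma sc_hUniv [simp]: "sc n (\<U> j)"
  by (rule scI) simp

text \<open>Function extensionality is available for families that are terms of type
  \<open>A \<rightarrow> \<U> j\<close>. This requires one level that serves for all extensions and
  all instances.\<close>

lemma fam_level:
  assumes B: "fam \<Gamma> A B"
  obtains j where "\<And>\<Delta>. ext \<Gamma> \<Delta> \<Longrightarrow> \<Delta> \<Turnstile> A \<Colon> \<U> j"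
    "\<And>\<Delta> x. ext \<Gamma> \<Delta> \<Longrightarrow> \<Delta> \<Turnstile> x \<Colon> A \<Longrightarrow> \<Delta> \<Turnstile> B x \<Colon> \<U> j"
proof -
  obtain j where A: "\<Gamma> \<turnstile> A (length \<Gamma>) : Univ j"
    and j: "\<Gamma> \<triangleright> A \<turnstile> B (hvar (length \<Gamma>)) (Suc (length \<Gamma>)) : Univ j"
    using fam_Univ[OF B] by blast
  \<comment> \<open>Induction along the extension, since \<open>fam_ext\<close> alone would forget
    which level was chosen.\<close>
  have *: "\<Delta> \<triangleright> A \<turnstile> B (hvar (length \<Delta>)) (Suc (length \<Delta>)) : Univ j" if "ext \<Gamma> \<Delta>" for \<Delta>
    using that B j
  proof (induction rule: ext.induct)
    case (ext_cext \<Gamma> \<Delta> C)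
    have "fam \<Delta> A B" using ext_cext by (blast intro: fam_ext)
    then show ?case
      using weak_under[of \<Delta> B A C j] ext_cext fam_nat ty_sc[OF fam_ty] by (simp del: nat_defs)
  qed simp
  show ?thesis
  proof
    fix \<Delta> assume \<Delta>: "ext \<Gamma> \<Delta>"
    have "\<Gamma> \<Turnstile> A \<Colon> \<U> j"
      using A fam_ty[OF B] by (simp add: wt_def ty_def hterm_at)
    with \<Delta> show "\<Delta> \<Turnstile> A \<Colon> \<U> j" by (rule wt_ext)
    fix x assume x: "\<Delta> \<Turnstile> x \<Colon> A"
    have n: "natf (length \<Delta>) B" by (rule natf_up[OF fam_nat[OF B] ext_length[OF \<Delta>]])
    have "\<Delta> \<turnstile> subst 0 (x (length \<Delta>)) (B (hvar (length \<Delta>)) (Suc (length \<Delta>))) : Univ j"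
      using subst_typed[of \<Delta> "x (length \<Delta>)" "A (length \<Delta>)" "[]"] *[OF \<Delta>] x
      by (fastforce simp: cext_def wt_def)
    then show "\<Delta> \<Turnstile> B x \<Colon> \<U> j"
      using natf_inst[OF n, of x] sc_natf[OF n, of x] x by (simp add: wt_def hterm_at)
  qed
qed

lemma wt_conv:
  "\<Gamma> \<Turnstile> t \<Colon> A \<Longrightarrow> \<Gamma> \<turnstile> A (length \<Gamma>) \<equiv> B (length \<Gamma>) : Univ j \<Longrightarrow> sc (length \<Gamma>) B \<Longrightarrow> \<Gamma> \<Turnstile> t \<Colon> B"
  by (auto simp: wt_def intro: conv_typed)

lemma rel_isEquiv [simp]:
  "valid s \<Longrightarrow> \<forall>j\<ge>k. rel s j A A' \<Longrightarrow> \<forall>j\<ge>k. rel s j B B' \<Longrightarrow> \<forall>j\<ge>k. rel s j f f' \<Longrightarrow>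
   rel s k (isEquiv A B f) (isEquiv A' B' f')"
  by (simp add: isEquiv_def)

lemma rel_hEquiv [simp]:
  "valid s \<Longrightarrow> \<forall>j\<ge>k. rel s j A A' \<Longrightarrow> \<forall>j\<ge>k. rel s j B B' \<Longrightarrow> rel s k (A \<simeq> B) (A' \<simeq> B')"
  by (simp add: hEquiv_def)

lemma rel_eapp [simp]:
  "valid s \<Longrightarrow> \<forall>j\<ge>k. rel s j A A' \<Longrightarrow> \<forall>j\<ge>k. rel s j B B' \<Longrightarrow> rel s k e e' \<Longrightarrow> rel s k x x' \<Longrightarrow>
   rel s k (eapp A B e x) (eapp A' B' e' x')"
  by (simp add: eapp_def)

lemma rel_isProp [simp]: "valid s \<Longrightarrow> \<forall>j\<ge>k. rel s j A A' \<Longrightarrow> rel s k (isProp A) (isProp A')"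
  by (simp add: isProp_def)

lemma rel_isSet [simp]: "valid s \<Longrightarrow> \<forall>j\<ge>k. rel s j A A' \<Longrightarrow> rel s k (isSet A) (isSet A')"
  by (simp add: isSet_def)

lemma rel_isContr [simp]: "valid s \<Longrightarrow> \<forall>j\<ge>k. rel s j A A' \<Longrightarrow> rel s k (isContr A) (isContr A')"
  by (simp add: isContr_def)

lemma rel_hIff [simp]:
  "valid s \<Longrightarrow> \<forall>j\<ge>k. rel s j A A' \<Longrightarrow> \<forall>j\<ge>k. rel s j B B' \<Longrightarrow> rel s k (A \<leftrightarrow> B) (A' \<leftrightarrow> B')"
  by (simp add: hIff_def)

lemma rel_happly [simp]:
  "valid s \<Longrightarrow> \<forall>j\<ge>k. rel s j A A' \<Longrightarrow> \<forall>j\<ge>k. rel s j B B' \<Longrightarrow> \<forall>j\<ge>k. rel s j f f' \<Longrightarrow> \<forall>j\<ge>k. rel s j g g' \<Longrightarrow>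
   rel s k (happly A B f g) (happly A' B' f' g')"
  by (simp add: happly_def)

lemma ty_isEquiv:
  assumes [simp]: "ty \<Gamma> A" "ty \<Gamma> B" and f: "\<Gamma> \<Turnstile> f \<Colon> A \<rightarrow> B"
  shows "ty \<Gamma> (isEquiv A B f)"
    and fam_section: "fam \<Gamma> (B \<rightarrow> A) (\<lambda>g. \<Pi> y:B. f \<cdot> (g \<cdot> y) =\<^bsub>B\<^esub> y)"
    and fam_retraction: "fam \<Gamma> (B \<rightarrow> A) (\<lambda>h. \<Pi> x:A. h \<cdot> (f \<cdot> x) =\<^bsub>A\<^esub> x)"
proof -
  note [simp] = assms(1,2)[THEN ty_sc] wt_sc[OF f]
  show 1: "fam \<Gamma> (B \<rightarrow> A) (\<lambda>g. \<Pi> y:B. f \<cdot> (g \<cdot> y) =\<^bsub>B\<^esub> y)"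
    using f by (auto intro!: famI ty_hPi ty_hId wt_hApp_fun[where A = A and B = B]
        wt_hApp_fun[where A = B and B = A])
  show 2: "fam \<Gamma> (B \<rightarrow> A) (\<lambda>h. \<Pi> x:A. h \<cdot> (f \<cdot> x) =\<^bsub>A\<^esub> x)"
    using f by (auto intro!: famI ty_hPi ty_hId wt_hApp_fun[where A = A and B = B]
        wt_hApp_fun[where A = B and B = A])
  show "ty \<Gamma> (isEquiv A B f)"
    unfolding isEquiv_def by (intro ty_hProd ty_hSig 1 2)
qed

lemma isEquivE:
  assumes q: "inh \<Gamma> (isEquiv A B f)" and A: "ty \<Gamma> A" and B: "ty \<Gamma> B" and f: "\<Gamma> \<Turnstile> f \<Colon> A \<rightarrow> B"
  obtains g h where "\<Gamma> \<Turnstile> g \<Colon> B \<rightarrow> A" "inh \<Gamma> (\<Pi> y:B. f \<cdot> (g \<cdot> y) =\<^bsub>B\<^esub> y)"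
    "\<Gamma> \<Turnstile> h \<Colon> B \<rightarrow> A" "inh \<Gamma> (\<Pi> x:A. h \<cdot> (f \<cdot> x) =\<^bsub>A\<^esub> x)"
  using q inh_hProdE[OF _ ty_hSig ty_hSig, OF _ fam_section[OF A B f] fam_retraction[OF A B f]]
  unfolding isEquiv_def
  by (metis (no_types, lifting) inh_hSigE fam_section[OF A B f] fam_retraction[OF A B f])

lemma wt_FunExt: "\<turnstile> \<Gamma> ctx \<Longrightarrow> \<Gamma> \<Turnstile> (\<lambda>_. FunExt j) \<Colon> funext_type j"
proof -
  assume \<Gamma>: "\<turnstile> \<Gamma> ctx"
  \<comment> \<open>The axiom is stated at depth \<open>0\<close>. Its type is closed, so placing it
    at any other depth gives the same raw term.\<close>
  have eq: "funext_type j n = funext_type j 0" for n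
    by (simp add: funext_type_def isEquiv_def happly_def hFun_def hProd_def hterm_at hIndId_def)
  have "sc (length \<Gamma>) (\<lambda>_. FunExt j)"
    by (rule scI) simp
  moreover have "sc (length \<Gamma>) (funext_type j)"
    by (rule scI) (simp add: funext_type_def)
  ultimately show ?thesis
    using \<Gamma> funext[OF \<Gamma>, of j] eq[of "length \<Gamma>"] by (simp add: wt_def closed_def)
qed

text \<open>The axiom concerns a family given as a term, here
  \<open>B' = \<Lambda> x:A. B x\<close>. The family \<open>B' \<cdot> x\<close> agrees with
  \<open>B x\<close> only up to beta conversion, so the function type and both identity types are
  converted to the primed form before the axiom is applied and back afterwards.\<close>

lemma heq_funext:
  assumes B: "fam \<Gamma> A B" and f: "\<Gamma> \<Turnstile> f \<Colon> hPi A B" and g: "\<Gamma> \<Turnstile> g \<Colon> hPi A B"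
    and fg: "\<And>x. sc (Suc (length \<Gamma>)) x \<Longrightarrow> \<Gamma> \<triangleright> A \<Turnstile> x \<Colon> A \<Longrightarrow> \<Gamma> \<triangleright> A \<Turnstile> f \<cdot> x \<approx> g \<cdot> x \<Colon> B x"
  shows "\<Gamma> \<Turnstile> f \<approx> g \<Colon> hPi A B"
proof -
  let ?n = "length \<Gamma>"
  obtain j where AU: "\<And>\<Delta>. ext \<Gamma> \<Delta> \<Longrightarrow> \<Delta> \<Turnstile> A \<Colon> \<U> j"
    and BU: "\<And>\<Delta> x. ext \<Gamma> \<Delta> \<Longrightarrow> \<Delta> \<Turnstile> x \<Colon> A \<Longrightarrow> \<Delta> \<Turnstile> B x \<Colon> \<U> j"
    using fam_level[OF B] by blast
  have A: "ty \<Gamma> A" by (rule fam_ty[OF B])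
  note [simp] = A ty_sc[OF A] fam_natE[OF B] ext_length wt_sc[OF f] wt_sc[OF g]
  define B' where "B' = hLam A B"
  have B'_sc [simp]: "sc ?n B'" unfolding B'_def by (rule scI) simp
  have B': "\<Gamma> \<Turnstile> B' \<Colon> A \<rightarrow> \<U> j"
    unfolding B'_def hFun_def by (rule wt_hLam) (simp_all add: BU)
  have B'x: "\<Delta> \<Turnstile> B' \<cdot> x \<Colon> \<U> j" if "ext \<Gamma> \<Delta>" "\<Delta> \<Turnstile> x \<Colon> A" for \<Delta> x
    by (rule wt_hApp_fun[OF wt_ext[OF that(1) B'] that(2)]) simp
  have fam': "fam \<Gamma> A (\<lambda>x. B' \<cdot> x)"
    by (rule famI) (auto intro!: wt_Univ_ty[where i = j] B'x)
  let ?P = "\<Pi> x:A. B' \<cdot> x"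
  have tyP: "ty \<Gamma> ?P" by (rule ty_hPi[OF fam'])
  have beta: "\<Delta> \<turnstile> (B' \<cdot> x) (length \<Delta>) \<equiv> B x (length \<Delta>) : Univ j"
    if \<Delta>: "ext \<Gamma> \<Delta>" and x: "\<Delta> \<Turnstile> x \<Colon> A" for \<Delta> x
  proof -
    let ?m = "length \<Delta>"
    have A': "ty \<Delta> A" by (rule ty_ext[OF \<Delta> A])
    have "\<Delta> \<triangleright> A \<Turnstile> B (hvar ?m) \<Colon> \<U> j"
      by (rule BU) (use \<Delta> A' wt_var in simp_all)
    then have "A ?m # \<Delta> \<turnstile> B (hvar ?m) (Suc ?m) : Univ j"
      by (simp add: wt_def cext_def hterm_at)
    from pi_comp[OF this, of "x ?m"]
    show ?thesis
      using x natf_inst[OF natf_up[OF fam_nat[OF B] ext_length[OF \<Delta>]], of x]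
      by (simp add: B'_def hterm_at wt_def)
  qed
  have conv: "\<Gamma> \<turnstile> hPi A B ?n \<equiv> ?P ?n : Univ j"
    using AU[OF ext_refl] beta[OF ext_cext[OF ext_refl A] wt_var[OF A]]
    by (auto intro!: pi_form_eq jeq_refl jeq_sym[of _ "App _ _"] simp: cext_def hterm_at wt_def)
  have f': "\<Gamma> \<Turnstile> f \<Colon> ?P" and g': "\<Gamma> \<Turnstile> g \<Colon> ?P"
    using f g conv ty_sc[OF tyP] by (auto intro: wt_conv)
  let ?Q = "\<Pi> x:A. f \<cdot> x =\<^bsub>B' \<cdot> x\<^esub> g \<cdot> x"
  have tyfg: "ty \<Delta> (f' \<cdot> x =\<^bsub>B' \<cdot> x\<^esub> g' \<cdot> x)"
    if "ext \<Gamma> \<Delta>" "\<Delta> \<Turnstile> x \<Colon> A" "\<Delta> \<Turnstile> f' \<Colon> ?P" "\<Delta> \<Turnstile> g' \<Colon> ?P" for \<Delta> x f' g'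
    using that sc_ext[OF that(1) B'_sc]
    by (intro ty_hId wt_Univ_ty[OF B'x] wt_hApp[where A = A and B = "\<lambda>x. B' \<cdot> x"]) simp_all
  have famQ: "fam \<Delta> A (\<lambda>x. f' \<cdot> x =\<^bsub>B' \<cdot> x\<^esub> g' \<cdot> x)"
    if "ext \<Gamma> \<Delta>" "\<Delta> \<Turnstile> f' \<Colon> ?P" "\<Delta> \<Turnstile> g' \<Colon> ?P" for \<Delta> f' g'
    using that sc_ext[OF that(1) B'_sc] ty_ext[OF that(1) A] wt_sc[OF that(2)] wt_sc[OF that(3)]
    by (intro famI) (auto intro!: tyfg)
  have tyQ: "ty \<Gamma> ?Q" using famQ[OF _ f' g'] by (simp add: ty_hPi)
  have happly: "\<Gamma> \<Turnstile> happly A B' f g \<Colon> (f =\<^bsub>?P\<^esub> g) \<rightarrow> ?Q"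
    unfolding happly_def hFun_def
  proof (rule wt_hLam)
    show tyI: "ty \<Gamma> (f =\<^bsub>?P\<^esub> g)" using tyP f' g' by simp
    let ?\<Gamma> = "\<Gamma> \<triangleright> (f =\<^bsub>?P\<^esub> g)"
    show "\<forall>p. sc (Suc ?n) p \<longrightarrow> ?\<Gamma> \<Turnstile> p \<Colon> (f =\<^bsub>?P\<^esub> g) \<longrightarrow>
      ?\<Gamma> \<Turnstile> hIndId (\<lambda>f g p. \<Pi> x:A. f \<cdot> x =\<^bsub>B' \<cdot> x\<^esub> g \<cdot> x) (\<lambda>f. \<Lambda> x:A. hRefl (f \<cdot> x)) f g p \<Colon> ?Q"
    proof (intro allI impI, rule wt_hIndId[where A = ?P])
      fix h assume h: "sc (Suc (length ?\<Gamma>)) h" "?\<Gamma> \<triangleright> ?P \<Turnstile> h \<Colon> ?P"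
      then show "?\<Gamma> \<triangleright> ?P \<Turnstile> (\<Lambda> x:A. hRefl (h \<cdot> x)) \<Colon> (\<Pi> x:A. h \<cdot> x =\<^bsub>B' \<cdot> x\<^esub> h \<cdot> x)"
        using tyI tyP
        by (intro wt_hLam)
          (auto intro!: wt_hRefl wt_Univ_ty[OF B'x] wt_hApp[where A = A and B = "\<lambda>x. B' \<cdot> x"])
    qed (use tyI tyP f' g' in \<open>auto intro!: ty_hPi famQ\<close>)
  qed (use f' g' in simp_all)
  have ctx: "\<turnstile> \<Gamma> ctx" by (rule wt_ctx[OF f])
  have "inh \<Gamma> (isEquiv (f =\<^bsub>?P\<^esub> g) ?Q (happly A B' f g))"
  proof -
    have "\<Gamma> \<Turnstile> (\<lambda>_. FunExt j) \<cdot> A \<cdot> B' \<cdot> f \<cdot> g \<Colon> isEquiv (f =\<^bsub>?P\<^esub> g) ?Q (happly A B' f g)"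
      by (rule wt_hApp[OF wt_hApp[OF wt_hApp[OF wt_hApp[OF wt_FunExt[OF ctx, of j, unfolded funext_type_def]
        AU[OF ext_refl]] B'] f'] g']) simp_all
    then show ?thesis by (rule inhI)
  qed
  \<comment> \<open>The right inverse of \<open>happly\<close> is a map from pointwise equality to
    equality.\<close>
  then have "inh \<Gamma> (?Q \<rightarrow> (f =\<^bsub>?P\<^esub> g))"
    by (rule isEquivE) (use tyP tyQ f' g' happly in \<open>auto intro: inhI\<close>)
  moreover have "inh \<Gamma> ?Q"
  proof (rule inh_hPi[OF A])
    fix x assume x: "sc (Suc ?n) x" "\<Gamma> \<triangleright> A \<Turnstile> x \<Colon> A"
    then have e: "\<Gamma> \<triangleright> A \<Turnstile> f \<cdot> x \<approx> g \<cdot> x \<Colon> B x" by (rule fg)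
    obtain p where p: "\<Gamma> \<triangleright> A \<Turnstile> p \<Colon> (f \<cdot> x =\<^bsub>B x\<^esub> g \<cdot> x)" using heq_inh[OF e] by (rule inhE)
    have "\<Gamma> \<triangleright> A \<turnstile> (f \<cdot> x =\<^bsub>B x\<^esub> g \<cdot> x) (Suc ?n) \<equiv> (f \<cdot> x =\<^bsub>B' \<cdot> x\<^esub> g \<cdot> x) (Suc ?n) : Univ j"
      using beta[of "\<Gamma> \<triangleright> A" x] x heq_wt1[OF e] heq_wt2[OF e]
      unfolding hterm_at(6) by (intro id_form_eq jeq_refl jeq_sym[of _ "(B' \<cdot> x) _"]) (simp_all add: wt_def)
    then show "inh (\<Gamma> \<triangleright> A) (f \<cdot> x =\<^bsub>B' \<cdot> x\<^esub> g \<cdot> x)"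
      using x by (intro inhI[OF wt_conv[OF p]]) (auto intro!: sc_hId sc_hApp)
  qed simp
  ultimately have "inh \<Gamma> (f =\<^bsub>?P\<^esub> g)"
    by (rule inh_hFunE[OF _ ty_sc[OF ty_hId[OF tyP f' g']]])
  then obtain p where p: "\<Gamma> \<Turnstile> p \<Colon> (f =\<^bsub>?P\<^esub> g)" by (rule inhE)
  have "\<Gamma> \<turnstile> (f =\<^bsub>?P\<^esub> g) ?n \<equiv> (f =\<^bsub>hPi A B\<^esub> g) ?n : Univ j"
    unfolding hterm_at(6) using f' g'
    by (intro id_form_eq jeq_refl jeq_sym[OF conv]) (simp_all add: wt_def)
  then have "\<Gamma> \<Turnstile> p \<Colon> (f =\<^bsub>hPi A B\<^esub> g)"
    using ty_sc[OF ty_hPi[OF B]] by (intro wt_conv[OF p]) (simp_all add: sc_hId)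
  then have "inh \<Gamma> (f =\<^bsub>hPi A B\<^esub> g)"
    by (rule inhI)
  then show ?thesis using f g ty_hPi[OF B] by (simp add: heq_def)
qed

subsection \<open>Propositions and sets\<close>

definition prp :: "tm list \<Rightarrow> hterm \<Rightarrow> bool" where
  "prp \<Gamma> A \<longleftrightarrow> ty \<Gamma> A \<and> inh \<Gamma> (isProp A)"

definition st :: "tm list \<Rightarrow> hterm \<Rightarrow> bool" where
  "st \<Gamma> A \<longleftrightarrow> ty \<Gamma> A \<and> inh \<Gamma> (isSet A)"

text \<open>Propositionality is stored as an inhabitant of one \<Pi>-type, so it passes to extended
  contexts and specialises to every instance.\<close>

definition pfam :: "tm list \<Rightarrow> hterm \<Rightarrow> (hterm \<Rightarrow> hterm) \<Rightarrow> bool" where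
  "pfam \<Gamma> A B \<longleftrightarrow> fam \<Gamma> A B \<and> inh \<Gamma> (\<Pi> x:A. isProp (B x))"

lemma prp_ext: "ext \<Gamma> \<Delta> \<Longrightarrow> prp \<Gamma> A \<Longrightarrow> prp \<Delta> A"
  by (auto simp: prp_def intro: ty_ext inh_ext)

lemma st_ext: "ext \<Gamma> \<Delta> \<Longrightarrow> st \<Gamma> A \<Longrightarrow> st \<Delta> A"
  by (auto simp: st_def intro: ty_ext inh_ext)

lemma pfam_ext: "ext \<Gamma> \<Delta> \<Longrightarrow> pfam \<Gamma> A B \<Longrightarrow> pfam \<Delta> A B"
  by (auto simp: pfam_def intro: fam_ext inh_ext)

lemma prpI:
  assumes A: "ty \<Gamma> A" and eq: "\<And>\<Delta> x y. ext \<Gamma> \<Delta> \<Longrightarrow> \<Delta> \<Turnstile> x \<Colon> A \<Longrightarrow> \<Delta> \<Turnstile> y \<Colon> A \<Longrightarrow> \<Delta> \<Turnstile> x \<approx> y \<Colon> A"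
  shows "prp \<Gamma> A"
proof -
  note [simp] = A ty_sc[OF A]
  have "inh \<Gamma> (isProp A)"
    unfolding isProp_def by (intro inh_hPi heq_inh[OF eq]) simp_all
  then show ?thesis by (simp add: prp_def)
qed

lemma prpD:
  assumes p: "prp \<Gamma> A" and x: "\<Gamma> \<Turnstile> x \<Colon> A" and y: "\<Gamma> \<Turnstile> y \<Colon> A"
  shows "\<Gamma> \<Turnstile> x \<approx> y \<Colon> A"
proof -
  have A: "ty \<Gamma> A" and i: "inh \<Gamma> (\<Pi> x:A. \<Pi> y:A. x =\<^bsub>A\<^esub> y)" using p by (simp_all add: prp_def isProp_def)
  have "inh \<Gamma> (x =\<^bsub>A\<^esub> y)"
    by (rule inh_hPiE[OF inh_hPiE[OF i _ x] _ y]) (simp_all add: ty_sc[OF A] wt_sc[OF x])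
  then show ?thesis using A x y by (simp add: heq_def)
qed

lemma stD:
  assumes p: "st \<Gamma> A" and x: "\<Gamma> \<Turnstile> x \<Colon> A" and y: "\<Gamma> \<Turnstile> y \<Colon> A"
  shows "prp \<Gamma> (x =\<^bsub>A\<^esub> y)"
proof -
  have A: "ty \<Gamma> A" and i: "inh \<Gamma> (\<Pi> x:A. \<Pi> y:A. isProp (x =\<^bsub>A\<^esub> y))"
    using p by (simp_all add: st_def isSet_def)
  have "inh \<Gamma> (isProp (x =\<^bsub>A\<^esub> y))"
    by (rule inh_hPiE[OF inh_hPiE[OF i _ x] _ y]) (simp_all add: ty_sc[OF A] wt_sc[OF x])
  then show ?thesis using A x y by (simp add: prp_def)
qed

lemma st_ty: "st \<Gamma> A \<Longrightarrow> ty \<Gamma> A"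
  by (simp add: st_def)

lemma pfam_fam: "pfam \<Gamma> A B \<Longrightarrow> fam \<Gamma> A B"
  by (simp add: pfam_def)

lemma pfamI:
  assumes B: "fam \<Gamma> A B" and p: "\<And>\<Delta> x. ext \<Gamma> \<Delta> \<Longrightarrow> \<Delta> \<Turnstile> x \<Colon> A \<Longrightarrow> prp \<Delta> (B x)"
  shows "pfam \<Gamma> A B"
proof -
  note [simp] = fam_natE[OF B]
  have "inh \<Gamma> (\<Pi> x:A. isProp (B x))"
  proof (rule inh_hPi[OF fam_ty[OF B]])
    fix x assume "\<Gamma> \<triangleright> A \<Turnstile> x \<Colon> A"
    then show "inh (\<Gamma> \<triangleright> A) (isProp (B x))"
      using p[of "\<Gamma> \<triangleright> A" x] fam_ty[OF B] by (simp add: prp_def)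
  qed simp
  then show ?thesis using B by (simp add: pfam_def)
qed

lemma pfamD: "pfam \<Gamma> A B \<Longrightarrow> \<Gamma> \<Turnstile> a \<Colon> A \<Longrightarrow> prp \<Gamma> (B a)"
proof -
  assume B: "pfam \<Gamma> A B" and a: "\<Gamma> \<Turnstile> a \<Colon> A"
  note [simp] = fam_natE[OF pfam_fam[OF B]]
  show "prp \<Gamma> (B a)"
    using B inh_hPiE[OF _ _ a, of "\<lambda>x. isProp (B x)"] fam_sub[OF pfam_fam[OF B] a]
    by (simp add: prp_def pfam_def)
qed

text \<open>Two elements that are to be compared already provide an inhabitant, so inhabitation may
  be assumed beforehand.\<close>

lemma prp_assume:
  "ty \<Gamma> A \<Longrightarrow> (\<And>\<Delta>. ext \<Gamma> \<Delta> \<Longrightarrow> inh \<Delta> A \<Longrightarrow> prp \<Delta> A) \<Longrightarrow> prp \<Gamma> A"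
  by (rule prpI) (auto intro: prpD inhI)

text \<open>Function extensionality reduces the comparison of two functions to their values, which
  lie in propositions.\<close>

lemma prp_hPi:
  assumes B: "pfam \<Gamma> A B"
  shows "prp \<Gamma> (hPi A B)"
proof (rule prpI)
  note B' = pfam_fam[OF B]
  show "ty \<Gamma> (hPi A B)" by (rule ty_hPi[OF B'])
  fix \<Delta> f g assume \<Delta>: "ext \<Gamma> \<Delta>" and f: "\<Delta> \<Turnstile> f \<Colon> hPi A B" and g: "\<Delta> \<Turnstile> g \<Colon> hPi A B"
  have A: "ty \<Delta> A" and BD: "fam \<Delta> A B" using B' \<Delta> by (auto intro: ty_ext fam_ext fam_ty)
  show "\<Delta> \<Turnstile> f \<approx> g \<Colon> hPi A B"
  proof (rule heq_funext[OF BD f g])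
    fix x assume x: "\<Delta> \<triangleright> A \<Turnstile> x \<Colon> A"
    have \<Delta>': "ext \<Gamma> (\<Delta> \<triangleright> A)" using \<Delta> A by simp
    have n: "natf (length (\<Delta> \<triangleright> A)) B"
      using fam_nat[OF fam_ext[OF \<Delta>' B']] .
    show "\<Delta> \<triangleright> A \<Turnstile> f \<cdot> x \<approx> g \<cdot> x \<Colon> B x"
      by (rule prpD[OF pfamD[OF pfam_ext[OF \<Delta>' B] x]])
        (use f g x A n in \<open>auto intro!: wt_hApp[where A = A and B = B] simp del: nat_defs\<close>)
  qed
qed

lemma heq_hPair_prod:
  assumes aa: "\<Gamma> \<Turnstile> a \<approx> a' \<Colon> A" and bb: "\<Gamma> \<Turnstile> b \<approx> b' \<Colon> B"
  shows "\<Gamma> \<Turnstile> \<langle>a, b\<rangle> \<approx> \<langle>a', b'\<rangle> \<Colon> A \<otimes> B"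
proof -
  note [simp] = heqD[OF aa] heqD[OF bb] wt_sc[OF heq_wt2[OF aa]] wt_sc[OF heq_wt1[OF bb]]
  have "\<Gamma> \<Turnstile> \<langle>a, b\<rangle> \<approx> \<langle>a', b\<rangle> \<Colon> A \<otimes> B"
    by (rule heq_cong[OF aa, where f = "\<lambda>x. \<langle>x, b\<rangle>"]) (auto intro!: wt_hPair_prod)
  also have "\<Gamma> \<Turnstile> \<langle>a', b\<rangle> \<approx> \<langle>a', b'\<rangle> \<Colon> A \<otimes> B"
    by (rule heq_cong[OF bb, where f = "\<lambda>x. \<langle>a', x\<rangle>"]) (auto intro!: wt_hPair_prod)
  finally show ?thesis .
qed

lemma prp_hProd:
  assumes A: "prp \<Gamma> A" and B: "prp \<Gamma> B"
  shows "prp \<Gamma> (A \<otimes> B)"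
proof (rule prpI)
  show "ty \<Gamma> (A \<otimes> B)" using A B by (simp add: prp_def)
  fix \<Delta> p q assume \<Delta>: "ext \<Gamma> \<Delta>" and p: "\<Delta> \<Turnstile> p \<Colon> A \<otimes> B" and q: "\<Delta> \<Turnstile> q \<Colon> A \<otimes> B"
  have A': "prp \<Delta> A" and B': "prp \<Delta> B" using A B \<Delta> by (auto intro: prp_ext)
  have f: "fam \<Delta> A (\<lambda>_. B)" using A' B' by (simp add: prp_def)
  obtain a b where a: "\<Delta> \<Turnstile> a \<Colon> A" and b: "\<Delta> \<Turnstile> b \<Colon> B" and pe: "\<Delta> \<Turnstile> p \<approx> \<langle>a, b\<rangle> \<Colon> A \<otimes> B"
    using hSig_eta[OF f p[unfolded hProd_def]] unfolding hProd_def by blast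
  obtain a' b' where a': "\<Delta> \<Turnstile> a' \<Colon> A" and b': "\<Delta> \<Turnstile> b' \<Colon> B" and qe: "\<Delta> \<Turnstile> q \<approx> \<langle>a', b'\<rangle> \<Colon> A \<otimes> B"
    using hSig_eta[OF f q[unfolded hProd_def]] unfolding hProd_def by blast
  note pe
  also have "\<Delta> \<Turnstile> \<langle>a, b\<rangle> \<approx> \<langle>a', b'\<rangle> \<Colon> A \<otimes> B"
    by (intro heq_hPair_prod prpD[OF A' a a'] prpD[OF B' b b'])
  also note heq_sym[OF qe]
  finally show "\<Delta> \<Turnstile> p \<approx> q \<Colon> A \<otimes> B" .
qed

lemma natf2E:
  "natf2 n B \<Longrightarrow> valid s \<Longrightarrow> n \<le> base s \<Longrightarrow> (\<forall>j\<ge>k. rel s j t t') \<Longrightarrow> (\<forall>j\<ge>k. rel s j u u') \<Longrightarrow>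
   rel s k (B t u) (B t' u')"
  unfolding natf2_def by (metis rebase)

text \<open>Here \<open>k\<close> assembles a tuple from a component \<open>x\<close> and a proof
  \<open>t\<close> about it, at whatever depth they sit. Transport takes place in the family
  \<open>\<Pi> u:B z. k x t = k z u\<close>: by quantifying over all proofs \<open>u\<close>, the
  transported form of \<open>t\<close> never has to be described.\<close>

lemma tuple_eq:
  assumes B: "pfam \<Gamma> A B" and D: "ty \<Gamma> D" and nat: "natf2 (length \<Gamma>) k"
    and k: "\<And>\<Delta> x t. ext \<Gamma> \<Delta> \<Longrightarrow> \<Delta> \<Turnstile> x \<Colon> A \<Longrightarrow> \<Delta> \<Turnstile> t \<Colon> B x \<Longrightarrow> \<Delta> \<Turnstile> k x t \<Colon> D"
    and xx: "\<Gamma> \<Turnstile> x \<approx> x' \<Colon> A" and t: "\<Gamma> \<Turnstile> t \<Colon> B x" and t': "\<Gamma> \<Turnstile> t' \<Colon> B x'"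
  shows "\<Gamma> \<Turnstile> k x t \<approx> k x' t' \<Colon> D"
proof -
  note B' = pfam_fam[OF B]
  have kxt: "\<Gamma> \<Turnstile> k x t \<Colon> D" using k[OF ext_refl heq_wt1[OF xx] t] .
  note [simp] = natf2E[OF nat] fam_natE[OF B'] D ty_sc[OF D] wt_sc[OF kxt] fam_ty[OF B'] kxt
    wt_sc[OF heq_wt1[OF xx]] fam_sub[OF B' heq_wt1[OF xx]] heq_wt1[OF xx] t
  let ?C = "\<lambda>z. \<Pi> u:B z. k x t =\<^bsub>D\<^esub> k z u"
  have C: "fam \<Gamma> A ?C"
  proof (rule famI)
    show "\<forall>z. sc (Suc (length \<Gamma>)) z \<longrightarrow> \<Gamma> \<triangleright> A \<Turnstile> z \<Colon> A \<longrightarrow> ty (\<Gamma> \<triangleright> A) (?C z)"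
      using fam_sub[OF fam_weak[OF B' fam_ty[OF B']]]
      by (auto intro!: ty_hPi famI ty_hId k)
  qed simp_all
  have "inh \<Gamma> (?C x)"
  proof (rule inh_hPi)
    fix u assume u: "sc (Suc (length \<Gamma>)) u" "\<Gamma> \<triangleright> B x \<Turnstile> u \<Colon> B x"
    have "prp (\<Gamma> \<triangleright> B x) (B x)" by (rule prp_ext[OF _ pfamD[OF B]]) simp_all
    then have "\<Gamma> \<triangleright> B x \<Turnstile> t \<approx> u \<Colon> B x" using t u by (intro prpD) simp_all
    then have "\<Gamma> \<triangleright> B x \<Turnstile> k x t \<approx> k x u \<Colon> D"
      by (rule heq_cong) (auto intro!: k)
    then show "inh (\<Gamma> \<triangleright> B x) (k x t =\<^bsub>D\<^esub> k x u)" by (rule heq_inh)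
  qed simp_all
  from transport[OF xx C this]
  have "inh \<Gamma> (k x t =\<^bsub>D\<^esub> k x' t')"
    using wt_sc[OF heq_wt2[OF xx]] by (auto intro: inh_hPiE[OF _ _ t'])
  then show ?thesis using k[OF ext_refl heq_wt2[OF xx] t'] by (simp add: heq_def)
qed

text \<open>Meant for types of sections and of retractions: the functions may form a type with many
  elements, while those carrying the required homotopy agree.\<close>

lemma prp_hSig:
  assumes B: "pfam \<Gamma> A B"
    and eq: "\<And>\<Delta> x x'. ext \<Gamma> \<Delta> \<Longrightarrow> \<Delta> \<Turnstile> x \<Colon> A \<Longrightarrow> \<Delta> \<Turnstile> x' \<Colon> A \<Longrightarrow> inh \<Delta> (B x) \<Longrightarrow> inh \<Delta> (B x') \<Longrightarrow>
      \<Delta> \<Turnstile> x \<approx> x' \<Colon> A"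
  shows "prp \<Gamma> (hSig A B)"
proof (rule prpI)
  show "ty \<Gamma> (hSig A B)" by (rule ty_hSig[OF pfam_fam[OF B]])
  fix \<Delta> p q assume \<Delta>: "ext \<Gamma> \<Delta>" and p: "\<Delta> \<Turnstile> p \<Colon> hSig A B" and q: "\<Delta> \<Turnstile> q \<Colon> hSig A B"
  have B': "pfam \<Delta> A B" by (rule pfam_ext[OF \<Delta> B])
  obtain a b where a: "\<Delta> \<Turnstile> a \<Colon> A" and b: "\<Delta> \<Turnstile> b \<Colon> B a" and pe: "\<Delta> \<Turnstile> p \<approx> \<langle>a, b\<rangle> \<Colon> hSig A B"
    using hSig_eta[OF pfam_fam[OF B'] p] by blast
  obtain a' b' where a': "\<Delta> \<Turnstile> a' \<Colon> A" and b': "\<Delta> \<Turnstile> b' \<Colon> B a'" and qe: "\<Delta> \<Turnstile> q \<approx> \<langle>a', b'\<rangle> \<Colon> hSig A B"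
    using hSig_eta[OF pfam_fam[OF B'] q] by blast
  note pe
  also have "\<Delta> \<Turnstile> \<langle>a, b\<rangle> \<approx> \<langle>a', b'\<rangle> \<Colon> hSig A B"
    by (rule tuple_eq[OF B' heq_ty[OF pe], of hPair])
      (auto intro!: wt_hPair intro: fam_ext pfam_fam[OF B'] eq[OF \<Delta>] inhI a b a' b')
  also note heq_sym[OF qe]
  finally show "\<Delta> \<Turnstile> p \<approx> q \<Colon> hSig A B" .
qed

subsection \<open>Equivalences\<close>

lemma inh_hPi_heq:
  assumes "inh \<Gamma> (\<Pi> x:A. f x =\<^bsub>B\<^esub> g x)" "natf (length \<Gamma>) (\<lambda>x. f x =\<^bsub>B\<^esub> g x)" "\<Gamma> \<Turnstile> a \<Colon> A"
    "ty \<Gamma> B" "\<Gamma> \<Turnstile> f a \<Colon> B" "\<Gamma> \<Turnstile> g a \<Colon> B"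
  shows "\<Gamma> \<Turnstile> f a \<approx> g a \<Colon> B"
  using inh_hPiE[OF assms(1-3)] assms by (simp add: heq_def)

lemma homotopy_at:
  assumes i: "inh \<Gamma> (\<Pi> y:B. f \<cdot> (g \<cdot> y) =\<^bsub>B\<^esub> y)" and f: "\<Gamma> \<Turnstile> f \<Colon> A \<rightarrow> B" and g: "\<Gamma> \<Turnstile> g \<Colon> B \<rightarrow> A"
    and A: "ty \<Gamma> A" and B: "ty \<Gamma> B" and y: "\<Gamma> \<Turnstile> y \<Colon> B"
  shows "\<Gamma> \<Turnstile> f \<cdot> (g \<cdot> y) \<approx> y \<Colon> B"
  by (rule inh_hPi_heq[OF i])
    (use assms wt_sc[OF f] wt_sc[OF g] in \<open>auto simp: ty_sc
      intro!: wt_hApp_fun[where A = A and B = B] wt_hApp_fun[where A = B and B = A]\<close>)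

lemma homotopy_pfam:
  assumes A: "st \<Gamma> A" and f: "\<Gamma> \<Turnstile> f \<Colon> B \<rightarrow> A" and g: "\<Gamma> \<Turnstile> g \<Colon> A \<rightarrow> B" and B: "ty \<Gamma> B"
  shows "pfam \<Gamma> A (\<lambda>y. f \<cdot> (g \<cdot> y) =\<^bsub>A\<^esub> y)"
proof (rule pfamI)
  note [simp] = st_ty[OF A] ty_sc[OF st_ty[OF A]] ty_sc[OF B] wt_sc[OF f] wt_sc[OF g] B
  have fg: "\<Delta> \<Turnstile> f \<cdot> (g \<cdot> x) \<Colon> A" if "ext \<Gamma> \<Delta>" "\<Delta> \<Turnstile> x \<Colon> A" for \<Delta> x
    using that f g
    by (auto intro!: wt_hApp_fun[where A = A and B = B] wt_hApp_fun[where A = B and B = A]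
        intro: wt_ext sc_ext)
  show "fam \<Gamma> A (\<lambda>y. f \<cdot> (g \<cdot> y) =\<^bsub>A\<^esub> y)"
    by (rule famI) (auto intro!: ty_hId fg)
  show "prp \<Delta> (f \<cdot> (g \<cdot> x) =\<^bsub>A\<^esub> x)" if "ext \<Gamma> \<Delta>" "\<Delta> \<Turnstile> x \<Colon> A" for \<Delta> x
    by (rule stD[OF st_ext[OF that(1) A] fg[OF that] that(2)])
qed

lemma heq_funext_fun:
  assumes "\<Gamma> \<Turnstile> f \<Colon> A \<rightarrow> B" "\<Gamma> \<Turnstile> g \<Colon> A \<rightarrow> B" "ty \<Gamma> A" "ty \<Gamma> B"
    "\<And>x. \<Gamma> \<triangleright> A \<Turnstile> x \<Colon> A \<Longrightarrow> \<Gamma> \<triangleright> A \<Turnstile> f \<cdot> x \<approx> g \<cdot> x \<Colon> B"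
  shows "\<Gamma> \<Turnstile> f \<approx> g \<Colon> A \<rightarrow> B"
  using assms unfolding hFun_def by (intro heq_funext) simp_all

text \<open>By \<open>prp_assume\<close> the map may be taken to be invertible. Over sets the
  homotopies are propositions, so only the inverse functions are compared: all sections equal the
  given retraction \<open>h\<close>, and all retractions equal the given section
  \<open>g\<close>.\<close>

lemma prp_isEquiv:
  assumes A: "st \<Gamma> A" and B: "st \<Gamma> B" and f: "\<Gamma> \<Turnstile> f \<Colon> A \<rightarrow> B"
  shows "prp \<Gamma> (isEquiv A B f)"
proof (rule prp_assume)
  show "ty \<Gamma> (isEquiv A B f)" using A B f by (auto intro: ty_isEquiv st_ty)
  fix \<Delta> assume \<Delta>: "ext \<Gamma> \<Delta>" and q: "inh \<Delta> (isEquiv A B f)"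
  have A': "st \<Delta> A" and B': "st \<Delta> B" and f': "\<Delta> \<Turnstile> f \<Colon> A \<rightarrow> B"
    using A B f \<Delta> by (auto intro: st_ext wt_ext)
  note [simp] = st_ty[OF A'] st_ty[OF B'] ty_sc[OF st_ty[OF A']] ty_sc[OF st_ty[OF B']] wt_sc[OF f']
  obtain g h where g: "\<Delta> \<Turnstile> g \<Colon> B \<rightarrow> A" and fg: "inh \<Delta> (\<Pi> y:B. f \<cdot> (g \<cdot> y) =\<^bsub>B\<^esub> y)"
    and h: "\<Delta> \<Turnstile> h \<Colon> B \<rightarrow> A" and hf: "inh \<Delta> (\<Pi> x:A. h \<cdot> (f \<cdot> x) =\<^bsub>A\<^esub> x)"
    using isEquivE[OF q _ _ f'] by auto
  have sec: "pfam \<Delta> (B \<rightarrow> A) (\<lambda>g. \<Pi> y:B. f \<cdot> (g \<cdot> y) =\<^bsub>B\<^esub> y)"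
    and ret: "pfam \<Delta> (B \<rightarrow> A) (\<lambda>h. \<Pi> x:A. h \<cdot> (f \<cdot> x) =\<^bsub>A\<^esub> x)"
    subgoal
      by (intro pfamI fam_section prp_hPi homotopy_pfam[where A = B and B = A])
        (auto intro: f' st_ext A' B' wt_ext ty_ext)
    subgoal
      by (intro pfamI fam_retraction prp_hPi homotopy_pfam[where A = A and B = B])
        (auto intro: f' st_ext A' B' wt_ext ty_ext)
    done
  \<comment> \<open>Any section \<open>k\<close> equals any retraction \<open>k'\<close>, since
    \<open>k y = k' (f (k y)) = k' y\<close>.\<close>
  have inv: "E \<Turnstile> k \<approx> k' \<Colon> B \<rightarrow> A"
    if E: "ext \<Delta> E" and k: "E \<Turnstile> k \<Colon> B \<rightarrow> A" and k': "E \<Turnstile> k' \<Colon> B \<rightarrow> A"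
      and fk: "inh E (\<Pi> y:B. f \<cdot> (k \<cdot> y) =\<^bsub>B\<^esub> y)" and kf: "inh E (\<Pi> x:A. k' \<cdot> (f \<cdot> x) =\<^bsub>A\<^esub> x)" for E k k'
  proof (rule heq_funext_fun[OF k k'])
    show tA: "ty E A" and tB: "ty E B" using E by (auto intro: ty_ext)
    fix y assume y: "E \<triangleright> B \<Turnstile> y \<Colon> B"
    note [simp] = tA tB ty_sc[OF tA] ty_sc[OF tB]
    have E': "ext \<Delta> (E \<triangleright> B)" using E by simp
    have f'': "E \<triangleright> B \<Turnstile> f \<Colon> A \<rightarrow> B" by (rule wt_ext[OF E' f'])
    have ky: "E \<triangleright> B \<Turnstile> k \<cdot> y \<Colon> A"
      by (rule wt_hApp_fun[OF wt_weak[OF tB k] y]) simp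
    have "E \<triangleright> B \<Turnstile> k' \<cdot> (f \<cdot> (k \<cdot> y)) \<approx> k \<cdot> y \<Colon> A"
      using kf k' f'' ky by (intro homotopy_at[where A = B]) simp_all
    from heq_sym[OF this]
    have "E \<triangleright> B \<Turnstile> k \<cdot> y \<approx> k' \<cdot> (f \<cdot> (k \<cdot> y)) \<Colon> A" .
    also have "E \<triangleright> B \<Turnstile> f \<cdot> (k \<cdot> y) \<approx> y \<Colon> B"
      using fk k f'' y by (intro homotopy_at[where A = A]) simp_all
    from heq_app2[OF this wt_weak[OF tB k']]
    have "E \<triangleright> B \<Turnstile> k' \<cdot> (f \<cdot> (k \<cdot> y)) \<approx> k' \<cdot> y \<Colon> A" by simp
    finally show "E \<triangleright> B \<Turnstile> k \<cdot> y \<approx> k' \<cdot> y \<Colon> A" .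
  qed
  show "prp \<Delta> (isEquiv A B f)"
    unfolding isEquiv_def
  proof (intro prp_hProd prp_hSig[OF sec] prp_hSig[OF ret])
    fix E k k'
    assume E: "ext \<Delta> E" and k: "E \<Turnstile> k \<Colon> B \<rightarrow> A" "E \<Turnstile> k' \<Colon> B \<rightarrow> A"
      and i: "inh E (\<Pi> y:B. f \<cdot> (k \<cdot> y) =\<^bsub>B\<^esub> y)" "inh E (\<Pi> y:B. f \<cdot> (k' \<cdot> y) =\<^bsub>B\<^esub> y)"
    note h' = wt_ext[OF E h] inh_ext[OF E hf]
    show "E \<Turnstile> k \<approx> k' \<Colon> B \<rightarrow> A"
      using heq_trans[OF inv[OF E k(1) h'(1) i(1) h'(2)] heq_sym[OF inv[OF E k(2) h'(1) i(2) h'(2)]]] .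
  next
    fix E k k'
    assume E: "ext \<Delta> E" and k: "E \<Turnstile> k \<Colon> B \<rightarrow> A" "E \<Turnstile> k' \<Colon> B \<rightarrow> A"
      and i: "inh E (\<Pi> y:A. k \<cdot> (f \<cdot> y) =\<^bsub>A\<^esub> y)" "inh E (\<Pi> y:A. k' \<cdot> (f \<cdot> y) =\<^bsub>A\<^esub> y)"
    note g' = wt_ext[OF E g] inh_ext[OF E fg]
    show "E \<Turnstile> k \<approx> k' \<Colon> B \<rightarrow> A"
      using heq_trans[OF heq_sym[OF inv[OF E g'(1) k(1) g'(2) i(1)]] inv[OF E g'(1) k(2) g'(2) i(2)]] .
  qed
qed

lemma fam_isEquiv: "ty \<Gamma> A \<Longrightarrow> ty \<Gamma> B \<Longrightarrow> fam \<Gamma> (A \<rightarrow> B) (isEquiv A B)"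
  by (rule famI) (auto intro!: ty_isEquiv simp: ty_sc)

lemma ty_hEquiv: "ty \<Gamma> A \<Longrightarrow> ty \<Gamma> B \<Longrightarrow> ty \<Gamma> (A \<simeq> B)"
  unfolding hEquiv_def by (intro ty_hSig fam_isEquiv)

lemma wt_eapp: "\<Gamma> \<Turnstile> e \<Colon> A \<simeq> B \<Longrightarrow> ty \<Gamma> A \<Longrightarrow> ty \<Gamma> B \<Longrightarrow> \<Gamma> \<Turnstile> x \<Colon> A \<Longrightarrow> \<Gamma> \<Turnstile> eapp A B e x \<Colon> B"
  unfolding hEquiv_def eapp_def
  by (auto intro!: wt_hApp_fun[where A = A and B = B] wt_pr1 fam_isEquiv simp: ty_sc)

text \<open>After both equivalences are written as pairs, function extensionality identifies the
  first components, and the second ones lie in a proposition.\<close>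

lemma heq_hEquiv:
  assumes A: "st \<Gamma> A" and B: "st \<Gamma> B" and e: "\<Gamma> \<Turnstile> e \<Colon> A \<simeq> B" and e': "\<Gamma> \<Turnstile> e' \<Colon> A \<simeq> B"
    and eq: "\<And>x. \<Gamma> \<triangleright> A \<Turnstile> x \<Colon> A \<Longrightarrow> \<Gamma> \<triangleright> A \<Turnstile> eapp A B e x \<approx> eapp A B e' x \<Colon> B"
  shows "\<Gamma> \<Turnstile> e \<approx> e' \<Colon> A \<simeq> B"
proof -
  have F: "fam \<Gamma> (A \<rightarrow> B) (isEquiv A B)" using A B by (intro fam_isEquiv st_ty)
  have P: "pfam \<Gamma> (A \<rightarrow> B) (isEquiv A B)"
    using A B by (intro pfamI[OF F] prp_isEquiv) (auto intro: st_ext)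
  obtain f q where f: "\<Gamma> \<Turnstile> f \<Colon> A \<rightarrow> B" "\<Gamma> \<Turnstile> q \<Colon> isEquiv A B f"
    and ef: "\<Gamma> \<Turnstile> e \<approx> \<langle>f, q\<rangle> \<Colon> hSig (A \<rightarrow> B) (isEquiv A B)"
    using hSig_eta[OF F e[unfolded hEquiv_def]] by blast
  obtain f' q' where f': "\<Gamma> \<Turnstile> f' \<Colon> A \<rightarrow> B" "\<Gamma> \<Turnstile> q' \<Colon> isEquiv A B f'"
    and ef': "\<Gamma> \<Turnstile> e' \<approx> \<langle>f', q'\<rangle> \<Colon> hSig (A \<rightarrow> B) (isEquiv A B)"
    using hSig_eta[OF F e'[unfolded hEquiv_def]] by blast
  have p: "\<Gamma> \<Turnstile> pr1 (A \<rightarrow> B) e \<approx> f \<Colon> A \<rightarrow> B"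
    by (rule heq_trans[OF heq_pr1_cong[OF ef F] heq_pr1[OF F f]])
  have p': "\<Gamma> \<Turnstile> pr1 (A \<rightarrow> B) e' \<approx> f' \<Colon> A \<rightarrow> B"
    by (rule heq_trans[OF heq_pr1_cong[OF ef' F] heq_pr1[OF F f']])
  have "\<Gamma> \<Turnstile> pr1 (A \<rightarrow> B) e \<approx> pr1 (A \<rightarrow> B) e' \<Colon> A \<rightarrow> B"
    by (rule heq_funext_fun[OF heq_wt1[OF p] heq_wt1[OF p'] st_ty[OF A] st_ty[OF B]])
      (use eq in \<open>simp add: eapp_def\<close>)
  then have ff: "\<Gamma> \<Turnstile> f \<approx> f' \<Colon> A \<rightarrow> B"
    using heq_trans[OF heq_trans[OF heq_sym[OF p]] p'] by blast
  have "\<Gamma> \<Turnstile> \<langle>f, q\<rangle> \<approx> \<langle>f', q'\<rangle> \<Colon> hSig (A \<rightarrow> B) (isEquiv A B)"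
    by (rule tuple_eq[OF P heq_ty[OF ef], of hPair]) (auto intro!: wt_hPair ff f f' intro: fam_ext F)
  then show ?thesis
    unfolding hEquiv_def using heq_trans[OF heq_trans[OF ef] heq_sym[OF ef']] by blast
qed

text \<open>Turns an operation of HOL with a pointwise inverse into a term for a family of
  equivalences. Later arguments know this term only through its action up to equality, so the proof
  of invertibility can remain anonymous.\<close>

lemma ex_equiv_fam:
  assumes A: "fam \<Gamma> M A" and B: "fam \<Gamma> M B" and nat: "natf2 (length \<Gamma>) k" "natf2 (length \<Gamma>) k'"
    and k: "\<And>\<Delta> x h. ext \<Gamma> \<Delta> \<Longrightarrow> \<Delta> \<Turnstile> x \<Colon> M \<Longrightarrow> \<Delta> \<Turnstile> h \<Colon> A x \<Longrightarrow> \<Delta> \<Turnstile> k x h \<Colon> B x"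
    and k': "\<And>\<Delta> x h. ext \<Gamma> \<Delta> \<Longrightarrow> \<Delta> \<Turnstile> x \<Colon> M \<Longrightarrow> \<Delta> \<Turnstile> h \<Colon> B x \<Longrightarrow> \<Delta> \<Turnstile> k' x h \<Colon> A x"
    and k'k: "\<And>\<Delta> x h. ext \<Gamma> \<Delta> \<Longrightarrow> \<Delta> \<Turnstile> x \<Colon> M \<Longrightarrow> \<Delta> \<Turnstile> h \<Colon> A x \<Longrightarrow> \<Delta> \<Turnstile> k' x (k x h) \<approx> h \<Colon> A x"
    and kk': "\<And>\<Delta> x h. ext \<Gamma> \<Delta> \<Longrightarrow> \<Delta> \<Turnstile> x \<Colon> M \<Longrightarrow> \<Delta> \<Turnstile> h \<Colon> B x \<Longrightarrow> \<Delta> \<Turnstile> k x (k' x h) \<approx> h \<Colon> B x"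
  obtains l where "\<Gamma> \<Turnstile> l \<Colon> (\<Pi> x:M. A x \<simeq> B x)"
    "\<And>\<Delta> x h. ext \<Gamma> \<Delta> \<Longrightarrow> \<Delta> \<Turnstile> x \<Colon> M \<Longrightarrow> \<Delta> \<Turnstile> h \<Colon> A x \<Longrightarrow>
       \<Delta> \<Turnstile> eapp (A x) (B x) (l \<cdot> x) h \<approx> k x h \<Colon> B x"
proof -
  let ?n = "length \<Gamma>"
  note [simp] = fam_natE[OF A] fam_natE[OF B] natf2E[OF nat(1)] natf2E[OF nat(2)]
    fam_ty[OF A] ty_sc[OF fam_ty[OF A]] ext_length
  have M: "ty \<Gamma> M" by simp
  have tyA: "ty \<Delta> (A x)" and tyB: "ty \<Delta> (B x)" if "ext \<Gamma> \<Delta>" "\<Delta> \<Turnstile> x \<Colon> M" for \<Delta> x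
    using that A B by (auto intro: fam_sub fam_ext)
  have K: "\<Delta> \<Turnstile> hLam (A x) (k x) \<Colon> A x \<rightarrow> B x" "\<And>h. \<Delta> \<Turnstile> h \<Colon> A x \<Longrightarrow> \<Delta> \<Turnstile> hLam (A x) (k x) \<cdot> h \<approx> k x h \<Colon> B x"
    and K': "\<Delta> \<Turnstile> hLam (B x) (k' x) \<Colon> B x \<rightarrow> A x" "\<And>h. \<Delta> \<Turnstile> h \<Colon> B x \<Longrightarrow> \<Delta> \<Turnstile> hLam (B x) (k' x) \<cdot> h \<approx> k' x h \<Colon> A x"
    if \<Delta>: "ext \<Gamma> \<Delta>" and x: "\<Delta> \<Turnstile> x \<Colon> M" for \<Delta> x
  proof -
    note [simp] = tyA[OF \<Delta> x] tyB[OF \<Delta> x] tyA[OF \<Delta> x, THEN ty_sc] tyB[OF \<Delta> x, THEN ty_sc] wt_sc[OF x] \<Delta> x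
    show "\<Delta> \<Turnstile> hLam (A x) (k x) \<Colon> A x \<rightarrow> B x" "\<Delta> \<Turnstile> hLam (B x) (k' x) \<Colon> B x \<rightarrow> A x"
      unfolding hFun_def by (rule wt_hLam; auto intro!: k k' simp: ext_length[OF \<Delta>])+
    show "\<Delta> \<Turnstile> hLam (A x) (k x) \<cdot> h \<approx> k x h \<Colon> B x" if "\<Delta> \<Turnstile> h \<Colon> A x" for h
      by (rule heq_beta[where B = "\<lambda>_. B x"]) (use that in \<open>auto intro!: k simp: ext_length[OF \<Delta>]\<close>)
    show "\<Delta> \<Turnstile> hLam (B x) (k' x) \<cdot> h \<approx> k' x h \<Colon> A x" if "\<Delta> \<Turnstile> h \<Colon> B x" for h
      by (rule heq_beta[where B = "\<lambda>_. A x"]) (use that in \<open>auto intro!: k' simp: ext_length[OF \<Delta>]\<close>)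
  qed
  have "inh \<Gamma> (\<Pi> x:M. isEquiv (A x) (B x) (hLam (A x) (k x)))"
  proof (rule inh_hPi[OF M])
    fix x assume x: "sc (Suc ?n) x" "\<Gamma> \<triangleright> M \<Turnstile> x \<Colon> M"
    let ?\<Delta> = "\<Gamma> \<triangleright> M"
    have \<Delta>: "ext \<Gamma> ?\<Delta>" by simp
    note [simp] = tyA[OF \<Delta> x(2)] tyB[OF \<Delta> x(2)] tyA[OF \<Delta> x(2), THEN ty_sc, simplified] tyB[OF \<Delta> x(2), THEN ty_sc, simplified] x
    note Kx = K[OF \<Delta> x(2)] and Kx' = K'[OF \<Delta> x(2)]
    note [simp] = Kx(1)[THEN wt_sc, simplified] Kx'(1)[THEN wt_sc, simplified]
    have 1: "inh ?\<Delta> (\<Pi> y:B x. hLam (A x) (k x) \<cdot> (hLam (B x) (k' x) \<cdot> y) =\<^bsub>B x\<^esub> y)"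
    proof (rule inh_hPi)
      fix y assume y: "?\<Delta> \<triangleright> B x \<Turnstile> y \<Colon> B x"
      have E: "ext \<Gamma> (?\<Delta> \<triangleright> B x)" "?\<Delta> \<triangleright> B x \<Turnstile> x \<Colon> M" by simp_all
      have "?\<Delta> \<triangleright> B x \<Turnstile> hLam (A x) (k x) \<cdot> (hLam (B x) (k' x) \<cdot> y) \<approx> hLam (A x) (k x) \<cdot> k' x y \<Colon> B x"
        by (rule heq_app2[OF K'(2)[OF E y] K(1)[OF E] tyB[OF E]])
      also have "?\<Delta> \<triangleright> B x \<Turnstile> hLam (A x) (k x) \<cdot> k' x y \<approx> k x (k' x y) \<Colon> B x"
        by (rule K(2)[OF E k'[OF E y]])
      also note kk'[OF E y]
      finally show "inh (?\<Delta> \<triangleright> B x) (hLam (A x) (k x) \<cdot> (hLam (B x) (k' x) \<cdot> y) =\<^bsub>B x\<^esub> y)"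
        by (rule heq_inh)
    qed simp_all
    have 2: "inh ?\<Delta> (\<Pi> y:A x. hLam (B x) (k' x) \<cdot> (hLam (A x) (k x) \<cdot> y) =\<^bsub>A x\<^esub> y)"
    proof (rule inh_hPi)
      fix y assume y: "?\<Delta> \<triangleright> A x \<Turnstile> y \<Colon> A x"
      have E: "ext \<Gamma> (?\<Delta> \<triangleright> A x)" "?\<Delta> \<triangleright> A x \<Turnstile> x \<Colon> M" by simp_all
      have "?\<Delta> \<triangleright> A x \<Turnstile> hLam (B x) (k' x) \<cdot> (hLam (A x) (k x) \<cdot> y) \<approx> hLam (B x) (k' x) \<cdot> k x y \<Colon> A x"
        by (rule heq_app2[OF K(2)[OF E y] K'(1)[OF E] tyA[OF E]])
      also have "?\<Delta> \<triangleright> A x \<Turnstile> hLam (B x) (k' x) \<cdot> k x y \<approx> k' x (k x y) \<Colon> A x"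
        by (rule K'(2)[OF E k[OF E y]])
      also note k'k[OF E y]
      finally show "inh (?\<Delta> \<triangleright> A x) (hLam (B x) (k' x) \<cdot> (hLam (A x) (k x) \<cdot> y) =\<^bsub>A x\<^esub> y)"
        by (rule heq_inh)
    qed simp_all
    have f: "fam ?\<Delta> (B x \<rightarrow> A x) (\<lambda>g. \<Pi> y:B x. hLam (A x) (k x) \<cdot> (g \<cdot> y) =\<^bsub>B x\<^esub> y)"
      "fam ?\<Delta> (B x \<rightarrow> A x) (\<lambda>h. \<Pi> y:A x. h \<cdot> (hLam (A x) (k x) \<cdot> y) =\<^bsub>A x\<^esub> y)"
      by (rule fam_section[OF tyA[OF \<Delta> x(2)] tyB[OF \<Delta> x(2)] Kx(1)]
          fam_retraction[OF tyA[OF \<Delta> x(2)] tyB[OF \<Delta> x(2)] Kx(1)])+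
    have "inh ?\<Delta> (\<Sigma> g:B x \<rightarrow> A x. \<Pi> y:B x. hLam (A x) (k x) \<cdot> (g \<cdot> y) =\<^bsub>B x\<^esub> y)"
      by (rule inh_hSig[OF f(1) Kx'(1)], rule 1)
    moreover have "inh ?\<Delta> (\<Sigma> h:B x \<rightarrow> A x. \<Pi> y:A x. h \<cdot> (hLam (A x) (k x) \<cdot> y) =\<^bsub>A x\<^esub> y)"
      by (rule inh_hSig[OF f(2) Kx'(1)], rule 2)
    ultimately show "inh ?\<Delta> (isEquiv (A x) (B x) (hLam (A x) (k x)))"
      unfolding isEquiv_def by (rule inh_hProd[OF ty_hSig[OF f(1)] ty_hSig[OF f(2)]])
  qed simp
  \<comment> \<open>A single term \<open>Q\<close> proves invertibility for all \<open>x\<close>;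
    being independent of \<open>x\<close>, it leaves the body of the final abstraction
    natural.\<close>
  then obtain Q where Q: "\<Gamma> \<Turnstile> Q \<Colon> (\<Pi> x:M. isEquiv (A x) (B x) (hLam (A x) (k x)))" "sc ?n Q"
    by (rule inhE)
  note [simp] = Q(2)
  have q: "\<Delta> \<Turnstile> Q \<cdot> x \<Colon> isEquiv (A x) (B x) (hLam (A x) (k x))" if "ext \<Gamma> \<Delta>" "\<Delta> \<Turnstile> x \<Colon> M" for \<Delta> x
    by (rule wt_hApp[OF wt_ext[OF that(1) Q(1)] that(2)]) (simp add: ext_length[OF that(1)])
  have F: "fam \<Delta> (A x \<rightarrow> B x) (isEquiv (A x) (B x))" if "ext \<Gamma> \<Delta>" "\<Delta> \<Turnstile> x \<Colon> M" for \<Delta> x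
    using tyA[OF that] tyB[OF that] by (rule fam_isEquiv)
  let ?b = "\<lambda>x. \<langle>hLam (A x) (k x), Q \<cdot> x\<rangle>"
  have b: "\<Delta> \<Turnstile> ?b x \<Colon> A x \<simeq> B x" if "ext \<Gamma> \<Delta>" "\<Delta> \<Turnstile> x \<Colon> M" for \<Delta> x
    unfolding hEquiv_def by (rule wt_hPair[OF F[OF that] K(1)[OF that] q[OF that]])
  have l: "\<Gamma> \<Turnstile> hLam M ?b \<Colon> (\<Pi> x:M. A x \<simeq> B x)"
    by (rule wt_hLam) (auto intro!: b)
  show ?thesis
  proof (rule that[OF l])
    fix \<Delta> x h assume \<Delta>: "ext \<Gamma> \<Delta>" and x: "\<Delta> \<Turnstile> x \<Colon> M" and h: "\<Delta> \<Turnstile> h \<Colon> A x"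
    note [simp] = ext_length[OF \<Delta>] ty_ext[OF \<Delta> M] sc_ext[OF \<Delta> Q(2)] sc_ext[OF \<Delta> ty_sc[OF M]]
    have "\<Delta> \<Turnstile> hLam M ?b \<cdot> x \<approx> ?b x \<Colon> A x \<simeq> B x"
      by (rule heq_beta[where B = "\<lambda>x. A x \<simeq> B x"])
        (use x tyA[OF \<Delta> x] tyB[OF \<Delta> x] \<Delta> in \<open>auto intro!: b ty_hEquiv\<close>)
    from heq_pr1_cong[OF this[unfolded hEquiv_def] F[OF \<Delta> x]]
    have "\<Delta> \<Turnstile> pr1 (A x \<rightarrow> B x) (hLam M ?b \<cdot> x) \<approx> pr1 (A x \<rightarrow> B x) (?b x) \<Colon> A x \<rightarrow> B x" .
    also have "\<Delta> \<Turnstile> pr1 (A x \<rightarrow> B x) (?b x) \<approx> hLam (A x) (k x) \<Colon> A x \<rightarrow> B x"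
      by (rule heq_pr1[OF F[OF \<Delta> x] K(1)[OF \<Delta> x] q[OF \<Delta> x]])
    finally have "\<Delta> \<Turnstile> pr1 (A x \<rightarrow> B x) (hLam M ?b \<cdot> x) \<cdot> h \<approx> hLam (A x) (k x) \<cdot> h \<Colon> B x"
      using tyA[OF \<Delta> x] tyB[OF \<Delta> x] h by (rule heq_app1_fun)
    also note K(2)[OF \<Delta> x h]
    finally show "\<Delta> \<Turnstile> eapp (A x) (B x) (hLam M ?b \<cdot> x) h \<approx> k x h \<Colon> B x"
      by (simp add: eapp_def)
  qed
qed

lemma fam_sec:
  assumes "\<And>\<Delta> x. ext \<Gamma> \<Delta> \<Longrightarrow> \<Delta> \<Turnstile> x \<Colon> A \<Longrightarrow> ty \<Delta> (B x)" "ty \<Gamma> A" "natf (length \<Gamma>) B"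
  shows "fam \<Gamma> A B"
  using assms by (intro famI) (simp_all del: nat_defs)

text \<open>Let \<open>G y\<close> be an element of \<open>I\<close> related to \<open>y\<close>. If
  \<open>g\<close> and \<open>h\<close> are the two inverses of \<open>i\<close>, then
  \<open>g \<circ> G\<close> and \<open>h \<circ> G\<close> are the two inverses of
  \<open>d\<close>. Uniqueness on either side replaces any requirement that \<open>R\<close> be
  propositional. Existence is asked from \<open>D\<close> to \<open>I\<close>, so the converse
  implication follows from the same lemma with the two sides exchanged.\<close>

lemma equiv_transfer:
  assumes P: "ty \<Gamma> P" and I: "ty \<Gamma> I" and D: "ty \<Gamma> D" and i: "\<Gamma> \<Turnstile> i \<Colon> P \<rightarrow> I" and d: "\<Gamma> \<Turnstile> d \<Colon> P \<rightarrow> D"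
    and nat: "natf2 (length \<Gamma>) R"
    and tyR: "\<And>\<Delta> e y. ext \<Gamma> \<Delta> \<Longrightarrow> \<Delta> \<Turnstile> e \<Colon> I \<Longrightarrow> \<Delta> \<Turnstile> y \<Colon> D \<Longrightarrow> ty \<Delta> (R e y)"
    and ex: "\<And>\<Delta> y. ext \<Gamma> \<Delta> \<Longrightarrow> \<Delta> \<Turnstile> y \<Colon> D \<Longrightarrow> inh \<Delta> (\<Sigma> e:I. R e y)"
    and uD: "\<And>\<Delta> e y y'. ext \<Gamma> \<Delta> \<Longrightarrow> \<Delta> \<Turnstile> e \<Colon> I \<Longrightarrow> \<Delta> \<Turnstile> y \<Colon> D \<Longrightarrow> \<Delta> \<Turnstile> y' \<Colon> D \<Longrightarrow>
      inh \<Delta> (R e y) \<Longrightarrow> inh \<Delta> (R e y') \<Longrightarrow> \<Delta> \<Turnstile> y \<approx> y' \<Colon> D"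
    and uI: "\<And>\<Delta> e e' y. ext \<Gamma> \<Delta> \<Longrightarrow> \<Delta> \<Turnstile> e \<Colon> I \<Longrightarrow> \<Delta> \<Turnstile> e' \<Colon> I \<Longrightarrow> \<Delta> \<Turnstile> y \<Colon> D \<Longrightarrow>
      inh \<Delta> (R e y) \<Longrightarrow> inh \<Delta> (R e' y) \<Longrightarrow> \<Delta> \<Turnstile> e \<approx> e' \<Colon> I"
    and idR: "\<And>\<Delta> p. ext \<Gamma> \<Delta> \<Longrightarrow> \<Delta> \<Turnstile> p \<Colon> P \<Longrightarrow> inh \<Delta> (R (i \<cdot> p) (d \<cdot> p))"
    and eq: "inh \<Gamma> (isEquiv P I i)"
  shows "inh \<Gamma> (isEquiv P D d)"
proof -
  note [simp] = natf2E[OF nat] P I D P[THEN ty_sc] I[THEN ty_sc] D[THEN ty_sc] i[THEN wt_sc] d[THEN wt_sc]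
  have famR: "fam \<Delta> I (\<lambda>e. R e y)" if "ext \<Gamma> \<Delta>" "\<Delta> \<Turnstile> y \<Colon> D" for \<Delta> y
    using that by (intro fam_sec)
      (auto intro: tyR ty_ext ext_trans wt_ext simp: wt_sc ext_length)
  have "inh \<Gamma> (\<Pi> y:D. \<Sigma> e:I. R e y)"
    by (intro inh_hPi ex) simp_all
  \<comment> \<open>The existence premise for the generic variable of type \<open>D\<close> gives
    one function \<open>K\<close>, which makes \<open>G\<close> an operation definable in the object
    theory.\<close>
  then obtain K where K: "\<Gamma> \<Turnstile> K \<Colon> (\<Pi> y:D. \<Sigma> e:I. R e y)" "sc (length \<Gamma>) K" by (rule inhE)
  note [simp] = K(2)
  define G where "G y = pr1 I (K \<cdot> y)" for y
  have Ky: "\<Delta> \<Turnstile> K \<cdot> y \<Colon> (\<Sigma> e:I. R e y)" if "ext \<Gamma> \<Delta>" "\<Delta> \<Turnstile> y \<Colon> D" for \<Delta> y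
    by (rule wt_hApp[OF wt_ext[OF that(1) K(1)] that(2)])
      (simp add: ext_length[OF that(1)] sc_ext[OF that(1)])
  have G: "\<Delta> \<Turnstile> G y \<Colon> I" and RG: "inh \<Delta> (R (G y) y)" if "ext \<Gamma> \<Delta>" "\<Delta> \<Turnstile> y \<Colon> D" for \<Delta> y
    unfolding G_def by (rule wt_pr1[OF famR[OF that] Ky[OF that]], rule inh_pr2[OF famR[OF that] Ky[OF that]])
  have [simp]: "valid s \<Longrightarrow> length \<Gamma> \<le> base s \<Longrightarrow> \<forall>j\<ge>k. rel s j y y' \<Longrightarrow> rel s k (G y) (G y')" for s k y y'
    unfolding G_def using sc_up[OF K(2)] sc_up[OF ty_sc[OF I]] by simp
  obtain g h where g: "\<Gamma> \<Turnstile> g \<Colon> I \<rightarrow> P" and ig: "inh \<Gamma> (\<Pi> y:I. i \<cdot> (g \<cdot> y) =\<^bsub>I\<^esub> y)"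
    and h: "\<Gamma> \<Turnstile> h \<Colon> I \<rightarrow> P" and hi: "inh \<Gamma> (\<Pi> x:P. h \<cdot> (i \<cdot> x) =\<^bsub>P\<^esub> x)"
    using isEquivE[OF eq P I i] by blast
  have app: "\<Delta> \<Turnstile> k \<cdot> x \<Colon> B" if "\<Gamma> \<Turnstile> k \<Colon> A \<rightarrow> B" "\<Delta> \<Turnstile> x \<Colon> A" "ext \<Gamma> \<Delta>" "ty \<Gamma> B" for \<Delta> k x A B
    using wt_hApp_fun[OF wt_ext[OF that(3,1)] that(2)] sc_ext[OF that(3) ty_sc[OF that(4)]] by simp
  have lam: "\<Gamma> \<Turnstile> hLam D (\<lambda>y. k \<cdot> G y) \<Colon> D \<rightarrow> P"
    "\<And>\<Delta> y. ext \<Gamma> \<Delta> \<Longrightarrow> \<Delta> \<Turnstile> y \<Colon> D \<Longrightarrow> \<Delta> \<Turnstile> hLam D (\<lambda>y. k \<cdot> G y) \<cdot> y \<approx> k \<cdot> G y \<Colon> P"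
    if k: "\<Gamma> \<Turnstile> k \<Colon> I \<rightarrow> P" for k
  proof -
    note [simp] = wt_sc[OF k]
    show "\<Gamma> \<Turnstile> hLam D (\<lambda>y. k \<cdot> G y) \<Colon> D \<rightarrow> P"
      unfolding hFun_def by (rule wt_hLam) (auto intro!: app[OF k] G)
    fix \<Delta> y assume \<Delta>: "ext \<Gamma> \<Delta>" and y: "\<Delta> \<Turnstile> y \<Colon> D"
    show "\<Delta> \<Turnstile> hLam D (\<lambda>y. k \<cdot> G y) \<cdot> y \<approx> k \<cdot> G y \<Colon> P"
      by (rule heq_beta[where B = "\<lambda>_. P"])
        (use \<Delta> y in \<open>auto intro!: app[OF k] G simp: ext_length sc_ext[OF \<Delta>] ty_ext[OF \<Delta>]\<close>)
  qed
  have f: "fam \<Gamma> (D \<rightarrow> P) (\<lambda>g. \<Pi> y:D. d \<cdot> (g \<cdot> y) =\<^bsub>D\<^esub> y)"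
    "fam \<Gamma> (D \<rightarrow> P) (\<lambda>h. \<Pi> y:P. h \<cdot> (d \<cdot> y) =\<^bsub>P\<^esub> y)"
    by (rule fam_section[OF P D d] fam_retraction[OF P D d])+
  note [simp] = lam(1)[OF g, THEN wt_sc] lam(1)[OF h, THEN wt_sc]
  have "inh \<Gamma> (\<Sigma> g:D \<rightarrow> P. \<Pi> y:D. d \<cdot> (g \<cdot> y) =\<^bsub>D\<^esub> y)"
  proof (rule inh_hSig[OF f(1) lam(1)[OF g]], rule inh_hPi)
    fix y assume y: "\<Gamma> \<triangleright> D \<Turnstile> y \<Colon> D"
    have \<Delta>: "ext \<Gamma> (\<Gamma> \<triangleright> D)" by simp
    note Gy = G[OF \<Delta> y]
    have gG: "\<Gamma> \<triangleright> D \<Turnstile> g \<cdot> G y \<Colon> P" by (rule app[OF g Gy \<Delta> P])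
    have "\<Gamma> \<triangleright> D \<Turnstile> d \<cdot> (hLam D (\<lambda>y. g \<cdot> G y) \<cdot> y) \<approx> d \<cdot> (g \<cdot> G y) \<Colon> D"
      using heq_app2[OF lam(2)[OF g \<Delta> y] wt_ext[OF \<Delta> d]] by simp
    also have "\<Gamma> \<triangleright> D \<Turnstile> i \<cdot> (g \<cdot> G y) \<approx> G y \<Colon> I"
      using homotopy_at[OF inh_ext[OF \<Delta> ig] wt_ext[OF \<Delta> i] wt_ext[OF \<Delta> g] _ _ Gy] by simp
    \<comment> \<open>The element \<open>i (g (G y))\<close> is related to
      \<open>d (g (G y))\<close>. Replacing it by \<open>G y\<close> makes both
      \<open>d (g (G y))\<close> and \<open>y\<close> related to \<open>G y\<close>.\<close>
    from transport[OF this famR[OF \<Delta> app[OF d gG \<Delta> D]] idR[OF \<Delta> gG]]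
    have "\<Gamma> \<triangleright> D \<Turnstile> d \<cdot> (g \<cdot> G y) \<approx> y \<Colon> D"
      by (rule uD[OF \<Delta> Gy app[OF d gG \<Delta> D] y]) (rule RG[OF \<Delta> y])
    finally show "inh (\<Gamma> \<triangleright> D) (d \<cdot> (hLam D (\<lambda>y. g \<cdot> G y) \<cdot> y) =\<^bsub>D\<^esub> y)" by (rule heq_inh)
  qed simp_all
  moreover have "inh \<Gamma> (\<Sigma> h:D \<rightarrow> P. \<Pi> y:P. h \<cdot> (d \<cdot> y) =\<^bsub>P\<^esub> y)"
  proof (rule inh_hSig[OF f(2) lam(1)[OF h]], rule inh_hPi)
    fix p assume p: "\<Gamma> \<triangleright> P \<Turnstile> p \<Colon> P"
    have \<Delta>: "ext \<Gamma> (\<Gamma> \<triangleright> P)" by simp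
    have dp: "\<Gamma> \<triangleright> P \<Turnstile> d \<cdot> p \<Colon> D" by (rule app[OF d p \<Delta> D])
    have "\<Gamma> \<triangleright> P \<Turnstile> hLam D (\<lambda>y. h \<cdot> G y) \<cdot> (d \<cdot> p) \<approx> h \<cdot> G (d \<cdot> p) \<Colon> P"
      by (rule lam(2)[OF h \<Delta> dp])
    \<comment> \<open>Both sides are related to \<open>d \<cdot> p\<close>: the left one by the
      choice of \<open>G\<close>, the right one by compatibility of \<open>R\<close> with the two
      maps.\<close>
    also have "\<Gamma> \<triangleright> P \<Turnstile> G (d \<cdot> p) \<approx> i \<cdot> p \<Colon> I"
      by (rule uI[OF \<Delta> G[OF \<Delta> dp] app[OF i p \<Delta> I] dp RG[OF \<Delta> dp] idR[OF \<Delta> p]])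
    from heq_app2[OF this wt_ext[OF \<Delta> h]]
    have "\<Gamma> \<triangleright> P \<Turnstile> h \<cdot> G (d \<cdot> p) \<approx> h \<cdot> (i \<cdot> p) \<Colon> P" by simp
    also have "\<Gamma> \<triangleright> P \<Turnstile> h \<cdot> (i \<cdot> p) \<approx> p \<Colon> P"
      using homotopy_at[OF inh_ext[OF \<Delta> hi] wt_ext[OF \<Delta> h] wt_ext[OF \<Delta> i] _ _ p] by simp
    finally show "inh (\<Gamma> \<triangleright> P) (hLam D (\<lambda>y. h \<cdot> G y) \<cdot> (d \<cdot> p) =\<^bsub>P\<^esub> p)" by (rule heq_inh)
  qed simp_all
  ultimately show ?thesis
    unfolding isEquiv_def by (rule inh_hProd[OF ty_hSig[OF f(1)] ty_hSig[OF f(2)]])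
qed

text \<open>The diagonal case is first collected into one function \<open>K\<close>, so that the
  branch \<open>\<lambda>x. K \<cdot> x\<close> is natural and can be given to the
  eliminator.\<close>

lemma path_induction:
  assumes A: "ty \<Gamma> A" and nat: "natf3 (length \<Gamma>) C"
    and C: "\<And>\<Delta> x y p. ext \<Gamma> \<Delta> \<Longrightarrow> \<Delta> \<Turnstile> x \<Colon> A \<Longrightarrow> \<Delta> \<Turnstile> y \<Colon> A \<Longrightarrow> \<Delta> \<Turnstile> p \<Colon> (x =\<^bsub>A\<^esub> y) \<Longrightarrow> ty \<Delta> (C x y p)"
    and c: "\<And>\<Delta> x. ext \<Gamma> \<Delta> \<Longrightarrow> \<Delta> \<Turnstile> x \<Colon> A \<Longrightarrow> inh \<Delta> (C x x (hRefl x))"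
    and a: "\<Gamma> \<Turnstile> a \<Colon> A" and b: "\<Gamma> \<Turnstile> b \<Colon> A" and p: "\<Gamma> \<Turnstile> p \<Colon> (a =\<^bsub>A\<^esub> b)"
  shows "inh \<Gamma> (C a b p)"
proof -
  have D: "natf (length \<Gamma>) (\<lambda>x. C x x (hRefl x))" using nat by simp
  have "inh \<Gamma> (\<Pi> x:A. C x x (hRefl x))"
    using A D c by (intro inh_hPi) (simp_all del: nat_defs)
  then obtain K where K: "\<Gamma> \<Turnstile> K \<Colon> (\<Pi> x:A. C x x (hRefl x))" "sc (length \<Gamma>) K" by (rule inhE)
  have "\<Gamma> \<Turnstile> hIndId C (\<lambda>x. K \<cdot> x) a b p \<Colon> C a b p"
  proof (rule wt_hIndId[OF A nat _ _ _ a b p])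
    fix x assume x: "\<Gamma> \<triangleright> A \<Turnstile> x \<Colon> A"
    show "\<Gamma> \<triangleright> A \<Turnstile> K \<cdot> x \<Colon> C x x (hRefl x)"
      by (rule wt_hApp[OF wt_weak[OF A K(1)] x natf_up[OF D]]) simp
  qed (use A K in \<open>auto intro!: C\<close>)
  then show ?thesis by (rule inhI)
qed

section \<open>The precategory of a FOLDS-category\<close>

lemma rel_hom [simp]: "valid s \<Longrightarrow> rel s k MA MA' \<Longrightarrow> rel s k x x' \<Longrightarrow> rel s k y y' \<Longrightarrow>
  rel s k (hom MA x y) (hom MA' x' y')"
  by (simp add: hom_def)

lemma sc_hFun: "sc n A \<Longrightarrow> sc n B \<Longrightarrow> sc n (A \<rightarrow> B)"
  by (rule scI) simp

lemma sc_hom: "sc n MA \<Longrightarrow> sc n x \<Longrightarrow> sc n y \<Longrightarrow> sc n (hom MA x y)"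
  by (rule scI) simp

lemma rel_ident [simp]:
  "valid s \<Longrightarrow> \<forall>j\<ge>k. rel s j MA MA' \<Longrightarrow> \<forall>j\<ge>k. rel s j MI MI' \<Longrightarrow> \<forall>j\<ge>k. rel s j uI uI' \<Longrightarrow>
   \<forall>j\<ge>k. rel s j x x' \<Longrightarrow> rel s k (ident MA MI uI x) (ident MA' MI' uI' x')"
  by (simp add: ident_def)

lemma rel_cmp [simp]:
  "valid s \<Longrightarrow> \<forall>j\<ge>k. rel s j MA MA' \<Longrightarrow> \<forall>j\<ge>k. rel s j MT MT' \<Longrightarrow> \<forall>j\<ge>k. rel s j uT uT' \<Longrightarrow>
   \<forall>j\<ge>k. rel s j x x' \<Longrightarrow> \<forall>j\<ge>k. rel s j y y' \<Longrightarrow> \<forall>j\<ge>k. rel s j z z' \<Longrightarrow>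
   \<forall>j\<ge>k. rel s j g g' \<Longrightarrow> \<forall>j\<ge>k. rel s j f f' \<Longrightarrow>
   rel s k (cmp MA MT uT x y z g f) (cmp MA' MT' uT' x' y' z' g' f')"
  by (simp add: cmp_def)

text \<open>The iterated projection is the first component of the centre, and any other solution is
  reached by projecting the path from the centre. The terms \<open>ident\<close> and
  \<open>cmp\<close> are by definition such projections.\<close>

lemma contr_unique:
  assumes c: "\<Gamma> \<Turnstile> c \<Colon> isContr (hSig A B)" and B: "fam \<Gamma> A B"
  shows "\<Gamma> \<Turnstile> pr1 A (pr1 (hSig A B) c) \<Colon> A" "inh \<Gamma> (B (pr1 A (pr1 (hSig A B) c)))"
    "\<And>h. \<Gamma> \<Turnstile> h \<Colon> A \<Longrightarrow> inh \<Gamma> (B h) \<Longrightarrow> \<Gamma> \<Turnstile> pr1 A (pr1 (hSig A B) c) \<approx> h \<Colon> A"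
proof -
  let ?S = "hSig A B"
  note [simp] = ty_hSig[OF B] ty_sc[OF ty_hSig[OF B]]
  have F: "fam \<Gamma> ?S (\<lambda>x. \<Pi> y:?S. x =\<^bsub>?S\<^esub> y)"
    by (auto intro!: famI ty_hPi)
  have c1: "\<Gamma> \<Turnstile> pr1 ?S c \<Colon> ?S" and c2: "inh \<Gamma> (\<Pi> y:?S. pr1 ?S c =\<^bsub>?S\<^esub> y)"
    using wt_pr1[OF F] inh_pr2[OF F] c by (simp_all add: isContr_def)
  show "\<Gamma> \<Turnstile> pr1 A (pr1 ?S c) \<Colon> A" "inh \<Gamma> (B (pr1 A (pr1 ?S c)))"
    by (rule wt_pr1[OF B c1], rule inh_pr2[OF B c1])
  fix h assume h: "\<Gamma> \<Turnstile> h \<Colon> A" and Bh: "inh \<Gamma> (B h)"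
  obtain t where t: "\<Gamma> \<Turnstile> t \<Colon> B h" using Bh by (rule inhE)
  have ht: "\<Gamma> \<Turnstile> \<langle>h, t\<rangle> \<Colon> ?S" by (rule wt_hPair[OF B h t])
  have "inh \<Gamma> (pr1 ?S c =\<^bsub>?S\<^esub> \<langle>h, t\<rangle>)"
    by (rule inh_hPiE[OF c2 _ ht]) (simp add: wt_sc[OF c1])
  then have "\<Gamma> \<Turnstile> pr1 ?S c \<approx> \<langle>h, t\<rangle> \<Colon> ?S" using c1 ht by (simp add: heq_def)
  from heq_trans[OF heq_pr1_cong[OF this B] heq_pr1[OF B h t]]
  show "\<Gamma> \<Turnstile> pr1 A (pr1 ?S c) \<approx> h \<Colon> A" .
qed

text \<open>The locales grow with the telescope of hypotheses. The type of a later component is well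
  formed only by virtue of the earlier ones, so each stage has to be usable before the next
  hypothesis is available.\<close>

locale folds_hom =
  fixes i :: nat and \<Gamma>\<^sub>0 :: "tm list" and MO MA :: hterm
  assumes wt_MO: "\<Gamma>\<^sub>0 \<Turnstile> MO \<Colon> \<U> i"
    and wt_MA: "\<Gamma>\<^sub>0 \<Turnstile> MA \<Colon> MO \<otimes> MO \<rightarrow> \<U> i"
begin

abbreviation Hom :: "hterm \<Rightarrow> hterm \<Rightarrow> hterm" where "Hom \<equiv> hom MA"

lemma sc_MO [simp]: "ext \<Gamma>\<^sub>0 \<Gamma> \<Longrightarrow> sc (length \<Gamma>) MO" and sc_MA [simp]: "ext \<Gamma>\<^sub>0 \<Gamma> \<Longrightarrow> sc (length \<Gamma>) MA"
  using wt_MO wt_MA by (auto intro: wt_sc wt_ext)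

lemma ty_MO [simp]: "ext \<Gamma>\<^sub>0 \<Gamma> \<Longrightarrow> ty \<Gamma> MO"
  using wt_MO by (blast intro: wt_Univ_ty ty_ext)

lemma ty_hom [simp]:
  assumes "ext \<Gamma>\<^sub>0 \<Gamma>" "\<Gamma> \<Turnstile> x \<Colon> MO" "\<Gamma> \<Turnstile> y \<Colon> MO"
  shows "ty \<Gamma> (Hom x y)"
  unfolding hom_def
  by (rule wt_Univ_ty[OF wt_hApp_fun[OF wt_ext[OF assms(1) wt_MA] wt_hPair_prod]])
    (use assms in simp_all)

end

locale folds_MI = folds_hom i \<Gamma>\<^sub>0 MO MA for i \<Gamma>\<^sub>0 MO MA +
  fixes MI :: hterm
  assumes wt_MI: "\<Gamma>\<^sub>0 \<Turnstile> MI \<Colon> (\<Pi> x:MO. hom MA x x \<rightarrow> \<U> i)"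
begin

lemma sc_MI [simp]: "ext \<Gamma>\<^sub>0 \<Gamma> \<Longrightarrow> sc (length \<Gamma>) MI"
  using wt_MI by (auto intro: wt_sc wt_ext)

lemma ty_MI [simp]:
  assumes "ext \<Gamma>\<^sub>0 \<Gamma>" "\<Gamma> \<Turnstile> x \<Colon> MO" "\<Gamma> \<Turnstile> f \<Colon> Hom x x"
  shows "ty \<Gamma> (MI \<cdot> x \<cdot> f)"
  by (rule wt_Univ_ty[where i = i],
    rule wt_hApp_fun[OF wt_hApp[OF wt_ext[OF assms(1) wt_MI] assms(2)] assms(3)])
    (use assms in \<open>simp_all add: wt_sc\<close>)

lemma fam_MI:
  assumes "ext \<Gamma>\<^sub>0 \<Gamma>" "\<Gamma> \<Turnstile> x \<Colon> MO"
  shows "fam \<Gamma> (Hom x x) (\<lambda>f. MI \<cdot> x \<cdot> f)"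
  by (rule famI) (use assms in \<open>auto simp: wt_sc\<close>)

end

locale folds_MT = folds_hom i \<Gamma>\<^sub>0 MO MA for i \<Gamma>\<^sub>0 MO MA +
  fixes MT :: hterm
  assumes wt_MT: "\<Gamma>\<^sub>0 \<Turnstile> MT \<Colon> MT_type i MO MA"
begin

lemma sc_MT [simp]: "ext \<Gamma>\<^sub>0 \<Gamma> \<Longrightarrow> sc (length \<Gamma>) MT"
  using wt_MT by (auto intro: wt_sc wt_ext)

lemma ty_MT [simp]:
  assumes "ext \<Gamma>\<^sub>0 \<Gamma>" "\<Gamma> \<Turnstile> x \<Colon> MO" "\<Gamma> \<Turnstile> y \<Colon> MO" "\<Gamma> \<Turnstile> z \<Colon> MO"
    "\<Gamma> \<Turnstile> f \<Colon> Hom x y" "\<Gamma> \<Turnstile> g \<Colon> Hom y z" "\<Gamma> \<Turnstile> h \<Colon> Hom x z"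
  shows "ty \<Gamma> (MT \<cdot> x \<cdot> y \<cdot> z \<cdot> f \<cdot> g \<cdot> h)"
  by (rule wt_Univ_ty[where i = i],
    rule wt_hApp_fun[OF wt_hApp_fun[OF wt_hApp_fun[OF wt_hApp[OF wt_hApp[OF wt_hApp[OF
      wt_ext[OF assms(1) wt_MT[unfolded MT_type_def]] assms(2)] assms(3)] assms(4)] assms(5)] assms(6)]
      assms(7)])
    (use assms in \<open>simp_all add: wt_sc sc_hFun sc_hom\<close>)

lemma fam_MT:
  assumes "ext \<Gamma>\<^sub>0 \<Gamma>" "\<Gamma> \<Turnstile> x \<Colon> MO" "\<Gamma> \<Turnstile> y \<Colon> MO" "\<Gamma> \<Turnstile> z \<Colon> MO" "\<Gamma> \<Turnstile> f \<Colon> Hom x y" "\<Gamma> \<Turnstile> g \<Colon> Hom y z"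
  shows "fam \<Gamma> (Hom x z) (\<lambda>h. MT \<cdot> x \<cdot> y \<cdot> z \<cdot> f \<cdot> g \<cdot> h)"
  by (rule famI) (use assms in \<open>auto simp: wt_sc\<close>)

end

locale folds_identities = folds_MI i \<Gamma>\<^sub>0 MO MA MI for i \<Gamma>\<^sub>0 MO MA MI +
  fixes uI :: hterm
  assumes wt_uI: "\<Gamma>\<^sub>0 \<Turnstile> uI \<Colon> unique_identities MO MA MI"
begin

abbreviation one :: "hterm \<Rightarrow> hterm" where "one \<equiv> ident MA MI uI"

lemma sc_uI [simp]: "ext \<Gamma>\<^sub>0 \<Gamma> \<Longrightarrow> sc (length \<Gamma>) uI"
  using wt_uI by (auto intro: wt_sc wt_ext)

lemma wt_uI_app:
  assumes "ext \<Gamma>\<^sub>0 \<Gamma>" "\<Gamma> \<Turnstile> x \<Colon> MO"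
  shows "\<Gamma> \<Turnstile> uI \<cdot> x \<Colon> isContr (\<Sigma> f:Hom x x. MI \<cdot> x \<cdot> f)"
  by (rule wt_hApp[OF wt_ext[OF assms(1) wt_uI[unfolded unique_identities_def]] assms(2)])
    (use assms in simp)

lemma wt_one [simp]: "ext \<Gamma>\<^sub>0 \<Gamma> \<Longrightarrow> \<Gamma> \<Turnstile> x \<Colon> MO \<Longrightarrow> \<Gamma> \<Turnstile> one x \<Colon> Hom x x"
  unfolding ident_def by (rule contr_unique(1)[OF wt_uI_app fam_MI])

text \<open>Contractibility yields one direction; the other transports the proof that comes with the
  centre. The predicate is thereby exchanged for an equation with \<open>one x\<close>.\<close>

lemma MI_iff:
  assumes "ext \<Gamma>\<^sub>0 \<Gamma>" "\<Gamma> \<Turnstile> x \<Colon> MO" "\<Gamma> \<Turnstile> f \<Colon> Hom x x"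
  shows "inh \<Gamma> (MI \<cdot> x \<cdot> f) \<longleftrightarrow> \<Gamma> \<Turnstile> one x \<approx> f \<Colon> Hom x x"
proof
  note u = contr_unique[OF wt_uI_app[OF assms(1,2)] fam_MI[OF assms(1,2)], folded ident_def]
  show "inh \<Gamma> (MI \<cdot> x \<cdot> f) \<Longrightarrow> \<Gamma> \<Turnstile> one x \<approx> f \<Colon> Hom x x"
    using u(3)[OF assms(3)] .
  show "\<Gamma> \<Turnstile> one x \<approx> f \<Colon> Hom x x \<Longrightarrow> inh \<Gamma> (MI \<cdot> x \<cdot> f)"
    by (rule transport[OF _ fam_MI[OF assms(1,2)]], assumption, rule u(2))
qed

end

locale folds_composites = folds_MT i \<Gamma>\<^sub>0 MO MA MT for i \<Gamma>\<^sub>0 MO MA MT +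
  fixes uT :: hterm
  assumes wt_uT: "\<Gamma>\<^sub>0 \<Turnstile> uT \<Colon> unique_composites MO MA MT"
begin

abbreviation comp :: "hterm \<Rightarrow> hterm \<Rightarrow> hterm \<Rightarrow> hterm \<Rightarrow> hterm \<Rightarrow> hterm" where "comp \<equiv> cmp MA MT uT"

lemma sc_uT [simp]: "ext \<Gamma>\<^sub>0 \<Gamma> \<Longrightarrow> sc (length \<Gamma>) uT"
  using wt_uT by (auto intro: wt_sc wt_ext)

lemma wt_uT_app:
  assumes "ext \<Gamma>\<^sub>0 \<Gamma>" "\<Gamma> \<Turnstile> x \<Colon> MO" "\<Gamma> \<Turnstile> y \<Colon> MO" "\<Gamma> \<Turnstile> z \<Colon> MO" "\<Gamma> \<Turnstile> f \<Colon> Hom x y" "\<Gamma> \<Turnstile> g \<Colon> Hom y z"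
  shows "\<Gamma> \<Turnstile> uT \<cdot> x \<cdot> y \<cdot> z \<cdot> f \<cdot> g \<Colon> isContr (\<Sigma> h:Hom x z. MT \<cdot> x \<cdot> y \<cdot> z \<cdot> f \<cdot> g \<cdot> h)"
  by (rule wt_hApp[OF wt_hApp[OF wt_hApp[OF wt_hApp[OF wt_hApp[OF
      wt_ext[OF assms(1) wt_uT[unfolded unique_composites_def]] assms(2)] assms(3)] assms(4)] assms(5)] assms(6)])
    (use assms in \<open>simp_all add: wt_sc\<close>)

lemma wt_comp [simp]:
  "ext \<Gamma>\<^sub>0 \<Gamma> \<Longrightarrow> \<Gamma> \<Turnstile> x \<Colon> MO \<Longrightarrow> \<Gamma> \<Turnstile> y \<Colon> MO \<Longrightarrow> \<Gamma> \<Turnstile> z \<Colon> MO \<Longrightarrow> \<Gamma> \<Turnstile> g \<Colon> Hom y z \<Longrightarrow> \<Gamma> \<Turnstile> f \<Colon> Hom x y \<Longrightarrow>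
   \<Gamma> \<Turnstile> comp x y z g f \<Colon> Hom x z"
  unfolding cmp_def by (rule contr_unique(1)[OF wt_uT_app fam_MT])

text \<open>As for identities, from contractibility and transport. It turns every clause on
  \<open>MT\<close> into an equation between composites, where associativity and the unit laws
  apply.\<close>

lemma MT_iff:
  assumes "ext \<Gamma>\<^sub>0 \<Gamma>" "\<Gamma> \<Turnstile> x \<Colon> MO" "\<Gamma> \<Turnstile> y \<Colon> MO" "\<Gamma> \<Turnstile> z \<Colon> MO" "\<Gamma> \<Turnstile> f \<Colon> Hom x y" "\<Gamma> \<Turnstile> g \<Colon> Hom y z"
    "\<Gamma> \<Turnstile> h \<Colon> Hom x z"
  shows "inh \<Gamma> (MT \<cdot> x \<cdot> y \<cdot> z \<cdot> f \<cdot> g \<cdot> h) \<longleftrightarrow> \<Gamma> \<Turnstile> comp x y z g f \<approx> h \<Colon> Hom x z"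
proof
  note u = contr_unique[OF wt_uT_app[OF assms(1-6)] fam_MT[OF assms(1-6)], folded cmp_def]
  show "inh \<Gamma> (MT \<cdot> x \<cdot> y \<cdot> z \<cdot> f \<cdot> g \<cdot> h) \<Longrightarrow> \<Gamma> \<Turnstile> comp x y z g f \<approx> h \<Colon> Hom x z"
    using u(3)[OF assms(7)] .
  show "\<Gamma> \<Turnstile> comp x y z g f \<approx> h \<Colon> Hom x z \<Longrightarrow> inh \<Gamma> (MT \<cdot> x \<cdot> y \<cdot> z \<cdot> f \<cdot> g \<cdot> h)"
    by (rule transport[OF _ fam_MT[OF assms(1-6)]], assumption, rule u(2))
qed

lemma comp_cong:
  assumes X: "ext \<Gamma>\<^sub>0 \<Gamma>" and xyz: "\<Gamma> \<Turnstile> x \<Colon> MO" "\<Gamma> \<Turnstile> y \<Colon> MO" "\<Gamma> \<Turnstile> z \<Colon> MO"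
    and gg: "\<Gamma> \<Turnstile> g \<approx> g' \<Colon> Hom y z" and ff: "\<Gamma> \<Turnstile> f \<approx> f' \<Colon> Hom x y"
  shows "\<Gamma> \<Turnstile> comp x y z g f \<approx> comp x y z g' f' \<Colon> Hom x z"
proof -
  note [simp] = X xyz xyz[THEN wt_sc] heqD[OF gg] heqD[OF ff] wt_sc[OF heq_wt1[OF ff]] wt_sc[OF heq_wt2[OF gg]]
  have "\<Gamma> \<Turnstile> comp x y z g f \<approx> comp x y z g' f \<Colon> Hom x z"
    by (rule heq_cong[OF gg]) auto
  also have "\<Gamma> \<Turnstile> comp x y z g' f \<approx> comp x y z g' f' \<Colon> Hom x z"
    by (rule heq_cong[OF ff]) auto
  finally show ?thesis .
qed

end

locale folds_operations = folds_identities i \<Gamma>\<^sub>0 MO MA MI uI + folds_composites i \<Gamma>\<^sub>0 MO MA MT uT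
  for i :: nat and \<Gamma>\<^sub>0 :: "tm list" and MO MA MI MT uI uT

text \<open>Among the laws only the right unit law is fixed as a term: \<open>ru\<close> occurs
  inside \<open>id_iso\<close>, and hence in the canonical map to isomorphisms. The others enter as
  inhabited types.\<close>

locale folds_category = folds_operations i \<Gamma>\<^sub>0 MO MA MI MT uI uT
  for i :: nat and \<Gamma>\<^sub>0 :: "tm list" and MO MA MI MT uI uT +
  fixes ru :: hterm
  assumes MA_set: "inh \<Gamma>\<^sub>0 (\<Pi> x:MO. \<Pi> y:MO. isSet (hom MA x y))"
    and MI_pr: "inh \<Gamma>\<^sub>0 (\<Pi> x:MO. \<Pi> f:hom MA x x. isProp (MI \<cdot> x \<cdot> f))"
    and MT_pr: "inh \<Gamma>\<^sub>0 (MT_prop MO MA MT)"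
    and wt_ru: "\<Gamma>\<^sub>0 \<Turnstile> ru \<Colon> right_unit_law MO MA MI MT uI uT"
    and left_unit: "inh \<Gamma>\<^sub>0 (left_unit_law MO MA MI MT uI uT)"
    and assoc: "inh \<Gamma>\<^sub>0 (assoc_law MO MA MT uT)"
begin

lemma sc_ru [simp]: "ext \<Gamma>\<^sub>0 \<Gamma> \<Longrightarrow> sc (length \<Gamma>) ru"
  using wt_ru by (auto intro: wt_sc wt_ext)

lemma st_hom:
  assumes "ext \<Gamma>\<^sub>0 \<Gamma>" "\<Gamma> \<Turnstile> x \<Colon> MO" "\<Gamma> \<Turnstile> y \<Colon> MO"
  shows "st \<Gamma> (Hom x y)"
proof -
  have "inh \<Gamma> (isSet (Hom x y))"
    by (rule inh_hPiE[OF inh_hPiE[OF inh_ext[OF assms(1) MA_set] _ assms(2)] _ assms(3)])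
      (use assms in \<open>simp_all add: wt_sc\<close>)
  then show ?thesis using assms by (simp add: st_def)
qed

lemma prp_MT:
  assumes "ext \<Gamma>\<^sub>0 \<Gamma>" "\<Gamma> \<Turnstile> x \<Colon> MO" "\<Gamma> \<Turnstile> y \<Colon> MO" "\<Gamma> \<Turnstile> z \<Colon> MO"
    "\<Gamma> \<Turnstile> f \<Colon> Hom x y" "\<Gamma> \<Turnstile> g \<Colon> Hom y z" "\<Gamma> \<Turnstile> h \<Colon> Hom x z"
  shows "prp \<Gamma> (MT \<cdot> x \<cdot> y \<cdot> z \<cdot> f \<cdot> g \<cdot> h)"
proof -
  have "inh \<Gamma> (isProp (MT \<cdot> x \<cdot> y \<cdot> z \<cdot> f \<cdot> g \<cdot> h))"
    by (rule inh_hPiE[OF inh_hPiE[OF inh_hPiE[OF inh_hPiE[OF inh_hPiE[OF inh_hPiE[OF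
        inh_ext[OF assms(1) MT_pr[unfolded MT_prop_def]] _ assms(2)] _ assms(3)] _ assms(4)] _ assms(5)]
        _ assms(6)] _ assms(7)])
      (use assms in \<open>simp_all add: wt_sc\<close>)
  then show ?thesis using assms by (simp add: prp_def)
qed

lemma prp_MI:
  assumes "ext \<Gamma>\<^sub>0 \<Gamma>" "\<Gamma> \<Turnstile> x \<Colon> MO" "\<Gamma> \<Turnstile> f \<Colon> Hom x x"
  shows "prp \<Gamma> (MI \<cdot> x \<cdot> f)"
proof -
  have "inh \<Gamma> (isProp (MI \<cdot> x \<cdot> f))"
    by (rule inh_hPiE[OF inh_hPiE[OF inh_ext[OF assms(1) MI_pr] _ assms(2)] _ assms(3)])
      (use assms in \<open>simp_all add: wt_sc\<close>)
  then show ?thesis using assms by (simp add: prp_def)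
qed

lemma comp_one:
  assumes "ext \<Gamma>\<^sub>0 \<Gamma>" "\<Gamma> \<Turnstile> x \<Colon> MO" "\<Gamma> \<Turnstile> y \<Colon> MO" "\<Gamma> \<Turnstile> f \<Colon> Hom x y"
  shows wt_ru_app: "\<Gamma> \<Turnstile> ru \<cdot> x \<cdot> y \<cdot> f \<Colon> (comp x x y f (one x) =\<^bsub>Hom x y\<^esub> f)"
    and comp_one_right: "\<Gamma> \<Turnstile> comp x x y f (one x) \<approx> f \<Colon> Hom x y"
    and comp_one_left: "\<Gamma> \<Turnstile> comp x y y (one y) f \<approx> f \<Colon> Hom x y"
proof -
  show r: "\<Gamma> \<Turnstile> ru \<cdot> x \<cdot> y \<cdot> f \<Colon> (comp x x y f (one x) =\<^bsub>Hom x y\<^esub> f)"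
    by (rule wt_hApp[OF wt_hApp[OF wt_hApp[OF wt_ext[OF assms(1) wt_ru[unfolded right_unit_law_def]]
        assms(2)] assms(3)] assms(4)])
      (use assms in \<open>simp_all add: wt_sc\<close>)
  have l: "inh \<Gamma> (comp x y y (one y) f =\<^bsub>Hom x y\<^esub> f)"
    by (rule inh_hPiE[OF inh_hPiE[OF inh_hPiE[OF inh_ext[OF assms(1) left_unit[unfolded left_unit_law_def]]
        _ assms(2)] _ assms(3)] _ assms(4)])
      (use assms in \<open>simp_all add: wt_sc\<close>)
  show "\<Gamma> \<Turnstile> comp x x y f (one x) \<approx> f \<Colon> Hom x y" "\<Gamma> \<Turnstile> comp x y y (one y) f \<approx> f \<Colon> Hom x y"
    using assms l inhI[OF r] by (simp_all add: heq_def)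
qed

lemma comp_assoc:
  assumes "ext \<Gamma>\<^sub>0 \<Gamma>" "\<Gamma> \<Turnstile> x \<Colon> MO" "\<Gamma> \<Turnstile> y \<Colon> MO" "\<Gamma> \<Turnstile> z \<Colon> MO" "\<Gamma> \<Turnstile> w \<Colon> MO"
    "\<Gamma> \<Turnstile> f \<Colon> Hom x y" "\<Gamma> \<Turnstile> g \<Colon> Hom y z" "\<Gamma> \<Turnstile> h \<Colon> Hom z w"
  shows "\<Gamma> \<Turnstile> comp x z w h (comp x y z g f) \<approx> comp x y w (comp y z w h g) f \<Colon> Hom x w"
proof -
  have l: "inh \<Gamma> (comp x z w h (comp x y z g f) =\<^bsub>Hom x w\<^esub> comp x y w (comp y z w h g) f)"
    by (rule inh_hPiE[OF inh_hPiE[OF inh_hPiE[OF inh_hPiE[OF inh_hPiE[OF inh_hPiE[OF inh_hPiE[OF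
        inh_ext[OF assms(1) assoc[unfolded assoc_law_def]] _ assms(2)] _ assms(3)] _ assms(4)]
        _ assms(5)] _ assms(6)] _ assms(7)] _ assms(8)])
      (use assms in \<open>simp_all add: wt_sc\<close>)
  then show ?thesis using assms by (simp add: heq_def)
qed

end

section \<open>Components of indiscernibilities\<close>

text \<open>A variant for descending through a telescope of binders: the premise for the body hands
  back the formation of the domain. \<open>inh_hPiI\<close>, \<open>wt_hLamI\<close> and
  \<open>ty_hPiI\<close> have the same shape.\<close>

lemma prp_hPiI:
  assumes A: "ty \<Gamma> A" and n: "natf (length \<Gamma>) B"
    and p: "\<And>x. ty \<Gamma> A \<Longrightarrow> sc (Suc (length \<Gamma>)) x \<Longrightarrow> \<Gamma> \<triangleright> A \<Turnstile> x \<Colon> A \<Longrightarrow> prp (\<Gamma> \<triangleright> A) (B x)"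
  shows "prp \<Gamma> (hPi A B)"
proof (rule prp_hPi)
  have "fam \<Gamma> A B" using A n p by (intro famI) (auto simp: prp_def)
  moreover have "inh \<Gamma> (\<Pi> x:A. isProp (B x))"
    using A n p by (intro inh_hPi) (auto simp: prp_def)
  ultimately show "pfam \<Gamma> A B" by (simp add: pfam_def)
qed

lemma prp_hFun: "ty \<Gamma> A \<Longrightarrow> prp \<Gamma> B \<Longrightarrow> prp \<Gamma> (A \<rightarrow> B)"
  unfolding hFun_def by (rule prp_hPiI) (auto simp: prp_def ty_sc intro: prp_ext[OF ext_cext, unfolded prp_def])

lemma prp_hIff: "prp \<Gamma> A \<Longrightarrow> prp \<Gamma> B \<Longrightarrow> prp \<Gamma> (A \<leftrightarrow> B)"
  unfolding hIff_def by (intro prp_hProd prp_hFun) (auto simp: prp_def)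

lemma inh_hIff:
  assumes A: "ty \<Gamma> A" and B: "ty \<Gamma> B" and AB: "\<And>\<Delta>. ext \<Gamma> \<Delta> \<Longrightarrow> inh \<Delta> A \<longleftrightarrow> inh \<Delta> B"
  shows "inh \<Gamma> (A \<leftrightarrow> B)"
  unfolding hIff_def
  by (intro inh_hProd inh_hFun) (use A B AB[of "\<Gamma> \<triangleright> A"] AB[of "\<Gamma> \<triangleright> B"] in \<open>auto simp: ty_sc\<close>)

lemma inh_hIffD: "inh \<Gamma> (A \<leftrightarrow> B) \<Longrightarrow> ty \<Gamma> A \<Longrightarrow> ty \<Gamma> B \<Longrightarrow> inh \<Gamma> A \<Longrightarrow> inh \<Gamma> B"
  unfolding hIff_def by (drule inh_hProdE(1)) (auto intro: inh_hFunE simp: ty_sc)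

lemma rel_phi [simp]:
  assumes "valid s" "\<forall>j\<ge>k. rel s j MA MA'" "\<forall>j\<ge>k. rel s j a a'" "\<forall>j\<ge>k. rel s j b b'"
    "\<forall>j\<ge>k. rel s j l l'" "\<forall>j\<ge>k. rel s j x x'" "\<forall>j\<ge>k. rel s j f f'"
  shows "rel s k (\<phi>l MA a b l x f) (\<phi>l MA' a' b' l' x' f')"
    "rel s k (\<phi>r MA a b l x f) (\<phi>r MA' a' b' l' x' f')"
  using assms by (simp_all add: \<phi>l_def \<phi>r_def)

lemma rel_phic [simp]:
  assumes "valid s" "\<forall>j\<ge>k. rel s j MA MA'" "\<forall>j\<ge>k. rel s j a a'" "\<forall>j\<ge>k. rel s j b b'"
    "\<forall>j\<ge>k. rel s j l l'" "\<forall>j\<ge>k. rel s j f f'"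
  shows "rel s k (\<phi>c MA a b l f) (\<phi>c MA' a' b' l' f')"
  using assms by (simp add: \<phi>c_def)

context folds_category
begin

abbreviation Lty :: "hterm \<Rightarrow> hterm \<Rightarrow> hterm" where "Lty a b \<equiv> (\<Pi> x:MO. Hom x a \<simeq> Hom x b)"
abbreviation Rty :: "hterm \<Rightarrow> hterm \<Rightarrow> hterm" where "Rty a b \<equiv> (\<Pi> z:MO. Hom a z \<simeq> Hom b z)"
abbreviation Cty :: "hterm \<Rightarrow> hterm \<Rightarrow> hterm" where "Cty a b \<equiv> Hom a a \<simeq> Hom b b"

text \<open>The eight clauses of \<open>indisc\<close> in their order, with \<open>ind\<close> as
  their product. Naming them separates the propositional part of an indiscernibility from its data
  \<open>l\<close>, \<open>r\<close>, \<open>c\<close>.\<close>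

definition ind1 where "ind1 a b l = (\<Pi> x:MO. \<Pi> y:MO. \<Pi> f:Hom x y. \<Pi> g:Hom y a. \<Pi> h:Hom x a.
  MT \<cdot> x \<cdot> y \<cdot> a \<cdot> f \<cdot> g \<cdot> h \<leftrightarrow> MT \<cdot> x \<cdot> y \<cdot> b \<cdot> f \<cdot> \<phi>l MA a b l y g \<cdot> \<phi>l MA a b l x h)"
definition ind2 where "ind2 a b l r = (\<Pi> x:MO. \<Pi> z:MO. \<Pi> f:Hom x a. \<Pi> g:Hom a z. \<Pi> h:Hom x z.
  MT \<cdot> x \<cdot> a \<cdot> z \<cdot> f \<cdot> g \<cdot> h \<leftrightarrow> MT \<cdot> x \<cdot> b \<cdot> z \<cdot> \<phi>l MA a b l x f \<cdot> \<phi>r MA a b r z g \<cdot> h)"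
definition ind3 where "ind3 a b r = (\<Pi> z:MO. \<Pi> w:MO. \<Pi> f:Hom a z. \<Pi> g:Hom z w. \<Pi> h:Hom a w.
  MT \<cdot> a \<cdot> z \<cdot> w \<cdot> f \<cdot> g \<cdot> h \<leftrightarrow> MT \<cdot> b \<cdot> z \<cdot> w \<cdot> \<phi>r MA a b r z f \<cdot> g \<cdot> \<phi>r MA a b r w h)"
definition ind4 where "ind4 a b l c = (\<Pi> x:MO. \<Pi> f:Hom x a. \<Pi> g:Hom a a. \<Pi> h:Hom x a.
  MT \<cdot> x \<cdot> a \<cdot> a \<cdot> f \<cdot> g \<cdot> h \<leftrightarrow> MT \<cdot> x \<cdot> b \<cdot> b \<cdot> \<phi>l MA a b l x f \<cdot> \<phi>c MA a b c g \<cdot> \<phi>l MA a b l x h)"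
definition ind5 where "ind5 a b l r c = (\<Pi> x:MO. \<Pi> f:Hom a x. \<Pi> g:Hom x a. \<Pi> h:Hom a a.
  MT \<cdot> a \<cdot> x \<cdot> a \<cdot> f \<cdot> g \<cdot> h \<leftrightarrow> MT \<cdot> b \<cdot> x \<cdot> b \<cdot> \<phi>r MA a b r x f \<cdot> \<phi>l MA a b l x g \<cdot> \<phi>c MA a b c h)"
definition ind6 where "ind6 a b r c = (\<Pi> x:MO. \<Pi> f:Hom a a. \<Pi> g:Hom a x. \<Pi> h:Hom a x.
  MT \<cdot> a \<cdot> a \<cdot> x \<cdot> f \<cdot> g \<cdot> h \<leftrightarrow> MT \<cdot> b \<cdot> b \<cdot> x \<cdot> \<phi>c MA a b c f \<cdot> \<phi>r MA a b r x g \<cdot> \<phi>r MA a b r x h)"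
definition ind7 where "ind7 a b c = (\<Pi> f:Hom a a. \<Pi> g:Hom a a. \<Pi> h:Hom a a.
  MT \<cdot> a \<cdot> a \<cdot> a \<cdot> f \<cdot> g \<cdot> h \<leftrightarrow> MT \<cdot> b \<cdot> b \<cdot> b \<cdot> \<phi>c MA a b c f \<cdot> \<phi>c MA a b c g \<cdot> \<phi>c MA a b c h)"
definition ind8 where "ind8 a b c = (\<Pi> f:Hom a a. MI \<cdot> a \<cdot> f \<leftrightarrow> MI \<cdot> b \<cdot> \<phi>c MA a b c f)"

lemmas ind_defs = ind1_def ind2_def ind3_def ind4_def ind5_def ind6_def ind7_def ind8_def

definition ind where "ind a b l r c = ind1 a b l \<otimes> ind2 a b l r \<otimes> ind3 a b r \<otimes> ind4 a b l c \<otimes>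
  ind5 a b l r c \<otimes> ind6 a b r c \<otimes> ind7 a b c \<otimes> ind8 a b c"

abbreviation Indisc where "Indisc \<equiv> indisc MO MA MI MT"

lemma Indisc_eq: "Indisc a b = (\<Sigma> l:Lty a b. \<Sigma> r:Rty a b. \<Sigma> c:Cty a b. ind a b l r c)"
  unfolding indisc_def ind_def ind_defs ..

lemma wt_phi [simp]:
  assumes [simp]: "ext \<Gamma>\<^sub>0 \<Gamma>" "\<Gamma> \<Turnstile> a \<Colon> MO" "\<Gamma> \<Turnstile> b \<Colon> MO"
  shows wt_phil: "\<Gamma> \<Turnstile> l \<Colon> Lty a b \<Longrightarrow> \<Gamma> \<Turnstile> x \<Colon> MO \<Longrightarrow> \<Gamma> \<Turnstile> f \<Colon> Hom x a \<Longrightarrow> \<Gamma> \<Turnstile> \<phi>l MA a b l x f \<Colon> Hom x b"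
    and wt_phir: "\<Gamma> \<Turnstile> r \<Colon> Rty a b \<Longrightarrow> \<Gamma> \<Turnstile> x \<Colon> MO \<Longrightarrow> \<Gamma> \<Turnstile> g \<Colon> Hom a x \<Longrightarrow> \<Gamma> \<Turnstile> \<phi>r MA a b r x g \<Colon> Hom b x"
    and wt_phic: "\<Gamma> \<Turnstile> c \<Colon> Cty a b \<Longrightarrow> \<Gamma> \<Turnstile> h \<Colon> Hom a a \<Longrightarrow> \<Gamma> \<Turnstile> \<phi>c MA a b c h \<Colon> Hom b b"
  unfolding \<phi>l_def \<phi>r_def \<phi>c_def
  subgoal
    by (rule wt_eapp, drule (1) wt_hApp) (simp_all add: assms(2,3)[THEN wt_sc])
  subgoal
    by (rule wt_eapp, drule (1) wt_hApp) (simp_all add: assms(2,3)[THEN wt_sc])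
  subgoal by (rule wt_eapp) simp_all
  done

lemma prp_ind:
  assumes [simp]: "ext \<Gamma>\<^sub>0 \<Gamma>" "\<Gamma> \<Turnstile> a \<Colon> MO" "\<Gamma> \<Turnstile> b \<Colon> MO" "\<Gamma> \<Turnstile> l \<Colon> Lty a b" "\<Gamma> \<Turnstile> r \<Colon> Rty a b" "\<Gamma> \<Turnstile> c \<Colon> Cty a b"
  shows "prp \<Gamma> (ind1 a b l)" "prp \<Gamma> (ind2 a b l r)" "prp \<Gamma> (ind3 a b r)" "prp \<Gamma> (ind4 a b l c)"
    "prp \<Gamma> (ind5 a b l r c)" "prp \<Gamma> (ind6 a b r c)" "prp \<Gamma> (ind7 a b c)" "prp \<Gamma> (ind8 a b c)"
proof -
  note [simp] = assms(2-)[THEN wt_sc]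
  show "prp \<Gamma> (ind1 a b l)" "prp \<Gamma> (ind2 a b l r)" "prp \<Gamma> (ind3 a b r)" "prp \<Gamma> (ind4 a b l c)"
    "prp \<Gamma> (ind5 a b l r c)" "prp \<Gamma> (ind6 a b r c)" "prp \<Gamma> (ind7 a b c)" "prp \<Gamma> (ind8 a b c)"
    unfolding ind_defs
    by (intro prp_hPiI prp_hIff prp_MT prp_MI; (unfold length_cext)?; simp (no_asm_simp))+
qed

end

lemma prp_ty: "prp \<Gamma> A \<Longrightarrow> ty \<Gamma> A"
  by (simp add: prp_def)

context folds_category
begin

lemma rel_ind [simp]:
  assumes "valid s" "sc (base s) MO" "sc (base s) MA" "sc (base s) MI" "sc (base s) MT"
    "\<forall>j\<ge>k. rel s j a a'" "\<forall>j\<ge>k. rel s j b b'" "\<forall>j\<ge>k. rel s j l l'" "\<forall>j\<ge>k. rel s j r r'" "\<forall>j\<ge>k. rel s j c c'"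
  shows "rel s k (ind a b l r c) (ind a' b' l' r' c')"
  using assms by (simp add: ind_def ind_defs)

lemma fam_equivs:
  assumes [simp]: "ext \<Gamma>\<^sub>0 \<Gamma>" "\<Gamma> \<Turnstile> a \<Colon> MO" "\<Gamma> \<Turnstile> b \<Colon> MO"
  shows fam_Lty: "fam \<Gamma> MO (\<lambda>x. Hom x a \<simeq> Hom x b)" and fam_Rty: "fam \<Gamma> MO (\<lambda>z. Hom a z \<simeq> Hom b z)"
    and ty_Cty [simp]: "ty \<Gamma> (Cty a b)"
  using assms(2,3)[THEN wt_sc] by (auto intro!: famI ty_hEquiv)

lemma ty_Lty [simp]: "ext \<Gamma>\<^sub>0 \<Gamma> \<Longrightarrow> \<Gamma> \<Turnstile> a \<Colon> MO \<Longrightarrow> \<Gamma> \<Turnstile> b \<Colon> MO \<Longrightarrow> ty \<Gamma> (Lty a b)"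
  and ty_Rty [simp]: "ext \<Gamma>\<^sub>0 \<Gamma> \<Longrightarrow> \<Gamma> \<Turnstile> a \<Colon> MO \<Longrightarrow> \<Gamma> \<Turnstile> b \<Colon> MO \<Longrightarrow> ty \<Gamma> (Rty a b)"
  by (intro ty_hPi fam_equivs; assumption)+

lemma prp_ind_all:
  assumes "ext \<Gamma>\<^sub>0 \<Gamma>" "\<Gamma> \<Turnstile> a \<Colon> MO" "\<Gamma> \<Turnstile> b \<Colon> MO" "\<Gamma> \<Turnstile> l \<Colon> Lty a b" "\<Gamma> \<Turnstile> r \<Colon> Rty a b" "\<Gamma> \<Turnstile> c \<Colon> Cty a b"
  shows "prp \<Gamma> (ind a b l r c)"
  unfolding ind_def by (intro prp_hProd prp_ind[OF assms])

lemma ind_fams: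
  assumes X [simp]: "ext \<Gamma>\<^sub>0 \<Gamma>" and [simp]: "\<Gamma> \<Turnstile> a \<Colon> MO" "\<Gamma> \<Turnstile> b \<Colon> MO"
  shows fam_L: "fam \<Gamma> (Lty a b) (\<lambda>l. \<Sigma> r:Rty a b. \<Sigma> c:Cty a b. ind a b l r c)"
    and fam_R: "\<Gamma> \<Turnstile> l \<Colon> Lty a b \<Longrightarrow> fam \<Gamma> (Rty a b) (\<lambda>r. \<Sigma> c:Cty a b. ind a b l r c)"
    and fam_C: "\<Gamma> \<Turnstile> l \<Colon> Lty a b \<Longrightarrow> \<Gamma> \<Turnstile> r \<Colon> Rty a b \<Longrightarrow> fam \<Gamma> (Cty a b) (\<lambda>c. ind a b l r c)"
    and ty_Indisc [simp]: "ty \<Gamma> (Indisc a b)"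
proof -
  have C: "fam \<Delta> (Cty a b) (\<lambda>c. ind a b l r c)"
    if "ext \<Gamma>\<^sub>0 \<Delta>" "\<Delta> \<Turnstile> a \<Colon> MO" "\<Delta> \<Turnstile> b \<Colon> MO" "\<Delta> \<Turnstile> l \<Colon> Lty a b" "\<Delta> \<Turnstile> r \<Colon> Rty a b" for \<Delta> l r
    by (rule fam_sec) (use that that(2-)[THEN wt_sc] in
      \<open>auto intro!: prp_ty[OF prp_ind_all] intro: ext_trans wt_ext\<close>)
  have R: "fam \<Delta> (Rty a b) (\<lambda>r. \<Sigma> c:Cty a b. ind a b l r c)"
    if "ext \<Gamma>\<^sub>0 \<Delta>" "\<Delta> \<Turnstile> a \<Colon> MO" "\<Delta> \<Turnstile> b \<Colon> MO" "\<Delta> \<Turnstile> l \<Colon> Lty a b" for \<Delta> l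
    by (rule fam_sec) (use that that(2-)[THEN wt_sc] in
      \<open>auto intro!: ty_hSig C intro: ext_trans wt_ext\<close>)
  have L: "fam \<Delta> (Lty a b) (\<lambda>l. \<Sigma> r:Rty a b. \<Sigma> c:Cty a b. ind a b l r c)"
    if "ext \<Gamma>\<^sub>0 \<Delta>" "\<Delta> \<Turnstile> a \<Colon> MO" "\<Delta> \<Turnstile> b \<Colon> MO" for \<Delta>
    by (rule fam_sec) (use that that(2-)[THEN wt_sc] in
      \<open>auto intro!: ty_hSig R intro: ext_trans wt_ext\<close>)
  show "fam \<Gamma> (Lty a b) (\<lambda>l. \<Sigma> r:Rty a b. \<Sigma> c:Cty a b. ind a b l r c)" "ty \<Gamma> (Indisc a b)"
    unfolding Indisc_eq by (auto intro!: ty_hSig L)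
  show "\<Gamma> \<Turnstile> l \<Colon> Lty a b \<Longrightarrow> fam \<Gamma> (Rty a b) (\<lambda>r. \<Sigma> c:Cty a b. ind a b l r c)"
    "\<Gamma> \<Turnstile> l \<Colon> Lty a b \<Longrightarrow> \<Gamma> \<Turnstile> r \<Colon> Rty a b \<Longrightarrow> fam \<Gamma> (Cty a b) (\<lambda>c. ind a b l r c)"
    by (auto intro!: R C)
qed

end

lemma heq_hPair2:
  assumes B: "fam \<Gamma> A B" and a: "\<Gamma> \<Turnstile> a \<Colon> A" and bb: "\<Gamma> \<Turnstile> b \<approx> b' \<Colon> B a"
  shows "\<Gamma> \<Turnstile> \<langle>a, b\<rangle> \<approx> \<langle>a, b'\<rangle> \<Colon> hSig A B"
  by (rule heq_cong[OF bb ty_hSig[OF B], where f = "\<lambda>b. \<langle>a, b\<rangle>"])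
    (use B a bb heq_ty[OF bb] in \<open>auto simp: wt_sc intro!: wt_hPair\<close>)

context folds_category
begin

text \<open>Eta is applied three times and carried to the outside through the enclosing pairs. The
  last conclusion records the component that \<open>corr\<close> inspects.\<close>

lemma Indisc_eta:
  assumes X: "ext \<Gamma>\<^sub>0 \<Gamma>" and a: "\<Gamma> \<Turnstile> a \<Colon> MO" and b: "\<Gamma> \<Turnstile> b \<Colon> MO" and w: "\<Gamma> \<Turnstile> w \<Colon> Indisc a b"
  obtains l r c t where "\<Gamma> \<Turnstile> l \<Colon> Lty a b" "\<Gamma> \<Turnstile> r \<Colon> Rty a b" "\<Gamma> \<Turnstile> c \<Colon> Cty a b" "\<Gamma> \<Turnstile> t \<Colon> ind a b l r c"
    "\<Gamma> \<Turnstile> w \<approx> \<langle>l, \<langle>r, \<langle>c, t\<rangle>\<rangle>\<rangle> \<Colon> Indisc a b" "\<Gamma> \<Turnstile> pr1 (Lty a b) w \<approx> l \<Colon> Lty a b"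
proof -
  note L = fam_L[OF X a b]
  obtain l u where l: "\<Gamma> \<Turnstile> l \<Colon> Lty a b" and u: "\<Gamma> \<Turnstile> u \<Colon> (\<Sigma> r:Rty a b. \<Sigma> c:Cty a b. ind a b l r c)"
    and wl: "\<Gamma> \<Turnstile> w \<approx> \<langle>l, u\<rangle> \<Colon> Indisc a b"
    using hSig_eta[OF L w[unfolded Indisc_eq]] unfolding Indisc_eq by blast
  note R = fam_R[OF X a b l]
  obtain r v where r: "\<Gamma> \<Turnstile> r \<Colon> Rty a b" and v: "\<Gamma> \<Turnstile> v \<Colon> (\<Sigma> c:Cty a b. ind a b l r c)"
    and ur: "\<Gamma> \<Turnstile> u \<approx> \<langle>r, v\<rangle> \<Colon> (\<Sigma> r:Rty a b. \<Sigma> c:Cty a b. ind a b l r c)"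
    using hSig_eta[OF R u] by blast
  note C = fam_C[OF X a b l r]
  obtain c t where c: "\<Gamma> \<Turnstile> c \<Colon> Cty a b" and t: "\<Gamma> \<Turnstile> t \<Colon> ind a b l r c"
    and vc: "\<Gamma> \<Turnstile> v \<approx> \<langle>c, t\<rangle> \<Colon> (\<Sigma> c:Cty a b. ind a b l r c)"
    using hSig_eta[OF C v] by blast
  have uv: "\<Gamma> \<Turnstile> u \<approx> \<langle>r, \<langle>c, t\<rangle>\<rangle> \<Colon> (\<Sigma> r:Rty a b. \<Sigma> c:Cty a b. ind a b l r c)"
    by (rule heq_trans[OF ur], rule heq_hPair2[OF R r], rule vc)
  have "\<Gamma> \<Turnstile> w \<approx> \<langle>l, \<langle>r, \<langle>c, t\<rangle>\<rangle>\<rangle> \<Colon> Indisc a b"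
    unfolding Indisc_eq by (rule heq_trans[OF wl[unfolded Indisc_eq]], rule heq_hPair2[OF L l], rule uv)
  moreover have "\<Gamma> \<Turnstile> pr1 (Lty a b) w \<approx> l \<Colon> Lty a b"
    by (rule heq_trans[OF heq_pr1_cong[OF wl[unfolded Indisc_eq] L]], rule heq_pr1[OF L l], rule u)
  ultimately show ?thesis using that l r c t by blast
qed

subsection \<open>Isomorphisms\<close>

abbreviation Iso where "Iso \<equiv> iso MA MI MT uI uT"

definition isoT where "isoT a b f g = (comp a b a g f =\<^bsub>Hom a a\<^esub> one a) \<otimes> (comp b a b f g =\<^bsub>Hom b b\<^esub> one b)"

lemma Iso_eq: "Iso a b = (\<Sigma> f:Hom a b. \<Sigma> g:Hom b a. isoT a b f g)"
  unfolding iso_def isoT_def ..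

lemma rel_isoT [simp]:
  assumes "valid s" "sc (base s) MA" "sc (base s) MI" "sc (base s) MT" "sc (base s) uI" "sc (base s) uT"
    "\<forall>j\<ge>k. rel s j a a'" "\<forall>j\<ge>k. rel s j b b'" "\<forall>j\<ge>k. rel s j f f'" "\<forall>j\<ge>k. rel s j g g'"
  shows "rel s k (isoT a b f g) (isoT a' b' f' g')"
  using assms by (simp add: isoT_def)

lemma prp_isoT:
  assumes [simp]: "ext \<Gamma>\<^sub>0 \<Gamma>" "\<Gamma> \<Turnstile> a \<Colon> MO" "\<Gamma> \<Turnstile> b \<Colon> MO" "\<Gamma> \<Turnstile> f \<Colon> Hom a b" "\<Gamma> \<Turnstile> g \<Colon> Hom b a"
  shows "prp \<Gamma> (isoT a b f g)"
  unfolding isoT_def by (intro prp_hProd stD st_hom) simp_all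

lemma iso_fams:
  assumes X [simp]: "ext \<Gamma>\<^sub>0 \<Gamma>" and [simp]: "\<Gamma> \<Turnstile> a \<Colon> MO" "\<Gamma> \<Turnstile> b \<Colon> MO"
  shows fam_f: "fam \<Gamma> (Hom a b) (\<lambda>f. \<Sigma> g:Hom b a. isoT a b f g)"
    and fam_g: "\<Gamma> \<Turnstile> f \<Colon> Hom a b \<Longrightarrow> fam \<Gamma> (Hom b a) (\<lambda>g. isoT a b f g)"
    and ty_Iso [simp]: "ty \<Gamma> (Iso a b)"
proof -
  have C: "fam \<Delta> (Hom b a) (\<lambda>g. isoT a b f g)"
    if "ext \<Gamma>\<^sub>0 \<Delta>" "\<Delta> \<Turnstile> a \<Colon> MO" "\<Delta> \<Turnstile> b \<Colon> MO" "\<Delta> \<Turnstile> f \<Colon> Hom a b" for \<Delta> f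
    by (rule fam_sec) (use that that(2-)[THEN wt_sc] in
      \<open>auto intro!: prp_ty[OF prp_isoT] intro: ext_trans wt_ext\<close>)
  have R: "fam \<Delta> (Hom a b) (\<lambda>f. \<Sigma> g:Hom b a. isoT a b f g)"
    if "ext \<Gamma>\<^sub>0 \<Delta>" "\<Delta> \<Turnstile> a \<Colon> MO" "\<Delta> \<Turnstile> b \<Colon> MO" for \<Delta>
    by (rule fam_sec) (use that that(2-)[THEN wt_sc] in
      \<open>auto intro!: ty_hSig C intro: ext_trans wt_ext\<close>)
  show "fam \<Gamma> (Hom a b) (\<lambda>f. \<Sigma> g:Hom b a. isoT a b f g)" "ty \<Gamma> (Iso a b)"
    unfolding Iso_eq by (auto intro!: ty_hSig R)
  show "\<Gamma> \<Turnstile> f \<Colon> Hom a b \<Longrightarrow> fam \<Gamma> (Hom b a) (\<lambda>g. isoT a b f g)"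
    by (auto intro!: C)
qed

text \<open>The reading of \<open>isoT\<close> in HOL, see \<open>inh_isoT\<close>; in this form it
  supplies equations for chains of rewriting.\<close>

definition inverses where
  "inverses \<Gamma> a b f g \<longleftrightarrow> \<Gamma> \<Turnstile> f \<Colon> Hom a b \<and> \<Gamma> \<Turnstile> g \<Colon> Hom b a \<and>
     \<Gamma> \<Turnstile> comp a b a g f \<approx> one a \<Colon> Hom a a \<and> \<Gamma> \<Turnstile> comp b a b f g \<approx> one b \<Colon> Hom b b"

lemma inverses_sym: "inverses \<Gamma> a b f g \<Longrightarrow> inverses \<Gamma> b a g f"
  by (simp add: inverses_def)

lemma inverses_ext: "ext \<Gamma> \<Delta> \<Longrightarrow> inverses \<Gamma> a b f g \<Longrightarrow> inverses \<Delta> a b f g"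
  by (auto simp: inverses_def intro: wt_ext heq_ext)

lemma inh_isoT:
  assumes [simp]: "ext \<Gamma>\<^sub>0 \<Gamma>" "\<Gamma> \<Turnstile> a \<Colon> MO" "\<Gamma> \<Turnstile> b \<Colon> MO" "\<Gamma> \<Turnstile> f \<Colon> Hom a b" "\<Gamma> \<Turnstile> g \<Colon> Hom b a"
  shows "inh \<Gamma> (isoT a b f g) \<longleftrightarrow> inverses \<Gamma> a b f g"
  unfolding isoT_def inverses_def heq_def
  using inh_hProdE[of \<Gamma> "comp a b a g f =\<^bsub>Hom a a\<^esub> one a" "comp b a b f g =\<^bsub>Hom b b\<^esub> one b"]
  by (auto intro: inh_hProd)

lemma Iso_eta:
  assumes X: "ext \<Gamma>\<^sub>0 \<Gamma>" and a: "\<Gamma> \<Turnstile> a \<Colon> MO" and b: "\<Gamma> \<Turnstile> b \<Colon> MO" and w: "\<Gamma> \<Turnstile> w \<Colon> Iso a b"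
  obtains f g t where "inverses \<Gamma> a b f g" "\<Gamma> \<Turnstile> t \<Colon> isoT a b f g"
    "\<Gamma> \<Turnstile> w \<approx> \<langle>f, \<langle>g, t\<rangle>\<rangle> \<Colon> Iso a b" "\<Gamma> \<Turnstile> pr1 (Hom a b) w \<approx> f \<Colon> Hom a b"
proof -
  note F = fam_f[OF X a b]
  obtain f u where f: "\<Gamma> \<Turnstile> f \<Colon> Hom a b" and u: "\<Gamma> \<Turnstile> u \<Colon> (\<Sigma> g:Hom b a. isoT a b f g)"
    and wf: "\<Gamma> \<Turnstile> w \<approx> \<langle>f, u\<rangle> \<Colon> Iso a b"
    using hSig_eta[OF F w[unfolded Iso_eq]] unfolding Iso_eq by blast
  note G = fam_g[OF X a b f]
  obtain g t where g: "\<Gamma> \<Turnstile> g \<Colon> Hom b a" and t: "\<Gamma> \<Turnstile> t \<Colon> isoT a b f g"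
    and ug: "\<Gamma> \<Turnstile> u \<approx> \<langle>g, t\<rangle> \<Colon> (\<Sigma> g:Hom b a. isoT a b f g)"
    using hSig_eta[OF G u] by blast
  have "\<Gamma> \<Turnstile> w \<approx> \<langle>f, \<langle>g, t\<rangle>\<rangle> \<Colon> Iso a b"
    unfolding Iso_eq by (rule heq_trans[OF wf[unfolded Iso_eq]], rule heq_hPair2[OF F f], rule ug)
  moreover have "\<Gamma> \<Turnstile> pr1 (Hom a b) w \<approx> f \<Colon> Hom a b"
    by (rule heq_trans[OF heq_pr1_cong[OF wf[unfolded Iso_eq] F]], rule heq_pr1[OF F f], rule u)
  moreover have "inverses \<Gamma> a b f g"
    using inh_isoT[OF X a b f g] inhI[OF t] by simp
  ultimately show ?thesis using that t by blast
qed

lemma cancel: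
  assumes X [simp]: "ext \<Gamma>\<^sub>0 \<Gamma>" and [simp]: "\<Gamma> \<Turnstile> a \<Colon> MO" "\<Gamma> \<Turnstile> b \<Colon> MO" "\<Gamma> \<Turnstile> x \<Colon> MO"
    and i: "inverses \<Gamma> a b f g"
  shows cancel_left: "\<Gamma> \<Turnstile> h \<Colon> Hom x a \<Longrightarrow> \<Gamma> \<Turnstile> comp x b a g (comp x a b f h) \<approx> h \<Colon> Hom x a"
    and cancel_right: "\<Gamma> \<Turnstile> h \<Colon> Hom a x \<Longrightarrow> \<Gamma> \<Turnstile> comp a b x (comp b a x h g) f \<approx> h \<Colon> Hom a x"
proof -
  have [simp]: "\<Gamma> \<Turnstile> f \<Colon> Hom a b" "\<Gamma> \<Turnstile> g \<Colon> Hom b a" and gf: "\<Gamma> \<Turnstile> comp a b a g f \<approx> one a \<Colon> Hom a a"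
    using i by (simp_all add: inverses_def)
  {
    assume [simp]: "\<Gamma> \<Turnstile> h \<Colon> Hom x a"
    have "\<Gamma> \<Turnstile> comp x b a g (comp x a b f h) \<approx> comp x a a (comp a b a g f) h \<Colon> Hom x a"
      by (rule comp_assoc) simp_all
    also have "\<Gamma> \<Turnstile> comp x a a (comp a b a g f) h \<approx> comp x a a (one a) h \<Colon> Hom x a"
      by (rule comp_cong[OF _ _ _ _ gf]) simp_all
    also have "\<Gamma> \<Turnstile> comp x a a (one a) h \<approx> h \<Colon> Hom x a"
      by (rule comp_one_left) simp_all
    finally show "\<Gamma> \<Turnstile> comp x b a g (comp x a b f h) \<approx> h \<Colon> Hom x a" .
  }
  {
    assume [simp]: "\<Gamma> \<Turnstile> h \<Colon> Hom a x"
    have "\<Gamma> \<Turnstile> comp a a x h (comp a b a g f) \<approx> comp a b x (comp b a x h g) f \<Colon> Hom a x"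
      by (rule comp_assoc) simp_all
    from heq_sym[OF this]
    have "\<Gamma> \<Turnstile> comp a b x (comp b a x h g) f \<approx> comp a a x h (comp a b a g f) \<Colon> Hom a x" .
    also have "\<Gamma> \<Turnstile> comp a a x h (comp a b a g f) \<approx> comp a a x h (one a) \<Colon> Hom a x"
      by (rule comp_cong[OF _ _ _ _ _ gf]) simp_all
    also have "\<Gamma> \<Turnstile> comp a a x h (one a) \<approx> h \<Colon> Hom a x"
      by (rule comp_one_right) simp_all
    finally show "\<Gamma> \<Turnstile> comp a b x (comp b a x h g) f \<approx> h \<Colon> Hom a x" .
  }
qed

text \<open>The usual computation \<open>g = g \<circ> (f' \<circ> g') = g \<circ> (f \<circ> g') =
  g'\<close>.\<close>

lemma inverse_unique:
  assumes X [simp]: "ext \<Gamma>\<^sub>0 \<Gamma>" and [simp]: "\<Gamma> \<Turnstile> a \<Colon> MO" "\<Gamma> \<Turnstile> b \<Colon> MO"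
    and i: "inverses \<Gamma> a b f g" and i': "inverses \<Gamma> a b f' g'" and ff: "\<Gamma> \<Turnstile> f \<approx> f' \<Colon> Hom a b"
  shows "\<Gamma> \<Turnstile> g \<approx> g' \<Colon> Hom b a"
proof -
  have [simp]: "\<Gamma> \<Turnstile> f \<Colon> Hom a b" "\<Gamma> \<Turnstile> g \<Colon> Hom b a" "\<Gamma> \<Turnstile> f' \<Colon> Hom a b" "\<Gamma> \<Turnstile> g' \<Colon> Hom b a"
    and fg: "\<Gamma> \<Turnstile> comp b a b f' g' \<approx> one b \<Colon> Hom b b"
    using i i' by (simp_all add: inverses_def)
  have "\<Gamma> \<Turnstile> comp b b a g (one b) \<approx> g \<Colon> Hom b a" by (rule comp_one_right) simp_all
  from heq_sym[OF this] have "\<Gamma> \<Turnstile> g \<approx> comp b b a g (one b) \<Colon> Hom b a" .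
  also have "\<Gamma> \<Turnstile> comp b b a g (one b) \<approx> comp b b a g (comp b a b f' g') \<Colon> Hom b a"
    by (rule comp_cong[OF _ _ _ _ _ heq_sym[OF fg]]) simp_all
  also have "\<Gamma> \<Turnstile> comp b b a g (comp b a b f' g') \<approx> comp b b a g (comp b a b f g') \<Colon> Hom b a"
    by (rule comp_cong[OF _ _ _ _ _ comp_cong[OF _ _ _ _ heq_sym[OF ff]]]) simp_all
  also have "\<Gamma> \<Turnstile> comp b b a g (comp b a b f g') \<approx> g' \<Colon> Hom b a"
    by (rule cancel_left[OF _ _ _ _ i]) simp_all
  finally show ?thesis .
qed

end

lemma inh_hPiI:
  assumes A: "ty \<Gamma> A" and B: "natf (length \<Gamma>) B"
    and b: "\<And>x. ty \<Gamma> A \<Longrightarrow> sc (Suc (length \<Gamma>)) x \<Longrightarrow> \<Gamma> \<triangleright> A \<Turnstile> x \<Colon> A \<Longrightarrow> inh (\<Gamma> \<triangleright> A) (B x)"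
  shows "inh \<Gamma> (hPi A B)"
  using inh_hPi[OF A B] b A by blast

section \<open>Equivalences of hom-sets given by composition with an isomorphism\<close>

context folds_category
begin

text \<open>Here \<open>l\<close> composes with \<open>f\<close> after, \<open>r\<close> composes
  with \<open>g\<close> before, and \<open>c\<close> conjugates. The equations are demanded in all
  extensions because they are applied to variables bound later. Isomorphisms give such data by
  construction, and indiscernibilities give them by a Yoneda argument, so both constructions meet in
  this predicate.\<close>

definition acts where
  "acts \<Gamma> a b f g l r c \<longleftrightarrow> ext \<Gamma>\<^sub>0 \<Gamma> \<and> \<Gamma> \<Turnstile> a \<Colon> MO \<and> \<Gamma> \<Turnstile> b \<Colon> MO \<and>
     inverses \<Gamma> a b f g \<and> \<Gamma> \<Turnstile> l \<Colon> Lty a b \<and> \<Gamma> \<Turnstile> r \<Colon> Rty a b \<and> \<Gamma> \<Turnstile> c \<Colon> Cty a b \<and>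
     (\<forall>\<Delta> x h. ext \<Gamma> \<Delta> \<longrightarrow> \<Delta> \<Turnstile> x \<Colon> MO \<longrightarrow> \<Delta> \<Turnstile> h \<Colon> Hom x a \<longrightarrow>
        \<Delta> \<Turnstile> \<phi>l MA a b l x h \<approx> comp x a b f h \<Colon> Hom x b) \<and>
     (\<forall>\<Delta> x h. ext \<Gamma> \<Delta> \<longrightarrow> \<Delta> \<Turnstile> x \<Colon> MO \<longrightarrow> \<Delta> \<Turnstile> h \<Colon> Hom a x \<longrightarrow>
        \<Delta> \<Turnstile> \<phi>r MA a b r x h \<approx> comp b a x h g \<Colon> Hom b x) \<and>
     (\<forall>\<Delta> h. ext \<Gamma> \<Delta> \<longrightarrow> \<Delta> \<Turnstile> h \<Colon> Hom a a \<longrightarrow>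
        \<Delta> \<Turnstile> \<phi>c MA a b c h \<approx> comp b a b f (comp b a a h g) \<Colon> Hom b b)"

lemma acts_ext: "ext \<Gamma> \<Delta> \<Longrightarrow> acts \<Gamma> a b f g l r c \<Longrightarrow> acts \<Delta> a b f g l r c"
  unfolding acts_def by (blast intro: ext_trans wt_ext inverses_ext)

lemma actsD:
  assumes "acts \<Gamma> a b f g l r c"
  shows "ext \<Gamma>\<^sub>0 \<Gamma>" "\<Gamma> \<Turnstile> a \<Colon> MO" "\<Gamma> \<Turnstile> b \<Colon> MO" "\<Gamma> \<Turnstile> f \<Colon> Hom a b" "\<Gamma> \<Turnstile> g \<Colon> Hom b a"
    "\<Gamma> \<Turnstile> l \<Colon> Lty a b" "\<Gamma> \<Turnstile> r \<Colon> Rty a b" "\<Gamma> \<Turnstile> c \<Colon> Cty a b"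
  and acts_inv: "inverses \<Gamma> a b f g"
  and acts_l: "\<And>x h. \<Gamma> \<Turnstile> x \<Colon> MO \<Longrightarrow> \<Gamma> \<Turnstile> h \<Colon> Hom x a \<Longrightarrow> \<Gamma> \<Turnstile> \<phi>l MA a b l x h \<approx> comp x a b f h \<Colon> Hom x b"
  and acts_r: "\<And>x h. \<Gamma> \<Turnstile> x \<Colon> MO \<Longrightarrow> \<Gamma> \<Turnstile> h \<Colon> Hom a x \<Longrightarrow> \<Gamma> \<Turnstile> \<phi>r MA a b r x h \<approx> comp b a x h g \<Colon> Hom b x"
  and acts_c: "\<And>h. \<Gamma> \<Turnstile> h \<Colon> Hom a a \<Longrightarrow> \<Gamma> \<Turnstile> \<phi>c MA a b c h \<approx> comp b a b f (comp b a a h g) \<Colon> Hom b b"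
  using assms by (auto simp: acts_def inverses_def)

lemma comp_left_iff:
  assumes X [simp]: "ext \<Gamma>\<^sub>0 \<Gamma>" and [simp]: "\<Gamma> \<Turnstile> a \<Colon> MO" "\<Gamma> \<Turnstile> b \<Colon> MO" "\<Gamma> \<Turnstile> x \<Colon> MO"
    and i: "inverses \<Gamma> a b f g" and u: "\<Gamma> \<Turnstile> u \<Colon> Hom x a" and v: "\<Gamma> \<Turnstile> v \<Colon> Hom x a"
  shows "\<Gamma> \<Turnstile> u \<approx> v \<Colon> Hom x a \<longleftrightarrow> \<Gamma> \<Turnstile> comp x a b f u \<approx> comp x a b f v \<Colon> Hom x b"
proof
  have [simp]: "\<Gamma> \<Turnstile> f \<Colon> Hom a b" "\<Gamma> \<Turnstile> g \<Colon> Hom b a" using i by (simp_all add: inverses_def)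
  show "\<Gamma> \<Turnstile> comp x a b f u \<approx> comp x a b f v \<Colon> Hom x b" if "\<Gamma> \<Turnstile> u \<approx> v \<Colon> Hom x a"
    by (rule comp_cong[OF _ _ _ _ _ that]) simp_all
  assume e: "\<Gamma> \<Turnstile> comp x a b f u \<approx> comp x a b f v \<Colon> Hom x b"
  have "\<Gamma> \<Turnstile> u \<approx> comp x b a g (comp x a b f u) \<Colon> Hom x a"
    by (rule heq_sym[OF cancel_left[OF _ _ _ _ i u]]) simp_all
  also have "\<Gamma> \<Turnstile> comp x b a g (comp x a b f u) \<approx> comp x b a g (comp x a b f v) \<Colon> Hom x a"
    by (rule comp_cong[OF _ _ _ _ _ e]) simp_all
  also have "\<Gamma> \<Turnstile> comp x b a g (comp x a b f v) \<approx> v \<Colon> Hom x a"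
    by (rule cancel_left[OF _ _ _ _ i v]) simp_all
  finally show "\<Gamma> \<Turnstile> u \<approx> v \<Colon> Hom x a" .
qed

lemma comp_right_iff:
  assumes X [simp]: "ext \<Gamma>\<^sub>0 \<Gamma>" and [simp]: "\<Gamma> \<Turnstile> a \<Colon> MO" "\<Gamma> \<Turnstile> b \<Colon> MO" "\<Gamma> \<Turnstile> x \<Colon> MO"
    and i: "inverses \<Gamma> a b f g" and u: "\<Gamma> \<Turnstile> u \<Colon> Hom a x" and v: "\<Gamma> \<Turnstile> v \<Colon> Hom a x"
  shows "\<Gamma> \<Turnstile> u \<approx> v \<Colon> Hom a x \<longleftrightarrow> \<Gamma> \<Turnstile> comp b a x u g \<approx> comp b a x v g \<Colon> Hom b x"
proof
  have [simp]: "\<Gamma> \<Turnstile> f \<Colon> Hom a b" "\<Gamma> \<Turnstile> g \<Colon> Hom b a" using i by (simp_all add: inverses_def)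
  show "\<Gamma> \<Turnstile> comp b a x u g \<approx> comp b a x v g \<Colon> Hom b x" if "\<Gamma> \<Turnstile> u \<approx> v \<Colon> Hom a x"
    by (rule comp_cong[OF _ _ _ _ that]) simp_all
  assume e: "\<Gamma> \<Turnstile> comp b a x u g \<approx> comp b a x v g \<Colon> Hom b x"
  have "\<Gamma> \<Turnstile> u \<approx> comp a b x (comp b a x u g) f \<Colon> Hom a x"
    by (rule heq_sym[OF cancel_right[OF _ _ _ _ i u]]) simp_all
  also have "\<Gamma> \<Turnstile> comp a b x (comp b a x u g) f \<approx> comp a b x (comp b a x v g) f \<Colon> Hom a x"
    by (rule comp_cong[OF _ _ _ _ e]) simp_all
  also have "\<Gamma> \<Turnstile> comp a b x (comp b a x v g) f \<approx> v \<Colon> Hom a x"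
    by (rule cancel_right[OF _ _ _ _ i v]) simp_all
  finally show "\<Gamma> \<Turnstile> u \<approx> v \<Colon> Hom a x" .
qed

text \<open>The factors \<open>g\<close> and \<open>f\<close> meet after reassociation: \<open>(q
  \<circ> g) \<circ> (f \<circ> p) = q \<circ> (g \<circ> (f \<circ> p)) = q \<circ>
  p\<close>.\<close>

lemma comp_middle:
  assumes X [simp]: "ext \<Gamma>\<^sub>0 \<Gamma>" and [simp]: "\<Gamma> \<Turnstile> a \<Colon> MO" "\<Gamma> \<Turnstile> b \<Colon> MO" "\<Gamma> \<Turnstile> x \<Colon> MO" "\<Gamma> \<Turnstile> z \<Colon> MO"
    and i: "inverses \<Gamma> a b f g" and [simp]: "\<Gamma> \<Turnstile> p \<Colon> Hom x a" "\<Gamma> \<Turnstile> q \<Colon> Hom a z"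
  shows "\<Gamma> \<Turnstile> comp x b z (comp b a z q g) (comp x a b f p) \<approx> comp x a z q p \<Colon> Hom x z"
proof -
  have [simp]: "\<Gamma> \<Turnstile> f \<Colon> Hom a b" "\<Gamma> \<Turnstile> g \<Colon> Hom b a" using i by (simp_all add: inverses_def)
  have "\<Gamma> \<Turnstile> comp x b z (comp b a z q g) (comp x a b f p) \<approx> comp x a z q (comp x b a g (comp x a b f p)) \<Colon> Hom x z"
    by (rule heq_sym[OF comp_assoc]) simp_all
  also have "\<Gamma> \<Turnstile> comp x a z q (comp x b a g (comp x a b f p)) \<approx> comp x a z q p \<Colon> Hom x z"
    by (rule comp_cong[OF _ _ _ _ _ cancel_left[OF _ _ _ _ i]]) simp_all
  finally show ?thesis .
qed

text \<open>By \<open>MT_iff\<close> each side is an equation with a composite. The operation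
  \<open>K\<close> carries the first equation to the second, and it loses nothing because it
  preserves and reflects equality.\<close>

lemma inh_iff_MT:
  assumes X [simp]: "ext \<Gamma>\<^sub>0 \<Gamma>"
    and [simp]: "\<Gamma> \<Turnstile> x \<Colon> MO" "\<Gamma> \<Turnstile> y \<Colon> MO" "\<Gamma> \<Turnstile> z \<Colon> MO" "\<Gamma> \<Turnstile> p \<Colon> Hom x y" "\<Gamma> \<Turnstile> q \<Colon> Hom y z" "\<Gamma> \<Turnstile> h \<Colon> Hom x z"
      "\<Gamma> \<Turnstile> x' \<Colon> MO" "\<Gamma> \<Turnstile> y' \<Colon> MO" "\<Gamma> \<Turnstile> z' \<Colon> MO" "\<Gamma> \<Turnstile> p' \<Colon> Hom x' y'" "\<Gamma> \<Turnstile> q' \<Colon> Hom y' z'" "\<Gamma> \<Turnstile> h' \<Colon> Hom x' z'"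
    and comp: "\<Gamma> \<Turnstile> comp x' y' z' q' p' \<approx> K (comp x y z q p) \<Colon> Hom x' z'" and h: "\<Gamma> \<Turnstile> h' \<approx> K h \<Colon> Hom x' z'"
    and K: "\<And>\<Delta> u v. ext \<Gamma> \<Delta> \<Longrightarrow> \<Delta> \<Turnstile> u \<Colon> Hom x z \<Longrightarrow> \<Delta> \<Turnstile> v \<Colon> Hom x z \<Longrightarrow>
      \<Delta> \<Turnstile> u \<approx> v \<Colon> Hom x z \<longleftrightarrow> \<Delta> \<Turnstile> K u \<approx> K v \<Colon> Hom x' z'"
  shows "inh \<Gamma> (MT \<cdot> x \<cdot> y \<cdot> z \<cdot> p \<cdot> q \<cdot> h \<leftrightarrow> MT \<cdot> x' \<cdot> y' \<cdot> z' \<cdot> p' \<cdot> q' \<cdot> h')"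
proof (rule inh_hIff)
  fix \<Delta> assume \<Delta>: "ext \<Gamma> \<Delta>"
  have X' [simp]: "ext \<Gamma>\<^sub>0 \<Delta>" by (rule ext_trans[OF \<Delta> X])
  note [simp] = assms(2-13)[THEN wt_ext[OF \<Delta>]]
  note comp' = heq_ext[OF \<Delta> comp] and h' = heq_ext[OF \<Delta> h]
  have "inh \<Delta> (MT \<cdot> x \<cdot> y \<cdot> z \<cdot> p \<cdot> q \<cdot> h) \<longleftrightarrow> \<Delta> \<Turnstile> comp x y z q p \<approx> h \<Colon> Hom x z"
    by (rule MT_iff) simp_all
  also have "\<dots> \<longleftrightarrow> \<Delta> \<Turnstile> K (comp x y z q p) \<approx> K h \<Colon> Hom x' z'"
    by (rule K[OF \<Delta>]) simp_all
  also have "\<dots> \<longleftrightarrow> \<Delta> \<Turnstile> comp x' y' z' q' p' \<approx> h' \<Colon> Hom x' z'"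
    using comp' h' by (blast intro: heq_trans heq_sym)
  also have "\<dots> \<longleftrightarrow> inh \<Delta> (MT \<cdot> x' \<cdot> y' \<cdot> z' \<cdot> p' \<cdot> q' \<cdot> h')"
    by (rule MT_iff[symmetric]) simp_all
  finally show "inh \<Delta> (MT \<cdot> x \<cdot> y \<cdot> z \<cdot> p \<cdot> q \<cdot> h) \<longleftrightarrow> inh \<Delta> (MT \<cdot> x' \<cdot> y' \<cdot> z' \<cdot> p' \<cdot> q' \<cdot> h')" .
qed simp_all

text \<open>One computation for each of the seven clauses on \<open>MT\<close>: the composite of the
  transformed arrows is the transform of the composite, that is, its image under composition with
  \<open>f\<close>, composition with \<open>g\<close>, conjugation, or the identity.\<close>

lemma acts_comp:
  assumes A: "acts \<Gamma> a b f g l r c" and [simp]: "\<Gamma> \<Turnstile> x \<Colon> MO" "\<Gamma> \<Turnstile> y \<Colon> MO"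
  shows acts_comp1: "\<Gamma> \<Turnstile> p \<Colon> Hom x y \<Longrightarrow> \<Gamma> \<Turnstile> q \<Colon> Hom y a \<Longrightarrow>
      \<Gamma> \<Turnstile> comp x y b (\<phi>l MA a b l y q) p \<approx> comp x a b f (comp x y a q p) \<Colon> Hom x b"
    and acts_comp2: "\<Gamma> \<Turnstile> p \<Colon> Hom x a \<Longrightarrow> \<Gamma> \<Turnstile> q \<Colon> Hom a y \<Longrightarrow>
      \<Gamma> \<Turnstile> comp x b y (\<phi>r MA a b r y q) (\<phi>l MA a b l x p) \<approx> comp x a y q p \<Colon> Hom x y"
    and acts_comp3: "\<Gamma> \<Turnstile> p \<Colon> Hom a x \<Longrightarrow> \<Gamma> \<Turnstile> q \<Colon> Hom x y \<Longrightarrow>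
      \<Gamma> \<Turnstile> comp b x y q (\<phi>r MA a b r x p) \<approx> comp b a y (comp a x y q p) g \<Colon> Hom b y"
    and acts_comp4: "\<Gamma> \<Turnstile> p \<Colon> Hom x a \<Longrightarrow> \<Gamma> \<Turnstile> q \<Colon> Hom a a \<Longrightarrow>
      \<Gamma> \<Turnstile> comp x b b (\<phi>c MA a b c q) (\<phi>l MA a b l x p) \<approx> comp x a b f (comp x a a q p) \<Colon> Hom x b"
    and acts_comp5: "\<Gamma> \<Turnstile> p \<Colon> Hom a x \<Longrightarrow> \<Gamma> \<Turnstile> q \<Colon> Hom x a \<Longrightarrow>
      \<Gamma> \<Turnstile> comp b x b (\<phi>l MA a b l x q) (\<phi>r MA a b r x p) \<approx> comp b a b f (comp b a a (comp a x a q p) g) \<Colon> Hom b b"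
    and acts_comp6: "\<Gamma> \<Turnstile> p \<Colon> Hom a a \<Longrightarrow> \<Gamma> \<Turnstile> q \<Colon> Hom a x \<Longrightarrow>
      \<Gamma> \<Turnstile> comp b b x (\<phi>r MA a b r x q) (\<phi>c MA a b c p) \<approx> comp b a x (comp a a x q p) g \<Colon> Hom b x"
    and acts_comp7: "\<Gamma> \<Turnstile> p \<Colon> Hom a a \<Longrightarrow> \<Gamma> \<Turnstile> q \<Colon> Hom a a \<Longrightarrow>
      \<Gamma> \<Turnstile> comp b b b (\<phi>c MA a b c q) (\<phi>c MA a b c p) \<approx> comp b a b f (comp b a a (comp a a a q p) g) \<Colon> Hom b b"
proof -
  note [simp] = actsD(1-8)[OF A] and L = acts_l[OF A] and R = acts_r[OF A] and C = acts_c[OF A] and i = acts_inv[OF A]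
  {
    assume [simp]: "\<Gamma> \<Turnstile> p \<Colon> Hom x y" "\<Gamma> \<Turnstile> q \<Colon> Hom y a"
    have "\<Gamma> \<Turnstile> comp x y b (\<phi>l MA a b l y q) p \<approx> comp x y b (comp y a b f q) p \<Colon> Hom x b"
      by (rule comp_cong[OF _ _ _ _ L]) simp_all
    also have "\<Gamma> \<Turnstile> comp x y b (comp y a b f q) p \<approx> comp x a b f (comp x y a q p) \<Colon> Hom x b"
      by (rule heq_sym[OF comp_assoc]) simp_all
    finally show "\<Gamma> \<Turnstile> comp x y b (\<phi>l MA a b l y q) p \<approx> comp x a b f (comp x y a q p) \<Colon> Hom x b" .
  next
    assume [simp]: "\<Gamma> \<Turnstile> p \<Colon> Hom x a" "\<Gamma> \<Turnstile> q \<Colon> Hom a y"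
    have "\<Gamma> \<Turnstile> comp x b y (\<phi>r MA a b r y q) (\<phi>l MA a b l x p) \<approx> comp x b y (comp b a y q g) (comp x a b f p) \<Colon> Hom x y"
      by (rule comp_cong[OF _ _ _ _ R L]) simp_all
    also have "\<Gamma> \<Turnstile> comp x b y (comp b a y q g) (comp x a b f p) \<approx> comp x a y q p \<Colon> Hom x y"
      by (rule comp_middle[OF _ _ _ _ _ i]) simp_all
    finally show "\<Gamma> \<Turnstile> comp x b y (\<phi>r MA a b r y q) (\<phi>l MA a b l x p) \<approx> comp x a y q p \<Colon> Hom x y" .
  next
    assume [simp]: "\<Gamma> \<Turnstile> p \<Colon> Hom a x" "\<Gamma> \<Turnstile> q \<Colon> Hom x y"
    have "\<Gamma> \<Turnstile> comp b x y q (\<phi>r MA a b r x p) \<approx> comp b x y q (comp b a x p g) \<Colon> Hom b y"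
      by (rule comp_cong[OF _ _ _ _ _ R]) simp_all
    also have "\<Gamma> \<Turnstile> comp b x y q (comp b a x p g) \<approx> comp b a y (comp a x y q p) g \<Colon> Hom b y"
      by (rule comp_assoc) simp_all
    finally show "\<Gamma> \<Turnstile> comp b x y q (\<phi>r MA a b r x p) \<approx> comp b a y (comp a x y q p) g \<Colon> Hom b y" .
  next
    assume [simp]: "\<Gamma> \<Turnstile> p \<Colon> Hom x a" "\<Gamma> \<Turnstile> q \<Colon> Hom a a"
    have "\<Gamma> \<Turnstile> comp x b b (\<phi>c MA a b c q) (\<phi>l MA a b l x p) \<approx>
        comp x b b (comp b a b f (comp b a a q g)) (comp x a b f p) \<Colon> Hom x b"
      by (rule comp_cong[OF _ _ _ _ C L]) simp_all
    also have "\<Gamma> \<Turnstile> comp x b b (comp b a b f (comp b a a q g)) (comp x a b f p) \<approx>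
        comp x a b f (comp x b a (comp b a a q g) (comp x a b f p)) \<Colon> Hom x b"
      by (rule heq_sym[OF comp_assoc]) simp_all
    also have "\<Gamma> \<Turnstile> comp x a b f (comp x b a (comp b a a q g) (comp x a b f p)) \<approx>
        comp x a b f (comp x a a q p) \<Colon> Hom x b"
      by (rule comp_cong[OF _ _ _ _ _ comp_middle[OF _ _ _ _ _ i]]) simp_all
    finally show "\<Gamma> \<Turnstile> comp x b b (\<phi>c MA a b c q) (\<phi>l MA a b l x p) \<approx> comp x a b f (comp x a a q p) \<Colon> Hom x b" .
  next
    assume [simp]: "\<Gamma> \<Turnstile> p \<Colon> Hom a x" "\<Gamma> \<Turnstile> q \<Colon> Hom x a"
    have "\<Gamma> \<Turnstile> comp b x b (\<phi>l MA a b l x q) (\<phi>r MA a b r x p) \<approx> comp b x b (comp x a b f q) (comp b a x p g) \<Colon> Hom b b"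
      by (rule comp_cong[OF _ _ _ _ L R]) simp_all
    also have "\<Gamma> \<Turnstile> comp b x b (comp x a b f q) (comp b a x p g) \<approx>
        comp b a b f (comp b x a q (comp b a x p g)) \<Colon> Hom b b"
      by (rule heq_sym[OF comp_assoc]) simp_all
    also have "\<Gamma> \<Turnstile> comp b a b f (comp b x a q (comp b a x p g)) \<approx>
        comp b a b f (comp b a a (comp a x a q p) g) \<Colon> Hom b b"
      by (rule comp_cong[OF _ _ _ _ _ comp_assoc]) simp_all
    finally show "\<Gamma> \<Turnstile> comp b x b (\<phi>l MA a b l x q) (\<phi>r MA a b r x p) \<approx>
        comp b a b f (comp b a a (comp a x a q p) g) \<Colon> Hom b b" .
  }
  \<comment> \<open>The common core of the two remaining cases: \<open>(q \<circ> g) \<circ> (f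
    \<circ> (p \<circ> g)) = q \<circ> (p \<circ> g) = (q \<circ> p) \<circ> g\<close>.\<close>
  have C': "\<Gamma> \<Turnstile> comp b b z (comp b a z q g) (\<phi>c MA a b c p) \<approx> comp b a z (comp a a z q p) g \<Colon> Hom b z"
    if [simp]: "\<Gamma> \<Turnstile> z \<Colon> MO" "\<Gamma> \<Turnstile> p \<Colon> Hom a a" "\<Gamma> \<Turnstile> q \<Colon> Hom a z" for p q z
  proof -
    have "\<Gamma> \<Turnstile> comp b b z (comp b a z q g) (\<phi>c MA a b c p) \<approx>
        comp b b z (comp b a z q g) (comp b a b f (comp b a a p g)) \<Colon> Hom b z"
      by (rule comp_cong[OF _ _ _ _ _ C]) simp_all
    also have "\<Gamma> \<Turnstile> comp b b z (comp b a z q g) (comp b a b f (comp b a a p g)) \<approx>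
        comp b a z q (comp b a a p g) \<Colon> Hom b z"
      by (rule comp_middle[OF _ _ _ _ _ i]) simp_all
    also have "\<Gamma> \<Turnstile> comp b a z q (comp b a a p g) \<approx> comp b a z (comp a a z q p) g \<Colon> Hom b z"
      by (rule comp_assoc) simp_all
    finally show ?thesis .
  qed
  {
    assume [simp]: "\<Gamma> \<Turnstile> p \<Colon> Hom a a" "\<Gamma> \<Turnstile> q \<Colon> Hom a x"
    have "\<Gamma> \<Turnstile> comp b b x (\<phi>r MA a b r x q) (\<phi>c MA a b c p) \<approx> comp b b x (comp b a x q g) (\<phi>c MA a b c p) \<Colon> Hom b x"
      by (rule comp_cong[OF _ _ _ _ R]) simp_all
    also have "\<Gamma> \<Turnstile> comp b b x (comp b a x q g) (\<phi>c MA a b c p) \<approx> comp b a x (comp a a x q p) g \<Colon> Hom b x"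
      by (rule C') simp_all
    finally show "\<Gamma> \<Turnstile> comp b b x (\<phi>r MA a b r x q) (\<phi>c MA a b c p) \<approx> comp b a x (comp a a x q p) g \<Colon> Hom b x" .
  next
    assume [simp]: "\<Gamma> \<Turnstile> p \<Colon> Hom a a" "\<Gamma> \<Turnstile> q \<Colon> Hom a a"
    have "\<Gamma> \<Turnstile> comp b b b (\<phi>c MA a b c q) (\<phi>c MA a b c p) \<approx>
        comp b b b (comp b a b f (comp b a a q g)) (\<phi>c MA a b c p) \<Colon> Hom b b"
      by (rule comp_cong[OF _ _ _ _ C]) simp_all
    also have "\<Gamma> \<Turnstile> comp b b b (comp b a b f (comp b a a q g)) (\<phi>c MA a b c p) \<approx>
        comp b a b f (comp b b a (comp b a a q g) (\<phi>c MA a b c p)) \<Colon> Hom b b"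
      by (rule heq_sym[OF comp_assoc]) simp_all
    also have "\<Gamma> \<Turnstile> comp b a b f (comp b b a (comp b a a q g) (\<phi>c MA a b c p)) \<approx>
        comp b a b f (comp b a a (comp a a a q p) g) \<Colon> Hom b b"
      by (rule comp_cong[OF _ _ _ _ _ C']) simp_all
    finally show "\<Gamma> \<Turnstile> comp b b b (\<phi>c MA a b c q) (\<phi>c MA a b c p) \<approx>
        comp b a b f (comp b a a (comp a a a q p) g) \<Colon> Hom b b" .
  }
qed

text \<open>Composition with an isomorphism can be cancelled; for conjugation this is done on the
  right and then on the left. The three operations are thus admissible as \<open>K\<close> in
  \<open>inh_iff_MT\<close>.\<close>

lemma acts_K:
  assumes A: "acts \<Gamma> a b f g l r c" and \<Delta>: "ext \<Gamma> \<Delta>"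
  shows acts_KL: "\<Delta> \<Turnstile> x \<Colon> MO \<Longrightarrow> \<Delta> \<Turnstile> u \<Colon> Hom x a \<Longrightarrow> \<Delta> \<Turnstile> v \<Colon> Hom x a \<Longrightarrow>
      \<Delta> \<Turnstile> u \<approx> v \<Colon> Hom x a \<longleftrightarrow> \<Delta> \<Turnstile> comp x a b f u \<approx> comp x a b f v \<Colon> Hom x b"
    and acts_KR: "\<Delta> \<Turnstile> x \<Colon> MO \<Longrightarrow> \<Delta> \<Turnstile> u \<Colon> Hom a x \<Longrightarrow> \<Delta> \<Turnstile> v \<Colon> Hom a x \<Longrightarrow>
      \<Delta> \<Turnstile> u \<approx> v \<Colon> Hom a x \<longleftrightarrow> \<Delta> \<Turnstile> comp b a x u g \<approx> comp b a x v g \<Colon> Hom b x"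
    and acts_KC: "\<Delta> \<Turnstile> u \<Colon> Hom a a \<Longrightarrow> \<Delta> \<Turnstile> v \<Colon> Hom a a \<Longrightarrow>
      \<Delta> \<Turnstile> u \<approx> v \<Colon> Hom a a \<longleftrightarrow>
      \<Delta> \<Turnstile> comp b a b f (comp b a a u g) \<approx> comp b a b f (comp b a a v g) \<Colon> Hom b b"
proof -
  note A' = acts_ext[OF \<Delta> A]
  note [simp] = actsD(1-8)[OF A'] and i = acts_inv[OF A']
  show L: "\<Delta> \<Turnstile> u \<approx> v \<Colon> Hom x a \<longleftrightarrow> \<Delta> \<Turnstile> comp x a b f u \<approx> comp x a b f v \<Colon> Hom x b"
    if "\<Delta> \<Turnstile> x \<Colon> MO" "\<Delta> \<Turnstile> u \<Colon> Hom x a" "\<Delta> \<Turnstile> v \<Colon> Hom x a" for u v x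
    by (rule comp_left_iff[OF _ _ _ _ i]) (use that in simp_all)
  show R: "\<Delta> \<Turnstile> u \<approx> v \<Colon> Hom a x \<longleftrightarrow> \<Delta> \<Turnstile> comp b a x u g \<approx> comp b a x v g \<Colon> Hom b x"
    if "\<Delta> \<Turnstile> x \<Colon> MO" "\<Delta> \<Turnstile> u \<Colon> Hom a x" "\<Delta> \<Turnstile> v \<Colon> Hom a x" for u v x
    by (rule comp_right_iff[OF _ _ _ _ i]) (use that in simp_all)
  show "\<Delta> \<Turnstile> u \<approx> v \<Colon> Hom a a \<longleftrightarrow>
      \<Delta> \<Turnstile> comp b a b f (comp b a a u g) \<approx> comp b a b f (comp b a a v g) \<Colon> Hom b b"
    if [simp]: "\<Delta> \<Turnstile> u \<Colon> Hom a a" "\<Delta> \<Turnstile> v \<Colon> Hom a a"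
    using R[of a u v] L[of b "comp b a a u g" "comp b a a v g"] by simp
qed

text \<open>The choice of \<open>K\<close> depends on the ends of \<open>h\<close>: composition with
  \<open>f\<close> if only its target is \<open>a\<close>, with \<open>g\<close> if only its source
  is \<open>a\<close>, conjugation if both are, and the identity if neither is. The clause on
  \<open>MI\<close> is treated apart.\<close>

lemma acts_iff:
  assumes A: "acts \<Gamma> a b f g l r c" and \<Delta>: "ext \<Gamma> \<Delta>"
  shows "\<Delta> \<Turnstile> x \<Colon> MO \<Longrightarrow> \<Delta> \<Turnstile> y \<Colon> MO \<Longrightarrow> \<Delta> \<Turnstile> p \<Colon> Hom x y \<Longrightarrow> \<Delta> \<Turnstile> q \<Colon> Hom y a \<Longrightarrow> \<Delta> \<Turnstile> h \<Colon> Hom x a \<Longrightarrow>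
      inh \<Delta> (MT \<cdot> x \<cdot> y \<cdot> a \<cdot> p \<cdot> q \<cdot> h \<leftrightarrow> MT \<cdot> x \<cdot> y \<cdot> b \<cdot> p \<cdot> \<phi>l MA a b l y q \<cdot> \<phi>l MA a b l x h)"
    and "\<Delta> \<Turnstile> x \<Colon> MO \<Longrightarrow> \<Delta> \<Turnstile> y \<Colon> MO \<Longrightarrow> \<Delta> \<Turnstile> p \<Colon> Hom x a \<Longrightarrow> \<Delta> \<Turnstile> q \<Colon> Hom a y \<Longrightarrow> \<Delta> \<Turnstile> h \<Colon> Hom x y \<Longrightarrow>
      inh \<Delta> (MT \<cdot> x \<cdot> a \<cdot> y \<cdot> p \<cdot> q \<cdot> h \<leftrightarrow> MT \<cdot> x \<cdot> b \<cdot> y \<cdot> \<phi>l MA a b l x p \<cdot> \<phi>r MA a b r y q \<cdot> h)"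
    and "\<Delta> \<Turnstile> x \<Colon> MO \<Longrightarrow> \<Delta> \<Turnstile> y \<Colon> MO \<Longrightarrow> \<Delta> \<Turnstile> p \<Colon> Hom a x \<Longrightarrow> \<Delta> \<Turnstile> q \<Colon> Hom x y \<Longrightarrow> \<Delta> \<Turnstile> h \<Colon> Hom a y \<Longrightarrow>
      inh \<Delta> (MT \<cdot> a \<cdot> x \<cdot> y \<cdot> p \<cdot> q \<cdot> h \<leftrightarrow> MT \<cdot> b \<cdot> x \<cdot> y \<cdot> \<phi>r MA a b r x p \<cdot> q \<cdot> \<phi>r MA a b r y h)"
    and "\<Delta> \<Turnstile> x \<Colon> MO \<Longrightarrow> \<Delta> \<Turnstile> p \<Colon> Hom x a \<Longrightarrow> \<Delta> \<Turnstile> q \<Colon> Hom a a \<Longrightarrow> \<Delta> \<Turnstile> h \<Colon> Hom x a \<Longrightarrow>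
      inh \<Delta> (MT \<cdot> x \<cdot> a \<cdot> a \<cdot> p \<cdot> q \<cdot> h \<leftrightarrow> MT \<cdot> x \<cdot> b \<cdot> b \<cdot> \<phi>l MA a b l x p \<cdot> \<phi>c MA a b c q \<cdot> \<phi>l MA a b l x h)"
    and "\<Delta> \<Turnstile> x \<Colon> MO \<Longrightarrow> \<Delta> \<Turnstile> p \<Colon> Hom a x \<Longrightarrow> \<Delta> \<Turnstile> q \<Colon> Hom x a \<Longrightarrow> \<Delta> \<Turnstile> h \<Colon> Hom a a \<Longrightarrow>
      inh \<Delta> (MT \<cdot> a \<cdot> x \<cdot> a \<cdot> p \<cdot> q \<cdot> h \<leftrightarrow> MT \<cdot> b \<cdot> x \<cdot> b \<cdot> \<phi>r MA a b r x p \<cdot> \<phi>l MA a b l x q \<cdot> \<phi>c MA a b c h)"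
    and "\<Delta> \<Turnstile> x \<Colon> MO \<Longrightarrow> \<Delta> \<Turnstile> p \<Colon> Hom a a \<Longrightarrow> \<Delta> \<Turnstile> q \<Colon> Hom a x \<Longrightarrow> \<Delta> \<Turnstile> h \<Colon> Hom a x \<Longrightarrow>
      inh \<Delta> (MT \<cdot> a \<cdot> a \<cdot> x \<cdot> p \<cdot> q \<cdot> h \<leftrightarrow> MT \<cdot> b \<cdot> b \<cdot> x \<cdot> \<phi>c MA a b c p \<cdot> \<phi>r MA a b r x q \<cdot> \<phi>r MA a b r x h)"
    and "\<Delta> \<Turnstile> p \<Colon> Hom a a \<Longrightarrow> \<Delta> \<Turnstile> q \<Colon> Hom a a \<Longrightarrow> \<Delta> \<Turnstile> h \<Colon> Hom a a \<Longrightarrow>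
      inh \<Delta> (MT \<cdot> a \<cdot> a \<cdot> a \<cdot> p \<cdot> q \<cdot> h \<leftrightarrow> MT \<cdot> b \<cdot> b \<cdot> b \<cdot> \<phi>c MA a b c p \<cdot> \<phi>c MA a b c q \<cdot> \<phi>c MA a b c h)"
    and "\<Delta> \<Turnstile> p \<Colon> Hom a a \<Longrightarrow> inh \<Delta> (MI \<cdot> a \<cdot> p \<leftrightarrow> MI \<cdot> b \<cdot> \<phi>c MA a b c p)"
proof -
  note A' = acts_ext[OF \<Delta> A]
  note [simp] = actsD(1-8)[OF A']
  note E = acts_l[OF A'] acts_r[OF A'] acts_c[OF A']
  note c = acts_comp[OF A']
  have w: "ext \<Delta> E \<Longrightarrow> \<Delta> \<Turnstile> t \<Colon> T \<Longrightarrow> E \<Turnstile> t \<Colon> T" for E t T by (rule wt_ext)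
  show "inh \<Delta> (MT \<cdot> x \<cdot> y \<cdot> a \<cdot> p \<cdot> q \<cdot> h \<leftrightarrow> MT \<cdot> x \<cdot> y \<cdot> b \<cdot> p \<cdot> \<phi>l MA a b l y q \<cdot> \<phi>l MA a b l x h)"
    if [simp]: "\<Delta> \<Turnstile> x \<Colon> MO" "\<Delta> \<Turnstile> y \<Colon> MO" "\<Delta> \<Turnstile> p \<Colon> Hom x y" "\<Delta> \<Turnstile> q \<Colon> Hom y a" "\<Delta> \<Turnstile> h \<Colon> Hom x a"
    by (rule inh_iff_MT[where K = "comp x a b f"])
      ((rule c E acts_KL[OF A'] | simp | erule w)+)
  show "inh \<Delta> (MT \<cdot> x \<cdot> a \<cdot> y \<cdot> p \<cdot> q \<cdot> h \<leftrightarrow> MT \<cdot> x \<cdot> b \<cdot> y \<cdot> \<phi>l MA a b l x p \<cdot> \<phi>r MA a b r y q \<cdot> h)"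
    if [simp]: "\<Delta> \<Turnstile> x \<Colon> MO" "\<Delta> \<Turnstile> y \<Colon> MO" "\<Delta> \<Turnstile> p \<Colon> Hom x a" "\<Delta> \<Turnstile> q \<Colon> Hom a y" "\<Delta> \<Turnstile> h \<Colon> Hom x y"
    by (rule inh_iff_MT[where K = "\<lambda>u. u"]) ((rule c E | simp)+)
  show "inh \<Delta> (MT \<cdot> a \<cdot> x \<cdot> y \<cdot> p \<cdot> q \<cdot> h \<leftrightarrow> MT \<cdot> b \<cdot> x \<cdot> y \<cdot> \<phi>r MA a b r x p \<cdot> q \<cdot> \<phi>r MA a b r y h)"
    if [simp]: "\<Delta> \<Turnstile> x \<Colon> MO" "\<Delta> \<Turnstile> y \<Colon> MO" "\<Delta> \<Turnstile> p \<Colon> Hom a x" "\<Delta> \<Turnstile> q \<Colon> Hom x y" "\<Delta> \<Turnstile> h \<Colon> Hom a y"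
    by (rule inh_iff_MT[where K = "\<lambda>u. comp b a y u g"]) ((rule c E acts_KR[OF A'] | simp | erule w)+)
  show "inh \<Delta> (MT \<cdot> x \<cdot> a \<cdot> a \<cdot> p \<cdot> q \<cdot> h \<leftrightarrow> MT \<cdot> x \<cdot> b \<cdot> b \<cdot> \<phi>l MA a b l x p \<cdot> \<phi>c MA a b c q \<cdot> \<phi>l MA a b l x h)"
    if [simp]: "\<Delta> \<Turnstile> x \<Colon> MO" "\<Delta> \<Turnstile> p \<Colon> Hom x a" "\<Delta> \<Turnstile> q \<Colon> Hom a a" "\<Delta> \<Turnstile> h \<Colon> Hom x a"
    by (rule inh_iff_MT[where K = "comp x a b f"]) ((rule c(4)[where y = a] E acts_KL[OF A'] | simp | erule w)+)
  show "inh \<Delta> (MT \<cdot> a \<cdot> x \<cdot> a \<cdot> p \<cdot> q \<cdot> h \<leftrightarrow> MT \<cdot> b \<cdot> x \<cdot> b \<cdot> \<phi>r MA a b r x p \<cdot> \<phi>l MA a b l x q \<cdot> \<phi>c MA a b c h)"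
    if [simp]: "\<Delta> \<Turnstile> x \<Colon> MO" "\<Delta> \<Turnstile> p \<Colon> Hom a x" "\<Delta> \<Turnstile> q \<Colon> Hom x a" "\<Delta> \<Turnstile> h \<Colon> Hom a a"
    by (rule inh_iff_MT[where K = "\<lambda>u. comp b a b f (comp b a a u g)"])
      ((rule c(5)[where y = a] E acts_KC[OF A'] | simp | erule w)+)
  show "inh \<Delta> (MT \<cdot> a \<cdot> a \<cdot> x \<cdot> p \<cdot> q \<cdot> h \<leftrightarrow> MT \<cdot> b \<cdot> b \<cdot> x \<cdot> \<phi>c MA a b c p \<cdot> \<phi>r MA a b r x q \<cdot> \<phi>r MA a b r x h)"
    if [simp]: "\<Delta> \<Turnstile> x \<Colon> MO" "\<Delta> \<Turnstile> p \<Colon> Hom a a" "\<Delta> \<Turnstile> q \<Colon> Hom a x" "\<Delta> \<Turnstile> h \<Colon> Hom a x"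
    by (rule inh_iff_MT[where K = "\<lambda>u. comp b a x u g"]) ((rule c(6)[where y = a] E acts_KR[OF A'] | simp | erule w)+)
  show "inh \<Delta> (MT \<cdot> a \<cdot> a \<cdot> a \<cdot> p \<cdot> q \<cdot> h \<leftrightarrow> MT \<cdot> b \<cdot> b \<cdot> b \<cdot> \<phi>c MA a b c p \<cdot> \<phi>c MA a b c q \<cdot> \<phi>c MA a b c h)"
    if [simp]: "\<Delta> \<Turnstile> p \<Colon> Hom a a" "\<Delta> \<Turnstile> q \<Colon> Hom a a" "\<Delta> \<Turnstile> h \<Colon> Hom a a"
    by (rule inh_iff_MT[where K = "\<lambda>u. comp b a b f (comp b a a u g)"])
      ((rule c(7)[where x = a and y = a] E acts_KC[OF A'] | simp | erule w)+)
  show "inh \<Delta> (MI \<cdot> a \<cdot> p \<leftrightarrow> MI \<cdot> b \<cdot> \<phi>c MA a b c p)" if p [simp]: "\<Delta> \<Turnstile> p \<Colon> Hom a a"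
  proof (rule inh_hIff)
    fix E assume E: "ext \<Delta> E"
    note A'' = acts_ext[OF E A']
    note [simp] = actsD(1-8)[OF A''] wt_ext[OF E p]
    \<comment> \<open>Conjugation sends the identity of \<open>a\<close> to
      \<open>f \<circ> g\<close>, which is the identity of \<open>b\<close>; so it carries the
      equation for \<open>MI\<close> at \<open>a\<close> to the one at \<open>b\<close>.\<close>
    have "E \<Turnstile> comp b a b f (comp b a a (one a) g) \<approx> comp b a b f g \<Colon> Hom b b"
      by (rule comp_cong[OF _ _ _ _ _ comp_one_left]) simp_all
    also have "E \<Turnstile> comp b a b f g \<approx> one b \<Colon> Hom b b"
      using acts_inv[OF A''] by (simp add: inverses_def)
    finally have one: "E \<Turnstile> comp b a b f (comp b a a (one a) g) \<approx> one b \<Colon> Hom b b" .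
    have "inh E (MI \<cdot> a \<cdot> p) \<longleftrightarrow> E \<Turnstile> one a \<approx> p \<Colon> Hom a a"
      by (rule MI_iff) simp_all
    also have "\<dots> \<longleftrightarrow> E \<Turnstile> comp b a b f (comp b a a (one a) g) \<approx> comp b a b f (comp b a a p g) \<Colon> Hom b b"
      by (rule acts_KC[OF A' E]) simp_all
    also have "\<dots> \<longleftrightarrow> E \<Turnstile> one b \<approx> \<phi>c MA a b c p \<Colon> Hom b b"
      using one acts_c[OF A'' wt_ext[OF E p]] by (blast intro: heq_trans heq_sym)
    also have "\<dots> \<longleftrightarrow> inh E (MI \<cdot> b \<cdot> \<phi>c MA a b c p)"
      by (rule MI_iff[symmetric]) simp_all
    finally show "inh E (MI \<cdot> a \<cdot> p) \<longleftrightarrow> inh E (MI \<cdot> b \<cdot> \<phi>c MA a b c p)" .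
  qed simp_all
qed

lemma acts_ind:
  assumes A: "acts \<Gamma> a b f g l r c"
  shows "inh \<Gamma> (ind a b l r c)"
proof -
  note [simp] = actsD(1-8)[OF A] actsD(2-8)[OF A, THEN wt_sc]
  have "inh \<Gamma> (ind1 a b l)" "inh \<Gamma> (ind2 a b l r)" "inh \<Gamma> (ind3 a b r)" "inh \<Gamma> (ind4 a b l c)"
    "inh \<Gamma> (ind5 a b l r c)" "inh \<Gamma> (ind6 a b r c)" "inh \<Gamma> (ind7 a b c)" "inh \<Gamma> (ind8 a b c)"
    unfolding ind_defs
    by (intro inh_hPiI acts_iff[OF A]; (unfold length_cext)?; simp (no_asm_simp))+
  then show ?thesis
    unfolding ind_def by (intro inh_hProd ty_hProd prp_ind[OF actsD(1-3)[OF A] actsD(6-8)[OF A], THEN prp_ty])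
qed

end

section \<open>From an indiscernibility to composition with an isomorphism\<close>

lemma pfam_sec:
  assumes p: "\<And>\<Delta> x. ext \<Gamma> \<Delta> \<Longrightarrow> \<Delta> \<Turnstile> x \<Colon> A \<Longrightarrow> prp \<Delta> (B x)" and A: "ty \<Gamma> A" and n: "natf (length \<Gamma>) B"
  shows "pfam \<Gamma> A B"
  by (intro pfamI fam_sec p prp_ty A n)

context folds_category
begin

lemma indD:
  assumes X [simp]: "ext \<Gamma>\<^sub>0 \<Gamma>" and [simp]: "\<Gamma> \<Turnstile> a \<Colon> MO" "\<Gamma> \<Turnstile> b \<Colon> MO" "\<Gamma> \<Turnstile> l \<Colon> Lty a b" "\<Gamma> \<Turnstile> r \<Colon> Rty a b" "\<Gamma> \<Turnstile> c \<Colon> Cty a b"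
    and i: "inh \<Gamma> (ind a b l r c)"
  shows "inh \<Gamma> (ind1 a b l)" "inh \<Gamma> (ind2 a b l r)" "inh \<Gamma> (ind3 a b r)" "inh \<Gamma> (ind5 a b l r c)" "inh \<Gamma> (ind8 a b c)"
proof -
  note [simp] = prp_ind[OF assms(1-6), THEN prp_ty]
  note 1 = inh_hProdE[OF i[unfolded ind_def], simplified]
  note 2 = inh_hProdE[OF 1(2), simplified]
  note 3 = inh_hProdE[OF 2(2), simplified]
  note 4 = inh_hProdE[OF 3(2), simplified]
  note 5 = inh_hProdE[OF 4(2), simplified]
  note 6 = inh_hProdE[OF 5(2), simplified]
  note 7 = inh_hProdE[OF 6(2), simplified]
  show "inh \<Gamma> (ind1 a b l)" "inh \<Gamma> (ind2 a b l r)" "inh \<Gamma> (ind3 a b r)" "inh \<Gamma> (ind5 a b l r c)" "inh \<Gamma> (ind8 a b c)"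
    by (fact 1(1) 2(1) 3(1) 5(1) 7(2))+
qed

text \<open>The clauses in equational form, through \<open>MT_iff\<close> and \<open>MI_iff\<close>.
  The composite is kept as a separate \<open>h\<close> with an equation, so that the unit laws can
  be supplied directly as that equation.\<close>

lemma ind_comp:
  assumes X [simp]: "ext \<Gamma>\<^sub>0 \<Gamma>" and a [simp]: "\<Gamma> \<Turnstile> a \<Colon> MO" and b [simp]: "\<Gamma> \<Turnstile> b \<Colon> MO"
    and lrc [simp]: "\<Gamma> \<Turnstile> l \<Colon> Lty a b" "\<Gamma> \<Turnstile> r \<Colon> Rty a b" "\<Gamma> \<Turnstile> c \<Colon> Cty a b"
    and i: "inh \<Gamma> (ind a b l r c)"
  shows ind_comp1: "\<Gamma> \<Turnstile> x \<Colon> MO \<Longrightarrow> \<Gamma> \<Turnstile> y \<Colon> MO \<Longrightarrow> \<Gamma> \<Turnstile> p \<Colon> Hom x y \<Longrightarrow> \<Gamma> \<Turnstile> q \<Colon> Hom y a \<Longrightarrow> \<Gamma> \<Turnstile> h \<Colon> Hom x a \<Longrightarrow>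
      \<Gamma> \<Turnstile> comp x y a q p \<approx> h \<Colon> Hom x a \<Longrightarrow>
      \<Gamma> \<Turnstile> comp x y b (\<phi>l MA a b l y q) p \<approx> \<phi>l MA a b l x h \<Colon> Hom x b"
    and ind_comp2: "\<Gamma> \<Turnstile> x \<Colon> MO \<Longrightarrow> \<Gamma> \<Turnstile> y \<Colon> MO \<Longrightarrow> \<Gamma> \<Turnstile> p \<Colon> Hom x a \<Longrightarrow> \<Gamma> \<Turnstile> q \<Colon> Hom a y \<Longrightarrow> \<Gamma> \<Turnstile> h \<Colon> Hom x y \<Longrightarrow>
      \<Gamma> \<Turnstile> comp x a y q p \<approx> h \<Colon> Hom x y \<Longrightarrow>
      \<Gamma> \<Turnstile> comp x b y (\<phi>r MA a b r y q) (\<phi>l MA a b l x p) \<approx> h \<Colon> Hom x y"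
    and ind_comp3: "\<Gamma> \<Turnstile> x \<Colon> MO \<Longrightarrow> \<Gamma> \<Turnstile> y \<Colon> MO \<Longrightarrow> \<Gamma> \<Turnstile> p \<Colon> Hom a x \<Longrightarrow> \<Gamma> \<Turnstile> q \<Colon> Hom x y \<Longrightarrow> \<Gamma> \<Turnstile> h \<Colon> Hom a y \<Longrightarrow>
      \<Gamma> \<Turnstile> comp a x y q p \<approx> h \<Colon> Hom a y \<Longrightarrow>
      \<Gamma> \<Turnstile> comp b x y q (\<phi>r MA a b r x p) \<approx> \<phi>r MA a b r y h \<Colon> Hom b y"
    and ind_comp5: "\<Gamma> \<Turnstile> x \<Colon> MO \<Longrightarrow> \<Gamma> \<Turnstile> p \<Colon> Hom a x \<Longrightarrow> \<Gamma> \<Turnstile> q \<Colon> Hom x a \<Longrightarrow> \<Gamma> \<Turnstile> h \<Colon> Hom a a \<Longrightarrow>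
      \<Gamma> \<Turnstile> comp a x a q p \<approx> h \<Colon> Hom a a \<Longrightarrow>
      \<Gamma> \<Turnstile> comp b x b (\<phi>l MA a b l x q) (\<phi>r MA a b r x p) \<approx> \<phi>c MA a b c h \<Colon> Hom b b"
    and ind_one: "\<Gamma> \<Turnstile> one b \<approx> \<phi>c MA a b c (one a) \<Colon> Hom b b"
proof -
  note [simp] = assms(2-6)[THEN wt_sc]
  note D = indD[OF assms, unfolded ind_defs]
  show "\<Gamma> \<Turnstile> comp x y b (\<phi>l MA a b l y q) p \<approx> \<phi>l MA a b l x h \<Colon> Hom x b"
    if t: "\<Gamma> \<Turnstile> x \<Colon> MO" "\<Gamma> \<Turnstile> y \<Colon> MO" "\<Gamma> \<Turnstile> p \<Colon> Hom x y" "\<Gamma> \<Turnstile> q \<Colon> Hom y a" "\<Gamma> \<Turnstile> h \<Colon> Hom x a"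
      and e: "\<Gamma> \<Turnstile> comp x y a q p \<approx> h \<Colon> Hom x a"
  proof -
    note [simp] = t t[THEN wt_sc]
    have "inh \<Gamma> (MT \<cdot> x \<cdot> y \<cdot> a \<cdot> p \<cdot> q \<cdot> h \<leftrightarrow> MT \<cdot> x \<cdot> y \<cdot> b \<cdot> p \<cdot> \<phi>l MA a b l y q \<cdot> \<phi>l MA a b l x h)"
      by (rule inh_hPiE[OF inh_hPiE[OF inh_hPiE[OF inh_hPiE[OF inh_hPiE[OF D(1) _ t(1)] _ t(2)] _ t(3)] _ t(4)] _ t(5)])
        simp_all
    then have "inh \<Gamma> (MT \<cdot> x \<cdot> y \<cdot> b \<cdot> p \<cdot> \<phi>l MA a b l y q \<cdot> \<phi>l MA a b l x h)"
      by (rule inh_hIffD) (use e in \<open>simp_all add: MT_iff\<close>)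
    then show ?thesis by (simp add: MT_iff)
  qed
  show "\<Gamma> \<Turnstile> comp x b y (\<phi>r MA a b r y q) (\<phi>l MA a b l x p) \<approx> h \<Colon> Hom x y"
    if t: "\<Gamma> \<Turnstile> x \<Colon> MO" "\<Gamma> \<Turnstile> y \<Colon> MO" "\<Gamma> \<Turnstile> p \<Colon> Hom x a" "\<Gamma> \<Turnstile> q \<Colon> Hom a y" "\<Gamma> \<Turnstile> h \<Colon> Hom x y"
      and e: "\<Gamma> \<Turnstile> comp x a y q p \<approx> h \<Colon> Hom x y"
  proof -
    note [simp] = t t[THEN wt_sc]
    have "inh \<Gamma> (MT \<cdot> x \<cdot> a \<cdot> y \<cdot> p \<cdot> q \<cdot> h \<leftrightarrow> MT \<cdot> x \<cdot> b \<cdot> y \<cdot> \<phi>l MA a b l x p \<cdot> \<phi>r MA a b r y q \<cdot> h)"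
      by (rule inh_hPiE[OF inh_hPiE[OF inh_hPiE[OF inh_hPiE[OF inh_hPiE[OF D(2) _ t(1)] _ t(2)] _ t(3)] _ t(4)] _ t(5)])
        simp_all
    then have "inh \<Gamma> (MT \<cdot> x \<cdot> b \<cdot> y \<cdot> \<phi>l MA a b l x p \<cdot> \<phi>r MA a b r y q \<cdot> h)"
      by (rule inh_hIffD) (use e in \<open>simp_all add: MT_iff\<close>)
    then show ?thesis by (simp add: MT_iff)
  qed
  show "\<Gamma> \<Turnstile> comp b x y q (\<phi>r MA a b r x p) \<approx> \<phi>r MA a b r y h \<Colon> Hom b y"
    if t: "\<Gamma> \<Turnstile> x \<Colon> MO" "\<Gamma> \<Turnstile> y \<Colon> MO" "\<Gamma> \<Turnstile> p \<Colon> Hom a x" "\<Gamma> \<Turnstile> q \<Colon> Hom x y" "\<Gamma> \<Turnstile> h \<Colon> Hom a y"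
      and e: "\<Gamma> \<Turnstile> comp a x y q p \<approx> h \<Colon> Hom a y"
  proof -
    note [simp] = t t[THEN wt_sc]
    have "inh \<Gamma> (MT \<cdot> a \<cdot> x \<cdot> y \<cdot> p \<cdot> q \<cdot> h \<leftrightarrow> MT \<cdot> b \<cdot> x \<cdot> y \<cdot> \<phi>r MA a b r x p \<cdot> q \<cdot> \<phi>r MA a b r y h)"
      by (rule inh_hPiE[OF inh_hPiE[OF inh_hPiE[OF inh_hPiE[OF inh_hPiE[OF D(3) _ t(1)] _ t(2)] _ t(3)] _ t(4)] _ t(5)])
        simp_all
    then have "inh \<Gamma> (MT \<cdot> b \<cdot> x \<cdot> y \<cdot> \<phi>r MA a b r x p \<cdot> q \<cdot> \<phi>r MA a b r y h)"
      by (rule inh_hIffD) (use e in \<open>simp_all add: MT_iff\<close>)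
    then show ?thesis by (simp add: MT_iff)
  qed
  show "\<Gamma> \<Turnstile> comp b x b (\<phi>l MA a b l x q) (\<phi>r MA a b r x p) \<approx> \<phi>c MA a b c h \<Colon> Hom b b"
    if t: "\<Gamma> \<Turnstile> x \<Colon> MO" "\<Gamma> \<Turnstile> p \<Colon> Hom a x" "\<Gamma> \<Turnstile> q \<Colon> Hom x a" "\<Gamma> \<Turnstile> h \<Colon> Hom a a"
      and e: "\<Gamma> \<Turnstile> comp a x a q p \<approx> h \<Colon> Hom a a"
  proof -
    note [simp] = t t[THEN wt_sc]
    have "inh \<Gamma> (MT \<cdot> a \<cdot> x \<cdot> a \<cdot> p \<cdot> q \<cdot> h \<leftrightarrow> MT \<cdot> b \<cdot> x \<cdot> b \<cdot> \<phi>r MA a b r x p \<cdot> \<phi>l MA a b l x q \<cdot> \<phi>c MA a b c h)"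
      by (rule inh_hPiE[OF inh_hPiE[OF inh_hPiE[OF inh_hPiE[OF D(4) _ t(1)] _ t(2)] _ t(3)] _ t(4)])
        simp_all
    then have "inh \<Gamma> (MT \<cdot> b \<cdot> x \<cdot> b \<cdot> \<phi>r MA a b r x p \<cdot> \<phi>l MA a b l x q \<cdot> \<phi>c MA a b c h)"
      by (rule inh_hIffD) (use e in \<open>simp_all add: MT_iff\<close>)
    then show ?thesis by (simp add: MT_iff)
  qed
  have "inh \<Gamma> (MI \<cdot> a \<cdot> one a \<leftrightarrow> MI \<cdot> b \<cdot> \<phi>c MA a b c (one a))"
    by (rule inh_hPiE[OF D(5)]) simp_all
  then have "inh \<Gamma> (MI \<cdot> b \<cdot> \<phi>c MA a b c (one a))"
    by (rule inh_hIffD) (simp_all add: MI_iff)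
  then show "\<Gamma> \<Turnstile> one b \<approx> \<phi>c MA a b c (one a) \<Colon> Hom b b"
    by (simp add: MI_iff)
qed

text \<open>A Yoneda argument. The clauses are fed the unit laws: \<open>1 \<circ> h = h\<close>
  gives \<open>\<phi>l h = f \<circ> h\<close>, and \<open>h \<circ> 1 = h\<close> gives both
  \<open>\<phi>r h = h \<circ> g\<close> and \<open>\<phi>c h = \<phi>l h \<circ> g\<close>.\<close>

lemma acts_of_ind:
  assumes X: "ext \<Gamma>\<^sub>0 \<Gamma>" and a: "\<Gamma> \<Turnstile> a \<Colon> MO" and b: "\<Gamma> \<Turnstile> b \<Colon> MO"
    and lrc: "\<Gamma> \<Turnstile> l \<Colon> Lty a b" "\<Gamma> \<Turnstile> r \<Colon> Rty a b" "\<Gamma> \<Turnstile> c \<Colon> Cty a b"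
    and i: "inh \<Gamma> (ind a b l r c)"
  shows "acts \<Gamma> a b (\<phi>l MA a b l a (one a)) (\<phi>r MA a b r a (one a)) l r c"
proof -
  let ?f = "\<phi>l MA a b l a (one a)" and ?g = "\<phi>r MA a b r a (one a)"
  have *: "inverses \<Delta> a b ?f ?g \<and>
      (\<forall>x h. \<Delta> \<Turnstile> x \<Colon> MO \<longrightarrow> \<Delta> \<Turnstile> h \<Colon> Hom x a \<longrightarrow> \<Delta> \<Turnstile> \<phi>l MA a b l x h \<approx> comp x a b ?f h \<Colon> Hom x b) \<and>
      (\<forall>x h. \<Delta> \<Turnstile> x \<Colon> MO \<longrightarrow> \<Delta> \<Turnstile> h \<Colon> Hom a x \<longrightarrow> \<Delta> \<Turnstile> \<phi>r MA a b r x h \<approx> comp b a x h ?g \<Colon> Hom b x) \<and>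
      (\<forall>h. \<Delta> \<Turnstile> h \<Colon> Hom a a \<longrightarrow> \<Delta> \<Turnstile> \<phi>c MA a b c h \<approx> comp b a b ?f (comp b a a h ?g) \<Colon> Hom b b)"
    if \<Delta>: "ext \<Gamma> \<Delta>" for \<Delta>
  proof -
    note a' [simp] = ext_trans[OF \<Delta> X] a[THEN wt_ext[OF \<Delta>]] b[THEN wt_ext[OF \<Delta>]] lrc[THEN wt_ext[OF \<Delta>]]
    note c = ind_comp[OF a' inh_ext[OF \<Delta> i]]
    have oo: "\<Delta> \<Turnstile> comp a a a (one a) (one a) \<approx> one a \<Colon> Hom a a"
      by (rule comp_one_right) simp_all
    have L: "\<Delta> \<Turnstile> \<phi>l MA a b l x h \<approx> comp x a b ?f h \<Colon> Hom x b" if [simp]: "\<Delta> \<Turnstile> x \<Colon> MO" "\<Delta> \<Turnstile> h \<Colon> Hom x a" for x h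
      by (rule heq_sym, rule c(1)) (simp_all add: comp_one_left)
    have R: "\<Delta> \<Turnstile> \<phi>r MA a b r x h \<approx> comp b a x h ?g \<Colon> Hom b x" if [simp]: "\<Delta> \<Turnstile> x \<Colon> MO" "\<Delta> \<Turnstile> h \<Colon> Hom a x" for x h
      by (rule heq_sym, rule c(3)) (simp_all add: comp_one_right)
    have C: "\<Delta> \<Turnstile> \<phi>c MA a b c h \<approx> comp b a b ?f (comp b a a h ?g) \<Colon> Hom b b" if [simp]: "\<Delta> \<Turnstile> h \<Colon> Hom a a" for h
    proof -
      have "\<Delta> \<Turnstile> \<phi>c MA a b c h \<approx> comp b a b (\<phi>l MA a b l a h) ?g \<Colon> Hom b b"
        by (rule heq_sym, rule c(4)) (simp_all add: comp_one_right)
      also have "\<Delta> \<Turnstile> comp b a b (\<phi>l MA a b l a h) ?g \<approx> comp b a b (comp a a b ?f h) ?g \<Colon> Hom b b"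
        by (rule comp_cong[OF _ _ _ _ L]) simp_all
      also have "\<Delta> \<Turnstile> comp b a b (comp a a b ?f h) ?g \<approx> comp b a b ?f (comp b a a h ?g) \<Colon> Hom b b"
        by (rule heq_sym[OF comp_assoc]) simp_all
      finally show ?thesis .
    qed
    \<comment> \<open>Both inverse laws come from \<open>1 \<circ> 1 = 1\<close>. With the repeated
      object in the middle it gives \<open>g \<circ> f = 1\<close>; with it at both ends it gives
      \<open>f \<circ> g = \<phi>c 1\<close>, which the clause on \<open>MI\<close> identifies with
      the identity of \<open>b\<close>.\<close>
    have "\<Delta> \<Turnstile> comp a b a ?g ?f \<approx> one a \<Colon> Hom a a"
      by (rule c(2)) (simp_all add: oo)
    moreover have "\<Delta> \<Turnstile> comp b a b ?f ?g \<approx> one b \<Colon> Hom b b"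
      by (rule heq_trans[OF c(4) heq_sym[OF c(5)]]) (simp_all add: oo)
    ultimately have "inverses \<Delta> a b ?f ?g" by (simp add: inverses_def)
    then show ?thesis using L R C by blast
  qed
  show ?thesis
    unfolding acts_def using * X a b lrc by auto
qed

subsection \<open>Correspondence between isomorphisms and indiscernibilities\<close>

text \<open>Equivalences between sets are compared by their functions, which here are compositions
  with \<open>f\<close> and \<open>g\<close>. Equality of the inverses follows from equality of the
  arrows.\<close>

lemma acts_heq:
  assumes A: "acts \<Gamma> a b f g l r c" and A': "acts \<Gamma> a b f' g' l' r' c'" and ff: "\<Gamma> \<Turnstile> f \<approx> f' \<Colon> Hom a b"
  shows "\<Gamma> \<Turnstile> l \<approx> l' \<Colon> Lty a b" "\<Gamma> \<Turnstile> r \<approx> r' \<Colon> Rty a b" "\<Gamma> \<Turnstile> c \<approx> c' \<Colon> Cty a b"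
proof -
  note [simp] = actsD(1-8)[OF A] actsD(1-8)[OF A']
  note AD = actsD(1-8)[OF A] actsD(1-8)[OF A']
  have gg: "\<Gamma> \<Turnstile> g \<approx> g' \<Colon> Hom b a"
    by (rule inverse_unique[OF _ _ _ acts_inv[OF A] acts_inv[OF A'] ff]) simp_all
  show "\<Gamma> \<Turnstile> l \<approx> l' \<Colon> Lty a b"
  proof (rule heq_funext[OF fam_Lty])
    let ?\<Delta> = "\<Gamma> \<triangleright> MO"
    fix x assume x [simp]: "?\<Delta> \<Turnstile> x \<Colon> MO"
    have t: "?\<Delta> \<Turnstile> l \<cdot> x \<Colon> Hom x a \<simeq> Hom x b" "?\<Delta> \<Turnstile> l' \<cdot> x \<Colon> Hom x a \<simeq> Hom x b"
      by (rule wt_hApp[OF _ x]; simp add: AD(2,3)[THEN wt_sc])+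
    show "?\<Delta> \<Turnstile> l \<cdot> x \<approx> l' \<cdot> x \<Colon> Hom x a \<simeq> Hom x b"
    proof (rule heq_hEquiv[OF _ _ t])
      fix h assume h [simp]: "?\<Delta> \<triangleright> Hom x a \<Turnstile> h \<Colon> Hom x a"
      let ?E = "?\<Delta> \<triangleright> Hom x a"
      have E: "ext \<Gamma> ?E" by simp
      have x' [simp]: "?E \<Turnstile> x \<Colon> MO" by simp
      have "?E \<Turnstile> \<phi>l MA a b l x h \<approx> comp x a b f h \<Colon> Hom x b" by (rule acts_l[OF acts_ext[OF E A]]) simp_all
      also have "?E \<Turnstile> comp x a b f h \<approx> comp x a b f' h \<Colon> Hom x b"
        by (rule comp_cong[OF _ _ _ _ heq_ext[OF E ff]]) simp_all
      also have "?E \<Turnstile> comp x a b f' h \<approx> \<phi>l MA a b l' x h \<Colon> Hom x b"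
        by (rule heq_sym[OF acts_l[OF acts_ext[OF E A']]]) simp_all
      finally show "?E \<Turnstile> eapp (Hom x a) (Hom x b) (l \<cdot> x) h \<approx> eapp (Hom x a) (Hom x b) (l' \<cdot> x) h \<Colon> Hom x b"
        by (simp add: \<phi>l_def)
    qed (simp_all add: st_hom)
  qed simp_all
  show "\<Gamma> \<Turnstile> r \<approx> r' \<Colon> Rty a b"
  proof (rule heq_funext[OF fam_Rty])
    let ?\<Delta> = "\<Gamma> \<triangleright> MO"
    fix x assume x [simp]: "?\<Delta> \<Turnstile> x \<Colon> MO"
    have t: "?\<Delta> \<Turnstile> r \<cdot> x \<Colon> Hom a x \<simeq> Hom b x" "?\<Delta> \<Turnstile> r' \<cdot> x \<Colon> Hom a x \<simeq> Hom b x"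
      by (rule wt_hApp[OF _ x]; simp add: AD(2,3)[THEN wt_sc])+
    show "?\<Delta> \<Turnstile> r \<cdot> x \<approx> r' \<cdot> x \<Colon> Hom a x \<simeq> Hom b x"
    proof (rule heq_hEquiv[OF _ _ t])
      fix h assume h [simp]: "?\<Delta> \<triangleright> Hom a x \<Turnstile> h \<Colon> Hom a x"
      let ?E = "?\<Delta> \<triangleright> Hom a x"
      have E: "ext \<Gamma> ?E" by simp
      have x' [simp]: "?E \<Turnstile> x \<Colon> MO" by simp
      have "?E \<Turnstile> \<phi>r MA a b r x h \<approx> comp b a x h g \<Colon> Hom b x" by (rule acts_r[OF acts_ext[OF E A]]) simp_all
      also have "?E \<Turnstile> comp b a x h g \<approx> comp b a x h g' \<Colon> Hom b x"
        by (rule comp_cong[OF _ _ _ _ _ heq_ext[OF E gg]]) simp_all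
      also have "?E \<Turnstile> comp b a x h g' \<approx> \<phi>r MA a b r' x h \<Colon> Hom b x"
        by (rule heq_sym[OF acts_r[OF acts_ext[OF E A']]]) simp_all
      finally show "?E \<Turnstile> eapp (Hom a x) (Hom b x) (r \<cdot> x) h \<approx> eapp (Hom a x) (Hom b x) (r' \<cdot> x) h \<Colon> Hom b x"
        by (simp add: \<phi>r_def)
    qed (simp_all add: st_hom)
  qed simp_all
  show "\<Gamma> \<Turnstile> c \<approx> c' \<Colon> Cty a b"
  proof (rule heq_hEquiv)
    let ?E = "\<Gamma> \<triangleright> Hom a a"
    fix h assume h [simp]: "?E \<Turnstile> h \<Colon> Hom a a"
    have E: "ext \<Gamma> ?E" by simp
    have "?E \<Turnstile> \<phi>c MA a b c h \<approx> comp b a b f (comp b a a h g) \<Colon> Hom b b"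
      by (rule acts_c[OF acts_ext[OF E A]]) simp_all
    also have "?E \<Turnstile> comp b a b f (comp b a a h g) \<approx> comp b a b f' (comp b a a h g') \<Colon> Hom b b"
      by (rule comp_cong[OF _ _ _ _ heq_ext[OF E ff] comp_cong[OF _ _ _ _ _ heq_ext[OF E gg]]]) simp_all
    also have "?E \<Turnstile> comp b a b f' (comp b a a h g') \<approx> \<phi>c MA a b c' h \<Colon> Hom b b"
      by (rule heq_sym[OF acts_c[OF acts_ext[OF E A']]]) simp_all
    finally show "?E \<Turnstile> eapp (Hom a a) (Hom b b) c h \<approx> eapp (Hom a a) (Hom b b) c' h \<Colon> Hom b b"
      by (simp add: \<phi>c_def)
  qed (simp_all add: st_hom)
qed

lemma wt_indisc_tuple:
  assumes "ext \<Gamma>\<^sub>0 \<Gamma>" "\<Gamma> \<Turnstile> a \<Colon> MO" "\<Gamma> \<Turnstile> b \<Colon> MO" "\<Gamma> \<Turnstile> l \<Colon> Lty a b" "\<Gamma> \<Turnstile> r \<Colon> Rty a b" "\<Gamma> \<Turnstile> c \<Colon> Cty a b"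
    "\<Gamma> \<Turnstile> t \<Colon> ind a b l r c"
  shows "\<Gamma> \<Turnstile> \<langle>l, \<langle>r, \<langle>c, t\<rangle>\<rangle>\<rangle> \<Colon> Indisc a b"
  unfolding Indisc_eq
  by (rule wt_hPair[OF fam_L[OF assms(1-3)] assms(4)], rule wt_hPair[OF fam_R[OF assms(1-4)] assms(5)],
      rule wt_hPair[OF fam_C[OF assms(1-5)] assms(6)], rule assms(7))

text \<open>One statement for each argument, since \<open>tuple_eq\<close> replaces a single
  component at a time.\<close>

lemma pfam_ind:
  assumes "ext \<Gamma>\<^sub>0 \<Gamma>" "\<Gamma> \<Turnstile> a \<Colon> MO" "\<Gamma> \<Turnstile> b \<Colon> MO"
  shows pfam_ind_c: "\<Gamma> \<Turnstile> l \<Colon> Lty a b \<Longrightarrow> \<Gamma> \<Turnstile> r \<Colon> Rty a b \<Longrightarrow> pfam \<Gamma> (Cty a b) (\<lambda>c. ind a b l r c)"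
    and pfam_ind_r: "\<Gamma> \<Turnstile> l \<Colon> Lty a b \<Longrightarrow> \<Gamma> \<Turnstile> c \<Colon> Cty a b \<Longrightarrow> pfam \<Gamma> (Rty a b) (\<lambda>r. ind a b l r c)"
    and pfam_ind_l: "\<Gamma> \<Turnstile> r \<Colon> Rty a b \<Longrightarrow> \<Gamma> \<Turnstile> c \<Colon> Cty a b \<Longrightarrow> pfam \<Gamma> (Lty a b) (\<lambda>l. ind a b l r c)"
  by (rule pfam_sec; use assms in \<open>auto simp: wt_sc intro: prp_ind_all ext_trans wt_ext\<close>)+

text \<open>The components are exchanged one after the other, \<open>c\<close>, then
  \<open>r\<close>, then \<open>l\<close>. Their types do not depend on each other, so only the
  proof component has to follow: \<open>t1\<close> and \<open>t2\<close> are proofs for the mixed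
  tuples in between.\<close>

lemma indisc_tuple_heq:
  assumes A: "acts \<Gamma> a b f g l r c" and A': "acts \<Gamma> a b f' g' l' r' c'" and ff: "\<Gamma> \<Turnstile> f \<approx> f' \<Colon> Hom a b"
    and t: "\<Gamma> \<Turnstile> t \<Colon> ind a b l r c" and t': "\<Gamma> \<Turnstile> t' \<Colon> ind a b l' r' c'"
  shows "\<Gamma> \<Turnstile> \<langle>l, \<langle>r, \<langle>c, t\<rangle>\<rangle>\<rangle> \<approx> \<langle>l', \<langle>r', \<langle>c', t'\<rangle>\<rangle>\<rangle> \<Colon> Indisc a b"
proof -
  note D = actsD(1-8)[OF A] and D' = actsD(1-8)[OF A']
  note [simp] = D D' D(2-8)[THEN wt_sc] D'(2-8)[THEN wt_sc]
  note e = acts_heq[OF A A' ff]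
  note C = pfam_ind_c[OF D(1-3,6,7)] and R = pfam_ind_r[OF D(1-3,6) D'(8)] and L = pfam_ind_l[OF D(1-3) D'(7,8)]
  obtain t1 where t1: "\<Gamma> \<Turnstile> t1 \<Colon> ind a b l r c'"
    using transport[OF e(3) pfam_fam[OF C] inhI[OF t]] by (rule inhE)
  obtain t2 where t2: "\<Gamma> \<Turnstile> t2 \<Colon> ind a b l r' c'"
    by (rule inhE[OF transport[OF e(2) pfam_fam[OF R] inhI[OF t1]]])
  have I: "ty \<Gamma> (Indisc a b)" by simp
  have "\<Gamma> \<Turnstile> \<langle>l, \<langle>r, \<langle>c, t\<rangle>\<rangle>\<rangle> \<approx> \<langle>l, \<langle>r, \<langle>c', t1\<rangle>\<rangle>\<rangle> \<Colon> Indisc a b"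
    by (rule tuple_eq[OF C I, where k = "\<lambda>c t. \<langle>l, \<langle>r, \<langle>c, t\<rangle>\<rangle>\<rangle>"])
      (use e t t1 in \<open>auto intro!: wt_indisc_tuple intro: ext_trans wt_ext D\<close>)
  also have "\<Gamma> \<Turnstile> \<langle>l, \<langle>r, \<langle>c', t1\<rangle>\<rangle>\<rangle> \<approx> \<langle>l, \<langle>r', \<langle>c', t2\<rangle>\<rangle>\<rangle> \<Colon> Indisc a b"
    by (rule tuple_eq[OF R I, where k = "\<lambda>r t. \<langle>l, \<langle>r, \<langle>c', t\<rangle>\<rangle>\<rangle>"])
      (use e t1 t2 in \<open>auto intro!: wt_indisc_tuple intro: ext_trans wt_ext D D'\<close>)
  also have "\<Gamma> \<Turnstile> \<langle>l, \<langle>r', \<langle>c', t2\<rangle>\<rangle>\<rangle> \<approx> \<langle>l', \<langle>r', \<langle>c', t'\<rangle>\<rangle>\<rangle> \<Colon> Indisc a b"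
    by (rule tuple_eq[OF L I, where k = "\<lambda>l t. \<langle>l, \<langle>r', \<langle>c', t\<rangle>\<rangle>\<rangle>"])
      (use e t2 t' in \<open>auto intro!: wt_indisc_tuple intro: ext_trans wt_ext D D'\<close>)
  finally show ?thesis .
qed

lemma wt_iso_tuple:
  assumes "ext \<Gamma>\<^sub>0 \<Gamma>" "\<Gamma> \<Turnstile> a \<Colon> MO" "\<Gamma> \<Turnstile> b \<Colon> MO" "\<Gamma> \<Turnstile> f \<Colon> Hom a b" "\<Gamma> \<Turnstile> g \<Colon> Hom b a" "\<Gamma> \<Turnstile> t \<Colon> isoT a b f g"
  shows "\<Gamma> \<Turnstile> \<langle>f, \<langle>g, t\<rangle>\<rangle> \<Colon> Iso a b"
  unfolding Iso_eq
  by (rule wt_hPair[OF fam_f[OF assms(1-3)] assms(4)], rule wt_hPair[OF fam_g[OF assms(1-4)] assms(5)], rule assms(6))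

lemma pfam_iso:
  assumes "ext \<Gamma>\<^sub>0 \<Gamma>" "\<Gamma> \<Turnstile> a \<Colon> MO" "\<Gamma> \<Turnstile> b \<Colon> MO"
  shows pfam_iso_f: "\<Gamma> \<Turnstile> g \<Colon> Hom b a \<Longrightarrow> pfam \<Gamma> (Hom a b) (\<lambda>f. isoT a b f g)"
    and pfam_iso_g: "\<Gamma> \<Turnstile> f \<Colon> Hom a b \<Longrightarrow> pfam \<Gamma> (Hom b a) (\<lambda>g. isoT a b f g)"
  by (rule pfam_sec; use assms in \<open>auto simp: wt_sc intro: prp_isoT ext_trans wt_ext\<close>)+

lemma iso_tuple_heq:
  assumes X: "ext \<Gamma>\<^sub>0 \<Gamma>" and ab: "\<Gamma> \<Turnstile> a \<Colon> MO" "\<Gamma> \<Turnstile> b \<Colon> MO"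
    and i: "inverses \<Gamma> a b f g" and i': "inverses \<Gamma> a b f' g'" and ff: "\<Gamma> \<Turnstile> f \<approx> f' \<Colon> Hom a b"
    and t: "\<Gamma> \<Turnstile> t \<Colon> isoT a b f g" and t': "\<Gamma> \<Turnstile> t' \<Colon> isoT a b f' g'"
  shows "\<Gamma> \<Turnstile> \<langle>f, \<langle>g, t\<rangle>\<rangle> \<approx> \<langle>f', \<langle>g', t'\<rangle>\<rangle> \<Colon> Iso a b"
proof -
  have D: "\<Gamma> \<Turnstile> f \<Colon> Hom a b" "\<Gamma> \<Turnstile> g \<Colon> Hom b a" "\<Gamma> \<Turnstile> f' \<Colon> Hom a b" "\<Gamma> \<Turnstile> g' \<Colon> Hom b a"
    using i i' by (simp_all add: inverses_def)
  note [simp] = X ab D D[THEN wt_sc] ab[THEN wt_sc]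
  have gg: "\<Gamma> \<Turnstile> g \<approx> g' \<Colon> Hom b a" by (rule inverse_unique[OF X ab i i' ff])
  note G = pfam_iso_g[OF X ab D(1)] and F = pfam_iso_f[OF X ab D(4)]
  obtain t1 where t1: "\<Gamma> \<Turnstile> t1 \<Colon> isoT a b f g'"
    by (rule inhE[OF transport[OF gg pfam_fam[OF G] inhI[OF t]]])
  have I: "ty \<Gamma> (Iso a b)" by simp
  have "\<Gamma> \<Turnstile> \<langle>f, \<langle>g, t\<rangle>\<rangle> \<approx> \<langle>f, \<langle>g', t1\<rangle>\<rangle> \<Colon> Iso a b"
    by (rule tuple_eq[OF G I, where k = "\<lambda>g t. \<langle>f, \<langle>g, t\<rangle>\<rangle>"])
      (use gg t t1 in \<open>auto intro!: wt_iso_tuple intro: ext_trans wt_ext X ab D\<close>)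
  also have "\<Gamma> \<Turnstile> \<langle>f, \<langle>g', t1\<rangle>\<rangle> \<approx> \<langle>f', \<langle>g', t'\<rangle>\<rangle> \<Colon> Iso a b"
    by (rule tuple_eq[OF F I, where k = "\<lambda>f t. \<langle>f, \<langle>g', t\<rangle>\<rangle>"])
      (use ff t1 t' in \<open>auto intro!: wt_iso_tuple intro: ext_trans wt_ext X ab D\<close>)
  finally show ?thesis .
qed

text \<open>The correspondence is a type rather than a statement of HOL, because path induction
  takes it as motive and \<Sigma>-types are formed over it.\<close>

definition corr where
  "corr a b e w = (pr1 (Hom a b) e =\<^bsub>Hom a b\<^esub> \<phi>l MA a b (pr1 (Lty a b) w) a (one a))"

lemma rel_corr [simp]:
  assumes "valid s" "sc (base s) MO" "sc (base s) MA" "sc (base s) MI" "sc (base s) uI"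
    "\<forall>j\<ge>k. rel s j a a'" "\<forall>j\<ge>k. rel s j b b'" "\<forall>j\<ge>k. rel s j e e'" "\<forall>j\<ge>k. rel s j w w'"
  shows "rel s k (corr a b e w) (corr a' b' e' w')"
  using assms by (simp add: corr_def)

lemma phil_cong:
  assumes X [simp]: "ext \<Gamma>\<^sub>0 \<Gamma>" and ab [simp]: "\<Gamma> \<Turnstile> a \<Colon> MO" "\<Gamma> \<Turnstile> b \<Colon> MO" and ll: "\<Gamma> \<Turnstile> l \<approx> l' \<Colon> Lty a b"
    and x [simp]: "\<Gamma> \<Turnstile> x \<Colon> MO" and h [simp]: "\<Gamma> \<Turnstile> h \<Colon> Hom x a"
  shows "\<Gamma> \<Turnstile> \<phi>l MA a b l x h \<approx> \<phi>l MA a b l' x h \<Colon> Hom x b"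
  by (rule heq_cong[OF ll]) (auto simp: ab[THEN wt_sc] x[THEN wt_sc] h[THEN wt_sc])

lemma corr_wt:
  assumes X [simp]: "ext \<Gamma>\<^sub>0 \<Gamma>" and [simp]: "\<Gamma> \<Turnstile> a \<Colon> MO" "\<Gamma> \<Turnstile> b \<Colon> MO" and e: "\<Gamma> \<Turnstile> e \<Colon> Iso a b" and w: "\<Gamma> \<Turnstile> w \<Colon> Indisc a b"
  shows "\<Gamma> \<Turnstile> pr1 (Hom a b) e \<Colon> Hom a b" "\<Gamma> \<Turnstile> \<phi>l MA a b (pr1 (Lty a b) w) a (one a) \<Colon> Hom a b"
    and ty_corr [simp]: "ty \<Gamma> (corr a b e w)"
proof -
  show 1: "\<Gamma> \<Turnstile> pr1 (Hom a b) e \<Colon> Hom a b"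
    by (rule wt_pr1[OF fam_f e[unfolded Iso_eq]]) simp_all
  have "\<Gamma> \<Turnstile> pr1 (Lty a b) w \<Colon> Lty a b"
    by (rule wt_pr1[OF fam_L w[unfolded Indisc_eq]]) simp_all
  then show 2: "\<Gamma> \<Turnstile> \<phi>l MA a b (pr1 (Lty a b) w) a (one a) \<Colon> Hom a b" by simp
  show "ty \<Gamma> (corr a b e w)" unfolding corr_def using 1 2 by simp
qed

text \<open>Replaces the projections in \<open>corr\<close> by the components found by
  \<open>Iso_eta\<close> and \<open>Indisc_eta\<close>, to which the lemmas on \<open>acts\<close>
  apply.\<close>

lemma corr_iff:
  assumes X: "ext \<Gamma>\<^sub>0 \<Gamma>" and ab: "\<Gamma> \<Turnstile> a \<Colon> MO" "\<Gamma> \<Turnstile> b \<Colon> MO" and e: "\<Gamma> \<Turnstile> e \<Colon> Iso a b" and w: "\<Gamma> \<Turnstile> w \<Colon> Indisc a b"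
    and f: "\<Gamma> \<Turnstile> pr1 (Hom a b) e \<approx> f \<Colon> Hom a b" and l: "\<Gamma> \<Turnstile> pr1 (Lty a b) w \<approx> l \<Colon> Lty a b"
  shows "inh \<Gamma> (corr a b e w) \<longleftrightarrow> \<Gamma> \<Turnstile> f \<approx> \<phi>l MA a b l a (one a) \<Colon> Hom a b"
proof -
  have l': "\<Gamma> \<Turnstile> \<phi>l MA a b (pr1 (Lty a b) w) a (one a) \<approx> \<phi>l MA a b l a (one a) \<Colon> Hom a b"
    by (rule phil_cong[OF X ab l ab(1)]) (simp add: X ab)
  have "inh \<Gamma> (corr a b e w) \<longleftrightarrow> \<Gamma> \<Turnstile> pr1 (Hom a b) e \<approx> \<phi>l MA a b (pr1 (Lty a b) w) a (one a) \<Colon> Hom a b"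
    unfolding corr_def heq_def using corr_wt[OF X ab e w] X ab by simp
  also have "\<dots> \<longleftrightarrow> \<Gamma> \<Turnstile> f \<approx> \<phi>l MA a b l a (one a) \<Colon> Hom a b"
    using f l' by (blast intro: heq_trans heq_sym)
  finally show ?thesis .
qed

text \<open>Partners of \<open>e\<close> all act through its arrow, so their tuples agree by
  \<open>indisc_tuple_heq\<close>. Partners of \<open>w\<close> share the arrow that
  \<open>w\<close> determines, and the rest of an isomorphism is fixed by its arrow.\<close>

lemma corr_unique:
  assumes X: "ext \<Gamma>\<^sub>0 \<Gamma>" and ab: "\<Gamma> \<Turnstile> a \<Colon> MO" "\<Gamma> \<Turnstile> b \<Colon> MO"
  shows corr_unique_indisc: "\<Gamma> \<Turnstile> e \<Colon> Iso a b \<Longrightarrow> \<Gamma> \<Turnstile> w \<Colon> Indisc a b \<Longrightarrow> \<Gamma> \<Turnstile> w' \<Colon> Indisc a b \<Longrightarrow>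
      inh \<Gamma> (corr a b e w) \<Longrightarrow> inh \<Gamma> (corr a b e w') \<Longrightarrow> \<Gamma> \<Turnstile> w \<approx> w' \<Colon> Indisc a b"
    and corr_unique_iso: "\<Gamma> \<Turnstile> e \<Colon> Iso a b \<Longrightarrow> \<Gamma> \<Turnstile> e' \<Colon> Iso a b \<Longrightarrow> \<Gamma> \<Turnstile> w \<Colon> Indisc a b \<Longrightarrow>
      inh \<Gamma> (corr a b e w) \<Longrightarrow> inh \<Gamma> (corr a b e' w) \<Longrightarrow> \<Gamma> \<Turnstile> e \<approx> e' \<Colon> Iso a b"
proof -
  assume e: "\<Gamma> \<Turnstile> e \<Colon> Iso a b"
  obtain f g s where fg: "inverses \<Gamma> a b f g" "\<Gamma> \<Turnstile> s \<Colon> isoT a b f g" "\<Gamma> \<Turnstile> e \<approx> \<langle>f, \<langle>g, s\<rangle>\<rangle> \<Colon> Iso a b"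
    "\<Gamma> \<Turnstile> pr1 (Hom a b) e \<approx> f \<Colon> Hom a b"
    using Iso_eta[OF X ab e] by blast
  assume w: "\<Gamma> \<Turnstile> w \<Colon> Indisc a b"
  obtain l r c t where l: "\<Gamma> \<Turnstile> l \<Colon> Lty a b" "\<Gamma> \<Turnstile> r \<Colon> Rty a b" "\<Gamma> \<Turnstile> c \<Colon> Cty a b" "\<Gamma> \<Turnstile> t \<Colon> ind a b l r c"
    "\<Gamma> \<Turnstile> w \<approx> \<langle>l, \<langle>r, \<langle>c, t\<rangle>\<rangle>\<rangle> \<Colon> Indisc a b" "\<Gamma> \<Turnstile> pr1 (Lty a b) w \<approx> l \<Colon> Lty a b"
    using Indisc_eta[OF X ab w] by blast
  note A = acts_of_ind[OF X ab l(1-3) inhI[OF l(4)]]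
  assume "inh \<Gamma> (corr a b e w)"
  then have f: "\<Gamma> \<Turnstile> f \<approx> \<phi>l MA a b l a (one a) \<Colon> Hom a b"
    using corr_iff[OF X ab e w fg(4) l(6)] by simp
  {
    assume w': "\<Gamma> \<Turnstile> w' \<Colon> Indisc a b"
    obtain l' r' c' t' where l': "\<Gamma> \<Turnstile> l' \<Colon> Lty a b" "\<Gamma> \<Turnstile> r' \<Colon> Rty a b" "\<Gamma> \<Turnstile> c' \<Colon> Cty a b" "\<Gamma> \<Turnstile> t' \<Colon> ind a b l' r' c'"
      "\<Gamma> \<Turnstile> w' \<approx> \<langle>l', \<langle>r', \<langle>c', t'\<rangle>\<rangle>\<rangle> \<Colon> Indisc a b" "\<Gamma> \<Turnstile> pr1 (Lty a b) w' \<approx> l' \<Colon> Lty a b"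
      using Indisc_eta[OF X ab w'] by blast
    note A' = acts_of_ind[OF X ab l'(1-3) inhI[OF l'(4)]]
    assume "inh \<Gamma> (corr a b e w')"
    then have f': "\<Gamma> \<Turnstile> f \<approx> \<phi>l MA a b l' a (one a) \<Colon> Hom a b"
      using corr_iff[OF X ab e w' fg(4) l'(6)] by simp
    note l(5)
    also have "\<Gamma> \<Turnstile> \<langle>l, \<langle>r, \<langle>c, t\<rangle>\<rangle>\<rangle> \<approx> \<langle>l', \<langle>r', \<langle>c', t'\<rangle>\<rangle>\<rangle> \<Colon> Indisc a b"
      by (rule indisc_tuple_heq[OF A A' heq_trans[OF heq_sym[OF f] f'] l(4) l'(4)])
    also note heq_sym[OF l'(5)]
    finally show "\<Gamma> \<Turnstile> w \<approx> w' \<Colon> Indisc a b" .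
  next
    assume e': "\<Gamma> \<Turnstile> e' \<Colon> Iso a b"
    obtain f' g' s' where fg': "inverses \<Gamma> a b f' g'" "\<Gamma> \<Turnstile> s' \<Colon> isoT a b f' g'" "\<Gamma> \<Turnstile> e' \<approx> \<langle>f', \<langle>g', s'\<rangle>\<rangle> \<Colon> Iso a b"
      "\<Gamma> \<Turnstile> pr1 (Hom a b) e' \<approx> f' \<Colon> Hom a b"
      using Iso_eta[OF X ab e'] by blast
    assume "inh \<Gamma> (corr a b e' w)"
    then have f': "\<Gamma> \<Turnstile> f' \<approx> \<phi>l MA a b l a (one a) \<Colon> Hom a b"
      using corr_iff[OF X ab e' w fg'(4) l(6)] by simp
    note fg(3)
    also have "\<Gamma> \<Turnstile> \<langle>f, \<langle>g, s\<rangle>\<rangle> \<approx> \<langle>f', \<langle>g', s'\<rangle>\<rangle> \<Colon> Iso a b"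
      by (rule iso_tuple_heq[OF X ab fg(1) fg'(1) heq_trans[OF f heq_sym[OF f']] fg(2) fg'(2)])
    also note heq_sym[OF fg'(3)]
    finally show "\<Gamma> \<Turnstile> e \<approx> e' \<Colon> Iso a b" .
  }
qed

section \<open>Existence of corresponding elements on either side\<close>

lemma fam_corr:
  assumes "ext \<Gamma>\<^sub>0 \<Gamma>" "\<Gamma> \<Turnstile> a \<Colon> MO" "\<Gamma> \<Turnstile> b \<Colon> MO"
  shows "\<Gamma> \<Turnstile> w \<Colon> Indisc a b \<Longrightarrow> fam \<Gamma> (Iso a b) (\<lambda>e. corr a b e w)"
    "\<Gamma> \<Turnstile> e \<Colon> Iso a b \<Longrightarrow> fam \<Gamma> (Indisc a b) (\<lambda>w. corr a b e w)"
  by (rule fam_sec; use assms in \<open>auto simp: wt_sc intro: ty_corr ext_trans wt_ext\<close>)+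

lemma ex_corr_iso:
  assumes X: "ext \<Gamma>\<^sub>0 \<Gamma>" and ab: "\<Gamma> \<Turnstile> a \<Colon> MO" "\<Gamma> \<Turnstile> b \<Colon> MO" and w: "\<Gamma> \<Turnstile> w \<Colon> Indisc a b"
  shows "inh \<Gamma> (\<Sigma> e:Iso a b. corr a b e w)"
proof -
  obtain l r c t where l: "\<Gamma> \<Turnstile> l \<Colon> Lty a b" "\<Gamma> \<Turnstile> r \<Colon> Rty a b" "\<Gamma> \<Turnstile> c \<Colon> Cty a b" "\<Gamma> \<Turnstile> t \<Colon> ind a b l r c"
    "\<Gamma> \<Turnstile> w \<approx> \<langle>l, \<langle>r, \<langle>c, t\<rangle>\<rangle>\<rangle> \<Colon> Indisc a b" "\<Gamma> \<Turnstile> pr1 (Lty a b) w \<approx> l \<Colon> Lty a b"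
    using Indisc_eta[OF X ab w] by blast
  note A = acts_of_ind[OF X ab l(1-3) inhI[OF l(4)]]
  let ?f = "\<phi>l MA a b l a (one a)" and ?g = "\<phi>r MA a b r a (one a)"
  obtain s where s: "\<Gamma> \<Turnstile> s \<Colon> isoT a b ?f ?g"
    using inh_isoT[OF X ab actsD(4,5)[OF A]] acts_inv[OF A] inhE by blast
  have e: "\<Gamma> \<Turnstile> \<langle>?f, \<langle>?g, s\<rangle>\<rangle> \<Colon> Iso a b"
    by (rule wt_iso_tuple[OF X ab actsD(4,5)[OF A] s])
  have u: "\<Gamma> \<Turnstile> \<langle>?g, s\<rangle> \<Colon> (\<Sigma> g:Hom b a. isoT a b ?f g)"
    by (rule wt_hPair[OF fam_g[OF X ab actsD(4)[OF A]] actsD(5)[OF A]], rule s)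
  have "\<Gamma> \<Turnstile> pr1 (Hom a b) \<langle>?f, \<langle>?g, s\<rangle>\<rangle> \<approx> ?f \<Colon> Hom a b"
    by (rule heq_pr1[OF fam_f[OF X ab] actsD(4)[OF A]], rule u)
  then have "inh \<Gamma> (corr a b \<langle>?f, \<langle>?g, s\<rangle>\<rangle> w)"
    using corr_iff[OF X ab e w _ l(6)] actsD(4)[OF A] X ab by simp
  then show ?thesis
    by (rule inh_hSig[OF fam_corr(1)[OF X ab w] e])
qed

lemma ex_corr_indisc:
  assumes X [simp]: "ext \<Gamma>\<^sub>0 \<Gamma>" and ab [simp]: "\<Gamma> \<Turnstile> a \<Colon> MO" "\<Gamma> \<Turnstile> b \<Colon> MO" and e: "\<Gamma> \<Turnstile> e \<Colon> Iso a b"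
  shows "inh \<Gamma> (\<Sigma> w:Indisc a b. corr a b e w)"
proof -
  obtain f g s where i: "inverses \<Gamma> a b f g" and f': "\<Gamma> \<Turnstile> pr1 (Hom a b) e \<approx> f \<Colon> Hom a b"
    using Iso_eta[OF X ab e] by blast
  have f: "\<Gamma> \<Turnstile> f \<Colon> Hom a b" and g: "\<Gamma> \<Turnstile> g \<Colon> Hom b a" using i by (simp_all add: inverses_def)
  have w: "\<And>\<Delta> t T. ext \<Gamma> \<Delta> \<Longrightarrow> \<Gamma> \<Turnstile> t \<Colon> T \<Longrightarrow> \<Delta> \<Turnstile> t \<Colon> T" by (rule wt_ext)
  note i' = inverses_ext[OF _ i] and j' = inverses_sym[OF inverses_ext[OF _ i]]
  note [simp] = f g f[THEN wt_sc] g[THEN wt_sc] ab[THEN wt_sc]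
  have d: "ext \<Gamma>\<^sub>0 \<Delta>" "\<Delta> \<Turnstile> a \<Colon> MO" "\<Delta> \<Turnstile> b \<Colon> MO" "\<Delta> \<Turnstile> f \<Colon> Hom a b" "\<Delta> \<Turnstile> g \<Colon> Hom b a" if "ext \<Gamma> \<Delta>" for \<Delta>
    using that by (auto intro: ext_trans X wt_ext)
  have fams: "fam \<Gamma> MO (\<lambda>x. Hom x a)" "fam \<Gamma> MO (\<lambda>x. Hom x b)" "fam \<Gamma> MO (\<lambda>x. Hom a x)" "fam \<Gamma> MO (\<lambda>x. Hom b x)"
    "fam \<Gamma> MO (\<lambda>x. Hom a a)" "fam \<Gamma> MO (\<lambda>x. Hom b b)"
    by (rule famI; simp)+
  obtain l where l: "\<Gamma> \<Turnstile> l \<Colon> Lty a b" and L: "\<And>\<Delta> x h. ext \<Gamma> \<Delta> \<Longrightarrow> \<Delta> \<Turnstile> x \<Colon> MO \<Longrightarrow> \<Delta> \<Turnstile> h \<Colon> Hom x a \<Longrightarrow>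
       \<Delta> \<Turnstile> eapp (Hom x a) (Hom x b) (l \<cdot> x) h \<approx> comp x a b f h \<Colon> Hom x b"
    by (rule ex_equiv_fam[OF fams(1,2), where k = "\<lambda>x h. comp x a b f h" and k' = "\<lambda>x h. comp x b a g h"])
      (auto simp: d intro!: cancel_left[OF _ _ _ _ i'] cancel_left[OF _ _ _ _ j'])
  obtain r where r: "\<Gamma> \<Turnstile> r \<Colon> Rty a b" and R: "\<And>\<Delta> x h. ext \<Gamma> \<Delta> \<Longrightarrow> \<Delta> \<Turnstile> x \<Colon> MO \<Longrightarrow> \<Delta> \<Turnstile> h \<Colon> Hom a x \<Longrightarrow>
       \<Delta> \<Turnstile> eapp (Hom a x) (Hom b x) (r \<cdot> x) h \<approx> comp b a x h g \<Colon> Hom b x"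
    by (rule ex_equiv_fam[OF fams(3,4), where k = "\<lambda>x h. comp b a x h g" and k' = "\<lambda>x h. comp a b x h f"])
      (auto simp: d intro!: cancel_right[OF _ _ _ _ i'] cancel_right[OF _ _ _ _ j'])
  \<comment> \<open>Conjugation by a pair of inverses undoes conjugation by the swapped pair. It is
    stated for an arbitrary pair so as to give both inverse laws of the third equivalence.\<close>
  have cc: "\<Delta> \<Turnstile> comp y x y k (comp y x x (comp x y x k' (comp x y y h k)) k') \<approx> h \<Colon> Hom y y"
    if j: "inverses \<Delta> x y k k'" and [simp]: "ext \<Gamma>\<^sub>0 \<Delta>" "\<Delta> \<Turnstile> x \<Colon> MO" "\<Delta> \<Turnstile> y \<Colon> MO" "\<Delta> \<Turnstile> h \<Colon> Hom y y" for \<Delta> x y k k' h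
  proof -
    have [simp]: "\<Delta> \<Turnstile> k \<Colon> Hom x y" "\<Delta> \<Turnstile> k' \<Colon> Hom y x" using j by (simp_all add: inverses_def)
    have "\<Delta> \<Turnstile> comp y x x (comp x y x k' (comp x y y h k)) k' \<approx> comp y y x k' (comp y x y (comp x y y h k) k') \<Colon> Hom y x"
      by (rule heq_sym[OF comp_assoc]) simp_all
    also have "\<Delta> \<Turnstile> comp y y x k' (comp y x y (comp x y y h k) k') \<approx> comp y y x k' h \<Colon> Hom y x"
      by (rule comp_cong[OF _ _ _ _ _ cancel_right[OF _ _ _ _ inverses_sym[OF j]]]) simp_all
    finally have "\<Delta> \<Turnstile> comp y x y k (comp y x x (comp x y x k' (comp x y y h k)) k') \<approx> comp y x y k (comp y y x k' h) \<Colon> Hom y y"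
      by (intro comp_cong) simp_all
    also have "\<Delta> \<Turnstile> comp y x y k (comp y y x k' h) \<approx> h \<Colon> Hom y y"
      by (rule cancel_left[OF _ _ _ _ inverses_sym[OF j]]) simp_all
    finally show ?thesis .
  qed
  \<comment> \<open>The third component is a single equivalence; it is obtained as a constant family
    over \<open>MO\<close>, evaluated at \<open>a\<close>.\<close>
  obtain m where m: "\<Gamma> \<Turnstile> m \<Colon> (\<Pi> x:MO. Hom a a \<simeq> Hom b b)" and M: "\<And>\<Delta> x h. ext \<Gamma> \<Delta> \<Longrightarrow> \<Delta> \<Turnstile> x \<Colon> MO \<Longrightarrow> \<Delta> \<Turnstile> h \<Colon> Hom a a \<Longrightarrow>
       \<Delta> \<Turnstile> eapp (Hom a a) (Hom b b) (m \<cdot> x) h \<approx> comp b a b f (comp b a a h g) \<Colon> Hom b b"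
    by (rule ex_equiv_fam[OF fams(5,6), where k = "\<lambda>x h. comp b a b f (comp b a a h g)"
          and k' = "\<lambda>x h. comp a b a g (comp a b b h f)"])
      (auto simp: d intro!: cc[OF i'] cc[OF j'])
  have c: "\<Gamma> \<Turnstile> m \<cdot> a \<Colon> Cty a b" by (rule wt_hApp[OF m ab(1)]) simp
  have A: "acts \<Gamma> a b f g l r (m \<cdot> a)"
    unfolding acts_def \<phi>l_def \<phi>r_def \<phi>c_def using l r c i L R M w by (auto intro: ab)
  obtain t where t: "\<Gamma> \<Turnstile> t \<Colon> ind a b l r (m \<cdot> a)" by (rule inhE[OF acts_ind[OF A]])
  let ?w = "\<langle>l, \<langle>r, \<langle>m \<cdot> a, t\<rangle>\<rangle>\<rangle>"
  have w: "\<Gamma> \<Turnstile> ?w \<Colon> Indisc a b" by (rule wt_indisc_tuple[OF X ab l r c t])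
  have "\<Gamma> \<Turnstile> \<langle>r, \<langle>m \<cdot> a, t\<rangle>\<rangle> \<Colon> (\<Sigma> r:Rty a b. \<Sigma> c:Cty a b. ind a b l r c)"
    by (rule wt_hPair[OF fam_R[OF X ab l] r], rule wt_hPair[OF fam_C[OF X ab l r] c], rule t)
  then have wl: "\<Gamma> \<Turnstile> pr1 (Lty a b) ?w \<approx> l \<Colon> Lty a b"
    by (rule heq_pr1[OF fam_L[OF X ab] l])
  have "\<Gamma> \<Turnstile> \<phi>l MA a b l a (one a) \<approx> comp a a b f (one a) \<Colon> Hom a b"
    by (rule acts_l[OF A]) simp_all
  also have "\<Gamma> \<Turnstile> comp a a b f (one a) \<approx> f \<Colon> Hom a b"
    by (rule comp_one_right) simp_all
  finally have "inh \<Gamma> (corr a b e ?w)"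
    using corr_iff[OF X ab e w f' wl] by (simp add: heq_sym)
  then show ?thesis
    by (rule inh_hSig[OF fam_corr(2)[OF X ab e] w])
qed

end

section \<open>Canonical maps\<close>

lemma wt_hLamI:
  assumes "ty \<Gamma> A" "natf (length \<Gamma>) b" "natf (length \<Gamma>) B"
    "\<And>x. ty \<Gamma> A \<Longrightarrow> sc (Suc (length \<Gamma>)) x \<Longrightarrow> \<Gamma> \<triangleright> A \<Turnstile> x \<Colon> A \<Longrightarrow> \<Gamma> \<triangleright> A \<Turnstile> b x \<Colon> B x"
  shows "\<Gamma> \<Turnstile> hLam A b \<Colon> hPi A B"
  using assms by (intro wt_hLam) auto

text \<open>Accounts for the \<open>hRefl\<close> terms inside \<open>idEquiv\<close>, whose
  required type contains unreduced applications of the identity function.\<close>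

lemma wt_hRefl_conv:
  assumes A: "ty \<Gamma> A" and ab: "\<Gamma> \<Turnstile> a \<equiv> b \<Colon> A"
  shows "\<Gamma> \<Turnstile> hRefl b \<Colon> (a =\<^bsub>A\<^esub> b)"
proof -
  let ?n = "length \<Gamma>"
  note a = hjeq_wt1[OF ab] and b = hjeq_wt2[OF ab]
  obtain j where j: "\<Gamma> \<turnstile> A ?n : Univ j" using A by (auto simp: ty_def)
  have "\<Gamma> \<turnstile> (b =\<^bsub>A\<^esub> b) ?n \<equiv> (a =\<^bsub>A\<^esub> b) ?n : Univ j"
    unfolding hterm_at(6) using b j
    by (intro id_form_eq jeq_refl jeq_sym[OF hjeq_at[OF ab]]) (simp_all add: wt_def)
  then show ?thesis
    by (rule wt_conv[OF wt_hRefl[OF A b]]) (simp add: sc_hId ty_sc[OF A] wt_sc[OF a] wt_sc[OF b])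
qed

lemma rel_idFun [simp]: "valid s \<Longrightarrow> rel s k A A' \<Longrightarrow> rel s k (idFun A) (idFun A')"
  by (simp add: idFun_def)

lemma rel_idEquiv [simp]: "valid s \<Longrightarrow> rel s k A A' \<Longrightarrow> rel s k (idEquiv A) (idEquiv A')"
  by (simp add: idEquiv_def)

lemma rel_iff_refl [simp]: "valid s \<Longrightarrow> rel s k A A' \<Longrightarrow> rel s k (iff_refl A) (iff_refl A')"
  by (simp add: iff_refl_def)

lemma idFun_rules:
  assumes A [simp]: "ty \<Gamma> A"
  shows wt_idFun: "\<Gamma> \<Turnstile> idFun A \<Colon> A \<rightarrow> A"
    and hjeq_idFun: "\<Gamma> \<Turnstile> x \<Colon> A \<Longrightarrow> \<Gamma> \<Turnstile> idFun A \<cdot> x \<equiv> x \<Colon> A"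
  unfolding idFun_def hFun_def using ty_sc[OF A]
  by (auto intro!: wt_hLam hjeq_beta[where B = "\<lambda>_. A" and b = "\<lambda>x. x"])

lemma wt_idEquiv:
  assumes A [simp]: "ty \<Gamma> A"
  shows "\<Gamma> \<Turnstile> \<langle>\<langle>idFun A, \<Lambda> x:A. hRefl x\<rangle>, \<langle>idFun A, \<Lambda> x:A. hRefl x\<rangle>\<rangle> \<Colon> isEquiv A A (idFun A)"
    and "\<Gamma> \<Turnstile> idEquiv A \<Colon> A \<simeq> A"
proof -
  note [simp] = ty_sc[OF A] wt_idFun[OF A] wt_idFun[OF A, THEN wt_sc]
  have 1: "\<Gamma> \<Turnstile> (\<Lambda> x:A. hRefl x) \<Colon> (\<Pi> y:A. idFun A \<cdot> (idFun A \<cdot> y) =\<^bsub>A\<^esub> y)"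
  proof (rule wt_hLamI)
    fix x assume x: "\<Gamma> \<triangleright> A \<Turnstile> x \<Colon> A"
    have A' [simp]: "ty (\<Gamma> \<triangleright> A) A" by simp
    have "\<Gamma> \<triangleright> A \<Turnstile> idFun A \<cdot> (idFun A \<cdot> x) \<equiv> idFun A \<cdot> x \<Colon> A"
      by (rule hjeq_idFun[OF A']) (rule hjeq_wt1[OF hjeq_idFun[OF A' x]])
    also note hjeq_idFun[OF A' x]
    finally show "\<Gamma> \<triangleright> A \<Turnstile> hRefl x \<Colon> (idFun A \<cdot> (idFun A \<cdot> x) =\<^bsub>A\<^esub> x)"
      by (rule wt_hRefl_conv[OF A'])
  qed simp_all
  note f = fam_section[OF A A wt_idFun[OF A]] fam_retraction[OF A A wt_idFun[OF A]]
  show 2: "\<Gamma> \<Turnstile> \<langle>\<langle>idFun A, \<Lambda> x:A. hRefl x\<rangle>, \<langle>idFun A, \<Lambda> x:A. hRefl x\<rangle>\<rangle> \<Colon> isEquiv A A (idFun A)"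
    unfolding isEquiv_def
    by (rule wt_hPair_prod[OF ty_hSig[OF f(1)] ty_hSig[OF f(2)]]; rule wt_hPair[OF f(1)] wt_hPair[OF f(2)], rule wt_idFun[OF A], rule 1)
  show "\<Gamma> \<Turnstile> idEquiv A \<Colon> A \<simeq> A"
    unfolding idEquiv_def hEquiv_def
    by (rule wt_hPair[OF fam_isEquiv[OF A A] wt_idFun[OF A]], rule 2)
qed

text \<open>Stated for any \<open>e\<close> judgementally equal to \<open>idEquiv A\<close>, because
  in the identity indiscernibility \<open>e\<close> is an application of an abstraction over the
  objects that still has to be reduced.\<close>

lemma hjeq_eapp_idEquiv:
  assumes A: "ty \<Gamma> A" and e: "\<Gamma> \<Turnstile> e \<equiv> idEquiv A \<Colon> A \<simeq> A" and x: "\<Gamma> \<Turnstile> x \<Colon> A"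
  shows "\<Gamma> \<Turnstile> eapp A A e x \<equiv> x \<Colon> A"
proof -
  note F = fam_isEquiv[OF A A]
  have "\<Gamma> \<Turnstile> pr1 (A \<rightarrow> A) e \<equiv> pr1 (A \<rightarrow> A) (idEquiv A) \<Colon> A \<rightarrow> A"
    by (rule hjeq_pr1_cong[OF F e[unfolded hEquiv_def]])
  also have "\<Gamma> \<Turnstile> pr1 (A \<rightarrow> A) (idEquiv A) \<equiv> idFun A \<Colon> A \<rightarrow> A"
    unfolding idEquiv_def by (rule hjeq_pr1[OF F wt_idFun[OF A]], rule wt_idEquiv(1)[OF A])
  finally have "\<Gamma> \<Turnstile> eapp A A e x \<equiv> idFun A \<cdot> x \<Colon> A"
    unfolding eapp_def by (rule hjeq_app_fun) (simp_all add: hjeq_refl x ty_sc[OF A])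
  also note hjeq_idFun[OF A x]
  finally show ?thesis .
qed

text \<open>In the clauses for the identity indiscernibility the right-hand proposition contains
  applications of \<phi>, so it is only judgementally equal to the left-hand one. The pair of
  identity functions has to be typed across this conversion.\<close>

lemma wt_iff_refl:
  assumes PP: "\<Gamma> \<Turnstile> P \<equiv> Q \<Colon> \<U> i"
  shows "\<Gamma> \<Turnstile> iff_refl P \<Colon> P \<leftrightarrow> Q"
proof -
  let ?n = "length \<Gamma>"
  have P [simp]: "ty \<Gamma> P" and Q [simp]: "ty \<Gamma> Q" using hjeqD[OF PP] by (auto intro: wt_Univ_ty)
  note [simp] = ty_sc[OF P] ty_sc[OF Q]
  have "\<Gamma> \<Turnstile> idFun P \<Colon> P \<rightarrow> Q"
    unfolding idFun_def hFun_def
  proof (rule wt_hLamI)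
    fix x assume x: "\<Gamma> \<triangleright> P \<Turnstile> x \<Colon> P"
    show "\<Gamma> \<triangleright> P \<Turnstile> x \<Colon> Q"
      using hjeq_at[OF hjeq_weak[OF P PP]] by (intro wt_conv[OF x]) (simp_all add: hterm_at)
  qed simp_all
  \<comment> \<open>For the backward direction the annotation on the abstraction is \<open>P\<close>
    while the domain should be \<open>Q\<close>; the function type is converted as a whole.\<close>
  moreover have "\<Gamma> \<Turnstile> idFun P \<Colon> Q \<rightarrow> P"
  proof (rule wt_conv[OF wt_idFun[OF P]])
    have "P ?n # \<Gamma> \<turnstile> P (Suc ?n) : Univ i"
      using wt_weak[OF P hjeq_wt1[OF PP]] by (simp add: wt_def cext_def hterm_at)
    then show "\<Gamma> \<turnstile> (P \<rightarrow> P) ?n \<equiv> (Q \<rightarrow> P) ?n : Univ i"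
      unfolding hFun_def hterm_at(1) using hjeq_at[OF PP]
      by (intro pi_form_eq jeq_refl) (simp_all add: hterm_at)
  qed (simp add: sc_hFun)
  ultimately show ?thesis
    unfolding iff_refl_def hIff_def by (intro wt_hPair_prod) simp_all
qed

context folds_category
begin

lemma hjeq_MT:
  assumes X: "ext \<Gamma>\<^sub>0 \<Gamma>" and xyz: "\<Gamma> \<Turnstile> x \<Colon> MO" "\<Gamma> \<Turnstile> y \<Colon> MO" "\<Gamma> \<Turnstile> z \<Colon> MO"
    and p: "\<Gamma> \<Turnstile> p' \<equiv> p \<Colon> Hom x y" and q: "\<Gamma> \<Turnstile> q' \<equiv> q \<Colon> Hom y z" and h: "\<Gamma> \<Turnstile> h' \<equiv> h \<Colon> Hom x z"
  shows "\<Gamma> \<Turnstile> MT \<cdot> x \<cdot> y \<cdot> z \<cdot> p \<cdot> q \<cdot> h \<equiv> MT \<cdot> x \<cdot> y \<cdot> z \<cdot> p' \<cdot> q' \<cdot> h' \<Colon> \<U> i"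
  by (rule hjeq_app_fun[OF hjeq_app_fun[OF hjeq_app_fun[OF hjeq_refl[OF wt_hApp[OF wt_hApp[OF wt_hApp[OF
      wt_ext[OF X wt_MT[unfolded MT_type_def]] xyz(1)] xyz(2)] xyz(3)]] hjeq_sym[OF p]] hjeq_sym[OF q]] hjeq_sym[OF h]])
    (use X xyz in \<open>simp_all add: wt_sc sc_hFun sc_hom\<close>)

lemma hjeq_MI:
  assumes X: "ext \<Gamma>\<^sub>0 \<Gamma>" and x: "\<Gamma> \<Turnstile> x \<Colon> MO" and p: "\<Gamma> \<Turnstile> p' \<equiv> p \<Colon> Hom x x"
  shows "\<Gamma> \<Turnstile> MI \<cdot> x \<cdot> p \<equiv> MI \<cdot> x \<cdot> p' \<Colon> \<U> i"
  by (rule hjeq_app_fun[OF hjeq_refl[OF wt_hApp[OF wt_ext[OF X wt_MI] x]] hjeq_sym[OF p]])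
    (use X x in \<open>simp_all add: wt_sc\<close>)

abbreviation idl where "idl a \<equiv> (\<Lambda> x:MO. idEquiv (Hom x a))"
abbreviation idr where "idr a \<equiv> (\<Lambda> z:MO. idEquiv (Hom a z))"

lemma wt_ids [simp]:
  assumes [simp]: "ext \<Gamma>\<^sub>0 \<Gamma>" "\<Gamma> \<Turnstile> a \<Colon> MO"
  shows "\<Gamma> \<Turnstile> idl a \<Colon> Lty a a" "\<Gamma> \<Turnstile> idr a \<Colon> Rty a a" "\<Gamma> \<Turnstile> idEquiv (Hom a a) \<Colon> Cty a a"
  using wt_sc[OF assms(2)] by (auto intro!: wt_hLam wt_idEquiv(2))

lemma hjeq_phi:
  assumes X [simp]: "ext \<Gamma>\<^sub>0 \<Gamma>" and a [simp]: "\<Gamma> \<Turnstile> a \<Colon> MO"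
  shows hjeq_phil: "\<Gamma> \<Turnstile> x \<Colon> MO \<Longrightarrow> \<Gamma> \<Turnstile> f \<Colon> Hom x a \<Longrightarrow> \<Gamma> \<Turnstile> \<phi>l MA a a (idl a) x f \<equiv> f \<Colon> Hom x a"
    and hjeq_phir: "\<Gamma> \<Turnstile> x \<Colon> MO \<Longrightarrow> \<Gamma> \<Turnstile> g \<Colon> Hom a x \<Longrightarrow> \<Gamma> \<Turnstile> \<phi>r MA a a (idr a) x g \<equiv> g \<Colon> Hom a x"
    and hjeq_phic: "\<Gamma> \<Turnstile> h \<Colon> Hom a a \<Longrightarrow> \<Gamma> \<Turnstile> \<phi>c MA a a (idEquiv (Hom a a)) h \<equiv> h \<Colon> Hom a a"
proof -
  note [simp] = wt_sc[OF a]
  show "\<Gamma> \<Turnstile> \<phi>l MA a a (idl a) x f \<equiv> f \<Colon> Hom x a" if [simp]: "\<Gamma> \<Turnstile> x \<Colon> MO" "\<Gamma> \<Turnstile> f \<Colon> Hom x a"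
    unfolding \<phi>l_def
    by (rule hjeq_eapp_idEquiv, simp, rule hjeq_beta[where B = "\<lambda>x. Hom x a \<simeq> Hom x a"])
      (auto intro!: wt_idEquiv(2))
  show "\<Gamma> \<Turnstile> \<phi>r MA a a (idr a) x g \<equiv> g \<Colon> Hom a x" if [simp]: "\<Gamma> \<Turnstile> x \<Colon> MO" "\<Gamma> \<Turnstile> g \<Colon> Hom a x"
    unfolding \<phi>r_def
    by (rule hjeq_eapp_idEquiv, simp, rule hjeq_beta[where B = "\<lambda>x. Hom a x \<simeq> Hom a x"])
      (auto intro!: wt_idEquiv(2))
  show "\<Gamma> \<Turnstile> \<phi>c MA a a (idEquiv (Hom a a)) h \<equiv> h \<Colon> Hom a a" if [simp]: "\<Gamma> \<Turnstile> h \<Colon> Hom a a"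
    unfolding \<phi>c_def by (rule hjeq_eapp_idEquiv) (simp_all add: hjeq_refl)
qed

text \<open>By \<open>hjeq_phi\<close> every application of \<phi> computes to its argument, so each
  \<open>iff_refl\<close> fits its clause. The eight proofs are hidden in \<open>t\<close>; the
  three equivalences stay visible for the computation at reflexivity.\<close>

lemma wt_id_indisc:
  assumes X [simp]: "ext \<Gamma>\<^sub>0 \<Gamma>" and a [simp]: "\<Gamma> \<Turnstile> a \<Colon> MO"
  obtains t where "\<Gamma> \<Turnstile> t \<Colon> ind a a (idl a) (idr a) (idEquiv (Hom a a))"
    "id_indisc MO MA MI MT a = \<langle>idl a, \<langle>idr a, \<langle>idEquiv (Hom a a), t\<rangle>\<rangle>\<rangle>"
proof -
  note [simp] = wt_sc[OF a]
  let ?t1 = "\<Lambda> x:MO. \<Lambda> y:MO. \<Lambda> f:Hom x y. \<Lambda> g:Hom y a. \<Lambda> h:Hom x a. iff_refl (MT \<cdot> x \<cdot> y \<cdot> a \<cdot> f \<cdot> g \<cdot> h)"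
  let ?t2 = "\<Lambda> x:MO. \<Lambda> z:MO. \<Lambda> f:Hom x a. \<Lambda> g:Hom a z. \<Lambda> h:Hom x z. iff_refl (MT \<cdot> x \<cdot> a \<cdot> z \<cdot> f \<cdot> g \<cdot> h)"
  let ?t3 = "\<Lambda> z:MO. \<Lambda> w:MO. \<Lambda> f:Hom a z. \<Lambda> g:Hom z w. \<Lambda> h:Hom a w. iff_refl (MT \<cdot> a \<cdot> z \<cdot> w \<cdot> f \<cdot> g \<cdot> h)"
  let ?t4 = "\<Lambda> x:MO. \<Lambda> f:Hom x a. \<Lambda> g:Hom a a. \<Lambda> h:Hom x a. iff_refl (MT \<cdot> x \<cdot> a \<cdot> a \<cdot> f \<cdot> g \<cdot> h)"
  let ?t5 = "\<Lambda> x:MO. \<Lambda> f:Hom a x. \<Lambda> g:Hom x a. \<Lambda> h:Hom a a. iff_refl (MT \<cdot> a \<cdot> x \<cdot> a \<cdot> f \<cdot> g \<cdot> h)"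
  let ?t6 = "\<Lambda> x:MO. \<Lambda> f:Hom a a. \<Lambda> g:Hom a x. \<Lambda> h:Hom a x. iff_refl (MT \<cdot> a \<cdot> a \<cdot> x \<cdot> f \<cdot> g \<cdot> h)"
  let ?t7 = "\<Lambda> f:Hom a a. \<Lambda> g:Hom a a. \<Lambda> h:Hom a a. iff_refl (MT \<cdot> a \<cdot> a \<cdot> a \<cdot> f \<cdot> g \<cdot> h)"
  let ?t8 = "\<Lambda> f:Hom a a. iff_refl (MI \<cdot> a \<cdot> f)"
  have "\<Gamma> \<Turnstile> ?t1 \<Colon> ind1 a a (idl a)" "\<Gamma> \<Turnstile> ?t2 \<Colon> ind2 a a (idl a) (idr a)" "\<Gamma> \<Turnstile> ?t3 \<Colon> ind3 a a (idr a)"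
    "\<Gamma> \<Turnstile> ?t4 \<Colon> ind4 a a (idl a) (idEquiv (Hom a a))" "\<Gamma> \<Turnstile> ?t5 \<Colon> ind5 a a (idl a) (idr a) (idEquiv (Hom a a))"
    "\<Gamma> \<Turnstile> ?t6 \<Colon> ind6 a a (idr a) (idEquiv (Hom a a))" "\<Gamma> \<Turnstile> ?t7 \<Colon> ind7 a a (idEquiv (Hom a a))"
    "\<Gamma> \<Turnstile> ?t8 \<Colon> ind8 a a (idEquiv (Hom a a))"
    unfolding ind_defs
    by (intro wt_hLamI wt_iff_refl[where i = i] hjeq_MT hjeq_MI; ((rule hjeq_phi hjeq_refl)+)?;
        (unfold length_cext)?; simp (no_asm_simp))+
  then have "\<Gamma> \<Turnstile> \<langle>?t1, \<langle>?t2, \<langle>?t3, \<langle>?t4, \<langle>?t5, \<langle>?t6, \<langle>?t7, ?t8\<rangle>\<rangle>\<rangle>\<rangle>\<rangle>\<rangle>\<rangle> \<Colon> ind a a (idl a) (idr a) (idEquiv (Hom a a))"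
    unfolding ind_def by (intro wt_hPair_prod ty_hProd prp_ind[OF X a a wt_ids[OF X a], THEN prp_ty])
  then show ?thesis
    by (rule that) (simp add: id_indisc_def)
qed

end

lemma rel_iso [simp]:
  assumes "valid s" "\<forall>j\<ge>k. rel s j MA MA'" "\<forall>j\<ge>k. rel s j MI MI'" "\<forall>j\<ge>k. rel s j MT MT'"
    "\<forall>j\<ge>k. rel s j uI uI'" "\<forall>j\<ge>k. rel s j uT uT'" "\<forall>j\<ge>k. rel s j a a'" "\<forall>j\<ge>k. rel s j b b'"
  shows "rel s k (iso MA MI MT uI uT a b) (iso MA' MI' MT' uI' uT' a' b')"
  using assms by (simp add: iso_def)

lemma rel_id_iso [simp]:
  assumes "valid s" "\<forall>j\<ge>k. rel s j MA MA'" "\<forall>j\<ge>k. rel s j MI MI'" "\<forall>j\<ge>k. rel s j uI uI'"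
    "\<forall>j\<ge>k. rel s j ru ru'" "\<forall>j\<ge>k. rel s j a a'"
  shows "rel s k (id_iso MA MI uI ru a) (id_iso MA' MI' uI' ru' a')"
  using assms by (simp add: id_iso_def)

lemma rel_idtoiso [simp]:
  assumes "valid s" "\<forall>j\<ge>k. rel s j MO MO'" "\<forall>j\<ge>k. rel s j MA MA'" "\<forall>j\<ge>k. rel s j MI MI'" "\<forall>j\<ge>k. rel s j MT MT'"
    "\<forall>j\<ge>k. rel s j uI uI'" "\<forall>j\<ge>k. rel s j uT uT'" "\<forall>j\<ge>k. rel s j ru ru'" "\<forall>j\<ge>k. rel s j a a'" "\<forall>j\<ge>k. rel s j b b'"
  shows "rel s k (idtoiso MO MA MI MT uI uT ru a b) (idtoiso MO' MA' MI' MT' uI' uT' ru' a' b')"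
  using assms by (simp add: idtoiso_def)

lemma rel_indisc [simp]:
  assumes "valid s" "\<forall>j\<ge>k. rel s j MO MO'" "\<forall>j\<ge>k. rel s j MA MA'" "\<forall>j\<ge>k. rel s j MI MI'" "\<forall>j\<ge>k. rel s j MT MT'"
    "\<forall>j\<ge>k. rel s j a a'" "\<forall>j\<ge>k. rel s j b b'"
  shows "rel s k (indisc MO MA MI MT a b) (indisc MO' MA' MI' MT' a' b')"
  using assms by (simp add: indisc_def)

lemma rel_id_indisc [simp]:
  assumes "valid s" "\<forall>j\<ge>k. rel s j MO MO'" "\<forall>j\<ge>k. rel s j MA MA'" "\<forall>j\<ge>k. rel s j MI MI'" "\<forall>j\<ge>k. rel s j MT MT'"
    "\<forall>j\<ge>k. rel s j a a'"
  shows "rel s k (id_indisc MO MA MI MT a) (id_indisc MO' MA' MI' MT' a')"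
  using assms by (simp add: id_indisc_def)

lemma rel_idtoindisc [simp]:
  assumes "valid s" "\<forall>j\<ge>k. rel s j MO MO'" "\<forall>j\<ge>k. rel s j MA MA'" "\<forall>j\<ge>k. rel s j MI MI'" "\<forall>j\<ge>k. rel s j MT MT'"
    "\<forall>j\<ge>k. rel s j a a'" "\<forall>j\<ge>k. rel s j b b'"
  shows "rel s k (idtoindisc MO MA MI MT a b) (idtoindisc MO' MA' MI' MT' a' b')"
  using assms by (simp add: idtoindisc_def)

text \<open>Covers both canonical maps, each being path induction with a motive that depends on the
  endpoints alone. The value at reflexivity is given up to provable equality, which suffices for
  \<open>corr\<close> by \<open>corr_iff\<close>.\<close>

lemma idto_rules:
  assumes A: "ty \<Gamma> A" and nat: "natf2 (length \<Gamma>) C" "natf (length \<Gamma>) c"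
    and C: "\<And>\<Delta> x y. ext \<Gamma> \<Delta> \<Longrightarrow> \<Delta> \<Turnstile> x \<Colon> A \<Longrightarrow> \<Delta> \<Turnstile> y \<Colon> A \<Longrightarrow> ty \<Delta> (C x y)"
    and c: "\<And>\<Delta> x. ext \<Gamma> \<Delta> \<Longrightarrow> \<Delta> \<Turnstile> x \<Colon> A \<Longrightarrow> \<Delta> \<Turnstile> c x \<Colon> C x x"
    and a: "\<Gamma> \<Turnstile> a \<Colon> A" and b: "\<Gamma> \<Turnstile> b \<Colon> A"
  shows wt_idto: "\<Gamma> \<Turnstile> (\<Lambda> p:(a =\<^bsub>A\<^esub> b). hIndId (\<lambda>x y p. C x y) c a b p) \<Colon> (a =\<^bsub>A\<^esub> b) \<rightarrow> C a b"
    and idto_refl: "\<Gamma> \<Turnstile> (\<Lambda> p:(a =\<^bsub>A\<^esub> a). hIndId (\<lambda>x y p. C x y) c a a p) \<cdot> hRefl a \<approx> c a \<Colon> C a a"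
proof -
  note [simp] = A ty_sc[OF A] natf2E[OF nat(1)] natf_rel[OF natf_up[OF nat(2)]]
  have ind: "\<Delta> \<Turnstile> hIndId (\<lambda>x y p. C x y) c x y p \<Colon> C x y"
    "\<Delta> \<Turnstile> hIndId (\<lambda>x y p. C x y) c x x (hRefl x) \<approx> c x \<Colon> C x x"
    if \<Delta>: "ext \<Gamma> \<Delta>" and x: "\<Delta> \<Turnstile> x \<Colon> A" and y: "\<Delta> \<Turnstile> y \<Colon> A" and p: "\<Delta> \<Turnstile> p \<Colon> (x =\<^bsub>A\<^esub> y)" for \<Delta> x y p
  proof -
    have A': "ty \<Delta> A" by (rule ty_ext[OF \<Delta> A])
    have e: "ext \<Gamma> E" if "ext \<Delta> E" for E using ext_trans[OF that \<Delta>] .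
    show "\<Delta> \<Turnstile> hIndId (\<lambda>x y p. C x y) c x y p \<Colon> C x y"
      by (rule wt_hIndId[OF A' _ _ _ _ x y p]) (use A' in \<open>auto intro!: C c e simp: ext_length[OF \<Delta>]\<close>)
    show "\<Delta> \<Turnstile> hIndId (\<lambda>x y p. C x y) c x x (hRefl x) \<approx> c x \<Colon> C x x"
      by (rule hIndId_hRefl[OF A' _ _ _ _ x]) (use A' x in \<open>auto intro!: C c e simp: ext_length[OF \<Delta>]\<close>)
  qed
  have t: "ty \<Gamma> (a =\<^bsub>A\<^esub> y)" if "\<Gamma> \<Turnstile> y \<Colon> A" for y using a that by simp
  have nC: "natf (length \<Gamma>) (\<lambda>_. C a y)" if "\<Gamma> \<Turnstile> y \<Colon> A" for y
    using ty_sc[OF C[OF ext_refl a that]] by simp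
  have nI: "natf (length \<Gamma>) (\<lambda>p. hIndId (\<lambda>x y p. C x y) c a y p)" if "\<Gamma> \<Turnstile> y \<Colon> A" for y
    using wt_sc[OF a] wt_sc[OF that] by simp
  have body: "\<forall>p. sc (Suc (length \<Gamma>)) p \<longrightarrow> \<Gamma> \<triangleright> (a =\<^bsub>A\<^esub> y) \<Turnstile> p \<Colon> (a =\<^bsub>A\<^esub> y) \<longrightarrow>
      \<Gamma> \<triangleright> (a =\<^bsub>A\<^esub> y) \<Turnstile> hIndId (\<lambda>x y p. C x y) c a y p \<Colon> C a y" if "\<Gamma> \<Turnstile> y \<Colon> A" for y
    using a that t[OF that] by (auto intro!: ind(1))
  show "\<Gamma> \<Turnstile> (\<Lambda> p:(a =\<^bsub>A\<^esub> b). hIndId (\<lambda>x y p. C x y) c a b p) \<Colon> (a =\<^bsub>A\<^esub> b) \<rightarrow> C a b"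
    unfolding hFun_def by (rule wt_hLam[OF t[OF b] nI[OF b] nC[OF b] body[OF b]])
  have "\<Gamma> \<Turnstile> (\<Lambda> p:(a =\<^bsub>A\<^esub> a). hIndId (\<lambda>x y p. C x y) c a a p) \<cdot> hRefl a \<approx>
      hIndId (\<lambda>x y p. C x y) c a a (hRefl a) \<Colon> C a a"
    by (rule heq_beta[OF t[OF a] nI[OF a] nC[OF a] C[OF ext_refl a a] body[OF a] wt_hRefl[OF A a]])
  also note ind(2)[OF ext_refl a a wt_hRefl[OF A a]]
  finally show "\<Gamma> \<Turnstile> (\<Lambda> p:(a =\<^bsub>A\<^esub> a). hIndId (\<lambda>x y p. C x y) c a a p) \<cdot> hRefl a \<approx> c a \<Colon> C a a" .
qed

context folds_category
begin

lemma wt_id_iso: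
  assumes X [simp]: "ext \<Gamma>\<^sub>0 \<Gamma>" and a [simp]: "\<Gamma> \<Turnstile> a \<Colon> MO"
  obtains t where "\<Gamma> \<Turnstile> t \<Colon> isoT a a (one a) (one a)" "id_iso MA MI uI ru a = \<langle>one a, \<langle>one a, t\<rangle>\<rangle>"
proof -
  have "\<Gamma> \<Turnstile> \<langle>ru \<cdot> a \<cdot> a \<cdot> one a, ru \<cdot> a \<cdot> a \<cdot> one a\<rangle> \<Colon> isoT a a (one a) (one a)"
    unfolding isoT_def by (intro wt_hPair_prod wt_ru_app) simp_all
  then show ?thesis by (rule that) (simp add: id_iso_def)
qed

abbreviation toIso where "toIso \<equiv> idtoiso MO MA MI MT uI uT ru"
abbreviation toIndisc where "toIndisc \<equiv> idtoindisc MO MA MI MT"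

lemma toIso_rules:
  assumes X [simp]: "ext \<Gamma>\<^sub>0 \<Gamma>" and a: "\<Gamma> \<Turnstile> a \<Colon> MO" and b: "\<Gamma> \<Turnstile> b \<Colon> MO"
  shows wt_toIso: "\<Gamma> \<Turnstile> toIso a b \<Colon> (a =\<^bsub>MO\<^esub> b) \<rightarrow> Iso a b"
    and toIso_refl: "\<Gamma> \<Turnstile> toIso a a \<cdot> hRefl a \<approx> id_iso MA MI uI ru a \<Colon> Iso a a"
proof -
  have T: "ty \<Delta> (Iso x y)" if "ext \<Gamma> \<Delta>" "\<Delta> \<Turnstile> x \<Colon> MO" "\<Delta> \<Turnstile> y \<Colon> MO" for \<Delta> x y
    using that ext_trans[OF that(1) X] by simp
  have c: "\<Delta> \<Turnstile> id_iso MA MI uI ru x \<Colon> Iso x x" if "ext \<Gamma> \<Delta>" and [simp]: "\<Delta> \<Turnstile> x \<Colon> MO" for \<Delta> x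
  proof -
    have X' [simp]: "ext \<Gamma>\<^sub>0 \<Delta>" by (rule ext_trans[OF that(1) X])
    show ?thesis
      by (rule wt_id_iso[OF X' that(2)]) (simp add: wt_iso_tuple)
  qed
  show "\<Gamma> \<Turnstile> toIso a b \<Colon> (a =\<^bsub>MO\<^esub> b) \<rightarrow> Iso a b" "\<Gamma> \<Turnstile> toIso a a \<cdot> hRefl a \<approx> id_iso MA MI uI ru a \<Colon> Iso a a"
    unfolding idtoiso_def
    by (rule wt_idto[where C = Iso and c = "id_iso MA MI uI ru", OF ty_MO[OF X] _ _ T c a b]
        idto_refl[where C = Iso and c = "id_iso MA MI uI ru", OF ty_MO[OF X] _ _ T c a b]; simp)+
qed

lemma toIndisc_rules:
  assumes X [simp]: "ext \<Gamma>\<^sub>0 \<Gamma>" and a: "\<Gamma> \<Turnstile> a \<Colon> MO" and b: "\<Gamma> \<Turnstile> b \<Colon> MO"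
  shows wt_toIndisc: "\<Gamma> \<Turnstile> toIndisc a b \<Colon> (a =\<^bsub>MO\<^esub> b) \<rightarrow> Indisc a b"
    and toIndisc_refl: "\<Gamma> \<Turnstile> toIndisc a a \<cdot> hRefl a \<approx> id_indisc MO MA MI MT a \<Colon> Indisc a a"
proof -
  have T: "ty \<Delta> (Indisc x y)" if "ext \<Gamma> \<Delta>" "\<Delta> \<Turnstile> x \<Colon> MO" "\<Delta> \<Turnstile> y \<Colon> MO" for \<Delta> x y
    using that ext_trans[OF that(1) X] by simp
  have c: "\<Delta> \<Turnstile> id_indisc MO MA MI MT x \<Colon> Indisc x x" if "ext \<Gamma> \<Delta>" and [simp]: "\<Delta> \<Turnstile> x \<Colon> MO" for \<Delta> x
  proof -
    have X' [simp]: "ext \<Gamma>\<^sub>0 \<Delta>" by (rule ext_trans[OF that(1) X])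
    show ?thesis
      by (rule wt_id_indisc[OF X' that(2)]) (simp add: wt_indisc_tuple)
  qed
  show "\<Gamma> \<Turnstile> toIndisc a b \<Colon> (a =\<^bsub>MO\<^esub> b) \<rightarrow> Indisc a b"
    "\<Gamma> \<Turnstile> toIndisc a a \<cdot> hRefl a \<approx> id_indisc MO MA MI MT a \<Colon> Indisc a a"
    unfolding idtoindisc_def
    by (rule wt_idto[where C = Indisc and c = "id_indisc MO MA MI MT", OF ty_MO[OF X] _ _ T c a b]
        idto_refl[where C = Indisc and c = "id_indisc MO MA MI MT", OF ty_MO[OF X] _ _ T c a b]; simp)+
qed

text \<open>At reflexivity both canonical maps compute to their identity tuples, and the
  correspondence becomes the equation between \<open>one a\<close> and its image under the identity
  equivalence.\<close>

lemma corr_refl: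
  assumes X [simp]: "ext \<Gamma>\<^sub>0 \<Gamma>" and a [simp]: "\<Gamma> \<Turnstile> a \<Colon> MO"
  shows "inh \<Gamma> (corr a a (toIso a a \<cdot> hRefl a) (toIndisc a a \<cdot> hRefl a))"
proof -
  note e = toIso_refl[OF X a a] and w = toIndisc_refl[OF X a a]
  obtain s where s: "\<Gamma> \<Turnstile> s \<Colon> isoT a a (one a) (one a)" "id_iso MA MI uI ru a = \<langle>one a, \<langle>one a, s\<rangle>\<rangle>"
    using wt_id_iso[OF X a] by blast
  obtain t where t: "\<Gamma> \<Turnstile> t \<Colon> ind a a (idl a) (idr a) (idEquiv (Hom a a))"
    "id_indisc MO MA MI MT a = \<langle>idl a, \<langle>idr a, \<langle>idEquiv (Hom a a), t\<rangle>\<rangle>\<rangle>"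
    using wt_id_indisc[OF X a] by blast
  have o: "\<Gamma> \<Turnstile> one a \<Colon> Hom a a" by simp
  have s': "\<Gamma> \<Turnstile> \<langle>one a, s\<rangle> \<Colon> (\<Sigma> g:Hom a a. isoT a a (one a) g)"
    by (rule wt_hPair[OF fam_g[OF X a a o] o], rule s)
  have "\<Gamma> \<Turnstile> pr1 (Hom a a) \<langle>one a, \<langle>one a, s\<rangle>\<rangle> \<approx> one a \<Colon> Hom a a"
    by (rule heq_pr1[OF fam_f[OF X a a] o], rule s')
  then have f: "\<Gamma> \<Turnstile> pr1 (Hom a a) (toIso a a \<cdot> hRefl a) \<approx> one a \<Colon> Hom a a"
    using heq_pr1_cong[OF e[unfolded Iso_eq s(2)] fam_f[OF X a a]] by (rule heq_trans[rotated])
  note i = wt_ids[OF X a]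
  have t': "\<Gamma> \<Turnstile> \<langle>idr a, \<langle>idEquiv (Hom a a), t\<rangle>\<rangle> \<Colon> (\<Sigma> r:Rty a a. \<Sigma> c:Cty a a. ind a a (idl a) r c)"
    by (rule wt_hPair[OF fam_R[OF X a a i(1)] i(2)], rule wt_hPair[OF fam_C[OF X a a i(1,2)] i(3)], rule t)
  have "\<Gamma> \<Turnstile> pr1 (Lty a a) \<langle>idl a, \<langle>idr a, \<langle>idEquiv (Hom a a), t\<rangle>\<rangle>\<rangle> \<approx> idl a \<Colon> Lty a a"
    by (rule heq_pr1[OF fam_L[OF X a a] i(1)], rule t')
  then have l: "\<Gamma> \<Turnstile> pr1 (Lty a a) (toIndisc a a \<cdot> hRefl a) \<approx> idl a \<Colon> Lty a a"
    using heq_pr1_cong[OF w[unfolded Indisc_eq t(2)] fam_L[OF X a a]] by (rule heq_trans[rotated])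
  have "\<Gamma> \<Turnstile> one a \<approx> \<phi>l MA a a (idl a) a (one a) \<Colon> Hom a a"
    by (rule heq_sym[OF heq_hjeq[OF _ hjeq_phil]]) simp_all
  then show ?thesis
    using corr_iff[OF X a a heq_wt1[OF e] heq_wt1[OF w] f l] by simp
qed

lemma corr_idto:
  assumes X: "ext \<Gamma>\<^sub>0 \<Gamma>" and a: "\<Gamma> \<Turnstile> a \<Colon> MO" and b: "\<Gamma> \<Turnstile> b \<Colon> MO" and p: "\<Gamma> \<Turnstile> p \<Colon> (a =\<^bsub>MO\<^esub> b)"
  shows "inh \<Gamma> (corr a b (toIso a b \<cdot> p) (toIndisc a b \<cdot> p))"
proof (rule path_induction[where C = "\<lambda>x y p. corr x y (toIso x y \<cdot> p) (toIndisc x y \<cdot> p)", OF _ _ _ _ a b p])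
  have e: "ext \<Gamma>\<^sub>0 \<Delta>" if "ext \<Gamma> \<Delta>" for \<Delta> using ext_trans[OF that X] .
  show "inh \<Delta> (corr x x (toIso x x \<cdot> hRefl x) (toIndisc x x \<cdot> hRefl x))"
    if "ext \<Gamma> \<Delta>" "\<Delta> \<Turnstile> x \<Colon> MO" for \<Delta> x
    by (rule corr_refl[OF e[OF that(1)] that(2)])
  show "ty \<Delta> (corr x y (toIso x y \<cdot> q) (toIndisc x y \<cdot> q))"
    if "ext \<Gamma> \<Delta>" "\<Delta> \<Turnstile> x \<Colon> MO" "\<Delta> \<Turnstile> y \<Colon> MO" "\<Delta> \<Turnstile> q \<Colon> (x =\<^bsub>MO\<^esub> y)" for \<Delta> x y q
    using that e[OF that(1)]
    by (intro ty_corr wt_hApp_fun[OF wt_toIso] wt_hApp_fun[OF wt_toIndisc]) (auto intro: ty_sc ty_Iso ty_Indisc)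
qed (use X in simp_all)

text \<open>Both implications are instances of \<open>equiv_transfer\<close> for
  \<open>corr a b\<close>, read once from each side.\<close>

lemma isEquiv_iff:
  assumes X [simp]: "ext \<Gamma>\<^sub>0 \<Gamma>" and a [simp]: "\<Gamma> \<Turnstile> a \<Colon> MO" and b [simp]: "\<Gamma> \<Turnstile> b \<Colon> MO"
  shows "inh \<Gamma> (isEquiv (a =\<^bsub>MO\<^esub> b) (Indisc a b) (toIndisc a b)) \<longleftrightarrow>
    inh \<Gamma> (isEquiv (a =\<^bsub>MO\<^esub> b) (Iso a b) (toIso a b))"
proof
  note [simp] = wt_sc[OF a] wt_sc[OF b]
  have d: "ext \<Gamma>\<^sub>0 \<Delta>" "\<Delta> \<Turnstile> a \<Colon> MO" "\<Delta> \<Turnstile> b \<Colon> MO" if "ext \<Gamma> \<Delta>" for \<Delta>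
    using that by (auto intro: ext_trans X wt_ext)
  note i = wt_toIso[OF X a b] and w = wt_toIndisc[OF X a b]
  show "inh \<Gamma> (isEquiv (a =\<^bsub>MO\<^esub> b) (Indisc a b) (toIndisc a b))"
    if eq: "inh \<Gamma> (isEquiv (a =\<^bsub>MO\<^esub> b) (Iso a b) (toIso a b))"
    by (rule equiv_transfer[OF _ _ _ i w _ _ _ _ _ _ eq, where R = "corr a b"])
      (simp_all add: d ex_corr_iso corr_idto corr_unique_indisc[OF d] corr_unique_iso[OF d])
  show "inh \<Gamma> (isEquiv (a =\<^bsub>MO\<^esub> b) (Iso a b) (toIso a b))"
    if eq: "inh \<Gamma> (isEquiv (a =\<^bsub>MO\<^esub> b) (Indisc a b) (toIndisc a b))"
    by (rule equiv_transfer[OF _ _ _ w i _ _ _ _ _ _ eq, where R = "\<lambda>w e. corr a b e w"])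
      (simp_all add: d ex_corr_indisc corr_idto corr_unique_indisc[OF d] corr_unique_iso[OF d])
qed

end

section \<open>Univalence\<close>

lemma rel_folds [simp]:
  assumes "valid s" "\<forall>j\<ge>k. rel s j MO MO'" "\<forall>j\<ge>k. rel s j MA MA'"
  shows rel_MT_type: "rel s k (MT_type i MO MA) (MT_type i MO' MA')"
    and rel_MT_prop: "\<forall>j\<ge>k. rel s j MT MT' \<Longrightarrow> rel s k (MT_prop MO MA MT) (MT_prop MO' MA' MT')"
    and rel_unique_identities: "\<forall>j\<ge>k. rel s j MI MI' \<Longrightarrow>
      rel s k (unique_identities MO MA MI) (unique_identities MO' MA' MI')"
    and rel_unique_composites: "\<forall>j\<ge>k. rel s j MT MT' \<Longrightarrow>
      rel s k (unique_composites MO MA MT) (unique_composites MO' MA' MT')"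
    and rel_right_unit_law: "\<forall>j\<ge>k. rel s j MI MI' \<Longrightarrow> \<forall>j\<ge>k. rel s j MT MT' \<Longrightarrow> \<forall>j\<ge>k. rel s j uI uI' \<Longrightarrow>
      \<forall>j\<ge>k. rel s j uT uT' \<Longrightarrow> rel s k (right_unit_law MO MA MI MT uI uT) (right_unit_law MO' MA' MI' MT' uI' uT')"
    and rel_left_unit_law: "\<forall>j\<ge>k. rel s j MI MI' \<Longrightarrow> \<forall>j\<ge>k. rel s j MT MT' \<Longrightarrow> \<forall>j\<ge>k. rel s j uI uI' \<Longrightarrow>
      \<forall>j\<ge>k. rel s j uT uT' \<Longrightarrow> rel s k (left_unit_law MO MA MI MT uI uT) (left_unit_law MO' MA' MI' MT' uI' uT')"
    and rel_assoc_law: "\<forall>j\<ge>k. rel s j MT MT' \<Longrightarrow> \<forall>j\<ge>k. rel s j uT uT' \<Longrightarrow>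
      rel s k (assoc_law MO MA MT uT) (assoc_law MO' MA' MT' uT')"
    and rel_zero_univalent: "\<forall>j\<ge>k. rel s j MI MI' \<Longrightarrow> \<forall>j\<ge>k. rel s j MT MT' \<Longrightarrow>
      rel s k (zero_univalent MO MA MI MT) (zero_univalent MO' MA' MI' MT')"
    and rel_univalent_category: "\<forall>j\<ge>k. rel s j MI MI' \<Longrightarrow> \<forall>j\<ge>k. rel s j MT MT' \<Longrightarrow> \<forall>j\<ge>k. rel s j uI uI' \<Longrightarrow>
      \<forall>j\<ge>k. rel s j uT uT' \<Longrightarrow> \<forall>j\<ge>k. rel s j ru ru' \<Longrightarrow>
      rel s k (univalent_category MO MA MI MT uI uT ru) (univalent_category MO' MA' MI' MT' uI' uT' ru')"
  using assms
  by (simp_all add: MT_type_def MT_prop_def unique_identities_def unique_composites_def right_unit_law_def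
      left_unit_law_def assoc_law_def zero_univalent_def univalent_category_def)

section \<open>Formation of the hypotheses and of both univalence conditions\<close>

lemma ty_hPiI:
  assumes "ty \<Gamma> A" "natf (length \<Gamma>) B"
    "\<And>x. ty \<Gamma> A \<Longrightarrow> sc (Suc (length \<Gamma>)) x \<Longrightarrow> \<Gamma> \<triangleright> A \<Turnstile> x \<Colon> A \<Longrightarrow> ty (\<Gamma> \<triangleright> A) (B x)"
  shows "ty \<Gamma> (hPi A B)"
  using assms by (intro ty_hPi famI) auto

lemma ty_isProp: "ty \<Gamma> A \<Longrightarrow> ty \<Gamma> (isProp A)"
  unfolding isProp_def by (intro ty_hPiI ty_hId) (auto simp: ty_sc)

lemma ty_isSet: "ty \<Gamma> A \<Longrightarrow> ty \<Gamma> (isSet A)"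
  unfolding isSet_def by (intro ty_hPiI ty_isProp ty_hId) (auto simp: ty_sc)

lemma ty_isContr: "ty \<Gamma> A \<Longrightarrow> ty \<Gamma> (isContr A)"
  unfolding isContr_def by (intro ty_hSig famI) (auto simp: ty_sc intro!: ty_hPiI)

lemma ty_hIff: "ty \<Gamma> A \<Longrightarrow> ty \<Gamma> B \<Longrightarrow> ty \<Gamma> (A \<leftrightarrow> B)"
  unfolding hIff_def by simp

lemma ext_ctx: "ext \<Gamma> \<Delta> \<Longrightarrow> \<turnstile> \<Gamma> ctx \<Longrightarrow> \<turnstile> \<Delta> ctx"
  by (induction rule: ext.induct) auto

context folds_hom
begin

lemma ctx_ext0 [simp]: "ext \<Gamma>\<^sub>0 \<Gamma> \<Longrightarrow> \<turnstile> \<Gamma> ctx"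
  using ext_ctx wt_ctx[OF wt_MO] by blast

lemma ty_hom_data:
  assumes [simp]: "ext \<Gamma>\<^sub>0 \<Gamma>"
  shows "ty \<Gamma> (\<Pi> x:MO. \<Pi> y:MO. isSet (Hom x y))" "ty \<Gamma> (\<Pi> x:MO. Hom x x \<rightarrow> \<U> i)" "ty \<Gamma> (MT_type i MO MA)"
    "ty \<Gamma> (\<Pi> x:MO. \<Pi> y:MO. Hom x y \<rightarrow> Hom x y \<rightarrow> \<U> i)"
  unfolding MT_type_def
  by (intro ty_hPiI ty_isSet ty_hFun; (unfold length_cext)?; simp (no_asm_simp))+

lemma ty_ME_app:
  assumes "ext \<Gamma>\<^sub>0 \<Gamma>" "\<Gamma> \<Turnstile> ME \<Colon> (\<Pi> x:MO. \<Pi> y:MO. Hom x y \<rightarrow> Hom x y \<rightarrow> \<U> i)"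
    "\<Gamma> \<Turnstile> x \<Colon> MO" "\<Gamma> \<Turnstile> y \<Colon> MO" "\<Gamma> \<Turnstile> f \<Colon> Hom x y" "\<Gamma> \<Turnstile> g \<Colon> Hom x y"
  shows "ty \<Gamma> (ME \<cdot> x \<cdot> y \<cdot> f \<cdot> g)"
  by (rule wt_Univ_ty[where i = i],
    rule wt_hApp_fun[OF wt_hApp_fun[OF wt_hApp[OF wt_hApp[OF assms(2,3)] assms(4)] assms(5)] assms(6)])
    (use assms in \<open>simp_all add: wt_sc sc_hFun sc_hom\<close>)

lemma ty_ME_data:
  assumes [simp]: "ext \<Gamma>\<^sub>0 \<Gamma>" and ME [simp]: "\<Gamma> \<Turnstile> ME \<Colon> (\<Pi> x:MO. \<Pi> y:MO. Hom x y \<rightarrow> Hom x y \<rightarrow> \<U> i)"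
  shows "ty \<Gamma> (\<Pi> x:MO. \<Pi> y:MO. \<Pi> f:Hom x y. \<Pi> g:Hom x y. isProp (ME \<cdot> x \<cdot> y \<cdot> f \<cdot> g))"
    "ty \<Gamma> (\<Pi> x:MO. \<Pi> y:MO. \<Pi> f:Hom x y. \<Pi> g:Hom x y. ME \<cdot> x \<cdot> y \<cdot> f \<cdot> g \<leftrightarrow> (f =\<^bsub>Hom x y\<^esub> g))"
  using wt_sc[OF ME]
  by (intro ty_hPiI ty_isProp ty_hIff ty_hId ty_ME_app; (unfold length_cext)?; simp (no_asm_simp))+

end

lemma (in folds_MI) ty_MI_data:
  assumes [simp]: "ext \<Gamma>\<^sub>0 \<Gamma>"
  shows "ty \<Gamma> (\<Pi> x:MO. \<Pi> f:Hom x x. isProp (MI \<cdot> x \<cdot> f))" "ty \<Gamma> (unique_identities MO MA MI)"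
  unfolding unique_identities_def
  by (intro ty_hPiI ty_isProp ty_MI ty_isContr ty_hSig fam_MI; (unfold length_cext)?; simp (no_asm_simp))+

lemma (in folds_MT) ty_MT_data:
  assumes [simp]: "ext \<Gamma>\<^sub>0 \<Gamma>"
  shows "ty \<Gamma> (MT_prop MO MA MT)" "ty \<Gamma> (unique_composites MO MA MT)"
  unfolding MT_prop_def unique_composites_def
  by (intro ty_hPiI ty_isProp ty_MT ty_isContr ty_hSig fam_MT; (unfold length_cext)?; simp (no_asm_simp))+

lemma (in folds_composites) ty_assoc_law:
  assumes [simp]: "ext \<Gamma>\<^sub>0 \<Gamma>"
  shows "ty \<Gamma> (assoc_law MO MA MT uT)"
  unfolding assoc_law_def
  by (intro ty_hPiI ty_hId; (unfold length_cext)?; simp (no_asm_simp))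

lemma (in folds_operations) ty_unit_laws:
  assumes [simp]: "ext \<Gamma>\<^sub>0 \<Gamma>"
  shows "ty \<Gamma> (right_unit_law MO MA MI MT uI uT)" "ty \<Gamma> (left_unit_law MO MA MI MT uI uT)"
  unfolding right_unit_law_def left_unit_law_def
  by (intro ty_hPiI ty_hId; (unfold length_cext)?; simp (no_asm_simp))+

context folds_category
begin

lemma ty_univalence:
  assumes [simp]: "ext \<Gamma>\<^sub>0 \<Gamma>"
  shows "ty \<Gamma> (zero_univalent MO MA MI MT)" "ty \<Gamma> (univalent_category MO MA MI MT uI uT ru)"
  unfolding zero_univalent_def univalent_category_def
  by (intro ty_hPiI ty_isEquiv wt_toIso wt_toIndisc; (unfold length_cext)?; simp (no_asm_simp))+

text \<open>The comparison for a fixed pair of objects holds in every extension of the context, in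
  particular for generic objects, and therefore passes through the two outer binders.\<close>

lemma inh_univalence_iff:
  assumes X: "ext \<Gamma>\<^sub>0 \<Gamma>"
  shows "inh \<Gamma> (zero_univalent MO MA MI MT) \<longleftrightarrow> inh \<Gamma> (univalent_category MO MA MI MT uI uT ru)"
proof -
  \<comment> \<open>Inhabitation of a doubly quantified type, read as inhabitation of its instances
    in all extensions; the two conditions can then be compared instance by instance.\<close>
  have pi: "inh \<Gamma> (\<Pi> a:MO. \<Pi> b:MO. B a b) \<longleftrightarrow>
      (\<forall>\<Delta> a b. ext \<Gamma> \<Delta> \<longrightarrow> \<Delta> \<Turnstile> a \<Colon> MO \<longrightarrow> \<Delta> \<Turnstile> b \<Colon> MO \<longrightarrow> inh \<Delta> (B a b))"
    if B: "natf2 (length \<Gamma>) B" for B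
  proof (intro iffI allI impI)
    note [simp] = natf2E[OF B] X
    fix \<Delta> a b assume i: "inh \<Gamma> (\<Pi> a:MO. \<Pi> b:MO. B a b)" and \<Delta>: "ext \<Gamma> \<Delta>" and ab: "\<Delta> \<Turnstile> a \<Colon> MO" "\<Delta> \<Turnstile> b \<Colon> MO"
    show "inh \<Delta> (B a b)"
      by (rule inh_hPiE[OF inh_hPiE[OF inh_ext[OF \<Delta> i] _ ab(1)] _ ab(2)])
        (simp_all add: ext_length[OF \<Delta>] wt_sc[OF ab(1)] ext_trans[OF \<Delta> X])
  next
    note [simp] = natf2E[OF B] X
    assume r: "\<forall>\<Delta> a b. ext \<Gamma> \<Delta> \<longrightarrow> \<Delta> \<Turnstile> a \<Colon> MO \<longrightarrow> \<Delta> \<Turnstile> b \<Colon> MO \<longrightarrow> inh \<Delta> (B a b)"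
    show "inh \<Gamma> (\<Pi> a:MO. \<Pi> b:MO. B a b)"
      by (intro inh_hPiI r[rule_format]) simp_all
  qed
  have "natf2 (length \<Gamma>) (\<lambda>a b. isEquiv (a =\<^bsub>MO\<^esub> b) (Indisc a b) (toIndisc a b))"
    "natf2 (length \<Gamma>) (\<lambda>a b. isEquiv (a =\<^bsub>MO\<^esub> b) (Iso a b) (toIso a b))"
    using X by simp_all
  then show ?thesis
    unfolding zero_univalent_def univalent_category_def
    using isEquiv_iff[OF ext_trans[OF _ X]] by (simp only: pi) blast
qed

text \<open>The comparison in HOL is internalised: since it holds in the extensions by a proof of
  either side, \<open>inh_hIff\<close> obtains both functions of the biconditional.\<close>

lemma univalence_iff: "ext \<Gamma>\<^sub>0 \<Gamma> \<Longrightarrow> inh \<Gamma> (zero_univalent MO MA MI MT \<leftrightarrow> univalent_category MO MA MI MT uI uT ru)"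
  by (intro inh_hIff ty_univalence inh_univalence_iff) (auto intro: ext_trans)

end

section \<open>The closed type of the theorem\<close>

lemma inh_closed: "inh [] A \<Longrightarrow> \<exists>t. [] \<turnstile> t : closed A"
  by (auto simp: inh_def wt_def closed_def)

lemmas folds_intros = folds_hom.intro folds_MI.intro folds_MI_axioms.intro folds_MT.intro folds_MT_axioms.intro
  folds_identities.intro folds_identities_axioms.intro folds_composites.intro folds_composites_axioms.intro
  folds_operations.intro

theorem theorem2p8:
  fixes i :: nat
  shows "\<exists>t. [] \<turnstile> t : closed
    (\<Pi> MO:\<U> i.
     \<Pi> MA:(MO \<otimes> MO \<rightarrow> \<U> i).
     \<Pi> MA_set:(\<Pi> x:MO. \<Pi> y:MO. isSet (hom MA x y)).
     \<Pi> MI:(\<Pi> x:MO. hom MA x x \<rightarrow> \<U> i).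
     \<Pi> MI_pr:(\<Pi> x:MO. \<Pi> f:hom MA x x. isProp (MI \<cdot> x \<cdot> f)).
     \<Pi> MT:MT_type i MO MA.
     \<Pi> MT_pr:MT_prop MO MA MT.
     \<Pi> ME:(\<Pi> x:MO. \<Pi> y:MO. hom MA x y \<rightarrow> hom MA x y \<rightarrow> \<U> i).
     \<Pi> ME_pr:(\<Pi> x:MO. \<Pi> y:MO. \<Pi> f:hom MA x y. \<Pi> g:hom MA x y. isProp (ME \<cdot> x \<cdot> y \<cdot> f \<cdot> g)).
     \<Pi> ME_eq:(\<Pi> x:MO. \<Pi> y:MO. \<Pi> f:hom MA x y. \<Pi> g:hom MA x y.
               ME \<cdot> x \<cdot> y \<cdot> f \<cdot> g \<leftrightarrow> (f =\<^bsub>hom MA x y\<^esub> g)).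
     \<Pi> uI:unique_identities MO MA MI.
     \<Pi> uT:unique_composites MO MA MT.
     \<Pi> ru:right_unit_law MO MA MI MT uI uT.
     \<Pi> lu:left_unit_law MO MA MI MT uI uT.
     \<Pi> as:assoc_law MO MA MT uT.
       zero_univalent MO MA MI MT \<leftrightarrow> univalent_category MO MA MI MT uI uT ru)"
  apply (rule inh_closed)
  \<comment> \<open>Each binder moves one hypothesis into the context and leaves two side
    conditions: its type is well formed, which the structure collected so far provides, and the
    remaining type is natural in the new variable.\<close>
  apply (rule inh_hPiI, simp add: ctx_emp, simp)
  apply (rule inh_hPiI, simp (no_asm_simp) add: wt_Univ_ty, unfold list.size, simp (no_asm_simp))
  apply (rule inh_hPiI)
    apply (rule folds_hom.ty_hom_data(1)[where i = i, OF _ ext_refl]; (intro folds_intros)?; simp (no_asm_simp); fail)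
   apply (unfold length_cext list.size)[1]
   apply (simp (no_asm_simp))
  apply (rule inh_hPiI)
    apply (rule folds_hom.ty_hom_data(2)[where i = i, OF _ ext_refl]; (intro folds_intros)?; simp (no_asm_simp); fail)
   apply (unfold length_cext list.size)[1]
   apply (simp (no_asm_simp))
  apply (rule inh_hPiI)
    apply (rule folds_MI.ty_MI_data(1)[where i = i, OF _ ext_refl]; (intro folds_intros)?; simp (no_asm_simp); fail)
   apply (unfold length_cext list.size)[1]
   apply (simp (no_asm_simp))
  apply (rule inh_hPiI)
    apply (rule folds_hom.ty_hom_data(3)[where i = i, OF _ ext_refl]; (intro folds_intros)?; simp (no_asm_simp); fail)
   apply (unfold length_cext list.size)[1]
   apply (simp (no_asm_simp))
  apply (rule inh_hPiI)
    apply (rule folds_MT.ty_MT_data(1)[where i = i, OF _ ext_refl]; (intro folds_intros)?; simp (no_asm_simp); fail)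
   apply (unfold length_cext list.size)[1]
   apply (simp (no_asm_simp))
  apply (rule inh_hPiI)
    apply (rule folds_hom.ty_hom_data(4)[where i = i, OF _ ext_refl]; (intro folds_intros)?; simp (no_asm_simp); fail)
   apply (unfold length_cext list.size)[1]
   apply (simp (no_asm_simp))
  apply (rule inh_hPiI)
    apply (rule folds_hom.ty_ME_data(1)[where i = i, OF _ ext_refl]; (intro folds_intros)?; simp (no_asm_simp); fail)
   apply (unfold length_cext list.size)[1]
   apply (simp (no_asm_simp))
  apply (rule inh_hPiI)
    apply (rule folds_hom.ty_ME_data(2)[where i = i, OF _ ext_refl]; (intro folds_intros)?; simp (no_asm_simp); fail)
   apply (unfold length_cext list.size)[1]
   apply (simp (no_asm_simp))
  apply (rule inh_hPiI)
    apply (rule folds_MI.ty_MI_data(2)[where i = i, OF _ ext_refl]; (intro folds_intros)?; simp (no_asm_simp); fail)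
   apply (unfold length_cext list.size)[1]
   apply (simp (no_asm_simp))
  apply (rule inh_hPiI)
    apply (rule folds_MT.ty_MT_data(2)[where i = i, OF _ ext_refl]; (intro folds_intros)?; simp (no_asm_simp); fail)
   apply (unfold length_cext list.size)[1]
   apply (simp (no_asm_simp))
  apply (rule inh_hPiI)
    apply (rule folds_operations.ty_unit_laws(1)[where i = i, OF _ ext_refl]; (intro folds_intros)?; simp (no_asm_simp); fail)
   apply (unfold length_cext list.size)[1]
   apply (simp (no_asm_simp))
  apply (rule inh_hPiI)
    apply (rule folds_operations.ty_unit_laws(2)[where i = i, OF _ ext_refl]; (intro folds_intros)?; simp (no_asm_simp); fail)
   apply (unfold length_cext list.size)[1]
   apply (simp (no_asm_simp))
  apply (rule inh_hPiI)
    apply (rule folds_composites.ty_assoc_law[where i = i, OF _ ext_refl]; (intro folds_intros)?; simp (no_asm_simp); fail)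
   apply (unfold length_cext list.size)[1]
   apply (simp (no_asm_simp))
  subgoal premises p for MO MA MA_set MI MI_pr MT MT_pr ME ME_pr ME_eq uI uT ru lu as
  proof -
    \<comment> \<open>Every hypothesis contributes three facts, the third being the typing of its
      variable. The selected typings are those of \<open>MA_set\<close>, \<open>MI_pr\<close>,
      \<open>MT_pr\<close>, \<open>lu\<close> and \<open>as\<close>, which
      \<open>folds_category\<close> asks for as inhabited types.\<close>
    note [simp] = p p(9)[THEN inhI] p(15)[THEN inhI] p(21)[THEN inhI] p(42)[THEN inhI] p(45)[THEN inhI]
    show ?thesis
      by (rule folds_category.univalence_iff[where i = i, OF _ ext_refl];
          intro folds_category.intro folds_category_axioms.intro folds_intros; simp)
  qed
  done

end
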